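(* Let $\Gamma$ be a finitely generated group, $r\ge1$ an integer, and let $(\rho_N)$ be a sequence of permutation representations $\rho_N:\Gamma\to S_N$ which converges in distribution toward $\lambda$. Let $p\in M_r(\mathbb C)[\Gamma]$ with $p=p^*$ and let $I_0\subset\mathbb R$ be a compact interval such that condition (ACmat) holds for $P=\lambda(p)$ on $I_0$. Let $I$ be a closed interval (of positive length) contained in the interior of $I_0$, let $(\varphi_\alpha)_{\alpha\in[rN]}$ be, for each $N$, an orthonormal eigenbasis of $P_N=\rho_N(p)$, and let $T\subset\Gamma$ be finite. Then for sequences of $T$-local matrices $K_N\in M_r(\mathbb C)\otimes M_N(\mathbb C)$ with $\|K_N\|_{1,\infty}\le1$, quantum ergodicity (QE) and quantum mixing (QM) hold in $I$ provided that one of the following sets of conditions holds: (i) $(K_N)$ is asymptotically uncorrelated; (ii) $\Gamma$ has property (RD) with constant $C_1$, condition (R4mat) holds for some $C_1'>2C_1+1$, and $(K_N(t.x,x))_{x\in[N]}\in H_N^\perp$ for all $t\in T$, where $H_N\subset M_r(\mathbb C)\otimes\mathbb C^N$ is a certain sequence of vector subspaces with $\dim(H_N)=o(N)$ (that is: under these assumptions on $\Gamma$ and $P$ there exists such a sequence $(H_N)$, not depending on $(K_N)$, for which the conclusion holds for all such $(K_N)$); (iii) $\Gamma$ has property (RD) with constant $C_1$, condition (R4mat) holds for some $C_1'>2C_1+1$, $\rho_N$ converges strongly in distribution toward $\lambda$, and $(K_N(t.x,x))_{x\in[N]}\in M_r(\mathbb C)\otimes1^\perp$ for all $t\in T$.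
   Context: Representations. $e$ is the unit of $\Gamma$; $|g|$ is the word length for a fixed finite generating set. $\lambda$ is the left regular representation on $\ell^2(\Gamma)$, $\lambda(g)\delta_v=\delta_{gv}$. A permutation representation is a homomorphism $\rho_N:\Gamma\to S_N$; $g.x=\rho_N(g)(x)$ for $x\in[N]=\{1,\dots,N\}$, and $\rho_N(g)$ is identified with the matrix $\rho_N(g)(x,y)=\mathbf 1(x=g.y)$. Sequences are indexed by an infinite set of integers $N\to\infty$. $(\rho_N)$ converges in distribution toward $\lambda$ if $\frac1N\mathrm{Tr}(\rho_N(g))\to0$ for all $g\ne e$; it converges strongly in distribution if in addition $\|\rho_N(q)_{|1^\perp}\|_{\rm op}\to\|\lambda(q)\|_{\rm op}$ for every scalar $q=\sum_g q_g g\in\mathbb C[\Gamma]$, where $\rho(q)=\sum_g q_g\rho(g)$ and $1\in\mathbb C^N$ is the constant vector. (RD) with constant $C_1$: for some finite generating set $S$ there are $C,C_1>0$ with $\|\lambda(q)\|_{\rm op}\le C(\mathrm{diam}_S(q))^{C_1}(\sum_g|q_g|^2)^{1/2}$ for all $q\in\mathbb C[\Gamma]$, where $\mathrm{diam}_S(q)$ is the maximum of $1$ and the diameter of the support of $q$ in the Cayley graph $\mathrm{Cay}(\Gamma,S)$ (edges from $g$ to $sg$, $s\in S$). Matrix coefficients. $M_r(\mathbb C)[\Gamma]$ is the set of finite sums $p=\sum_g p_g g$, $p_g\in M_r(\mathbb C)$; the condition $p=p^*$ means $p_{g^{-1}}=(p_g)^*$ for all $g$. $\lambda(p)=\sum_g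 p_g\otimes\lambda(g)$ acts on $\mathbb C^r\otimes\ell^2(\Gamma)$, and $\rho_N(p)=\sum_g p_g\otimes\rho_N(g)$ acts on $\mathbb C^r\otimes\mathbb C^N$. For an operator $Q$ on $\mathbb C^r\otimes\ell^2(\Gamma)$ (resp. $\mathbb C^r\otimes\mathbb C^N$), $Q(g,h)\in M_r(\mathbb C)$ (resp. $Q(x,y)\in M_r(\mathbb C)$) denotes its block. $\|A\|_2=\sqrt{\mathrm{Tr}(AA^* )}$ on $M_r(\mathbb C)$. Put $R^z=(P-z\,\mathrm{Id})^{-1}$, $\Im R^z=(R^z-(R^z)^* )/(2i)$. (ACmat) on $I_0$: there is $C_0\ge1$ with $C_0^{-1}\le\mathrm{Tr}\{(\Im R^z)(e,e)\}\le C_0$ for all $z=E+i\eta$, $E\in I_0$, $0<\eta\le1$. (R4mat): $\displaystyle\lim_{\eta\to0}\sup_{\lambda_0\in I}\sum_{g\in\Gamma}\eta^2\|(\Im R^{\lambda_0+i\eta})(e,g)\|_2^4|g|^{C_1'}=0$. Observables. $K_N\in M_r(\mathbb C)\otimes M_N(\mathbb C)$ is $T$-local if $K_N(x,y)=0$ unless $x=g.y$ for some $g\in T$; $\|K_N\|_{1,\infty}=\max_{x,y}\|K_N(x,y)\|_2$; $\langle K_N\rangle=\rho_N(k_N)$ with $k_N=\sum_{g\in T}k_{N,g}\,g$, $k_{N,g}=\frac1N\sum_{x=1}^N K_N(g.x,x)\in M_r(\mathbb C)$. $(K_N)$ is asymptotically uncorrelated if for every $t\in T$, with $a_N(x)=K_N(t.x,x)\in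 M_r(\mathbb C)$ and $\langle a_N\rangle=\frac1N\sum_x a_N(x)$, one has $\lim_{|g|\to\infty}\sigma(g)=0$ where $\sigma(g)=\limsup_{N\to\infty}\bigl\|\frac1N\sum_{x\in[N]}\overline{(a_N(x)-\langle a_N\rangle)}\otimes(a_N(g.x)-\langle a_N\rangle)\bigr\|_{\rm op}$ (bar is entrywise conjugation). $H_N^\perp$ is the orthogonal complement in $M_r(\mathbb C)\otimes\mathbb C^N\simeq\mathbb C^{r^2N}$; $M_r(\mathbb C)\otimes1^\perp$ is the set of families $(M_x)_{x\in[N]}$ in $M_r(\mathbb C)$ with $\sum_xM_x=0$. Let $\lambda_\alpha$ be the eigenvalue of $\varphi_\alpha$, $\Lambda_J=\{\alpha:\lambda_\alpha\in J\}$, $J_E^\eta=[E-\eta,E+\eta]$; averages over an empty index set are $0$. (QE) in $I$: $\displaystyle\lim_{N\to\infty}\frac1{|\Lambda_I|}\sum_{\alpha\in\Lambda_I}|\langle\varphi_\alpha,K_N\varphi_\alpha\rangle-\langle\varphi_\alpha,\langle K_N\rangle\varphi_\alpha\rangle|^2=0$. (QM) in $I$: $\displaystyle\lim_{\eta\to0}\limsup_{N\to\infty}\sup_{E_1,E_2}\frac1{|\Lambda_{J_{E_1}^\eta}|}\sum_{\alpha\in\Lambda_{J_{E_1}^\eta}}\sum_{\beta\in\Lambda_{J_{E_2}^\eta}}|\langle\varphi_\beta,K_N\varphi_\alpha\rangle-\langle\varphi_\beta,\langle K_N\rangle\varphi_\alpha\rangle|^2=0$, the supremum being over $E_1,E_2$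 in the interior of $I$. *)

theory Defs
  imports
    "HOL-Analysis.Analysis"
    "HOL-Library.Poly_Mapping"
    "HOL-Library.Landau_Symbols"
    "HOL-Library.Function_Algebras"
    "HOL-Combinatorics.Permutations"
begin

text \<open>
  Conventions. The group is a type of class \<^class>\<open>group_add\<close>. That class is not assumed
  commutative; the group law is written additively, so \<open>g + h\<close> is the product \<open>gh\<close>, \<open>0\<close> is the
  unit \<open>e\<close> and \<open>- g\<close> is the inverse. Group-algebra elements \<open>\<Sum>\<^sub>g p\<^sub>g g\<close> are finitely supported
  functions \<open>'g \<Rightarrow>\<^sub>0 'c\<close>. The set \<open>[N]\<close> is \<open>{1..N}\<close>; vectors and matrices indexed by \<open>[N]\<close>
  are functions on \<^typ>\<open>nat\<close>, and only their values on \<open>{1..N}\<close> are ever used.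
  Blocks in \<open>M\<^sub>r(\<complex>)\<close> are of type \<open>complex^'r^'r\<close> with \<open>r = CARD('r) \<ge> 1\<close>.
\<close>

section \<open>Word length and Cayley graph\<close>

definition generates :: "'g::group_add set \<Rightarrow> bool" where
  "generates S \<longleftrightarrow> (\<forall>g. \<exists>ws. set ws \<subseteq> S \<union> uminus ` S \<and> sum_list ws = g)"

definition word_length :: "'g::group_add set \<Rightarrow> 'g \<Rightarrow> nat" where
  "word_length S g =
     (LEAST n. \<exists>ws. length ws = n \<and> set ws \<subseteq> S \<union> uminus ` S \<and> sum_list ws = g)"

definition cayley_edges :: "'g::group_add set \<Rightarrow> ('g \<times> 'g) set" where
  "cayley_edges S = {(g, h). \<exists>s\<in>S. h = s + g \<or> g = s + h}"

definition cayley_dist :: "'g::group_add set \<Rightarrow> 'g \<Rightarrow> 'g \<Rightarrow> nat" where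
  "cayley_dist S g h = (LEAST n. (g, h) \<in> cayley_edges S ^^ n)"

definition diam_supp :: "'g::group_add set \<Rightarrow> ('g \<Rightarrow>\<^sub>0 'c::zero) \<Rightarrow> nat" where
  "diam_supp S q = Max (insert 1 ((\<lambda>(g, h). cayley_dist S g h) ` (Poly_Mapping.keys q \<times> Poly_Mapping.keys q)))"

section \<open>Matrices\<close>

definition conj_transpose :: "complex^'n^'m \<Rightarrow> complex^'m^'n" where
  "conj_transpose A = map_matrix cnj (transpose A)"

definition hs_norm :: "complex^'r^'r \<Rightarrow> real" where
  "hs_norm A = sqrt (Re (trace (A ** conj_transpose A)))"

definition kron :: "complex^'r^'r \<Rightarrow> complex^'r^'r \<Rightarrow> complex^('r \<times> 'r)^('r \<times> 'r)" where
  "kron A B = (\<chi> i j. A $ fst i $ fst j * B $ snd i $ snd j)"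

section \<open>Operators on \<open>\<complex>\<^sup>r \<otimes> \<ell>\<^sup>2(\<Gamma>)\<close>\<close>

definition ell2 :: "('g \<Rightarrow> 'v::real_normed_vector) set" where
  "ell2 = {\<psi>. (\<lambda>g. (norm (\<psi> g))\<^sup>2) summable_on UNIV}"

definition ell2_norm :: "('g \<Rightarrow> 'v::real_normed_vector) \<Rightarrow> real" where
  "ell2_norm \<psi> = sqrt (\<Sum>\<^sub>\<infinity>g. (norm (\<psi> g))\<^sup>2)"

definition ell2_inner :: "('g \<Rightarrow> complex^'r) \<Rightarrow> ('g \<Rightarrow> complex^'r) \<Rightarrow> complex" where
  "ell2_inner \<phi> \<psi> = (\<Sum>\<^sub>\<infinity>g. \<Sum>i\<in>UNIV. cnj (\<phi> g $ i) * \<psi> g $ i)"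

definition ell2_onorm ::
  "(('g \<Rightarrow> 'v::real_normed_vector) \<Rightarrow> ('g \<Rightarrow> 'v)) \<Rightarrow> real" where
  "ell2_onorm A = (SUP \<psi>\<in>{\<psi> \<in> ell2. ell2_norm \<psi> \<le> 1}. ell2_norm (A \<psi>))"

definition ell2_adjoint ::
  "(('g \<Rightarrow> complex^'r) \<Rightarrow> ('g \<Rightarrow> complex^'r)) \<Rightarrow> ('g \<Rightarrow> complex^'r) \<Rightarrow> ('g \<Rightarrow> complex^'r)" where
  "ell2_adjoint A \<phi> =
     (THE \<xi>. \<xi> \<in> ell2 \<and> (\<forall>\<psi>\<in>ell2. ell2_inner \<xi> \<psi> = ell2_inner \<phi> (A \<psi>)))"

definition left_regular :: "'g::group_add \<Rightarrow> ('g \<Rightarrow> 'v) \<Rightarrow> ('g \<Rightarrow> 'v)" where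
  "left_regular g \<psi> = (\<lambda>h. \<psi> (- g + h))"

definition lam_scalar ::
  "('g::group_add \<Rightarrow>\<^sub>0 complex) \<Rightarrow> ('g \<Rightarrow> complex) \<Rightarrow> ('g \<Rightarrow> complex)" where
  "lam_scalar q \<psi> = (\<lambda>h. \<Sum>g\<in>Poly_Mapping.keys q. Poly_Mapping.lookup q g * left_regular g \<psi> h)"

definition lam ::
  "('g::group_add \<Rightarrow>\<^sub>0 complex^'r^'r) \<Rightarrow> ('g \<Rightarrow> complex^'r) \<Rightarrow> ('g \<Rightarrow> complex^'r)" where
  "lam p \<psi> = (\<lambda>h. \<Sum>g\<in>Poly_Mapping.keys p. Poly_Mapping.lookup p g *v left_regular g \<psi> h)"

definition resolvent ::
  "(('g \<Rightarrow> complex^'r) \<Rightarrow> ('g \<Rightarrow> complex^'r)) \<Rightarrow> complex \<Rightarrow> ('g \<Rightarrow> complex^'r) \<Rightarrow> ('g \<Rightarrow> complex^'r)"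
  where
  "resolvent P z = inv_into ell2 (\<lambda>\<psi> g. P \<psi> g - z *s \<psi> g)"

definition im_resolvent ::
  "(('g \<Rightarrow> complex^'r) \<Rightarrow> ('g \<Rightarrow> complex^'r)) \<Rightarrow> complex \<Rightarrow> ('g \<Rightarrow> complex^'r) \<Rightarrow> ('g \<Rightarrow> complex^'r)"
  where
  "im_resolvent P z =
     (\<lambda>\<psi> g. (1 / (2 * \<i>)) *s (resolvent P z \<psi> g - ell2_adjoint (resolvent P z) \<psi> g))"

text \<open>The entry \<open>(i, j)\<close> of the block \<open>Q(g,h)\<close> is
  \<open>\<langle>e\<^sub>i \<otimes> \<delta>\<^sub>g, Q (e\<^sub>j \<otimes> \<delta>\<^sub>h)\<rangle>\<close>.\<close>

definition op_block ::
  "(('g \<Rightarrow> complex^'r) \<Rightarrow> ('g \<Rightarrow> complex^'r)) \<Rightarrow> 'g \<Rightarrow> 'g \<Rightarrow> complex^'r^'r" where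
  "op_block Q g h = (\<chi> i j. Q (\<lambda>v. if v = h then axis j 1 else 0) g $ i)"

section \<open>Conditions on the group and on the limit operator\<close>

definition RD :: "'g::group_add itself \<Rightarrow> real \<Rightarrow> bool" where
  "RD _ C1 \<longleftrightarrow> C1 > 0 \<and>
     (\<exists>S :: 'g set. finite S \<and> generates S \<and>
        (\<exists>C>0. \<forall>q :: 'g \<Rightarrow>\<^sub>0 complex.
           ell2_onorm (lam_scalar q)
             \<le> C * real (diam_supp S q) powr C1 * sqrt (\<Sum>g\<in>Poly_Mapping.keys q. (cmod (Poly_Mapping.lookup q g))\<^sup>2)))"

definition self_adjoint :: "('g::group_add \<Rightarrow>\<^sub>0 complex^'r^'r) \<Rightarrow> bool" where
  "self_adjoint p \<longleftrightarrow> (\<forall>g. Poly_Mapping.lookup p (- g) = conj_transpose (Poly_Mapping.lookup p g))"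

text \<open>The trace in the next definition is real, as \<open>\<Im>R\<^sup>z\<close> is a self-adjoint operator.\<close>

definition ACmat :: "('g::group_add \<Rightarrow>\<^sub>0 complex^'r^'r) \<Rightarrow> real set \<Rightarrow> bool" where
  "ACmat p J \<longleftrightarrow>
     (\<exists>C0\<ge>1. \<forall>E\<in>J. \<forall>\<eta>. 0 < \<eta> \<and> \<eta> \<le> 1 \<longrightarrow>
        (let t = Re (trace (op_block (im_resolvent (lam p) (Complex E \<eta>)) 0 0))
         in inverse C0 \<le> t \<and> t \<le> C0))"

definition R4mat ::
  "'g::group_add set \<Rightarrow> ('g \<Rightarrow>\<^sub>0 complex^'r^'r) \<Rightarrow> real set \<Rightarrow> real \<Rightarrow> bool" where
  "R4mat S p J C1' \<longleftrightarrow>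
     ((\<lambda>\<eta>. SUP E\<in>J. \<Sum>\<^sub>\<infinity>g.
         ennreal (\<eta>\<^sup>2 * hs_norm (op_block (im_resolvent (lam p) (Complex E \<eta>)) 0 g) ^ 4
                  * real (word_length S g) powr C1'))
       \<longlongrightarrow> 0) (at_right 0)"

section \<open>Permutation representations\<close>

definition perm_rep :: "nat \<Rightarrow> ('g::group_add \<Rightarrow> nat \<Rightarrow> nat) \<Rightarrow> bool" where
  "perm_rep N \<rho> \<longleftrightarrow> (\<forall>g. \<rho> g permutes {1..N}) \<and> (\<forall>g h. \<rho> (g + h) = \<rho> g \<circ> \<rho> h)"

definition perm_mat :: "(nat \<Rightarrow> nat) \<Rightarrow> nat \<Rightarrow> nat \<Rightarrow> real" where
  "perm_mat \<sigma> x y = of_bool (x = \<sigma> y)"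

definition rep_mat ::
  "('g \<Rightarrow> nat \<Rightarrow> nat) \<Rightarrow> ('g \<Rightarrow>\<^sub>0 'c::real_vector) \<Rightarrow> nat \<Rightarrow> nat \<Rightarrow> 'c" where
  "rep_mat \<rho> p x y = (\<Sum>g\<in>Poly_Mapping.keys p. perm_mat (\<rho> g) x y *\<^sub>R Poly_Mapping.lookup p g)"

text \<open>Operator norm on the orthogonal complement of the constants in \<open>\<complex>\<^sup>N\<close>.\<close>

definition onorm_perp_one :: "nat \<Rightarrow> (nat \<Rightarrow> nat \<Rightarrow> complex) \<Rightarrow> real" where
  "onorm_perp_one N M =
     (SUP f\<in>{f. (\<Sum>x\<in>{1..N}. f x) = 0 \<and> L2_set (\<lambda>x. cmod (f x)) {1..N} \<le> 1}.
        L2_set (\<lambda>x. cmod (\<Sum>y\<in>{1..N}. M x y * f y)) {1..N})"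

text \<open>\<open>N \<rightarrow> \<infinity>\<close> along an infinite set of integers.\<close>

definition along :: "nat set \<Rightarrow> nat filter" where
  "along NN = inf sequentially (principal NN)"

definition conv_distr :: "nat set \<Rightarrow> (nat \<Rightarrow> 'g::group_add \<Rightarrow> nat \<Rightarrow> nat) \<Rightarrow> bool" where
  "conv_distr NN \<rho> \<longleftrightarrow>
     (\<forall>g. g \<noteq> 0 \<longrightarrow>
        ((\<lambda>N. (1 / real N) * (\<Sum>x\<in>{1..N}. perm_mat (\<rho> N g) x x)) \<longlongrightarrow> 0) (along NN))"

definition strong_conv_distr :: "nat set \<Rightarrow> (nat \<Rightarrow> 'g::group_add \<Rightarrow> nat \<Rightarrow> nat) \<Rightarrow> bool" where
  "strong_conv_distr NN \<rho> \<longleftrightarrow> conv_distr NN \<rho> \<and>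
     (\<forall>q :: 'g \<Rightarrow>\<^sub>0 complex.
        ((\<lambda>N. onorm_perp_one N (rep_mat (\<rho> N) q)) \<longlongrightarrow> ell2_onorm (lam_scalar q)) (along NN))"

section \<open>Eigenbases and observables on \<open>\<complex>\<^sup>r \<otimes> \<complex>\<^sup>N\<close>\<close>

definition mat_app ::
  "nat \<Rightarrow> (nat \<Rightarrow> nat \<Rightarrow> complex^'r^'r) \<Rightarrow> (nat \<Rightarrow> complex^'r) \<Rightarrow> nat \<Rightarrow> complex^'r" where
  "mat_app N K v x = (\<Sum>y\<in>{1..N}. K x y *v v y)"

definition vec_inner :: "nat \<Rightarrow> (nat \<Rightarrow> complex^'r) \<Rightarrow> (nat \<Rightarrow> complex^'r) \<Rightarrow> complex" where
  "vec_inner N u v = (\<Sum>x\<in>{1..N}. \<Sum>i\<in>UNIV. cnj (u x $ i) * v x $ i)"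

text \<open>\<open>\<phi> 1, \<dots>, \<phi> (rN)\<close> is an orthonormal family of eigenvectors with eigenvalues \<open>ev\<close>; it is a
  basis because its cardinality is the dimension of \<open>\<complex>\<^sup>r \<otimes> \<complex>\<^sup>N\<close>. The function \<open>ev\<close> is
  determined on \<open>{1..rN}\<close>, and real-valued when the matrix is Hermitian.\<close>

definition eigenbasis ::
  "nat \<Rightarrow> (nat \<Rightarrow> nat \<Rightarrow> complex^'r^'r) \<Rightarrow> (nat \<Rightarrow> real) \<Rightarrow> (nat \<Rightarrow> nat \<Rightarrow> complex^'r) \<Rightarrow> bool" where
  "eigenbasis N P ev \<phi> \<longleftrightarrow>
     (\<forall>\<alpha>\<in>{1..CARD('r) * N}. \<forall>\<beta>\<in>{1..CARD('r) * N}.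
        vec_inner N (\<phi> \<alpha>) (\<phi> \<beta>) = of_bool (\<alpha> = \<beta>)) \<and>
     (\<forall>\<alpha>\<in>{1..CARD('r) * N}. \<forall>x\<in>{1..N}.
        mat_app N P (\<phi> \<alpha>) x = complex_of_real (ev \<alpha>) *s \<phi> \<alpha> x)"

definition T_local ::
  "nat \<Rightarrow> ('g \<Rightarrow> nat \<Rightarrow> nat) \<Rightarrow> 'g set \<Rightarrow> (nat \<Rightarrow> nat \<Rightarrow> complex^'r^'r) \<Rightarrow> bool" where
  "T_local N \<rho> T K \<longleftrightarrow>
     (\<forall>x\<in>{1..N}. \<forall>y\<in>{1..N}. (\<nexists>g. g \<in> T \<and> x = \<rho> g y) \<longrightarrow> K x y = 0)"

definition norm_1_inf :: "nat \<Rightarrow> (nat \<Rightarrow> nat \<Rightarrow> complex^'r^'r) \<Rightarrow> real" where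
  "norm_1_inf N K = Max ((\<lambda>(x, y). hs_norm (K x y)) ` ({1..N} \<times> {1..N}))"

definition avg :: "nat \<Rightarrow> (nat \<Rightarrow> 'v::real_vector) \<Rightarrow> 'v" where
  "avg N a = (1 / real N) *\<^sub>R (\<Sum>x\<in>{1..N}. a x)"

definition avg_obs ::
  "nat \<Rightarrow> ('g \<Rightarrow> nat \<Rightarrow> nat) \<Rightarrow> 'g set \<Rightarrow> (nat \<Rightarrow> nat \<Rightarrow> complex^'r^'r) \<Rightarrow> nat \<Rightarrow> nat \<Rightarrow> complex^'r^'r"
  where
  "avg_obs N \<rho> T K =
     rep_mat \<rho> (\<Sum>g\<in>T. Poly_Mapping.single g (avg N (\<lambda>x. K (\<rho> g x) x)))"

definition correlation ::
  "nat \<Rightarrow> ('g \<Rightarrow> nat \<Rightarrow> nat) \<Rightarrow> (nat \<Rightarrow> complex^'r^'r) \<Rightarrow> 'g \<Rightarrow> real" where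
  "correlation N \<rho> a g =
     onorm ((*v) (avg N (\<lambda>x. kron (map_matrix cnj (a x - avg N a)) (a (\<rho> g x) - avg N a))))"

definition asymp_uncorrelated ::
  "'g::group_add set \<Rightarrow> nat set \<Rightarrow> (nat \<Rightarrow> 'g \<Rightarrow> nat \<Rightarrow> nat) \<Rightarrow> 'g set
     \<Rightarrow> (nat \<Rightarrow> nat \<Rightarrow> nat \<Rightarrow> complex^'r^'r) \<Rightarrow> bool" where
  "asymp_uncorrelated S NN \<rho> T K \<longleftrightarrow>
     (\<forall>t\<in>T.
        ((\<lambda>g. Limsup (along NN)
                (\<lambda>N. ereal (correlation N (\<rho> N) (\<lambda>x. K N (\<rho> N t x) x) g)))
          \<longlongrightarrow> 0) (filtercomap (word_length S) at_top))"

section \<open>Subspaces of \<open>M\<^sub>r(\<complex>) \<otimes> \<complex>\<^sup>N\<close>\<close>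

definition fam_scale :: "complex \<Rightarrow> (nat \<Rightarrow> complex^'r^'r) \<Rightarrow> (nat \<Rightarrow> complex^'r^'r)" where
  "fam_scale c M = (\<lambda>x. map_matrix ((*) c) (M x))"

interpretation fam: vector_space fam_scale
  by unfold_locales (auto simp: fam_scale_def fun_eq_iff vec_eq_iff algebra_simps)

text \<open>Elements of \<open>M\<^sub>r(\<complex>) \<otimes> \<complex>\<^sup>N\<close> are represented by families vanishing outside \<open>{1..N}\<close>, so that
  \<open>fam.dim\<close> of a subspace is its complex dimension, at most \<open>r\<^sup>2 N\<close>.\<close>

definition fam_subspace :: "nat \<Rightarrow> (nat \<Rightarrow> complex^'r^'r) set \<Rightarrow> bool" where
  "fam_subspace N H \<longleftrightarrow> fam.subspace H \<and> (\<forall>M\<in>H. \<forall>x. x \<notin> {1..N} \<longrightarrow> M x = 0)"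

definition fam_perp :: "nat \<Rightarrow> (nat \<Rightarrow> complex^'r^'r) set \<Rightarrow> (nat \<Rightarrow> complex^'r^'r) set" where
  "fam_perp N H =
     {M. \<forall>L\<in>H. (\<Sum>x\<in>{1..N}. \<Sum>i\<in>UNIV. \<Sum>j\<in>UNIV. cnj (L x $ i $ j) * M x $ i $ j) = 0}"

section \<open>Quantum ergodicity and quantum mixing\<close>

definition spec_index :: "nat \<Rightarrow> (nat \<Rightarrow> real) \<Rightarrow> real set \<Rightarrow> nat set" where
  "spec_index n ev J = {\<alpha>\<in>{1..n}. ev \<alpha> \<in> J}"

definition obs_diff ::
  "nat \<Rightarrow> ('g \<Rightarrow> nat \<Rightarrow> nat) \<Rightarrow> 'g set \<Rightarrow> (nat \<Rightarrow> nat \<Rightarrow> complex^'r^'r)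
     \<Rightarrow> (nat \<Rightarrow> complex^'r) \<Rightarrow> (nat \<Rightarrow> complex^'r) \<Rightarrow> real" where
  "obs_diff N \<rho> T K u v =
     (cmod (vec_inner N u (mat_app N K v) - vec_inner N u (mat_app N (avg_obs N \<rho> T K) v)))\<^sup>2"

text \<open>Division by \<open>0\<close> gives \<open>0\<close>, so averages over empty index sets are \<open>0\<close>.\<close>

definition QE ::
  "nat set \<Rightarrow> (nat \<Rightarrow> 'g::group_add \<Rightarrow> nat \<Rightarrow> nat) \<Rightarrow> real set \<Rightarrow> (nat \<Rightarrow> nat \<Rightarrow> real)
     \<Rightarrow> (nat \<Rightarrow> nat \<Rightarrow> nat \<Rightarrow> complex^'r) \<Rightarrow> 'g set \<Rightarrow> (nat \<Rightarrow> nat \<Rightarrow> nat \<Rightarrow> complex^'r^'r) \<Rightarrow> bool" where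
  "QE NN \<rho> I ev \<phi> T K \<longleftrightarrow>
     ((\<lambda>N. let \<Lambda> = spec_index (CARD('r) * N) (ev N)
           in (1 / real (card (\<Lambda> I))) *
              (\<Sum>\<alpha>\<in>\<Lambda> I. obs_diff N (\<rho> N) T (K N) (\<phi> N \<alpha>) (\<phi> N \<alpha>)))
       \<longlongrightarrow> 0) (along NN)"

definition QM ::
  "nat set \<Rightarrow> (nat \<Rightarrow> 'g::group_add \<Rightarrow> nat \<Rightarrow> nat) \<Rightarrow> real set \<Rightarrow> (nat \<Rightarrow> nat \<Rightarrow> real)
     \<Rightarrow> (nat \<Rightarrow> nat \<Rightarrow> nat \<Rightarrow> complex^'r) \<Rightarrow> 'g set \<Rightarrow> (nat \<Rightarrow> nat \<Rightarrow> nat \<Rightarrow> complex^'r^'r) \<Rightarrow> bool" where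
  "QM NN \<rho> I ev \<phi> T K \<longleftrightarrow>
     ((\<lambda>\<eta>. Limsup (along NN)
       (\<lambda>N. let \<Lambda> = (\<lambda>E. spec_index (CARD('r) * N) (ev N) {E - \<eta>..E + \<eta>})
            in SUP (E1, E2)\<in>interior I \<times> interior I.
                 ereal ((1 / real (card (\<Lambda> E1))) *
                   (\<Sum>\<alpha>\<in>\<Lambda> E1. \<Sum>\<beta>\<in>\<Lambda> E2.
                      obs_diff N (\<rho> N) T (K N) (\<phi> N \<beta>) (\<phi> N \<alpha>)))))
       \<longlongrightarrow> 0) (at_right 0)"

text \<open>The data common to all cases: orthonormal eigenbases of \<open>\<rho>\<^sub>N(p)\<close>, a finite \<open>T\<close>, and
  \<open>T\<close>-local observables of norm at most \<open>1\<close>.\<close>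

definition admissible ::
  "nat set \<Rightarrow> (nat \<Rightarrow> 'g::group_add \<Rightarrow> nat \<Rightarrow> nat) \<Rightarrow> ('g \<Rightarrow>\<^sub>0 complex^'r^'r) \<Rightarrow> (nat \<Rightarrow> nat \<Rightarrow> real)
     \<Rightarrow> (nat \<Rightarrow> nat \<Rightarrow> nat \<Rightarrow> complex^'r) \<Rightarrow> 'g set \<Rightarrow> (nat \<Rightarrow> nat \<Rightarrow> nat \<Rightarrow> complex^'r^'r) \<Rightarrow> bool" where
  "admissible NN \<rho> p ev \<phi> T K \<longleftrightarrow> finite T \<and>
     (\<forall>N\<in>NN. eigenbasis N (rep_mat (\<rho> N) p) (ev N) (\<phi> N) \<and>
             T_local N (\<rho> N) T (K N) \<and> norm_1_inf N (K N) \<le> 1)"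

end

theory Submission
  imports Defs
begin

text \<open>
  The operator \<open>\<Im>R\<^sup>z = \<eta> ((P - E)\<^sup>2 + \<eta>\<^sup>2)\<^sup>-\<^sup>1\<close> is a norm limit of partial Neumann sums, which are
  polynomials in \<open>P\<close> and hence elements of the group algebra. The same elements act on \<open>\<complex>\<^sup>r \<otimes> \<complex>\<^sup>N\<close> through
  \<open>\<rho>\<^sub>N\<close> as functions of \<open>P\<^sub>N\<close> concentrated near \<open>E\<close>, and convergence in distribution transfers traces.
  Together with (ACmat) this shows that a window of half-width \<open>\<eta>\<close> contains at least \<open>c \<eta> N\<close> eigenvalues.

  Let \<open>q\<^sub>1\<close>, \<open>q\<^sub>2\<close> be such approximations of \<open>\<Im>R\<close> at \<open>E\<^sub>1 + i\<eta>\<close>, \<open>E\<^sub>2 + i\<eta>\<close>. For an observable \<open>M\<close> carried by a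
  single \<open>t \<in> T\<close>, with centred values \<open>a\<close>, the sum of \<open>|\<langle>\<phi>\<^sub>\<beta>, M \<phi>\<^sub>\<alpha>\<rangle>|\<^sup>2\<close> over two windows is at most a
  constant times \<open>\<eta>\<^sup>2 Tr(q\<^sub>1 M\<^sup>* q\<^sub>2 M)\<close>. Up to \<open>o(N)\<close> this is \<open>\<eta>\<^sup>2 N\<close> times a sum over \<open>g\<close> of the
  autocorrelation of \<open>a\<close> at \<open>g\<close> against \<open>q\<^sub>1(g) q\<^sub>2(t g\<^sup>-\<^sup>1 t\<^sup>-\<^sup>1)\<close>, so for mixing it suffices that \<open>\<eta>\<close> times
  this sum is small.
  In case (i) the autocorrelations are small off a finite set, and \<open>\<eta> \<Sum>\<^sub>g |q\<^sub>1| |q\<^sub>2|\<close> is bounded.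
  In cases (ii) and (iii) the sum is a matrix coefficient of \<open>\<rho>\<^sub>N(W)\<close> at \<open>a\<close> with \<open>W = \<eta> q\<^sub>1 q\<^sub>2\<close>, where
  \<open>\<parallel>\<lambda>(W)\<parallel>\<close> is small by (RD) and (R4mat). The norm bound passes to \<open>\<rho>\<^sub>N(W)\<close> by strong convergence in
  case (iii). In case (ii) it holds off the span of the vectors expanded by \<open>\<rho>\<^sub>N(w)\<close> by more than \<open>\<parallel>\<lambda>(w)\<parallel>\<close>,
  for \<open>w\<close> in growing finite nets; a moment estimate bounds the dimension of this span by \<open>o(N)\<close>.
  Quantum ergodicity follows from quantum mixing by covering the interval with windows.
\<close>

section \<open>Square-summable functions\<close>

text \<open>Convergence in distribution controls one group element at a time, whereas the resolvent
  has infinitely many coefficients, varying with the energy. Hence the order of limits: \<eta>, then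
  the truncation order n depending on \<eta>, then N. One constant \<open>shift_const\<close> serves
  all energies, so the truncation error \<open>decay_base \<eta> ^ n / \<eta>\<close> is uniform in
  E and every transfer concerns the finite set \<open>coeff_ball n\<close>. Truncation is harmless
  in weighted sums too: supports grow linearly in n while the error decays geometrically. The fourth
  power in (R4mat) arises from the square of a product of two coefficients, one per window. The norm
  bound on the product must hold for all pairs of energies at the same N, hence the nets of group
  algebra elements. A diagonal choice lets N admit finer and finer nets, which makes the exceptional
  subspace independent of the observables. The polynomial calculus is set up over real scalars on
  arbitrary function spaces, so that one computation serves the limit operator, the finite matrices
  and the coefficient functions.\<close>

lemma ell2I:
  fixes u :: "'x \<Rightarrow> 'v::real_normed_vector"
  assumes "\<And>F. finite F \<Longrightarrow> L2_set (\<lambda>x. norm (u x)) F \<le> B"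
  shows ell2I_mem: "u \<in> ell2" and ell2I_norm: "ell2_norm u \<le> B"
proof -
  have B: "0 \<le> B" using assms[of "{}"] by simp
  have *: "(\<Sum>x\<in>F. (norm (u x))\<^sup>2) \<le> B\<^sup>2" if "finite F" for F
    using assms[OF that] unfolding L2_set_def by (rule sqrt_le_D)
  have s: "(\<lambda>x. (norm (u x))\<^sup>2) summable_on UNIV"
    by (rule nonneg_bounded_partial_sums_imp_summable_on[of _ _ "B\<^sup>2"])
      (use * in \<open>auto intro!: eventually_finite_subsets_at_top_weakI\<close>)
  then show "u \<in> ell2" by (simp add: ell2_def)
  have "(\<Sum>\<^sub>\<infinity>x. (norm (u x))\<^sup>2) \<le> B\<^sup>2"
    using s by (rule infsum_le_finite_sums) (use * in auto)
  then show "ell2_norm u \<le> B" unfolding ell2_norm_def using B by (simp add: real_le_lsqrt)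
qed

lemma ell2_finite_le:
  assumes "u \<in> ell2" "finite F"
  shows "L2_set (\<lambda>x. norm (u x)) F \<le> ell2_norm u"
  unfolding L2_set_def ell2_norm_def
  using assms by (intro real_sqrt_le_mono finite_sum_le_infsum) (auto simp: ell2_def)

lemma ell2_norm_nonneg [simp]: "0 \<le> ell2_norm u"
  unfolding ell2_norm_def by (intro real_sqrt_ge_zero infsum_nonneg) auto

lemma ell2_norm_sq: "(ell2_norm u)\<^sup>2 = (\<Sum>\<^sub>\<infinity>g. (norm (u g))\<^sup>2)"
  unfolding ell2_norm_def by (simp add: infsum_nonneg)

lemma ell2_norm_ge_pointwise: "u \<in> ell2 \<Longrightarrow> norm (u x) \<le> ell2_norm u"
  using ell2_finite_le[of u "{x}"] by simp

lemma ell2_sum_sq_le: "u \<in> ell2 \<Longrightarrow> finite F \<Longrightarrow> (\<Sum>x\<in>F. (norm (u x))\<^sup>2) \<le> (ell2_norm u)\<^sup>2"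
  unfolding ell2_norm_sq by (intro finite_sum_le_infsum) (auto simp: ell2_def)

lemma ell2_zero: "(\<lambda>x. 0) \<in> ell2" "ell2_norm (\<lambda>x. 0) = 0"
  by (auto simp: ell2_def ell2_norm_def)

lemma ell2_norm_eq_0: "u \<in> ell2 \<Longrightarrow> ell2_norm u = 0 \<Longrightarrow> u = (\<lambda>x. 0)"
  using ell2_norm_ge_pointwise by (metis norm_le_zero_iff)

text \<open>Minkowski's inequality on finite sets passes to the whole sum, because
  \<open>ell2I\<close> reads membership and norm off finite subsets. Several estimates below follow
  this pattern.\<close>

lemma ell2_add:
  fixes u v :: "'x \<Rightarrow> 'v::real_normed_vector"
  assumes "u \<in> ell2" "v \<in> ell2"
  shows "(\<lambda>x. u x + v x) \<in> ell2" and "ell2_norm (\<lambda>x. u x + v x) \<le> ell2_norm u + ell2_norm v"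
proof -
  have *: "L2_set (\<lambda>x. norm (u x + v x)) F \<le> ell2_norm u + ell2_norm v" if "finite F" for F
  proof -
    have "L2_set (\<lambda>x. norm (u x + v x)) F \<le> L2_set (\<lambda>x. norm (u x) + norm (v x)) F"
      by (intro L2_set_mono) (auto intro: norm_triangle_ineq)
    also have "\<dots> \<le> L2_set (\<lambda>x. norm (u x)) F + L2_set (\<lambda>x. norm (v x)) F"
      by (rule L2_set_triangle_ineq)
    also have "\<dots> \<le> ell2_norm u + ell2_norm v"
      using assms that by (intro add_mono ell2_finite_le)
    finally show ?thesis .
  qed
  show "(\<lambda>x. u x + v x) \<in> ell2" by (rule ell2I_mem) (rule *)
  show "ell2_norm (\<lambda>x. u x + v x) \<le> ell2_norm u + ell2_norm v" by (rule ell2I_norm) (rule *)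
qed

lemma ell2_dominated:
  fixes u :: "'x \<Rightarrow> 'v::real_normed_vector" and v :: "'x \<Rightarrow> 'w::real_normed_vector"
  assumes "v \<in> ell2" "\<And>x. norm (u x) \<le> k * norm (v x)" "0 \<le> k"
  shows "u \<in> ell2" and "ell2_norm u \<le> k * ell2_norm v"
proof -
  have *: "L2_set (\<lambda>x. norm (u x)) F \<le> k * ell2_norm v" if "finite F" for F
  proof -
    have "L2_set (\<lambda>x. norm (u x)) F \<le> L2_set (\<lambda>x. k * norm (v x)) F"
      by (intro L2_set_mono) (use assms in auto)
    also have "\<dots> = k * L2_set (\<lambda>x. norm (v x)) F" using assms by (simp add: L2_set_right_distrib)
    also have "\<dots> \<le> k * ell2_norm v" using ell2_finite_le[OF assms(1) that] assms(3) by (rule mult_left_mono)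
    finally show ?thesis .
  qed
  show "u \<in> ell2" by (rule ell2I_mem) (rule *)
  show "ell2_norm u \<le> k * ell2_norm v" by (rule ell2I_norm) (rule *)
qed

lemma ell2_scaleR:
  fixes u :: "'x \<Rightarrow> 'v::real_normed_vector"
  shows "u \<in> ell2 \<Longrightarrow> (\<lambda>x. a *\<^sub>R u x) \<in> ell2" and "ell2_norm (\<lambda>x. a *\<^sub>R u x) = \<bar>a\<bar> * ell2_norm u"
proof -
  show "u \<in> ell2 \<Longrightarrow> (\<lambda>x. a *\<^sub>R u x) \<in> ell2" by (rule ell2_dominated(1)[of u _ "\<bar>a\<bar>"]) auto
  show "ell2_norm (\<lambda>x. a *\<^sub>R u x) = \<bar>a\<bar> * ell2_norm u"
    unfolding ell2_norm_def by (simp add: power_mult_distrib infsum_cmult_right' real_sqrt_mult)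
qed

lemma ell2_diff:
  fixes u v :: "'x \<Rightarrow> 'v::real_normed_vector"
  assumes "u \<in> ell2" "v \<in> ell2"
  shows "(\<lambda>x. u x - v x) \<in> ell2" and "ell2_norm (\<lambda>x. u x - v x) \<le> ell2_norm u + ell2_norm v"
  using ell2_add[OF assms(1) ell2_scaleR(1)[OF assms(2), of "-1"]] ell2_scaleR(2)[of "-1" v] by auto

lemma ell2_sum:
  fixes u :: "'i \<Rightarrow> 'x \<Rightarrow> 'v::real_normed_vector"
  assumes "finite I" "\<And>i. i \<in> I \<Longrightarrow> u i \<in> ell2"
  shows "(\<lambda>x. \<Sum>i\<in>I. u i x) \<in> ell2 \<and> ell2_norm (\<lambda>x. \<Sum>i\<in>I. u i x) \<le> (\<Sum>i\<in>I. ell2_norm (u i))"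
  using assms
proof (induction I rule: finite_induct)
  case empty then show ?case by (simp add: ell2_zero)
next
  case (insert i I)
  then have IH: "(\<lambda>x. \<Sum>i\<in>I. u i x) \<in> ell2" "ell2_norm (\<lambda>x. \<Sum>i\<in>I. u i x) \<le> (\<Sum>i\<in>I. ell2_norm (u i))"
    by auto
  show ?case using ell2_add[OF insert.prems[of i] IH(1)] IH(2) insert.hyps by simp
qed

lemma ell2_reindex:
  fixes u :: "'x \<Rightarrow> 'v::real_normed_vector"
  assumes "bij \<sigma>"
  shows "u \<in> ell2 \<Longrightarrow> (\<lambda>x. u (\<sigma> x)) \<in> ell2" and "ell2_norm (\<lambda>x. u (\<sigma> x)) = ell2_norm u"
proof -
  show "u \<in> ell2 \<Longrightarrow> (\<lambda>x. u (\<sigma> x)) \<in> ell2"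
    using summable_on_reindex_bij_betw[OF assms, of "\<lambda>x. (norm (u x))\<^sup>2"] by (simp add: ell2_def)
  show "ell2_norm (\<lambda>x. u (\<sigma> x)) = ell2_norm u"
    using infsum_reindex_bij_betw[OF assms, of "\<lambda>x. (norm (u x))\<^sup>2"] by (simp add: ell2_norm_def)
qed

lemma ell2_finite_support:
  fixes u :: "'x \<Rightarrow> 'v::real_normed_vector"
  assumes "finite A" "\<And>x. x \<notin> A \<Longrightarrow> u x = 0"
  shows "u \<in> ell2" and "ell2_norm u = L2_set (\<lambda>x. norm (u x)) A"
proof -
  have "(\<lambda>x. (norm (u x))\<^sup>2) summable_on UNIV"
    using summable_on_cong_neutral[of UNIV A "\<lambda>x. (norm (u x))\<^sup>2" "\<lambda>x. (norm (u x))\<^sup>2"] assms by auto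
  then show "u \<in> ell2" by (simp add: ell2_def)
  have "(\<Sum>\<^sub>\<infinity>x. (norm (u x))\<^sup>2) = (\<Sum>x\<in>A. (norm (u x))\<^sup>2)"
    using infsum_cong_neutral[of UNIV A "\<lambda>x. (norm (u x))\<^sup>2" "\<lambda>x. (norm (u x))\<^sup>2"] assms by auto
  then show "ell2_norm u = L2_set (\<lambda>x. norm (u x)) A" by (simp add: ell2_norm_def L2_set_def)
qed

text \<open>Only a real inner product: the operator estimates use real scalars, so that scalar and
  vector-valued functions are treated at once. \<open>ell2_inner_eip\<close> recovers the complex
  product from it.\<close>

definition eip :: "('x \<Rightarrow> 'v::real_inner) \<Rightarrow> ('x \<Rightarrow> 'v) \<Rightarrow> real" where
  "eip u v = (\<Sum>\<^sub>\<infinity>x. u x \<bullet> v x)"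

lemma eip_abs_summable:
  fixes u v :: "'x \<Rightarrow> 'v::real_inner"
  assumes "u \<in> ell2" "v \<in> ell2"
  shows "(\<lambda>x. norm (u x) * norm (v x)) summable_on UNIV"
proof (rule summable_on_comparison_test)
  show "(\<lambda>x. (norm (u x))\<^sup>2 + (norm (v x))\<^sup>2) summable_on UNIV"
    using assms by (intro summable_on_add) (auto simp: ell2_def)
  show "norm (u x) * norm (v x) \<le> (norm (u x))\<^sup>2 + (norm (v x))\<^sup>2" for x
    using sum_squares_bound[of "norm (u x)" "norm (v x)"] mult_nonneg_nonneg[OF norm_ge_zero norm_ge_zero, of "u x" "v x"] by linarith
qed auto

lemma eip_summable:
  fixes u v :: "'x \<Rightarrow> 'v::real_inner"
  assumes "u \<in> ell2" "v \<in> ell2"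
  shows "(\<lambda>x. u x \<bullet> v x) summable_on UNIV"
proof -
  have "(\<lambda>x. norm (u x \<bullet> v x)) summable_on UNIV"
    by (rule summable_on_comparison_test[OF eip_abs_summable[OF assms]]) (simp_all add: Cauchy_Schwarz_ineq2)
  then show ?thesis by (rule summable_on_iff_abs_summable_on_real[THEN iffD2])
qed

lemma eip_commute: "eip u v = eip v u"
  by (simp add: eip_def inner_commute)

lemma eip_add:
  fixes u v w :: "'x \<Rightarrow> 'v::real_inner"
  assumes "u \<in> ell2" "v \<in> ell2" "w \<in> ell2"
  shows "eip (\<lambda>x. u x + v x) w = eip u w + eip v w"
  unfolding eip_def inner_add_left using assms by (intro infsum_add eip_summable)

lemma eip_scaleR: "eip (\<lambda>x. a *\<^sub>R u x) w = a * eip u w"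
  by (simp add: eip_def infsum_cmult_right')

lemma eip_diff:
  fixes u v w :: "'x \<Rightarrow> 'v::real_inner"
  assumes "u \<in> ell2" "v \<in> ell2" "w \<in> ell2"
  shows "eip (\<lambda>x. u x - v x) w = eip u w - eip v w"
  using eip_add[OF assms(1) ell2_scaleR(1)[OF assms(2), of "-1"] assms(3)] eip_scaleR[of "-1" v w] by simp

lemma eip_sum:
  fixes u :: "'i \<Rightarrow> 'x \<Rightarrow> 'v::real_inner"
  assumes "finite I" "\<And>i. i \<in> I \<Longrightarrow> u i \<in> ell2" "w \<in> ell2"
  shows "eip (\<lambda>x. \<Sum>i\<in>I. u i x) w = (\<Sum>i\<in>I. eip (u i) w)"
  using assms
proof (induction I rule: finite_induct)
  case empty then show ?case by (simp add: eip_def)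
next
  case (insert i I)
  then show ?case using ell2_sum[of I u] by (simp add: eip_add)
qed

lemma eip_self: "eip u u = (ell2_norm u)\<^sup>2"
  by (simp add: eip_def ell2_norm_sq power2_norm_eq_inner)

lemma eip_le:
  fixes u v :: "'x \<Rightarrow> 'v::real_inner"
  assumes "u \<in> ell2" "v \<in> ell2"
  shows "\<bar>eip u v\<bar> \<le> ell2_norm u * ell2_norm v"
proof -
  have s: "(\<lambda>x. \<bar>u x \<bullet> v x\<bar>) summable_on UNIV"
    using summable_on_iff_abs_summable_on_real[THEN iffD1, OF eip_summable[OF assms]] by simp
  have "\<bar>eip u v\<bar> \<le> (\<Sum>\<^sub>\<infinity>x. \<bar>u x \<bullet> v x\<bar>)"
    unfolding eip_def using norm_infsum_bound[of "\<lambda>x. u x \<bullet> v x" UNIV] s by simp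
  also have "\<dots> \<le> ell2_norm u * ell2_norm v"
  proof (rule infsum_le_finite_sums[OF s])
    fix F :: "'x set" assume F: "finite F"
    have "(\<Sum>x\<in>F. \<bar>u x \<bullet> v x\<bar>) \<le> (\<Sum>x\<in>F. \<bar>norm (u x)\<bar> * \<bar>norm (v x)\<bar>)"
      by (intro sum_mono) (simp add: Cauchy_Schwarz_ineq2)
    also have "\<dots> \<le> L2_set (\<lambda>x. norm (u x)) F * L2_set (\<lambda>x. norm (v x)) F"
      by (rule L2_set_mult_ineq)
    also have "\<dots> \<le> ell2_norm u * ell2_norm v"
      using ell2_finite_le[OF _ F] assms by (intro mult_mono) auto
    finally show "(\<Sum>x\<in>F. \<bar>u x \<bullet> v x\<bar>) \<le> ell2_norm u * ell2_norm v" .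
  qed
  finally show ?thesis .
qed

lemma eip_reindex: "bij \<sigma> \<Longrightarrow> eip (\<lambda>x. u (\<sigma> x)) (\<lambda>x. v (\<sigma> x)) = eip u v"
  unfolding eip_def by (rule infsum_reindex_bij_betw[of \<sigma> UNIV UNIV "\<lambda>x. u x \<bullet> v x"])

lemma ell2_norm_diff_sq:
  fixes u v :: "'x \<Rightarrow> 'v::real_inner"
  assumes "u \<in> ell2" "v \<in> ell2"
  shows "(ell2_norm (\<lambda>x. u x - v x))\<^sup>2 = (ell2_norm u)\<^sup>2 - 2 * eip u v + (ell2_norm v)\<^sup>2"
  using assms eip_diff[OF assms ell2_diff(1)[OF assms]] eip_diff[OF assms assms(1)] eip_diff[OF assms assms(2)]
  by (simp add: eip_self[symmetric] eip_commute)

lemma eip_basis: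
  fixes u :: "'x \<Rightarrow> 'v::real_inner"
  shows "eip u (\<lambda>x. if x = y then e else 0) = u y \<bullet> e"
proof -
  have "eip u (\<lambda>x. if x = y then e else 0) = (\<Sum>\<^sub>\<infinity>x\<in>{y}. u x \<bullet> e)"
    unfolding eip_def by (rule infsum_cong_neutral) auto
  then show ?thesis by simp
qed

section \<open>Bessel's inequality\<close>

text \<open>Index set and vectors are kept apart: the notion serves both an eigenbasis with
  coordinates in \<open>{1..N} \<times> UNIV\<close> and a set of vectors indexed by itself.\<close>

definition orthonormal_fam :: "'x set \<Rightarrow> 'a set \<Rightarrow> ('a \<Rightarrow> 'x \<Rightarrow> complex) \<Rightarrow> bool" where
  "orthonormal_fam I A f \<longleftrightarrow> (\<forall>\<alpha>\<in>A. \<forall>\<beta>\<in>A. (\<Sum>x\<in>I. cnj (f \<alpha> x) * f \<beta> x) = of_bool (\<alpha> = \<beta>))"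

text \<open>Pythagoras for the projection onto the span. The exact defect, beyond Bessel's
  inequality, is what yields completeness by a dimension count.\<close>

lemma bessel_identity:
  assumes "finite I" "finite A" "orthonormal_fam I A f"
  defines "c \<equiv> \<lambda>v \<alpha>. \<Sum>x\<in>I. cnj (f \<alpha> x) * v x"
  shows "(\<Sum>x\<in>I. (cmod (v x - (\<Sum>\<alpha>\<in>A. c v \<alpha> * f \<alpha> x)))\<^sup>2)
           = (\<Sum>x\<in>I. (cmod (v x))\<^sup>2) - (\<Sum>\<alpha>\<in>A. (cmod (c v \<alpha>))\<^sup>2)"
proof -
  have inner: "(\<Sum>x\<in>I. v x * (z * cnj (f \<alpha> x))) = c v \<alpha> * z" for \<alpha> z
    unfolding c_def by (simp add: sum_distrib_left mult_ac)
  have eq1: "(\<Sum>x\<in>I. v x * cnj (\<Sum>\<alpha>\<in>A. c v \<alpha> * f \<alpha> x)) = (\<Sum>\<alpha>\<in>A. c v \<alpha> * cnj (c v \<alpha>))"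
  proof -
    have "(\<Sum>x\<in>I. v x * cnj (\<Sum>\<alpha>\<in>A. c v \<alpha> * f \<alpha> x)) = (\<Sum>\<alpha>\<in>A. \<Sum>x\<in>I. v x * (cnj (c v \<alpha>) * cnj (f \<alpha> x)))"
      by (simp only: cnj_sum complex_cnj_mult sum_distrib_left) (rule sum.swap)
    also have "\<dots> = (\<Sum>\<alpha>\<in>A. c v \<alpha> * cnj (c v \<alpha>))"
      by (simp only: inner)
    finally show ?thesis .
  qed
  have eq2: "(\<Sum>x\<in>I. (\<Sum>\<alpha>\<in>A. c v \<alpha> * f \<alpha> x) * cnj (v x)) = (\<Sum>\<alpha>\<in>A. c v \<alpha> * cnj (c v \<alpha>))"
    using arg_cong[OF eq1, of cnj] by (simp add: mult.commute)
  have "(\<Sum>x\<in>I. (\<Sum>\<alpha>\<in>A. c v \<alpha> * f \<alpha> x) * cnj (\<Sum>\<beta>\<in>A. c v \<beta> * f \<beta> x))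
        = (\<Sum>x\<in>I. \<Sum>\<alpha>\<in>A. \<Sum>\<beta>\<in>A. c v \<alpha> * cnj (c v \<beta>) * (cnj (f \<beta> x) * f \<alpha> x))"
    by (simp only: cnj_sum complex_cnj_mult sum_product) (simp only: mult_ac)
  also have "\<dots> = (\<Sum>\<alpha>\<in>A. \<Sum>x\<in>I. \<Sum>\<beta>\<in>A. c v \<alpha> * cnj (c v \<beta>) * (cnj (f \<beta> x) * f \<alpha> x))"
    by (rule sum.swap)
  also have "\<dots> = (\<Sum>\<alpha>\<in>A. \<Sum>\<beta>\<in>A. \<Sum>x\<in>I. c v \<alpha> * cnj (c v \<beta>) * (cnj (f \<beta> x) * f \<alpha> x))"
    by (intro sum.cong refl sum.swap)
  also have "\<dots> = (\<Sum>\<alpha>\<in>A. \<Sum>\<beta>\<in>A. c v \<alpha> * cnj (c v \<beta>) * of_bool (\<beta> = \<alpha>))"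
    using assms(3) unfolding orthonormal_fam_def by (intro sum.cong refl) (simp add: sum_distrib_left[symmetric])
  also have "\<dots> = (\<Sum>\<alpha>\<in>A. c v \<alpha> * cnj (c v \<alpha>))"
    using assms(2) by (intro sum.cong refl) (simp add: of_bool_def if_distrib sum.delta cong: if_cong)
  finally have eq3: "(\<Sum>x\<in>I. (\<Sum>\<alpha>\<in>A. c v \<alpha> * f \<alpha> x) * cnj (\<Sum>\<beta>\<in>A. c v \<beta> * f \<beta> x)) = (\<Sum>\<alpha>\<in>A. c v \<alpha> * cnj (c v \<alpha>))" .
  \<comment> \<open>Both cross terms and the square of the projection have the same value, so one
    copy of it survives with a minus sign.\<close>
  have expand: "(a - b) * cnj (a - b) = a * cnj a - a * cnj b - b * cnj a + b * cnj b" for a b :: complex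
    by (simp add: algebra_simps)
  have "complex_of_real (\<Sum>x\<in>I. (cmod (v x - (\<Sum>\<alpha>\<in>A. c v \<alpha> * f \<alpha> x)))\<^sup>2)
     = (\<Sum>x\<in>I. (v x - (\<Sum>\<alpha>\<in>A. c v \<alpha> * f \<alpha> x)) * cnj (v x - (\<Sum>\<alpha>\<in>A. c v \<alpha> * f \<alpha> x)))"
    by (simp only: of_real_sum complex_norm_square)
  also have "\<dots> = (\<Sum>x\<in>I. v x * cnj (v x)) - (\<Sum>x\<in>I. v x * cnj (\<Sum>\<alpha>\<in>A. c v \<alpha> * f \<alpha> x))
      - (\<Sum>x\<in>I. (\<Sum>\<alpha>\<in>A. c v \<alpha> * f \<alpha> x) * cnj (v x)) + (\<Sum>x\<in>I. (\<Sum>\<alpha>\<in>A. c v \<alpha> * f \<alpha> x) * cnj (\<Sum>\<beta>\<in>A. c v \<beta> * f \<beta> x))"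
    by (simp only: expand sum_subtractf sum.distrib)
  also have "\<dots> = complex_of_real ((\<Sum>x\<in>I. (cmod (v x))\<^sup>2) - (\<Sum>\<alpha>\<in>A. (cmod (c v \<alpha>))\<^sup>2))"
    unfolding eq1 eq2 eq3 by (simp only: of_real_sum of_real_diff complex_norm_square) simp
  finally show ?thesis using of_real_eq_iff by blast
qed

lemma bessel:
  assumes "finite I" "finite A" "orthonormal_fam I A f"
  shows "(\<Sum>\<alpha>\<in>A. (cmod (\<Sum>x\<in>I. cnj (f \<alpha> x) * v x))\<^sup>2) \<le> (\<Sum>x\<in>I. (cmod (v x))\<^sup>2)"
  using bessel_identity[OF assms, of v]
    sum_nonneg[of I "\<lambda>x. (cmod (v x - (\<Sum>\<alpha>\<in>A. (\<Sum>x\<in>I. cnj (f \<alpha> x) * v x) * f \<alpha> x)))\<^sup>2"] by simp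

lemma orthonormal_fam_norm:
  assumes "orthonormal_fam I A f" "\<alpha> \<in> A"
  shows "(\<Sum>x\<in>I. (cmod (f \<alpha> x))\<^sup>2) = 1"
proof -
  have "(\<Sum>x\<in>I. cnj (f \<alpha> x) * f \<alpha> x) = 1" using assms by (auto simp: orthonormal_fam_def)
  then have "complex_of_real (\<Sum>x\<in>I. (cmod (f \<alpha> x))\<^sup>2) = 1"
    by (simp only: of_real_sum complex_norm_square) (simp add: mult.commute)
  then show ?thesis using of_real_eq_1_iff by blast
qed

lemma sum_indicator_mult:
  fixes h :: "'x \<Rightarrow> 'c::semiring_1"
  assumes "finite I" "y \<in> I"
  shows "(\<Sum>x\<in>I. h x * of_bool (x = y)) = h y"
proof -
  have "(\<Sum>x\<in>I. h x * of_bool (x = y)) = (\<Sum>x\<in>I. if x = y then h x else 0)" by (intro sum.cong) auto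
  then show ?thesis using assms by simp
qed

lemma sum_cmod_indicator:
  assumes "finite I" "y \<in> I"
  shows "(\<Sum>x\<in>I. (cmod (of_bool (x = y)))\<^sup>2) = 1"
proof -
  have "(\<Sum>x\<in>I. (cmod (of_bool (x = y)))\<^sup>2) = (\<Sum>x\<in>I. if x = y then 1 else 0)" by (intro sum.cong) auto
  then show ?thesis using assms by simp
qed

lemma bessel_pointwise:
  assumes "finite I" "finite A" "orthonormal_fam I A f" "y \<in> I"
  shows "(\<Sum>\<alpha>\<in>A. (cmod (f \<alpha> y))\<^sup>2) \<le> 1"
  using bessel[OF assms(1-3), of "\<lambda>x. of_bool (x = y)"]
  by (simp only: sum_indicator_mult[OF assms(1,4)] sum_cmod_indicator[OF assms(1,4)] complex_mod_cnj)

text \<open>Double counting of all squared entries: each vector contributes 1, each coordinate at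
  most 1.\<close>

lemma orthonormal_fam_card_le:
  assumes "finite I" "finite A" "orthonormal_fam I A f"
  shows "card A \<le> card I"
proof -
  have "real (card A) = (\<Sum>\<alpha>\<in>A. \<Sum>x\<in>I. (cmod (f \<alpha> x))\<^sup>2)"
    using orthonormal_fam_norm[OF assms(3)] by simp
  also have "\<dots> = (\<Sum>x\<in>I. \<Sum>\<alpha>\<in>A. (cmod (f \<alpha> x))\<^sup>2)" by (rule sum.swap)
  also have "\<dots> \<le> (\<Sum>x\<in>I. 1)" using bessel_pointwise[OF assms] by (intro sum_mono) auto
  finally show ?thesis by simp
qed

text \<open>If there are as many vectors as coordinates, Bessel's inequality for the coordinate vectors is
  an equality after summation, hence an equality for each of them.\<close>

lemma orthonormal_fam_complete:
  assumes "finite I" "finite A" "orthonormal_fam I A f" "card A = card I" "x \<in> I" "y \<in> I"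
  shows "(\<Sum>\<alpha>\<in>A. f \<alpha> x * cnj (f \<alpha> y)) = of_bool (x = y)"
proof -
  define s where "s = (\<lambda>y. \<Sum>\<alpha>\<in>A. (cmod (f \<alpha> y))\<^sup>2)"
  have "(\<Sum>y\<in>I. s y) = (\<Sum>\<alpha>\<in>A. \<Sum>x\<in>I. (cmod (f \<alpha> x))\<^sup>2)" unfolding s_def by (rule sum.swap)
  also have "\<dots> = card I" using orthonormal_fam_norm[OF assms(3)] assms(4) by simp
  finally have "(\<Sum>y\<in>I. 1 - s y) = 0" by (simp add: sum_subtractf)
  moreover have "0 \<le> 1 - s y" if "y \<in> I" for y
    using bessel_pointwise[OF assms(1-3) that] by (simp add: s_def)
  ultimately have s1: "s y = 1" using assms(1,6) by (simp add: sum_nonneg_eq_0_iff)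
  let ?v = "\<lambda>x. of_bool (x = y) :: complex"
  have c: "(\<Sum>x\<in>I. cnj (f \<alpha> x) * ?v x) = cnj (f \<alpha> y)" for \<alpha>
    by (rule sum_indicator_mult[OF assms(1,6)])
  have "(\<Sum>x\<in>I. (cmod (?v x - (\<Sum>\<alpha>\<in>A. cnj (f \<alpha> y) * f \<alpha> x)))\<^sup>2) = 1 - s y"
    using bessel_identity[OF assms(1-3), of ?v]
    unfolding c s_def sum_cmod_indicator[OF assms(1,6)] complex_mod_cnj .
  then have "(cmod (?v x - (\<Sum>\<alpha>\<in>A. cnj (f \<alpha> y) * f \<alpha> x)))\<^sup>2 = 0"
    using s1 assms(1,5) by (simp add: sum_nonneg_eq_0_iff)
  then show ?thesis by (simp add: mult.commute)
qed

section \<open>Resolvents of bounded symmetric operators\<close>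

text \<open>Nothing but a real vector space of values is required, since the same polynomial in
  \<open>P\<close> is formed on square-summable functions, on finite vectors and on matrix-valued
  coefficient functions.\<close>

definition shiftop :: "(('x \<Rightarrow> 'v::real_vector) \<Rightarrow> 'x \<Rightarrow> 'v) \<Rightarrow> real \<Rightarrow> ('x \<Rightarrow> 'v) \<Rightarrow> 'x \<Rightarrow> 'v" where
  "shiftop P E u = (\<lambda>x. P u x - E *\<^sub>R u x)"

definition Dop :: "(('x \<Rightarrow> 'v::real_vector) \<Rightarrow> 'x \<Rightarrow> 'v) \<Rightarrow> real \<Rightarrow> real \<Rightarrow> real \<Rightarrow> ('x \<Rightarrow> 'v) \<Rightarrow> 'x \<Rightarrow> 'v" where
  "Dop P c E \<eta> u = (\<lambda>x. (1 - \<eta>\<^sup>2 / c) *\<^sub>R u x - (1 / c) *\<^sub>R shiftop P E (shiftop P E u) x)"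

definition Qop :: "(('x \<Rightarrow> 'v::real_vector) \<Rightarrow> 'x \<Rightarrow> 'v) \<Rightarrow> real \<Rightarrow> real \<Rightarrow> real \<Rightarrow> nat \<Rightarrow> ('x \<Rightarrow> 'v) \<Rightarrow> 'x \<Rightarrow> 'v" where
  "Qop P c E \<eta> n u = (\<lambda>x. (\<eta> / c) *\<^sub>R (\<Sum>k<n. (Dop P c E \<eta> ^^ k) u x))"

text \<open>The inverse of \<open>(P - E)\<^sup>2 + \<eta>\<^sup>2 = c (1 - D)\<close>, as a Neumann series.\<close>

definition Ainv :: "(('x \<Rightarrow> 'v::real_normed_vector) \<Rightarrow> 'x \<Rightarrow> 'v) \<Rightarrow> real \<Rightarrow> real \<Rightarrow> real \<Rightarrow> ('x \<Rightarrow> 'v) \<Rightarrow> 'x \<Rightarrow> 'v" where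
  "Ainv P c E \<eta> u = (\<lambda>x. (1 / c) *\<^sub>R suminf (\<lambda>k. (Dop P c E \<eta> ^^ k) u x))"

text \<open>Fatou's lemma for the counting measure. It takes the place of completeness: limits are
  formed pointwise and recognised as square-summable afterwards.\<close>

lemma ell2_limit:
  fixes u :: "nat \<Rightarrow> 'x \<Rightarrow> 'v::real_normed_vector"
  assumes "\<And>n. u n \<in> ell2" "\<And>n. ell2_norm (u n) \<le> B" "\<And>x. (\<lambda>n. u n x) \<longlonglongrightarrow> l x"
  shows "l \<in> ell2" and "ell2_norm l \<le> B"
proof -
  have *: "L2_set (\<lambda>x. norm (l x)) F \<le> B" if "finite F" for F
  proof (rule LIMSEQ_le_const2)
    show "(\<lambda>n. L2_set (\<lambda>x. norm (u n x)) F) \<longlonglongrightarrow> L2_set (\<lambda>x. norm (l x)) F"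
      unfolding L2_set_def by (intro tendsto_intros assms)
    show "\<exists>N. \<forall>n\<ge>N. L2_set (\<lambda>x. norm (u n x)) F \<le> B"
      using ell2_finite_le[OF assms(1) that] assms(2) order_trans by blast
  qed
  show "l \<in> ell2" by (rule ell2I_mem) (rule *)
  show "ell2_norm l \<le> B" by (rule ell2I_norm) (rule *)
qed

lemma eip_scaleR_right: "eip u (\<lambda>x. a *\<^sub>R v x) = a * eip u v"
  using eip_scaleR[of a v u] by (simp add: eip_commute)

locale linear_op =
  fixes P :: "('x \<Rightarrow> 'v::real_vector) \<Rightarrow> 'x \<Rightarrow> 'v"
  assumes lin: "P (\<lambda>x. r *\<^sub>R u x + s *\<^sub>R v x) = (\<lambda>x. r *\<^sub>R P u x + s *\<^sub>R P v x)"
begin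

lemma lin_add: "P (\<lambda>x. u x + v x) = (\<lambda>x. P u x + P v x)"
  using lin[of 1 u 1 v] by simp

lemma lin_scale: "P (\<lambda>x. r *\<^sub>R u x) = (\<lambda>x. r *\<^sub>R P u x)"
  using lin[of r u 0 u] by simp

lemma lin_zero: "P (\<lambda>x. 0) = (\<lambda>x. 0)"
  using lin_scale[of 0 "\<lambda>x. 0"] by simp

lemma lin_sum: "finite I \<Longrightarrow> P (\<lambda>x. \<Sum>i\<in>I. u i x) = (\<lambda>x. \<Sum>i\<in>I. P (u i) x)"
  by (induction I rule: finite_induct) (simp_all add: lin_zero lin_add)

end

lemma linear_op_shiftop:
  assumes "linear_op P" shows "linear_op (shiftop P E)"
  unfolding linear_op_def shiftop_def linear_op.lin[OF assms] by (simp add: fun_eq_iff algebra_simps)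

lemma linear_op_Dop:
  assumes "linear_op P" shows "linear_op (Dop P c E \<eta>)"
  unfolding linear_op_def Dop_def linear_op.lin[OF linear_op_shiftop[OF assms]]
  by (simp add: fun_eq_iff algebra_simps)

text \<open>Polynomials commute with intertwiners. The predicate \<open>\<Phi>\<close> marks an
  invariant subspace, since the evaluation map used for \<open>J\<close> is linear only on finitely
  supported functions.\<close>

lemma Dop_intertwine:
  assumes "linear_op P2"
    and \<Phi>P: "\<And>m. \<Phi> m \<Longrightarrow> \<Phi> (P1 m)"
    and \<Phi>lin: "\<And>m m' r s. \<Phi> m \<Longrightarrow> \<Phi> m' \<Longrightarrow> \<Phi> (\<lambda>x. r *\<^sub>R m x + s *\<^sub>R m' x)"
    and Jlin: "\<And>m m' r s. \<Phi> m \<Longrightarrow> \<Phi> m' \<Longrightarrow> J (\<lambda>x. r *\<^sub>R m x + s *\<^sub>R m' x) = (\<lambda>x. r *\<^sub>R J m x + s *\<^sub>R J m' x)"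
    and JP: "\<And>m. \<Phi> m \<Longrightarrow> J (P1 m) = P2 (J m)"
    and m: "\<Phi> m"
  shows "\<Phi> ((Dop P1 c E \<eta> ^^ k) m) \<and> J ((Dop P1 c E \<eta> ^^ k) m) = (Dop P2 c E \<eta> ^^ k) (J m)"
proof (induction k)
  case 0 then show ?case using m by simp
next
  case (Suc k)
  have X: "\<Phi> (shiftop P1 E n) \<and> J (shiftop P1 E n) = shiftop P2 E (J n)" if "\<Phi> n" for n
    using \<Phi>lin[OF \<Phi>P[OF that] that, of 1 "-E"] Jlin[OF \<Phi>P[OF that] that, of 1 "-E"] JP[OF that]
    by (simp add: shiftop_def)
  have D: "\<Phi> (Dop P1 c E \<eta> n) \<and> J (Dop P1 c E \<eta> n) = Dop P2 c E \<eta> (J n)" if n: "\<Phi> n" for n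
  proof -
    have XX: "\<Phi> (shiftop P1 E (shiftop P1 E n))" "J (shiftop P1 E (shiftop P1 E n)) = shiftop P2 E (shiftop P2 E (J n))"
      using X n by auto
    show ?thesis
      using \<Phi>lin[OF n XX(1), of "1 - \<eta>\<^sup>2 / c" "- (1 / c)"] Jlin[OF n XX(1), of "1 - \<eta>\<^sup>2 / c" "- (1 / c)"] XX(2)
      by (simp add: Dop_def)
  qed
  show ?case using D[of "(Dop P1 c E \<eta> ^^ k) m"] Suc.IH by simp
qed

definition Dval :: "real \<Rightarrow> real \<Rightarrow> real \<Rightarrow> real \<Rightarrow> real" where
  "Dval c E \<eta> x = 1 - ((x - E)\<^sup>2 + \<eta>\<^sup>2) / c"

definition Qval :: "real \<Rightarrow> real \<Rightarrow> real \<Rightarrow> nat \<Rightarrow> real \<Rightarrow> real" where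
  "Qval c E \<eta> n x = (\<eta> / c) * (\<Sum>k<n. Dval c E \<eta> x ^ k)"

lemma Qop_eigenvector:
  assumes "linear_op P" "P f = (\<lambda>x. l *\<^sub>R f x)"
  shows "Qop P c E \<eta> n f = (\<lambda>x. Qval c E \<eta> n l *\<^sub>R f x)"
proof -
  interpret linear_op P by fact
  interpret X: linear_op "shiftop P E" by (rule linear_op_shiftop) fact
  have X: "shiftop P E f = (\<lambda>x. (l - E) *\<^sub>R f x)"
    using assms(2) by (simp add: shiftop_def fun_eq_iff algebra_simps)
  have XX: "shiftop P E (shiftop P E f) = (\<lambda>x. (l - E)\<^sup>2 *\<^sub>R f x)"
    unfolding X X.lin_scale by (simp add: power2_eq_square)
  have D: "Dop P c E \<eta> f = (\<lambda>x. Dval c E \<eta> l *\<^sub>R f x)"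
    by (simp add: Dop_def XX Dval_def fun_eq_iff scaleR_left_diff_distrib[symmetric] add_divide_distrib algebra_simps)
  interpret D: linear_op "Dop P c E \<eta>" by (rule linear_op_Dop) fact
  have Dk: "(Dop P c E \<eta> ^^ k) f = (\<lambda>x. Dval c E \<eta> l ^ k *\<^sub>R f x)" for k
    by (induction k) (simp_all add: D.lin_scale D mult.commute)
  show ?thesis by (simp add: Qop_def Dk Qval_def scaleR_sum_left[symmetric])
qed

text \<open>A finite geometric sum: the Poisson kernel at \<open>E\<close> times a truncation
  factor.\<close>

lemma Qval_eq:
  assumes "0 < \<eta>" "0 < c"
  shows "Qval c E \<eta> n x = \<eta> / ((x - E)\<^sup>2 + \<eta>\<^sup>2) * (1 - Dval c E \<eta> x ^ n)"
proof -
  have p: "(x - E)\<^sup>2 + \<eta>\<^sup>2 > 0" using assms by (simp add: add_nonneg_pos)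
  then have ne: "Dval c E \<eta> x \<noteq> 1" using assms by (simp add: Dval_def)
  have "(\<Sum>k<n. Dval c E \<eta> x ^ k) = (1 - Dval c E \<eta> x ^ n) / (1 - Dval c E \<eta> x)"
    using ne by (simp add: sum_gp_strict)
  then show ?thesis using p assms by (simp add: Qval_def Dval_def)
qed

text \<open>The assumption \<open>ptwise\<close> is continuity under pointwise convergence,
  available because group algebra elements involve finitely many translates. It allows the Neumann
  series to be summed pointwise.\<close>

locale sym_op = linear_op P for P :: "('x \<Rightarrow> 'v::{real_inner,banach}) \<Rightarrow> 'x \<Rightarrow> 'v" +
  fixes L :: real
  assumes mem: "u \<in> ell2 \<Longrightarrow> P u \<in> ell2"
    and bnd: "u \<in> ell2 \<Longrightarrow> ell2_norm (P u) \<le> L * ell2_norm u"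
    and L0: "0 \<le> L"
    and sym: "u \<in> ell2 \<Longrightarrow> v \<in> ell2 \<Longrightarrow> eip (P u) v = eip u (P v)"
    and ptwise: "(\<And>x. (\<lambda>n. w n x) \<longlonglongrightarrow> l x) \<Longrightarrow> (\<lambda>n. P (w n) x) \<longlonglongrightarrow> P l x"

text \<open>The condition on \<open>c\<close> makes \<open>(P - E)^2 + \<eta>^2\<close> at most
  \<open>c\<close> as a quadratic form, so that \<open>D\<close> lies between 0 and
  \<open>1 - \<eta>^2 / c\<close>.\<close>

locale sym_op_shift = sym_op +
  fixes c E \<eta> :: real
  assumes eta: "0 < \<eta>" and c: "(L + \<bar>E\<bar>)\<^sup>2 + \<eta>\<^sup>2 \<le> c"
begin

abbreviation "X \<equiv> shiftop P E"
abbreviation "D \<equiv> Dop P c E \<eta>"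

sublocale X: linear_op X by (rule linear_op_shiftop) (rule linear_op_axioms)
sublocale D: linear_op D by (rule linear_op_Dop) (rule linear_op_axioms)

lemma c_pos: "0 < c"
  using c eta by (smt (verit) zero_le_power2 zero_less_power)

definition b :: real where "b = 1 - \<eta>\<^sup>2 / c"

lemma b_bounds: "0 \<le> b" "b < 1" "(L + \<bar>E\<bar>)\<^sup>2 \<le> c * b"
proof -
  show "b < 1" using c_pos eta by (simp add: b_def)
  show *: "(L + \<bar>E\<bar>)\<^sup>2 \<le> c * b" using c c_pos by (simp add: b_def algebra_simps)
  then have "0 \<le> c * b" by (meson order_trans zero_le_power2)
  then show "0 \<le> b" using c_pos by (simp add: zero_le_mult_iff)
qed

lemma X_mem: "u \<in> ell2 \<Longrightarrow> X u \<in> ell2"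
  unfolding shiftop_def by (intro ell2_diff ell2_scaleR mem)

lemma X_bnd: assumes "u \<in> ell2" shows "ell2_norm (X u) \<le> (L + \<bar>E\<bar>) * ell2_norm u"
  using ell2_diff(2)[OF mem[OF assms] ell2_scaleR(1)[OF assms, of E]] bnd[OF assms]
  by (simp add: shiftop_def ell2_scaleR(2) algebra_simps)

lemma X_sym: assumes "u \<in> ell2" "v \<in> ell2" shows "eip (X u) v = eip u (X v)"
proof -
  have "eip (X u) v = eip (P u) v - E * eip u v"
    unfolding shiftop_def using assms by (simp add: eip_diff mem ell2_scaleR eip_scaleR)
  moreover have "eip (X v) u = eip (P v) u - E * eip v u"
    unfolding shiftop_def using assms by (simp add: eip_diff mem ell2_scaleR eip_scaleR)
  ultimately show ?thesis using sym[OF assms] by (simp add: eip_commute)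
qed

text \<open>Expanding the square avoids spectral theory: the term in \<open>X (X u)\<close> is at
  most \<open>b / c\<close> times the square of the norm of \<open>X u\<close>, which is half of
  what the negative cross term supplies.\<close>

lemma D_contraction:
  assumes "u \<in> ell2"
  shows "D u \<in> ell2" and "ell2_norm (D u) \<le> b * ell2_norm u"
proof -
  have Xu: "X u \<in> ell2" and XXu: "X (X u) \<in> ell2" using assms by (auto intro: X_mem)
  show Du: "D u \<in> ell2" unfolding Dop_def by (intro ell2_diff ell2_scaleR assms XXu)
  have 1: "(ell2_norm (D u))\<^sup>2 = b\<^sup>2 * (ell2_norm u)\<^sup>2 - 2 * (b * ((1 / c) * (ell2_norm (X u))\<^sup>2)) + (1 / c)\<^sup>2 * (ell2_norm (X (X u)))\<^sup>2"
  proof -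
    have "eip (\<lambda>x. b *\<^sub>R u x) (\<lambda>x. (1 / c) *\<^sub>R X (X u) x) = b * ((1 / c) * (ell2_norm (X u))\<^sup>2)"
      using X_sym[OF assms Xu] by (simp add: eip_scaleR eip_scaleR_right eip_self)
    then show ?thesis
      unfolding Dop_def b_def[symmetric] ell2_norm_diff_sq[OF ell2_scaleR(1)[OF assms] ell2_scaleR(1)[OF XXu]]
      by (simp add: ell2_scaleR(2) power_mult_distrib power_divide)
  qed
  have "(ell2_norm (X (X u)))\<^sup>2 \<le> ((L + \<bar>E\<bar>) * ell2_norm (X u))\<^sup>2"
    using X_bnd[OF Xu] by (intro power_mono) auto
  also have "\<dots> \<le> c * b * (ell2_norm (X u))\<^sup>2"
    unfolding power_mult_distrib by (intro mult_right_mono b_bounds) auto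
  finally have "(1 / c)\<^sup>2 * (ell2_norm (X (X u)))\<^sup>2 \<le> (1 / c)\<^sup>2 * (c * b * (ell2_norm (X u))\<^sup>2)"
    by (intro mult_left_mono) auto
  also have "\<dots> = b * ((1 / c) * (ell2_norm (X u))\<^sup>2)" using c_pos by (simp add: power2_eq_square)
  finally have "(ell2_norm (D u))\<^sup>2 \<le> b\<^sup>2 * (ell2_norm u)\<^sup>2 - b * ((1 / c) * (ell2_norm (X u))\<^sup>2)"
    using 1 by linarith
  also have "\<dots> \<le> (b * ell2_norm u)\<^sup>2"
    using b_bounds(1) c_pos by (simp add: power_mult_distrib)
  finally show "ell2_norm (D u) \<le> b * ell2_norm u"
    using b_bounds(1) by (simp add: abs_le_square_iff[symmetric])
qed

lemma Dpow: assumes "u \<in> ell2" shows "(D ^^ k) u \<in> ell2 \<and> ell2_norm ((D ^^ k) u) \<le> b ^ k * ell2_norm u"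
proof (induction k)
  case 0 then show ?case using assms by simp
next
  case (Suc k)
  then show ?case using D_contraction[of "(D ^^ k) u"] mult_left_mono[OF conjunct2[OF Suc] b_bounds(1)] by auto
qed

lemma Dpow_summable: assumes "u \<in> ell2" shows "summable (\<lambda>k. (D ^^ k) u x)"
proof (rule summable_comparison_test)
  show "summable (\<lambda>k. b ^ k * ell2_norm u)"
    using b_bounds by (intro summable_mult2 summable_geometric) auto
  show "\<exists>N. \<forall>n\<ge>N. norm ((D ^^ n) u x) \<le> b ^ n * ell2_norm u"
  proof (intro exI[of _ 0] allI impI)
    show "norm ((D ^^ n) u x) \<le> b ^ n * ell2_norm u" for n
      using ell2_norm_ge_pointwise[of "(D ^^ n) u" x] Dpow[OF assms, of n] by linarith
  qed
qed

lemma Ainv_sums: "u \<in> ell2 \<Longrightarrow> (\<lambda>k. (D ^^ k) u x) sums (c *\<^sub>R Ainv P c E \<eta> u x)"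
  using summable_sums[OF Dpow_summable] c_pos by (simp add: Ainv_def)

lemma Qop_tendsto: "u \<in> ell2 \<Longrightarrow> (\<lambda>n. Qop P c E \<eta> n u x) \<longlonglongrightarrow> \<eta> *\<^sub>R Ainv P c E \<eta> u x"
  using tendsto_scaleR[OF tendsto_const[of "\<eta> / c"] Ainv_sums[unfolded sums_def]] c_pos
  by (simp add: Qop_def)

text \<open>The tail is dominated by a geometric series in operator norm, hence uniformly over unit
  vectors.\<close>

lemma Qop_tail:
  assumes "u \<in> ell2"
  shows "(\<lambda>x. \<eta> *\<^sub>R Ainv P c E \<eta> u x - Qop P c E \<eta> n u x) \<in> ell2"
    and "ell2_norm (\<lambda>x. \<eta> *\<^sub>R Ainv P c E \<eta> u x - Qop P c E \<eta> n u x) \<le> b ^ n / \<eta> * ell2_norm u"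
proof -
  \<comment> \<open>Finite blocks of the tail: they are uniformly bounded and converge to it
    pointwise, as \<open>ell2_limit\<close> requires.\<close>
  define w where "w = (\<lambda>m x. (\<eta> / c) *\<^sub>R (\<Sum>k\<in>{n..<n + m}. (D ^^ k) u x))"
  have lim: "(\<lambda>m. w m x) \<longlonglongrightarrow> \<eta> *\<^sub>R Ainv P c E \<eta> u x - Qop P c E \<eta> n u x" for x
  proof -
    have "w m x = Qop P c E \<eta> (m + n) u x - Qop P c E \<eta> n u x" for m
      unfolding w_def Qop_def scaleR_diff_right[symmetric]
      by (simp add: lessThan_atLeast0 sum_diff_nat_ivl add.commute)
    then show ?thesis
      by (simp only:) (intro tendsto_intros LIMSEQ_ignore_initial_segment Qop_tendsto assms)
  qed
  have w: "w m \<in> ell2 \<and> ell2_norm (w m) \<le> b ^ n / \<eta> * ell2_norm u" for m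
  proof -
    have s: "(\<lambda>x. \<Sum>k\<in>{n..<n + m}. (D ^^ k) u x) \<in> ell2"
      "ell2_norm (\<lambda>x. \<Sum>k\<in>{n..<n + m}. (D ^^ k) u x) \<le> (\<Sum>k\<in>{n..<n + m}. ell2_norm ((D ^^ k) u))"
      using ell2_sum[of "{n..<n+m}" "\<lambda>k. (D ^^ k) u"] Dpow[OF assms] by auto
    have "(\<Sum>k\<in>{n..<n + m}. ell2_norm ((D ^^ k) u)) \<le> (\<Sum>k\<in>{n..<n + m}. b ^ k * ell2_norm u)"
      using Dpow[OF assms] by (intro sum_mono) auto
    also have "\<dots> = b ^ n * (\<Sum>k<m. b ^ k) * ell2_norm u"
    proof -
      have "{n..<n + m} = {0 + n..<m + n}" by auto
      then show ?thesis
        by (simp only: sum.shift_bounds_nat_ivl)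
           (simp add: power_add sum_distrib_left sum_distrib_right lessThan_atLeast0 mult_ac)
    qed
    also have "\<dots> \<le> b ^ n * (1 / (1 - b)) * ell2_norm u"
    proof -
      have "(\<Sum>k<m. b ^ k) \<le> 1 / (1 - b)"
        using b_bounds sum_le_suminf[of "\<lambda>k. b ^ k" "{..<m}"] suminf_geometric[of b] summable_geometric[of b] by simp
      then show ?thesis using b_bounds by (intro mult_right_mono mult_left_mono) auto
    qed
    finally have "ell2_norm (\<lambda>x. \<Sum>k\<in>{n..<n + m}. (D ^^ k) u x) \<le> b ^ n * (1 / (1 - b)) * ell2_norm u"
      using s(2) by linarith
    then have "\<bar>\<eta> / c\<bar> * ell2_norm (\<lambda>x. \<Sum>k\<in>{n..<n + m}. (D ^^ k) u x) \<le> \<bar>\<eta> / c\<bar> * (b ^ n * (1 / (1 - b)) * ell2_norm u)"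
      by (intro mult_left_mono) auto
    \<comment> \<open>Here \<open>1 - b = \<eta>^2 / c\<close>, so the factor
      \<open>\<eta> / c\<close> turns \<open>1 / (1 - b)\<close> into
      \<open>1 / \<eta>\<close>.\<close>
    also have "\<dots> = b ^ n / \<eta> * ell2_norm u" using eta c_pos by (simp add: b_def power2_eq_square)
    finally show ?thesis using ell2_scaleR(1)[OF s(1), of "\<eta> / c"] by (simp add: w_def ell2_scaleR(2))
  qed
  show "(\<lambda>x. \<eta> *\<^sub>R Ainv P c E \<eta> u x - Qop P c E \<eta> n u x) \<in> ell2"
    by (rule ell2_limit(1)[of w "b ^ n / \<eta> * ell2_norm u"]) (use w lim in auto)
  show "ell2_norm (\<lambda>x. \<eta> *\<^sub>R Ainv P c E \<eta> u x - Qop P c E \<eta> n u x) \<le> b ^ n / \<eta> * ell2_norm u"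
    by (rule ell2_limit(2)[of w]) (use w lim in auto)
qed

text \<open>The tail from \<open>n = 0\<close> is \<eta> times the inverse itself.\<close>

lemma Ainv_mem: assumes "u \<in> ell2" shows "Ainv P c E \<eta> u \<in> ell2"
  using ell2_scaleR(1)[OF Qop_tail(1)[OF assms, of 0], of "1 / \<eta>"] eta by (simp add: Qop_def)

lemma X_ptwise: "(\<And>x. (\<lambda>n. w n x) \<longlonglongrightarrow> l x) \<Longrightarrow> (\<lambda>n. X (w n) x) \<longlonglongrightarrow> X l x"
  unfolding shiftop_def by (intro tendsto_intros ptwise)

lemma A_eq: "X (X w) x + \<eta>\<^sup>2 *\<^sub>R w x = c *\<^sub>R (w x - D w x)"
  using c_pos by (simp add: Dop_def algebra_simps)

text \<open>The product of \<open>1 - D\<close> with a partial sum telescopes to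
  \<open>1 - D^n\<close>, and \<open>D^n u\<close> tends to 0 pointwise.\<close>

lemma Ainv_eq:
  assumes "u \<in> ell2"
  shows "X (X (Ainv P c E \<eta> u)) x + \<eta>\<^sup>2 *\<^sub>R Ainv P c E \<eta> u x = u x"
proof -
  define w where "w = (\<lambda>n x. \<Sum>k<n. (D ^^ k) u x)"
  define v where "v = (\<lambda>x. c *\<^sub>R Ainv P c E \<eta> u x)"
  have lim: "(\<lambda>n. w n x) \<longlonglongrightarrow> v x" for x
    using Ainv_sums[OF assms] by (simp add: sums_def w_def v_def)
  have Dw: "w n x - D (w n) x = u x - (D ^^ n) u x" for n x
  proof -
    have "D (w n) x = (\<Sum>k<n. (D ^^ Suc k) u x)" unfolding w_def by (subst D.lin_sum) auto
    then have "w n x - D (w n) x = (\<Sum>k<n. (D ^^ k) u x - (D ^^ Suc k) u x)"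
      by (simp only: w_def sum_subtractf)
    also have "\<dots> = u x - (D ^^ n) u x" by (subst sum_lessThan_telescope') simp
    finally show ?thesis .
  qed
  have l1: "(\<lambda>n. X (X (w n)) x + \<eta>\<^sup>2 *\<^sub>R w n x) \<longlonglongrightarrow> X (X v) x + \<eta>\<^sup>2 *\<^sub>R v x"
    by (intro tendsto_intros X_ptwise lim)
  have "(\<lambda>n. c *\<^sub>R (u x - (D ^^ n) u x)) \<longlonglongrightarrow> c *\<^sub>R (u x - 0)"
    by (intro tendsto_intros summable_LIMSEQ_zero Dpow_summable assms)
  then have l2: "(\<lambda>n. X (X (w n)) x + \<eta>\<^sup>2 *\<^sub>R w n x) \<longlonglongrightarrow> c *\<^sub>R u x"
    by (simp only: A_eq Dw diff_zero)
  have "X (X v) x + \<eta>\<^sup>2 *\<^sub>R v x = c *\<^sub>R u x" using LIMSEQ_unique[OF l1 l2] .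
  moreover have "X (X v) x + \<eta>\<^sup>2 *\<^sub>R v x = c *\<^sub>R (X (X (Ainv P c E \<eta> u)) x + \<eta>\<^sup>2 *\<^sub>R Ainv P c E \<eta> u x)"
    unfolding v_def X.lin_scale by (simp add: algebra_simps)
  ultimately show ?thesis using c_pos by simp
qed

text \<open>A vector in the kernel is fixed by \<open>D\<close>, which contracts strictly.\<close>

lemma A_injective:
  assumes "u \<in> ell2" "\<And>x. X (X u) x + \<eta>\<^sup>2 *\<^sub>R u x = 0"
  shows "u = (\<lambda>x. 0)"
proof -
  have "D u = u" using A_eq[of u] assms(2) c_pos by (auto simp: fun_eq_iff)
  then have "ell2_norm u \<le> b * ell2_norm u" using D_contraction(2)[OF assms(1)] by simp
  then have "(1 - b) * ell2_norm u \<le> 0" by (simp add: algebra_simps)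
  then have "ell2_norm u = 0" using b_bounds ell2_norm_nonneg[of u] by (simp add: mult_le_0_iff)
  then show ?thesis using ell2_norm_eq_0[OF assms(1)] by simp
qed

lemma eip_A:
  assumes "v \<in> ell2" "w \<in> ell2"
  shows "eip (\<lambda>x. X (X w) x + \<eta>\<^sup>2 *\<^sub>R w x) v = eip (X w) (X v) + \<eta>\<^sup>2 * eip w v"
  using assms by (simp add: eip_add X_mem ell2_scaleR eip_scaleR X_sym)

lemma Ainv_quadratic:
  assumes "u \<in> ell2"
  shows "eip u (Ainv P c E \<eta> u) = (ell2_norm (X (Ainv P c E \<eta> u)))\<^sup>2 + \<eta>\<^sup>2 * (ell2_norm (Ainv P c E \<eta> u))\<^sup>2"
  using eip_A[OF Ainv_mem[OF assms] Ainv_mem[OF assms]] by (simp add: Ainv_eq[OF assms] eip_self)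

text \<open>The form \<open>eip w (Ainv u)\<close> is a positive semidefinite form in the two
  preimages, so its diagonal controls it. The factor 2 comes from estimating \<open>x y\<close> by
  \<open>x^2 + y^2\<close>. This later bounds all coefficients by the trace at the unit.\<close>

lemma Ainv_bilinear_le:
  assumes "u \<in> ell2" "w \<in> ell2" "eip u (Ainv P c E \<eta> u) \<le> C" "eip w (Ainv P c E \<eta> w) \<le> C"
  shows "\<bar>eip w (Ainv P c E \<eta> u)\<bar> \<le> 2 * C"
proof -
  let ?u = "Ainv P c E \<eta> u" and ?w = "Ainv P c E \<eta> w"
  have m: "?u \<in> ell2" "?w \<in> ell2" using assms Ainv_mem by auto
  have "eip w ?u = eip (X ?w) (X ?u) + \<eta>\<^sup>2 * eip ?w ?u"
    using eip_A[OF m] by (simp add: Ainv_eq[OF assms(2)])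
  then have "\<bar>eip w ?u\<bar> \<le> \<bar>eip (X ?w) (X ?u)\<bar> + \<eta>\<^sup>2 * \<bar>eip ?w ?u\<bar>"
    by (simp add: abs_mult order_trans[OF abs_triangle_ineq])
  also have "\<dots> \<le> ell2_norm (X ?w) * ell2_norm (X ?u) + \<eta>\<^sup>2 * (ell2_norm ?w * ell2_norm ?u)"
    using m by (intro add_mono mult_left_mono eip_le X_mem) auto
  also have "\<dots> \<le> ((ell2_norm (X ?w))\<^sup>2 + (ell2_norm (X ?u))\<^sup>2) + \<eta>\<^sup>2 * ((ell2_norm ?w)\<^sup>2 + (ell2_norm ?u)\<^sup>2)"
  proof -
    have "x * y \<le> x\<^sup>2 + y\<^sup>2" if "0 \<le> x" "0 \<le> y" for x y :: real
      using sum_squares_bound[of x y] mult_nonneg_nonneg[OF that] by linarith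
    then show ?thesis by (intro add_mono mult_left_mono) auto
  qed
  also have "\<dots> \<le> 2 * C"
    using Ainv_quadratic[OF assms(1)] Ainv_quadratic[OF assms(2)] assms(3,4) by (simp add: algebra_simps)
  finally show ?thesis .
qed

end

section \<open>Group algebra elements acting on functions\<close>

text \<open>The multiplication \<open>sm\<close> is a parameter because three cases occur: matrices
  acting on vectors, matrices multiplying matrix coefficients, and scalars.\<close>

definition gact :: "('c::zero \<Rightarrow> 'v \<Rightarrow> 'v::comm_monoid_add) \<Rightarrow> ('g::group_add \<Rightarrow> 'x \<Rightarrow> 'x)
    \<Rightarrow> ('g \<Rightarrow>\<^sub>0 'c) \<Rightarrow> ('x \<Rightarrow> 'v) \<Rightarrow> 'x \<Rightarrow> 'v" where
  "gact sm \<sigma> p f = (\<lambda>x. \<Sum>g\<in>Poly_Mapping.keys p. sm (Poly_Mapping.lookup p g) (f (\<sigma> (- g) x)))"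

lemma lam_eq_gact: "lam p = gact (*v) (+) p"
  by (simp add: fun_eq_iff lam_def gact_def left_regular_def)

lemma lam_scalar_eq_gact: "lam_scalar q = gact (*) (+) q"
  by (simp add: fun_eq_iff lam_scalar_def gact_def left_regular_def)

lemma gact_superset:
  assumes "finite G" "Poly_Mapping.keys p \<subseteq> G" "\<And>v. sm 0 v = 0"
  shows "gact sm \<sigma> p f x = (\<Sum>g\<in>G. sm (Poly_Mapping.lookup p g) (f (\<sigma> (- g) x)))"
  unfolding gact_def using assms by (intro sum.mono_neutral_left) (auto simp: in_keys_iff)

locale group_action =
  fixes \<sigma> :: "'g::group_add \<Rightarrow> 'x \<Rightarrow> 'x"
  assumes act_zero [simp]: "\<sigma> 0 x = x" and act_add: "\<sigma> (g + h) x = \<sigma> g (\<sigma> h x)"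
begin

lemma act_minus [simp]: "\<sigma> (- g) (\<sigma> g x) = x" "\<sigma> g (\<sigma> (- g) x) = x"
  using act_add[of "-g" g x] act_add[of g "-g" x] by simp_all

lemma bij_act: "bij (\<sigma> g)"
  by (rule bij_betw_byWitness[of _ "\<sigma> (- g)"]) auto

end

lemma group_action_left: "group_action ((+) :: 'g::group_add \<Rightarrow> 'g \<Rightarrow> 'g)"
  by unfold_locales (auto simp: add.assoc)

lemma linear_op_gact:
  assumes "\<And>c. linear (sm c)"
  shows "linear_op (gact sm \<sigma> p)"
  unfolding linear_op_def gact_def
  by (simp add: linear_add[OF assms] linear_scale[OF assms] sum.distrib scaleR_sum_right)

locale coeff_action = group_action \<sigma> for \<sigma> :: "'g::group_add \<Rightarrow> 'x \<Rightarrow> 'x" +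
  fixes sm :: "'c::zero \<Rightarrow> 'v::{real_inner,banach} \<Rightarrow> 'v" and nm :: "'c \<Rightarrow> real" and adj :: "'c \<Rightarrow> 'c"
  assumes sm_bl: "bounded_linear (sm a)"
    and sm_zero [simp]: "sm 0 v = 0"
    and nm: "norm (sm a v) \<le> nm a * norm v"
    and nm_nonneg: "0 \<le> nm a"
    and adj: "sm a v \<bullet> w = v \<bullet> sm (adj a) w"
begin

lemma linear_gact: "linear_op (gact sm \<sigma> p)"
  by (rule linear_op_gact) (rule bounded_linear.linear[OF sm_bl])

definition nm1 :: "('g \<Rightarrow>\<^sub>0 'c) \<Rightarrow> real" where
  "nm1 p = (\<Sum>g\<in>Poly_Mapping.keys p. nm (Poly_Mapping.lookup p g))"

lemma nm1_nonneg: "0 \<le> nm1 p"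
  unfolding nm1_def by (intro sum_nonneg nm_nonneg)

lemma gact_term:
  assumes "u \<in> ell2"
  shows "(\<lambda>x. sm a (u (\<sigma> g x))) \<in> ell2" and "ell2_norm (\<lambda>x. sm a (u (\<sigma> g x))) \<le> nm a * ell2_norm u"
  using ell2_dominated[OF ell2_reindex(1)[OF bij_act assms] nm nm_nonneg, of a g]
  unfolding ell2_reindex(2)[OF bij_act, of u g] .

lemma gact_bounded:
  assumes "u \<in> ell2"
  shows gact_ell2: "gact sm \<sigma> p u \<in> ell2" and gact_norm: "ell2_norm (gact sm \<sigma> p u) \<le> nm1 p * ell2_norm u"
proof -
  have *: "gact sm \<sigma> p u \<in> ell2 \<and> ell2_norm (gact sm \<sigma> p u)
      \<le> (\<Sum>g\<in>Poly_Mapping.keys p. ell2_norm (\<lambda>x. sm (Poly_Mapping.lookup p g) (u (\<sigma> (- g) x))))"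
    unfolding gact_def by (rule ell2_sum) (auto intro: gact_term assms)
  then show "gact sm \<sigma> p u \<in> ell2" by simp
  have "(\<Sum>g\<in>Poly_Mapping.keys p. ell2_norm (\<lambda>x. sm (Poly_Mapping.lookup p g) (u (\<sigma> (- g) x)))) \<le> nm1 p * ell2_norm u"
    unfolding nm1_def sum_distrib_right by (intro sum_mono gact_term assms)
  then show "ell2_norm (gact sm \<sigma> p u) \<le> nm1 p * ell2_norm u" using * by linarith
qed

lemma gact_tendsto:
  assumes "\<And>x. (\<lambda>n. w n x) \<longlonglongrightarrow> l x"
  shows "(\<lambda>n. gact sm \<sigma> p (w n) x) \<longlonglongrightarrow> gact sm \<sigma> p l x"
  unfolding gact_def by (intro tendsto_sum bounded_linear.tendsto[OF sm_bl] assms)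

lemma gact_adjoint:
  assumes p': "\<And>g. Poly_Mapping.lookup p' (- g) = adj (Poly_Mapping.lookup p g)"
    and u: "u \<in> ell2" and v: "v \<in> ell2"
  shows "eip (gact sm \<sigma> p u) v = eip u (gact sm \<sigma> p' v)"
proof -
  \<comment> \<open>One finite set for both elements: \<open>adj\<close> is not known to vanish only
    at 0, so the keys of \<open>p'\<close> need not be exactly the inverted keys of
    \<open>p\<close>.\<close>
  define G where "G = Poly_Mapping.keys p \<union> uminus ` Poly_Mapping.keys p'"
  have G: "finite G" "Poly_Mapping.keys p \<subseteq> G" "Poly_Mapping.keys p' \<subseteq> uminus ` G"
    by (force simp: G_def image_Un image_image)+
  let ?p = "Poly_Mapping.lookup p" and ?p' = "Poly_Mapping.lookup p'"
  have "eip (gact sm \<sigma> p u) v = eip (\<lambda>x. \<Sum>g\<in>G. sm (?p g) (u (\<sigma> (- g) x))) v"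
    using gact_superset[OF G(1,2)] by (metis (no_types, lifting) ext sm_zero)
  also have "\<dots> = (\<Sum>g\<in>G. eip (\<lambda>x. sm (?p g) (u (\<sigma> (- g) x))) v)"
    using G(1) u v by (intro eip_sum gact_term)
  also have "\<dots> = (\<Sum>g\<in>G. eip u (\<lambda>x. sm (?p' (- g)) (v (\<sigma> g x))))"
  proof (rule sum.cong[OF refl])
    fix g
    have "eip (\<lambda>x. sm (?p g) (u (\<sigma> (- g) x))) v = eip (\<lambda>x. u (\<sigma> (- g) x)) (\<lambda>x. sm (adj (?p g)) (v x))"
      by (simp add: eip_def adj)
    also have "\<dots> = eip (\<lambda>x. u (\<sigma> (- g) (\<sigma> g x))) (\<lambda>x. sm (adj (?p g)) (v (\<sigma> g x)))"
      by (rule eip_reindex[OF bij_act, symmetric])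
    finally show "eip (\<lambda>x. sm (?p g) (u (\<sigma> (- g) x))) v = eip u (\<lambda>x. sm (?p' (- g)) (v (\<sigma> g x)))"
      by (simp add: p')
  qed
  also have "\<dots> = (\<Sum>g\<in>uminus ` G. eip u (\<lambda>x. sm (?p' g) (v (\<sigma> (- g) x))))"
    by (subst sum.reindex) (auto simp: inj_on_def)
  also have "\<dots> = (\<Sum>g\<in>uminus ` G. eip (\<lambda>x. sm (?p' g) (v (\<sigma> (- g) x))) u)"
    by (simp only: eip_commute[of u])
  also have "\<dots> = eip (\<lambda>x. \<Sum>g\<in>uminus ` G. sm (?p' g) (v (\<sigma> (- g) x))) u"
    using G(1) u v by (intro eip_sum[symmetric] gact_term) auto
  also have "\<dots> = eip (gact sm \<sigma> p' v) u"
    using gact_superset[OF finite_imageI[OF G(1)] G(3)] by (metis (no_types, lifting) ext sm_zero)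
  finally show ?thesis by (simp only: eip_commute[of u])
qed

lemma sym_op_gact:
  assumes "\<And>g. Poly_Mapping.lookup p (- g) = adj (Poly_Mapping.lookup p g)"
  shows "sym_op (gact sm \<sigma> p) (nm1 p)"
  by (intro sym_op.intro sym_op_axioms.intro linear_gact gact_ell2 gact_norm nm1_nonneg
      gact_adjoint[OF assms] gact_tendsto)

end

lemma inner_complex_cnj: "(a::complex) \<bullet> b = Re (cnj a * b)"
  by (simp add: inner_complex_def)

lemma inner_cvec: "(u::complex^'r) \<bullet> v = Re (\<Sum>i\<in>UNIV. cnj (u $ i) * v $ i)"
  by (simp add: inner_vec_def inner_complex_cnj)

lemma conj_transpose_nth: "conj_transpose A $ i $ j = cnj (A $ j $ i)"
  by (simp add: conj_transpose_def transpose_def)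

lemma inner_conj_transpose: "(A *v x) \<bullet> y = (x::complex^'r) \<bullet> (conj_transpose (A::complex^'r^'r) *v y)"
proof -
  have "(\<Sum>i\<in>UNIV. cnj ((A *v x) $ i) * y $ i) = (\<Sum>i\<in>UNIV. \<Sum>j\<in>UNIV. cnj (A $ i $ j) * cnj (x $ j) * y $ i)"
    by (simp add: matrix_vector_mult_def sum_distrib_right)
  also have "\<dots> = (\<Sum>j\<in>UNIV. \<Sum>i\<in>UNIV. cnj (A $ i $ j) * cnj (x $ j) * y $ i)" by (rule sum.swap)
  also have "\<dots> = (\<Sum>j\<in>UNIV. cnj (x $ j) * (conj_transpose A *v y) $ j)"
    by (simp add: matrix_vector_mult_def sum_distrib_left conj_transpose_nth mult_ac)
  finally show ?thesis by (simp add: inner_cvec)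
qed

lemma coeff_action_matrix:
  assumes "group_action \<sigma>"
  shows "coeff_action \<sigma> ((*v) :: complex^'r^'r \<Rightarrow> complex^'r \<Rightarrow> complex^'r) (\<lambda>A. onorm ((*v) A)) conj_transpose"
proof -
  interpret group_action \<sigma> by fact
  show ?thesis
    by (intro coeff_action.intro coeff_action_axioms.intro assms)
      (simp_all only: matrix_vector_mul_bounded_linear onorm[OF matrix_vector_mul_bounded_linear]
        onorm_pos_le[OF matrix_vector_mul_bounded_linear] inner_conj_transpose matrix_vector_mult_0)
qed

lemma coeff_action_scalar:
  assumes "group_action \<sigma>"
  shows "coeff_action \<sigma> ((*) :: complex \<Rightarrow> complex \<Rightarrow> complex) cmod cnj"
proof -
  interpret group_action \<sigma> by fact
  show ?thesis
    by unfold_locales (auto simp: bounded_linear_mult_right norm_mult inner_complex_def algebra_simps)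
qed

section \<open>Coefficients of the approximate resolvent\<close>

lemma Qop_intertwine:
  assumes "linear_op P2"
    and "\<And>m. \<Phi> m \<Longrightarrow> \<Phi> (P1 m)"
    and \<Phi>lin: "\<And>m m' r s. \<Phi> m \<Longrightarrow> \<Phi> m' \<Longrightarrow> \<Phi> (\<lambda>x. r *\<^sub>R m x + s *\<^sub>R m' x)"
    and Jlin: "\<And>m m' r s. \<Phi> m \<Longrightarrow> \<Phi> m' \<Longrightarrow> J (\<lambda>x. r *\<^sub>R m x + s *\<^sub>R m' x) = (\<lambda>x. r *\<^sub>R J m x + s *\<^sub>R J m' x)"
    and "\<And>m. \<Phi> m \<Longrightarrow> J (P1 m) = P2 (J m)"
    and m: "\<Phi> m"
  shows "\<Phi> (Qop P1 c E \<eta> n m) \<and> J (Qop P1 c E \<eta> n m) = Qop P2 c E \<eta> n (J m)"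
proof -
  have D: "\<Phi> ((Dop P1 c E \<eta> ^^ k) m)" "J ((Dop P1 c E \<eta> ^^ k) m) = (Dop P2 c E \<eta> ^^ k) (J m)" for k
    using Dop_intertwine[of P2 \<Phi> P1 J m k c E \<eta>] assms by auto
  have *: "\<Phi> (\<lambda>x. \<Sum>k<n. (Dop P1 c E \<eta> ^^ k) m x) \<and>
      J (\<lambda>x. \<Sum>k<n. (Dop P1 c E \<eta> ^^ k) m x) = (\<lambda>x. \<Sum>k<n. (Dop P2 c E \<eta> ^^ k) (J m) x)"
  proof (induction n)
    case 0
    show ?case using \<Phi>lin[OF m m, of 0 0] Jlin[OF m m, of 0 0] by simp
  next
    case (Suc n)
    show ?case using \<Phi>lin[OF conjunct1[OF Suc] D(1), of 1 1 n] Jlin[OF conjunct1[OF Suc] D(1), of 1 1 n] Suc D(2) by simp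
  qed
  show ?thesis
    using \<Phi>lin[OF conjunct1[OF *] m, of "\<eta> / c" 0] Jlin[OF conjunct1[OF *] m, of "\<eta> / c" 0] *
    by (simp add: Qop_def)
qed

definition unit_coeff :: "'g::zero \<Rightarrow> complex^'r^'r" where
  "unit_coeff = (\<lambda>g. if g = 0 then mat 1 else 0)"

text \<open>Left convolution by \<open>p\<close> acts on coefficient functions; the polynomial
  applied to the unit is therefore its own element of the group algebra, obtained without
  multiplying matrix-valued elements.\<close>

definition qcoef :: "('g::group_add \<Rightarrow>\<^sub>0 complex^'r^'r) \<Rightarrow> real \<Rightarrow> real \<Rightarrow> real \<Rightarrow> nat \<Rightarrow> 'g \<Rightarrow> complex^'r^'r" where
  "qcoef p c E \<eta> n = Qop (gact (**) (+) p) c E \<eta> n unit_coeff"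

lemma scaleR_mult_vec: "(r *\<^sub>R A) *v x = r *\<^sub>R ((A::complex^'r^'r) *v x)"
  by (simp add: vec_eq_iff matrix_vector_mult_def scaleR_sum_right)

lemma sum_matrix_mult_vec: "(\<Sum>a\<in>K. B a) *v x = (\<Sum>a\<in>K. (B a :: complex^'r^'r) *v x)"
  by (induction K rule: infinite_finite_induct) (simp_all add: matrix_vector_mult_add_rdistrib)

lemma sum_support_superset:
  fixes m :: "'g \<Rightarrow> complex^'r^'r"
  assumes "finite G" "{g. m g \<noteq> 0} \<subseteq> G"
  shows "(\<Sum>g | m g \<noteq> 0. m g *v F g) = (\<Sum>g\<in>G. m g *v F g)"
  using assms by (intro sum.mono_neutral_left) auto

lemma finite_support_gact:
  fixes m :: "'g::group_add \<Rightarrow> complex^'r^'r"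
  assumes "{g. m g \<noteq> 0} \<subseteq> G"
  shows "{g. gact (**) (+) p m g \<noteq> 0} \<subseteq> (\<lambda>(a, b). a + b) ` (Poly_Mapping.keys p \<times> G)"
proof
  fix h assume "h \<in> {g. gact (**) (+) p m g \<noteq> 0}"
  then have "(\<Sum>g\<in>Poly_Mapping.keys p. Poly_Mapping.lookup p g ** m (- g + h)) \<noteq> 0" by (simp add: gact_def)
  then obtain g where g: "g \<in> Poly_Mapping.keys p" "Poly_Mapping.lookup p g ** m (- g + h) \<noteq> 0"
    by (meson sum.not_neutral_contains_not_neutral)
  then have "m (- g + h) \<noteq> 0" by auto
  then have "- g + h \<in> G" using assms by auto
  then show "h \<in> (\<lambda>(a, b). a + b) ` (Poly_Mapping.keys p \<times> G)"
    using g(1) by (intro image_eqI[of _ _ "(g, - g + h)"]) (auto simp: add.assoc[symmetric])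
qed

text \<open>One element of the group algebra represents the polynomial in every action: evaluation
  at \<open>f\<close> intertwines convolution by \<open>p\<close> with the action of
  \<open>p\<close> and sends the unit to \<open>f\<close>. This is the bridge between the limit
  operator and the finite matrices.\<close>

lemma
  fixes p :: "'g::group_add \<Rightarrow>\<^sub>0 complex^'r^'r"
  assumes "group_action \<sigma>"
  shows qcoef_finite: "finite {g. qcoef p c E \<eta> n g \<noteq> 0}"
    and qcoef_action: "Qop (gact (*v) \<sigma> p) c E \<eta> n f x
     = (\<Sum>g | qcoef p c E \<eta> n g \<noteq> 0. qcoef p c E \<eta> n g *v f (\<sigma> (- g) x))"
proof -
  interpret group_action \<sigma> by fact
  interpret coeff_action \<sigma> "(*v) :: complex^'r^'r \<Rightarrow> complex^'r \<Rightarrow> complex^'r" "\<lambda>A. onorm ((*v) A)" conj_transpose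
    by (rule coeff_action_matrix) fact
  define \<Phi> where "\<Phi> = (\<lambda>m::'g \<Rightarrow> complex^'r^'r. finite {g. m g \<noteq> 0})"
  define J where "J = (\<lambda>(m::'g \<Rightarrow> complex^'r^'r) x. \<Sum>g | m g \<noteq> 0. m g *v f (\<sigma> (- g) x))"
  have \<Phi>P: "\<Phi> (gact (**) (+) p m)" if "\<Phi> m" for m
    using finite_subset[OF finite_support_gact[where m=m and p=p, OF order_refl]] that by (simp add: \<Phi>_def)
  have \<Phi>lin: "\<Phi> (\<lambda>x. r *\<^sub>R m x + s *\<^sub>R m' x)" if "\<Phi> m" "\<Phi> m'" for m m' r s
    using that unfolding \<Phi>_def by (rule_tac finite_subset[of _ "{g. m g \<noteq> 0} \<union> {g. m' g \<noteq> 0}"]) auto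
  have Jlin: "J (\<lambda>x. r *\<^sub>R m x + s *\<^sub>R m' x) = (\<lambda>x. r *\<^sub>R J m x + s *\<^sub>R J m' x)" if "\<Phi> m" "\<Phi> m'" for m m' r s
  proof
    fix x
    let ?G = "{g. m g \<noteq> 0} \<union> {g. m' g \<noteq> 0}"
    have fin: "finite ?G" using that by (simp add: \<Phi>_def)
    have "J (\<lambda>x. r *\<^sub>R m x + s *\<^sub>R m' x) x = (\<Sum>g\<in>?G. (r *\<^sub>R m g + s *\<^sub>R m' g) *v f (\<sigma> (- g) x))"
      unfolding J_def by (rule sum_support_superset[OF fin]) auto
    also have "\<dots> = r *\<^sub>R (\<Sum>g\<in>?G. m g *v f (\<sigma> (- g) x)) + s *\<^sub>R (\<Sum>g\<in>?G. m' g *v f (\<sigma> (- g) x))"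
      by (simp add: matrix_vector_mult_add_rdistrib scaleR_mult_vec sum.distrib scaleR_sum_right)
    also have "\<dots> = r *\<^sub>R J m x + s *\<^sub>R J m' x"
      unfolding J_def by (subst (1 2) sum_support_superset[OF fin]) auto
    finally show "J (\<lambda>x. r *\<^sub>R m x + s *\<^sub>R m' x) x = r *\<^sub>R J m x + s *\<^sub>R J m' x" .
  qed
  have JP: "J (gact (**) (+) p m) = gact (*v) \<sigma> p (J m)" if "\<Phi> m" for m
  proof
    fix x
    let ?K = "Poly_Mapping.keys p" and ?G = "{g. m g \<noteq> 0}" and ?p = "Poly_Mapping.lookup p"
    let ?G' = "(\<lambda>(a, b). a + b) ` (?K \<times> ?G)"
    have fin: "finite ?G" using that by (simp add: \<Phi>_def)
    have "J (gact (**) (+) p m) x = (\<Sum>h\<in>?G'. gact (**) (+) p m h *v f (\<sigma> (- h) x))"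
      unfolding J_def using fin by (intro sum_support_superset finite_support_gact) auto
    also have "\<dots> = (\<Sum>h\<in>?G'. \<Sum>a\<in>?K. ?p a *v (m (- a + h) *v f (\<sigma> (- h) x)))"
      by (simp add: gact_def sum_matrix_mult_vec matrix_vector_mul_assoc)
    also have "\<dots> = (\<Sum>a\<in>?K. \<Sum>h\<in>?G'. ?p a *v (m (- a + h) *v f (\<sigma> (- h) x)))" by (rule sum.swap)
    also have "\<dots> = (\<Sum>a\<in>?K. ?p a *v J m (\<sigma> (- a) x))"
    proof (rule sum.cong[OF refl])
      fix a assume a: "a \<in> ?K"
      \<comment> \<open>For fixed \<open>a\<close> the shifted coefficient vanishes off the
        translate of the support of \<open>m\<close>, so the sum over products becomes a sum over
        that support.\<close>
      have "(\<Sum>h\<in>?G'. ?p a *v (m (- a + h) *v f (\<sigma> (- h) x))) = (\<Sum>h\<in>(+) a ` ?G. ?p a *v (m (- a + h) *v f (\<sigma> (- h) x)))"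
      proof (rule sum.mono_neutral_right)
        show "finite ?G'" using fin by auto
        show "(+) a ` ?G \<subseteq> ?G'" using a by force
        show "\<forall>h\<in>?G' - (+) a ` ?G. ?p a *v (m (- a + h) *v f (\<sigma> (- h) x)) = 0"
        proof
          fix h assume "h \<in> ?G' - (+) a ` ?G"
          then have "m (- a + h) = 0" by (metis (mono_tags, lifting) DiffD2 add_minus_cancel imageI mem_Collect_eq)
          then show "?p a *v (m (- a + h) *v f (\<sigma> (- h) x)) = 0" by simp
        qed
      qed
      also have "\<dots> = (\<Sum>b\<in>?G. ?p a *v (m b *v f (\<sigma> (- b) (\<sigma> (- a) x))))"
      proof -
        have "\<sigma> (- b - a) x = \<sigma> (- b) (\<sigma> (- a) x)" for b
          using act_add[of "- b" "- a" x] by simp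
        then show ?thesis
          by (subst sum.reindex) (auto simp: inj_on_def minus_add add.assoc[symmetric])
      qed
      also have "\<dots> = ?p a *v J m (\<sigma> (- a) x)"
        unfolding J_def by (rule linear_sum[OF bounded_linear.linear[OF sm_bl[of "?p a"]], symmetric])
      finally show "(\<Sum>h\<in>?G'. ?p a *v (m (- a + h) *v f (\<sigma> (- h) x))) = ?p a *v J m (\<sigma> (- a) x)" .
    qed
    finally show "J (gact (**) (+) p m) x = gact (*v) \<sigma> p (J m) x" by (simp add: gact_def)
  qed
  have \<Phi>u: "\<Phi> unit_coeff" unfolding \<Phi>_def by (rule finite_subset[of _ "{0}"]) (auto simp: unit_coeff_def)
  have Ju: "J unit_coeff = f"
  proof
    fix x
    have "J unit_coeff x = (\<Sum>g\<in>{0}. unit_coeff g *v f (\<sigma> (- g) x))"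
      unfolding J_def by (rule sum_support_superset) (auto simp: unit_coeff_def)
    then show "J unit_coeff x = f x" by (simp add: unit_coeff_def)
  qed
  have *: "\<Phi> (Qop (gact (**) (+) p) c E \<eta> n unit_coeff) \<and>
      J (Qop (gact (**) (+) p) c E \<eta> n unit_coeff) = Qop (gact (*v) \<sigma> p) c E \<eta> n (J unit_coeff)"
    by (rule Qop_intertwine[of _ \<Phi>]) (use linear_gact \<Phi>P \<Phi>lin Jlin JP \<Phi>u in auto)
  then show "finite {g. qcoef p c E \<eta> n g \<noteq> 0}" by (simp add: \<Phi>_def qcoef_def)
  show "Qop (gact (*v) \<sigma> p) c E \<eta> n f x = (\<Sum>g | qcoef p c E \<eta> n g \<noteq> 0. qcoef p c E \<eta> n g *v f (\<sigma> (- g) x))"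
  proof -
    have "J (Qop (gact (**) (+) p) c E \<eta> n unit_coeff) x = Qop (gact (*v) \<sigma> p) c E \<eta> n f x"
      using * Ju by simp
    then show ?thesis by (simp add: J_def qcoef_def)
  qed
qed

section \<open>The resolvent of the limit operator\<close>

lemma vector_scalar_mult_scaleR: "complex_of_real r *s (v::complex^'r) = r *\<^sub>R v"
  by (simp add: vec_eq_iff complex_eq_iff)

lemma inner_ii_ii: "(\<i> *s u) \<bullet> (\<i> *s v) = (u::complex^'r) \<bullet> v"
  by (simp add: inner_vec_def inner_complex_def algebra_simps)

lemma ell2_csmult:
  fixes u :: "'x \<Rightarrow> complex^'r"
  assumes "u \<in> ell2" shows "(\<lambda>x. a *s u x) \<in> ell2"
proof (rule ell2_dominated(1)[OF assms, of _ "cmod a"])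
  show "norm (a *s u x) \<le> cmod a * norm (u x)" for x
    by (simp add: norm_vec_def norm_mult L2_set_right_distrib)
qed simp

text \<open>The product is conjugate-linear in the first slot, so rotating that slot by
  \<open>\<i>\<close> moves the imaginary part into the real part with a plus sign.\<close>

lemma ell2_inner_eip:
  fixes u v :: "'g \<Rightarrow> complex^'r"
  assumes "u \<in> ell2" "v \<in> ell2"
  shows "ell2_inner u v = Complex (eip u v) (eip (\<lambda>x. \<i> *s u x) v)"
proof -
  let ?f = "\<lambda>g. \<Sum>i\<in>UNIV. cnj (u g $ i) * v g $ i"
  have f: "?f g = of_real (u g \<bullet> v g) + \<i> * of_real ((\<i> *s u g) \<bullet> v g)" for g
    by (rule complex_eqI) (simp_all add: inner_vec_def inner_complex_def algebra_simps)
  have s: "(\<lambda>g. of_real (u g \<bullet> v g) :: complex) summable_on UNIV"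
    "(\<lambda>g. \<i> * of_real ((\<i> *s u g) \<bullet> v g)) summable_on UNIV"
    using eip_summable[OF assms] eip_summable[OF ell2_csmult[OF assms(1), of \<i>] assms(2)]
    by (auto intro!: summable_on_cmult_right summable_on_of_real)
  have t: "(\<Sum>\<^sub>\<infinity>x. complex_of_real (h x)) = of_real (\<Sum>\<^sub>\<infinity>x. h x)" if "h summable_on UNIV" for h :: "'g \<Rightarrow> real"
    by (rule infsumI) (simp add: has_sum_of_real_iff that)
  have "ell2_inner u v = (\<Sum>\<^sub>\<infinity>g. of_real (u g \<bullet> v g)) + (\<Sum>\<^sub>\<infinity>g. \<i> * of_real ((\<i> *s u g) \<bullet> v g))"
    unfolding ell2_inner_def f by (rule infsum_add[OF s])
  also have "\<dots> = of_real (eip u v) + \<i> * of_real (eip (\<lambda>x. \<i> *s u x) v)"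
    using t[OF eip_summable[OF assms]] t[OF eip_summable[OF ell2_csmult[OF assms(1), of \<i>] assms(2)]]
    by (simp add: eip_def infsum_cmult_right')
  finally show ?thesis by (simp add: complex_eq_iff)
qed

definition delta_vec :: "'x \<Rightarrow> 'v \<Rightarrow> 'x \<Rightarrow> 'v::zero" where
  "delta_vec g e = (\<lambda>v. if v = g then e else 0)"

lemma delta_vec_ell2: "delta_vec g (e::'v::real_normed_vector) \<in> ell2"
  by (rule ell2_finite_support(1)[of "{g}"]) (auto simp: delta_vec_def)

lemma delta_vec_norm: "ell2_norm (delta_vec g (e::'v::real_normed_vector)) = norm e"
  by (subst ell2_finite_support(2)[of "{g}"]) (auto simp: delta_vec_def)

lemma eip_delta_vec: "eip (delta_vec g e) u = e \<bullet> u g"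
  using eip_basis[of u g e] by (simp add: eip_commute delta_vec_def inner_commute)

definition bound1 :: "('g::group_add \<Rightarrow>\<^sub>0 complex^'r^'r) \<Rightarrow> real" where
  "bound1 p = (\<Sum>g\<in>Poly_Mapping.keys p. onorm ((*v) (Poly_Mapping.lookup p g)))"

lemma sym_op_lam:
  fixes p :: "'g::group_add \<Rightarrow>\<^sub>0 complex^'r^'r"
  assumes "self_adjoint p"
  shows "sym_op (lam p) (bound1 p)"
proof -
  interpret coeff_action "(+) :: 'g \<Rightarrow> 'g \<Rightarrow> 'g" "(*v) :: complex^'r^'r \<Rightarrow> complex^'r \<Rightarrow> complex^'r"
     "\<lambda>A. onorm ((*v) A)" conj_transpose
    by (rule coeff_action_matrix) (rule group_action_left)
  show ?thesis
    using sym_op_gact[of p] assms by (simp add: lam_eq_gact self_adjoint_def nm1_def bound1_def)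
qed

lemma lam_csmult: "lam p (\<lambda>x. a *s u x) = (\<lambda>x. a *s lam p u x)"
  by (simp add: lam_def left_regular_def vector_scalar_commute fun_eq_iff vec_eq_iff sum_distrib_left)

locale resolvent_setup =
  fixes p :: "'g::group_add \<Rightarrow>\<^sub>0 complex^'r^'r" and c E \<eta> :: real
  assumes sa: "self_adjoint p" and eta0: "0 < \<eta>" and c0: "(bound1 p + \<bar>E\<bar>)\<^sup>2 + \<eta>\<^sup>2 \<le> c"

sublocale resolvent_setup \<subseteq> sym_op_shift "lam p" "bound1 p" c E \<eta>
  using sym_op_lam[OF sa] eta0 c0 by (auto simp: sym_op_shift_def sym_op_shift_axioms_def)

context resolvent_setup
begin

lemma X_csmult: "X (\<lambda>x. a *s u x) = (\<lambda>x. a *s X u x)"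
  unfolding shiftop_def lam_csmult by (simp add: vec_eq_iff fun_eq_iff algebra_simps)

text \<open>From \<open>(X - i s) (X + i s) = X^2 + s^2\<close>: for \<open>s = \<eta>\<close> this
  is the resolvent at \<open>E + i \<eta>\<close>, for \<open>s = - \<eta>\<close> its
  adjoint.\<close>

definition Rcand :: "real \<Rightarrow> ('g \<Rightarrow> complex^'r) \<Rightarrow> 'g \<Rightarrow> complex^'r" where
  "Rcand s u = (\<lambda>x. X (Ainv (lam p) c E \<eta> u) x + (\<i> * of_real s) *s Ainv (lam p) c E \<eta> u x)"

lemma shifted_lam: "(\<lambda>g. lam p \<psi> g - Complex E s *s \<psi> g) = (\<lambda>g. X \<psi> g - (\<i> * of_real s) *s \<psi> g)"
  by (simp add: shiftop_def fun_eq_iff vec_eq_iff complex_eq_iff Complex_eq algebra_simps)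

lemma Rcand_mem: "u \<in> ell2 \<Longrightarrow> Rcand s u \<in> ell2"
  unfolding Rcand_def by (intro ell2_add X_mem Ainv_mem ell2_csmult)

lemma X_add: "X (\<lambda>x. u x + v x) = (\<lambda>x. X u x + X v x)"
  using X.lin_add by simp

lemma Rcand_eq:
  assumes "u \<in> ell2" "s\<^sup>2 = \<eta>\<^sup>2"
  shows "(\<lambda>g. lam p (Rcand s u) g - Complex E s *s Rcand s u g) = u"
proof
  fix g
  let ?v = "Ainv (lam p) c E \<eta> u"
  have "X (Rcand s u) g - (\<i> * of_real s) *s Rcand s u g
     = X (X ?v) g + (\<i> * of_real s) *s X ?v g - (\<i> * of_real s) *s (X ?v g + (\<i> * of_real s) *s ?v g)"
    by (simp only: Rcand_def X_add X_csmult)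
  also have "\<dots> = X (X ?v) g + s\<^sup>2 *\<^sub>R ?v g"
    by (simp add: vec_eq_iff complex_eq_iff power2_eq_square algebra_simps)
  also have "\<dots> = u g" using Ainv_eq[OF assms(1)] assms(2) by simp
  finally show "lam p (Rcand s u) g - Complex E s *s Rcand s u g = u g"
    using fun_cong[OF shifted_lam[of "Rcand s u" s], of g] by simp
qed

text \<open>If \<open>X w = i s w\<close>, then \<open>X^2 w + \<eta>^2 w = 0\<close>, which forces
  \<open>w = 0\<close>. Injectivity identifies the preimage chosen by
  \<open>inv_into\<close>.\<close>

lemma shifted_lam_inj:
  assumes s: "s\<^sup>2 = \<eta>\<^sup>2"
  shows "inj_on (\<lambda>\<psi> g. lam p \<psi> g - Complex E s *s \<psi> g) ell2"
proof (rule inj_onI)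
  fix u v :: "'g \<Rightarrow> complex^'r"
  assume u: "u \<in> ell2" and v: "v \<in> ell2"
    and eq: "(\<lambda>g. lam p u g - Complex E s *s u g) = (\<lambda>g. lam p v g - Complex E s *s v g)"
  define w where "w = (\<lambda>x. u x - v x)"
  have w: "w \<in> ell2" unfolding w_def using u v by (rule ell2_diff)
  have Xw: "X w = (\<lambda>x. X u x - X v x)"
    using X.lin[of 1 u "-1" v] by (simp add: w_def)
  have "X u g - (\<i> * of_real s) *s u g = X v g - (\<i> * of_real s) *s v g" for g
    using eq unfolding shifted_lam by (rule fun_cong)
  then have "X w = (\<lambda>x. (\<i> * of_real s) *s w x)"
    unfolding Xw by (auto simp: w_def fun_eq_iff vec_eq_iff algebra_simps)
  then have "X (X w) x + \<eta>\<^sup>2 *\<^sub>R w x = 0" for x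
    using s by (simp add: X_csmult vec_eq_iff complex_eq_iff power2_eq_square algebra_simps)
  then have "w = (\<lambda>x. 0)" by (rule A_injective[OF w])
  then show "u = v" by (auto simp: w_def fun_eq_iff)
qed

lemma resolvent_eq:
  assumes "u \<in> ell2" "s\<^sup>2 = \<eta>\<^sup>2"
  shows "resolvent (lam p) (Complex E s) u = Rcand s u"
  unfolding resolvent_def
  by (rule inv_into_f_eq) (rule shifted_lam_inj[OF assms(2)] Rcand_mem[OF assms(1)] Rcand_eq[OF assms])+

lemma eip_shift:
  assumes "u \<in> ell2" "w \<in> ell2"
  shows "eip u (\<lambda>x. X w x - (\<i> * of_real s) *s w x) = eip (\<lambda>x. X u x + (\<i> * of_real s) *s u x) w"
proof -
  have 1: "eip u (\<lambda>x. (\<i> * of_real s) *s w x) = - eip (\<lambda>x. (\<i> * of_real s) *s u x) w"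
  proof -
    have "u x \<bullet> ((\<i> * of_real s) *s w x) = - (((\<i> * of_real s) *s u x) \<bullet> w x)" for x
      by (simp add: inner_vec_def inner_complex_def sum_negf[symmetric] algebra_simps)
    then show ?thesis by (simp add: eip_def infsum_uminus)
  qed
  have "eip u (\<lambda>x. X w x - (\<i> * of_real s) *s w x) = eip u (X w) - eip u (\<lambda>x. (\<i> * of_real s) *s w x)"
    using eip_diff[OF X_mem[OF assms(2)] ell2_csmult[OF assms(2)] assms(1)] by (simp only: eip_commute[of u])
  also have "\<dots> = eip (X u) w + eip (\<lambda>x. (\<i> * of_real s) *s u x) w"
    using X_sym[OF assms] 1 by simp
  also have "\<dots> = eip (\<lambda>x. X u x + (\<i> * of_real s) *s u x) w"
    by (rule eip_add[OF X_mem[OF assms(1)] ell2_csmult[OF assms(1)] assms(2), symmetric])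
  finally show ?thesis .
qed

text \<open>Moving the shift across the product changes the sign of its imaginary part. Both real
  parts of the complex product must be matched, hence the second computation with the vector rotated
  by \<open>\<i>\<close>.\<close>

lemma resolvent_adjoint:
  assumes \<phi>: "\<phi> \<in> ell2"
  shows "ell2_adjoint (resolvent (lam p) (Complex E \<eta>)) \<phi> = Rcand (- \<eta>) \<phi>"
  unfolding ell2_adjoint_def
proof (rule the_equality)
  have main: "ell2_inner (Rcand (- \<eta>) \<phi>) \<psi> = ell2_inner \<phi> (resolvent (lam p) (Complex E \<eta>) \<psi>)"
    if \<psi>: "\<psi> \<in> ell2" for \<psi>
  proof -
    let ?w = "Rcand \<eta> \<psi>" and ?\<xi> = "Rcand (- \<eta>) \<phi>"
    have m: "?w \<in> ell2" "?\<xi> \<in> ell2" using \<phi> \<psi> Rcand_mem by auto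
    have \<psi>eq: "\<psi> = (\<lambda>x. X ?w x - (\<i> * of_real \<eta>) *s ?w x)"
      using Rcand_eq[OF \<psi>, of \<eta>] shifted_lam[of ?w \<eta>] by simp
    have \<phi>eq: "(\<lambda>x. X ?\<xi> x + (\<i> * of_real \<eta>) *s ?\<xi> x) = \<phi>"
      using Rcand_eq[OF \<phi>, of "-\<eta>"] shifted_lam[of ?\<xi> "-\<eta>"] by (simp add: vec_eq_iff fun_eq_iff)
    have r: "eip ?\<xi> \<psi> = eip \<phi> ?w"
      by (subst \<psi>eq) (simp only: eip_shift[OF m(2,1)] \<phi>eq)
    have "eip (\<lambda>x. \<i> *s ?\<xi> x) \<psi> = eip (\<lambda>x. X (\<lambda>x. \<i> *s ?\<xi> x) x + (\<i> * of_real \<eta>) *s (\<i> *s ?\<xi> x)) ?w"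
      by (subst \<psi>eq) (rule eip_shift[OF ell2_csmult[OF m(2)] m(1)])
    also have "(\<lambda>x. X (\<lambda>x. \<i> *s ?\<xi> x) x + (\<i> * of_real \<eta>) *s (\<i> *s ?\<xi> x)) = (\<lambda>x. \<i> *s \<phi> x)"
      by (subst \<phi>eq[symmetric]) (simp add: X_csmult vec_eq_iff fun_eq_iff algebra_simps)
    finally show ?thesis
      using r by (simp add: ell2_inner_eip[OF m(2) \<psi>] ell2_inner_eip[OF \<phi> m(1)] resolvent_eq[OF \<psi>])
  qed
  show "Rcand (- \<eta>) \<phi> \<in> ell2 \<and> (\<forall>\<psi>\<in>ell2. ell2_inner (Rcand (- \<eta>) \<phi>) \<psi> = ell2_inner \<phi> (resolvent (lam p) (Complex E \<eta>) \<psi>))"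
    using main Rcand_mem[OF \<phi>] by blast
  fix \<xi> :: "'g \<Rightarrow> complex^'r"
  assume \<xi>: "\<xi> \<in> ell2 \<and> (\<forall>\<psi>\<in>ell2. ell2_inner \<xi> \<psi> = ell2_inner \<phi> (resolvent (lam p) (Complex E \<eta>) \<psi>))"
  \<comment> \<open>Uniqueness: the difference of two candidates is tested against itself.\<close>
  define d where "d = (\<lambda>x. \<xi> x - Rcand (- \<eta>) \<phi> x)"
  have d: "d \<in> ell2" unfolding d_def using \<xi> Rcand_mem[OF \<phi>] by (intro ell2_diff) auto
  have "ell2_inner \<xi> d = ell2_inner (Rcand (- \<eta>) \<phi>) d" using \<xi> d main by simp
  then have "eip \<xi> d = eip (Rcand (- \<eta>) \<phi>) d"
    using \<xi> d Rcand_mem[OF \<phi>] by (simp add: ell2_inner_eip)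
  then have "eip d d = 0" using eip_diff[of \<xi> "Rcand (- \<eta>) \<phi>" d] \<xi> d Rcand_mem[OF \<phi>] by (simp add: d_def)
  then have "d = (\<lambda>x. 0)" using ell2_norm_eq_0[OF d] by (simp add: eip_self)
  then show "\<xi> = Rcand (- \<eta>) \<phi>" by (auto simp: d_def fun_eq_iff)
qed

text \<open>The terms with \<open>X\<close> cancel in the difference of \<open>X + i \<eta>\<close>
  and \<open>X - i \<eta>\<close>, leaving \<open>2 i \<eta>\<close> times the inverse.\<close>

lemma im_resolvent_eq:
  assumes "u \<in> ell2"
  shows "im_resolvent (lam p) (Complex E \<eta>) u = (\<lambda>x. \<eta> *\<^sub>R Ainv (lam p) c E \<eta> u x)"
  unfolding im_resolvent_def resolvent_adjoint[OF assms] resolvent_eq[OF assms refl]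
  by (simp add: Rcand_def fun_eq_iff vec_eq_iff complex_eq_iff)

abbreviation q :: "nat \<Rightarrow> 'g \<Rightarrow> complex^'r^'r" where "q \<equiv> qcoef p c E \<eta>"

text \<open>The block \<open>(g, h)\<close> of a left convolution operator is its coefficient at
  \<open>g - h\<close>; on the row of the unit the coefficient at \<open>h\<close> therefore sits in
  column \<open>- h\<close>.\<close>

definition mlim :: "'g \<Rightarrow> complex^'r^'r" where
  "mlim h = op_block (im_resolvent (lam p) (Complex E \<eta>)) 0 (- h)"

lemma Qop_delta: "Qop (lam p) c E \<eta> n (delta_vec g e) h = q n (h - g) *v e"
proof -
  have *: "- a + h = g \<longleftrightarrow> a = h - g" for a :: 'g
  proof
    assume "- a + h = g"
    then have "a + g = h" using add_minus_cancel[of a h] by simp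
    then show "a = h - g" by (simp add: eq_diff_eq)
  next
    assume "a = h - g"
    then show "- a + h = g" by simp
  qed
  have "Qop (lam p) c E \<eta> n (delta_vec g e) h = (\<Sum>a | q n a \<noteq> 0. q n a *v delta_vec g e (- a + h))"
    unfolding lam_eq_gact by (rule qcoef_action) (rule group_action_left)
  also have "\<dots> = (\<Sum>a | q n a \<noteq> 0. if a = h - g then q n a *v e else 0)"
    by (intro sum.cong refl) (simp add: delta_vec_def *)
  also have "\<dots> = q n (h - g) *v e"
    using qcoef_finite[OF group_action_left, of p c E \<eta> n] by (auto simp: sum.delta)
  finally show ?thesis .
qed

lemma Ainv_delta_lim: "(\<lambda>n. q n (h - g) *v e) \<longlonglongrightarrow> \<eta> *\<^sub>R Ainv (lam p) c E \<eta> (delta_vec g e) h"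
  using Qop_tendsto[OF delta_vec_ell2[of g e], of h] by (simp only: Qop_delta)

lemma mult_axis_nth: "((A::complex^'r^'r) *v axis j 1) $ i = A $ i $ j"
  by (simp add: matrix_vector_mult_def axis_def if_distrib sum.delta cong: if_cong)

lemma mlim_tendsto: "(\<lambda>n. q n h $ i $ j) \<longlonglongrightarrow> mlim h $ i $ j"
proof -
  have "mlim h $ i $ j = (\<eta> *\<^sub>R Ainv (lam p) c E \<eta> (delta_vec (- h) (axis j 1)) 0) $ i"
    using im_resolvent_eq[OF delta_vec_ell2[of "- h" "axis j 1"]]
    by (simp add: mlim_def op_block_def delta_vec_def)
  then show ?thesis
    using tendsto_vec_nth[OF Ainv_delta_lim[of 0 "- h" "axis j 1"], of i] by (simp add: mult_axis_nth)
qed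

lemma mlim_mult: "\<eta> *\<^sub>R Ainv (lam p) c E \<eta> (delta_vec g e) h = mlim (h - g) *v e"
proof (rule LIMSEQ_unique[OF Ainv_delta_lim])
  show "(\<lambda>n. q n (h - g) *v e) \<longlonglongrightarrow> mlim (h - g) *v e"
    unfolding matrix_vector_mult_def by (intro vec_tendstoI) (auto intro!: tendsto_intros mlim_tendsto)
qed

text \<open>A column of coefficients is the image of a delta function, so the operator norm of the
  tail controls the sum of squares.\<close>

lemma mlim_tail:
  assumes "finite F"
  shows "(\<Sum>h\<in>F. (cmod (mlim h $ i $ j - q n h $ i $ j))\<^sup>2) \<le> (b ^ n / \<eta>)\<^sup>2"
proof -
  let ?u = "delta_vec 0 (axis j 1) :: 'g \<Rightarrow> complex^'r"
  let ?w = "\<lambda>x. \<eta> *\<^sub>R Ainv (lam p) c E \<eta> ?u x - Qop (lam p) c E \<eta> n ?u x"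
  have w: "?w h $ i = mlim h $ i $ j - q n h $ i $ j" for h
    by (simp only: mlim_mult Qop_delta diff_0_right vector_minus_component mult_axis_nth)
  have "(\<Sum>h\<in>F. (cmod (mlim h $ i $ j - q n h $ i $ j))\<^sup>2) \<le> (\<Sum>h\<in>F. (norm (?w h))\<^sup>2)"
    unfolding w[symmetric] by (intro sum_mono power_mono Finite_Cartesian_Product.norm_nth_le norm_ge_zero)
  also have "\<dots> \<le> (ell2_norm ?w)\<^sup>2"
    by (rule ell2_sum_sq_le[OF Qop_tail(1)[OF delta_vec_ell2] assms])
  also have "\<dots> \<le> (b ^ n / \<eta>)\<^sup>2"
    using Qop_tail(2)[OF delta_vec_ell2, of 0 "axis j 1" n] by (intro power_mono) (simp_all add: delta_vec_norm)
  finally show ?thesis .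
qed

lemma Ainv_delta_quadratic:
  "\<eta> * eip (delta_vec h e) (Ainv (lam p) c E \<eta> (delta_vec h e)) = e \<bullet> (mlim 0 *v e)"
  using mlim_mult[of h e h] by (simp add: eip_delta_vec inner_scaleR_right[symmetric])

lemma axis_inner_Re: "axis i 1 \<bullet> (w::complex^'r) = Re (w $ i)"
  by (simp add: inner_commute[of "axis i 1"] inner_axis inner_complex_def)

lemma axis_inner_Im: "(\<i> *s axis i 1) \<bullet> (w::complex^'r) = Im (w $ i)"
proof -
  have "\<i> *s (axis i 1 :: complex^'r) = axis i \<i>" by (simp add: vec_eq_iff axis_def)
  then show ?thesis by (simp add: inner_commute[of "axis i \<i>"] inner_axis inner_complex_def)
qed

lemma mlim_diag_nonneg: "0 \<le> Re (mlim 0 $ i $ i)"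
proof -
  have "0 \<le> eip (delta_vec 0 (axis i 1)) (Ainv (lam p) c E \<eta> (delta_vec 0 (axis i 1)))"
    unfolding Ainv_quadratic[OF delta_vec_ell2] by simp
  then have "0 \<le> \<eta> * eip (delta_vec 0 (axis i 1)) (Ainv (lam p) c E \<eta> (delta_vec 0 (axis i 1)))"
    using eta by simp
  then show ?thesis unfolding Ainv_delta_quadratic by (simp add: axis_inner_Re mult_axis_nth)
qed

lemma mlim_diag_le:
  assumes "Re (trace (mlim 0)) \<le> C"
  shows "Re (mlim 0 $ i $ i) \<le> C"
proof -
  have "Re (mlim 0 $ i $ i) \<le> (\<Sum>i\<in>UNIV. Re (mlim 0 $ i $ i))"
    by (rule member_le_sum) (auto simp: mlim_diag_nonneg)
  then show ?thesis using assms by (simp add: trace_def)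
qed

text \<open>A form of the Ward identity: \<eta>^2 times the squared norm of the image of a delta
  function under the inverse is at most the quadratic form there, which is the diagonal coefficient
  divided by \<eta>.\<close>

lemma mlim_sum_sq:
  assumes "Re (trace (mlim 0)) \<le> C" "finite F"
  shows "(\<Sum>h\<in>F. (cmod (mlim h $ i $ j))\<^sup>2) \<le> C / \<eta>"
proof -
  let ?u = "delta_vec 0 (axis j 1) :: 'g \<Rightarrow> complex^'r"
  let ?v = "Ainv (lam p) c E \<eta> ?u"
  have v: "?v \<in> ell2" by (rule Ainv_mem[OF delta_vec_ell2])
  have w: "(\<eta> *\<^sub>R ?v h) $ i = mlim h $ i $ j" for h
    by (simp only: mlim_mult diff_0_right mult_axis_nth)
  have "(\<Sum>h\<in>F. (cmod (mlim h $ i $ j))\<^sup>2) \<le> (\<Sum>h\<in>F. (norm (\<eta> *\<^sub>R ?v h))\<^sup>2)"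
    unfolding w[symmetric] by (intro sum_mono power_mono Finite_Cartesian_Product.norm_nth_le norm_ge_zero)
  also have "\<dots> \<le> (ell2_norm (\<lambda>h. \<eta> *\<^sub>R ?v h))\<^sup>2"
    by (rule ell2_sum_sq_le[OF ell2_scaleR(1)[OF v] assms(2)])
  also have "\<dots> = \<eta>\<^sup>2 * (ell2_norm ?v)\<^sup>2" by (simp add: ell2_scaleR(2) power_mult_distrib)
  also have "\<dots> \<le> eip ?u ?v" using Ainv_quadratic[OF delta_vec_ell2, of 0 "axis j 1"] by simp
  also have "\<dots> = Re (mlim 0 $ j $ j) / \<eta>"
    using Ainv_delta_quadratic[of 0 "axis j 1"] eta by (simp add: axis_inner_Re mult_axis_nth field_simps)
  also have "\<dots> \<le> C / \<eta>" using mlim_diag_le[OF assms(1)] eta by (intro divide_right_mono) auto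
  finally show ?thesis .
qed

text \<open>For a positive operator the diagonal dominates all entries. The product being real, the
  real and imaginary parts of an entry are tested separately, each giving
  \<open>2 C\<close>.\<close>

lemma mlim_le:
  assumes "Re (trace (mlim 0)) \<le> C"
  shows "cmod (mlim h $ i $ j) \<le> 4 * C"
proof -
  let ?A = "Ainv (lam p) c E \<eta>"
  have ii: "(\<i> *s x) \<bullet> (mlim 0 *v (\<i> *s x)) = x \<bullet> (mlim 0 *v x)" for x
    by (simp add: vector_scalar_commute inner_ii_ii)
  have quad: "eip (delta_vec g e) (?A (delta_vec g e)) \<le> C / \<eta>" if "e = axis k 1 \<or> e = \<i> *s axis k 1" for g e k
  proof -
    have "e \<bullet> (mlim 0 *v e) = Re (mlim 0 $ k $ k)"
      using that ii[of "axis k 1"] by (auto simp: axis_inner_Re mult_axis_nth)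
    then have "\<eta> * eip (delta_vec g e) (?A (delta_vec g e)) \<le> C"
      using Ainv_delta_quadratic[of g e] mlim_diag_le[OF assms, of k] by simp
    then show ?thesis using eta by (simp add: pos_le_divide_eq mult.commute)
  qed
  have bil: "\<bar>e \<bullet> (mlim h *v axis j 1)\<bar> \<le> 2 * C" if "e = axis i 1 \<or> e = \<i> *s axis i 1" for e
  proof -
    have "\<bar>eip (delta_vec h e) (?A (delta_vec 0 (axis j 1)))\<bar> \<le> 2 * (C / \<eta>)"
      by (rule Ainv_bilinear_le[OF delta_vec_ell2 delta_vec_ell2]) (use quad that in auto)
    then have "\<eta> * \<bar>e \<bullet> ?A (delta_vec 0 (axis j 1)) h\<bar> \<le> 2 * C"
      using eta by (simp add: eip_delta_vec field_simps)
    moreover have "\<eta> * \<bar>e \<bullet> ?A (delta_vec 0 (axis j 1)) h\<bar> = \<bar>e \<bullet> (mlim h *v axis j 1)\<bar>"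
      using mlim_mult[of 0 "axis j 1" h] eta inner_scaleR_right[of e \<eta> "?A (delta_vec 0 (axis j 1)) h"]
      by (simp add: abs_mult)
    ultimately show ?thesis by simp
  qed
  have "cmod (mlim h $ i $ j) \<le> \<bar>Re (mlim h $ i $ j)\<bar> + \<bar>Im (mlim h $ i $ j)\<bar>" by (rule cmod_le)
  also have "\<dots> \<le> 2 * C + 2 * C"
    using bil[of "axis i 1"] bil[of "\<i> *s axis i 1"]
    by (intro add_mono) (simp_all add: axis_inner_Re axis_inner_Im mult_axis_nth)
  finally show ?thesis by simp
qed

end

section \<open>Word length and rapid decay\<close>

lemma word_length_witness:
  assumes "generates S"
  obtains ws where "length ws = word_length S g" "set ws \<subseteq> S \<union> uminus ` S" "sum_list ws = g"
proof -
  have "\<exists>n ws. length ws = n \<and> set ws \<subseteq> S \<union> uminus ` S \<and> sum_list ws = g"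
    using assms by (auto simp: generates_def)
  from LeastI_ex[OF this] show ?thesis using that unfolding word_length_def by blast
qed

lemma word_length_le:
  "set ws \<subseteq> S \<union> uminus ` S \<Longrightarrow> sum_list ws = g \<Longrightarrow> word_length S g \<le> length ws"
  unfolding word_length_def by (rule Least_le) blast

lemma word_length_add:
  assumes "generates S"
  shows "word_length S (g + h) \<le> word_length S g + word_length S h"
proof -
  obtain ws where ws: "length ws = word_length S g" "set ws \<subseteq> S \<union> uminus ` S" "sum_list ws = g"
    using word_length_witness[OF assms] .
  obtain vs where vs: "length vs = word_length S h" "set vs \<subseteq> S \<union> uminus ` S" "sum_list vs = h"
    using word_length_witness[OF assms] .
  show ?thesis using word_length_le[of "ws @ vs" S "g + h"] ws vs by simp
qed

lemma sum_list_rev_uminus: "sum_list (rev (map uminus ws)) = - sum_list (ws :: 'g::group_add list)"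
  by (induction ws) (simp_all add: minus_add)

lemma word_length_minus:
  assumes "generates S"
  shows "word_length S (- g) = word_length S g"
proof -
  have "word_length S (- h) \<le> word_length S h" for h
  proof -
    obtain ws where ws: "length ws = word_length S h" "set ws \<subseteq> S \<union> uminus ` S" "sum_list ws = h"
      using word_length_witness[OF assms] .
    have "set (rev (map uminus ws)) \<subseteq> S \<union> uminus ` S" using ws(2) by auto
    from word_length_le[OF this sum_list_rev_uminus] show ?thesis using ws by simp
  qed
  from this[of g] this[of "- g"] show ?thesis by simp
qed

lemma word_length_eq_0:
  assumes "generates S"
  shows "word_length S g = 0 \<longleftrightarrow> g = 0"
proof
  assume *: "word_length S g = 0"
  obtain ws where "length ws = word_length S g" "sum_list ws = g"
    using word_length_witness[OF assms] by metis
  then show "g = 0" using * by simp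
next
  assume "g = 0"
  then show "word_length S g = 0" using word_length_le[of "[]" S g] by simp
qed

definition wball :: "'g::group_add set \<Rightarrow> nat \<Rightarrow> 'g set" where
  "wball S n = {g. word_length S g \<le> n}"

lemma finite_wball:
  assumes "finite S" "generates S"
  shows "finite (wball S n)"
proof (rule finite_subset)
  show "wball S n \<subseteq> sum_list ` {ws. set ws \<subseteq> S \<union> uminus ` S \<and> length ws \<le> n}"
  proof
    fix g assume g: "g \<in> wball S n"
    obtain ws where "length ws = word_length S g" "set ws \<subseteq> S \<union> uminus ` S" "sum_list ws = g"
      using word_length_witness[OF assms(2)] .
    then show "g \<in> sum_list ` {ws. set ws \<subseteq> S \<union> uminus ` S \<and> length ws \<le> n}"
      using g by (intro image_eqI[of _ _ ws]) (auto simp: wball_def)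
  qed
  show "finite (sum_list ` {ws. set ws \<subseteq> S \<union> uminus ` S \<and> length ws \<le> n})"
    using assms(1) by (intro finite_imageI finite_lists_length_le) auto
qed

lemma finite_set_in_wball:
  assumes "finite F" shows "\<exists>n. F \<subseteq> wball S n"
proof
  show "F \<subseteq> wball S (Max (word_length S ` F))" using assms by (auto simp: wball_def)
qed

text \<open>Property (RD) supplies its own generating set, whereas (R4mat) measures lengths in
  \<open>S\<close>.\<close>

lemma word_length_comparison:
  assumes "finite S" "generates S" "generates S'"
  shows "\<exists>\<kappa>. \<forall>g. word_length S' g \<le> \<kappa> * word_length S g"
proof -
  let ?A = "S \<union> uminus ` S"
  define \<kappa> where "\<kappa> = Max (insert 0 (word_length S' ` ?A))"
  have \<kappa>: "word_length S' s \<le> \<kappa>" if "s \<in> ?A" for s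
    unfolding \<kappa>_def using that assms(1) by (intro Max_ge) auto
  have *: "word_length S' (sum_list ws) \<le> \<kappa> * length ws" if "set ws \<subseteq> ?A" for ws
    using that
  proof (induction ws)
    case Nil then show ?case using word_length_eq_0[OF assms(3), of 0] by simp
  next
    case (Cons w ws)
    have "word_length S' (w + sum_list ws) \<le> word_length S' w + word_length S' (sum_list ws)"
      by (rule word_length_add[OF assms(3)])
    also have "\<dots> \<le> \<kappa> + \<kappa> * length ws" using Cons by (intro add_mono \<kappa>) auto
    finally show ?case by simp
  qed
  show ?thesis
  proof (intro exI allI)
    fix g
    obtain ws where "length ws = word_length S g" "set ws \<subseteq> ?A" "sum_list ws = g"
      using word_length_witness[OF assms(2)] .
    then show "word_length S' g \<le> \<kappa> * word_length S g" using *[of ws] by simp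
  qed
qed

text \<open>Edges multiply on the left, so a word for \<open>h - g\<close>, read from its last
  letter, spells a path from \<open>g\<close> to \<open>h\<close>.\<close>

lemma cayley_dist_le:
  assumes "generates S"
  shows "cayley_dist S g h \<le> word_length S (h - g)"
proof -
  obtain ws where ws: "length ws = word_length S (h - g)" "set ws \<subseteq> S \<union> uminus ` S" "sum_list ws = h - g"
    using word_length_witness[OF assms] .
  have "(g, sum_list vs + g) \<in> cayley_edges S ^^ length vs" if "set vs \<subseteq> S \<union> uminus ` S" for vs
    using that
  proof (induction vs)
    case Nil then show ?case by simp
  next
    case (Cons v vs)
    have "(sum_list vs + g, v + (sum_list vs + g)) \<in> cayley_edges S"
    proof (cases "v \<in> S")
      case True
      then show ?thesis by (auto simp: cayley_edges_def)
    next
      case False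
      then obtain x where "x \<in> S" "v = - x" using Cons.prems by auto
      then show ?thesis by (auto simp: cayley_edges_def add.assoc[symmetric] intro!: bexI[of _ x])
    qed
    then show ?case using Cons by (auto simp: add.assoc intro: relpow_Suc_I)
  qed
  from this[OF ws(2)] have "(g, h) \<in> cayley_edges S ^^ length ws" using ws(3) by simp
  then show ?thesis unfolding cayley_dist_def ws(1)[symmetric] by (rule Least_le)
qed

lemma ell2_onorm_least:
  fixes A :: "('g \<Rightarrow> 'v::real_normed_vector) \<Rightarrow> 'g \<Rightarrow> 'v"
  assumes "\<And>\<psi>. \<psi> \<in> ell2 \<Longrightarrow> ell2_norm \<psi> \<le> 1 \<Longrightarrow> ell2_norm (A \<psi>) \<le> B"
  shows "ell2_onorm A \<le> B"
  unfolding ell2_onorm_def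
proof (rule cSUP_least)
  show "{\<psi> \<in> ell2. ell2_norm (\<psi> :: 'g \<Rightarrow> 'v) \<le> 1} \<noteq> {}"
  proof -
    have "(\<lambda>x. 0) \<in> {\<psi> \<in> ell2. ell2_norm (\<psi> :: 'g \<Rightarrow> 'v) \<le> 1}" by (simp add: ell2_zero)
    then show ?thesis by blast
  qed
qed (use assms in auto)

lemma coeff_action_lam_scalar: "coeff_action ((+) :: 'g::group_add \<Rightarrow> 'g \<Rightarrow> 'g) ((*) :: complex \<Rightarrow> complex \<Rightarrow> complex) cmod cnj"
  by (rule coeff_action_scalar) (rule group_action_left)

lemma ell2_onorm_upper:
  fixes q :: "'g::group_add \<Rightarrow>\<^sub>0 complex"
  assumes "\<psi> \<in> ell2" "ell2_norm \<psi> \<le> 1"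
  shows "ell2_norm (lam_scalar q \<psi>) \<le> ell2_onorm (lam_scalar q)"
proof -
  interpret coeff_action "(+) :: 'g \<Rightarrow> 'g \<Rightarrow> 'g" "(*) :: complex \<Rightarrow> complex \<Rightarrow> complex" cmod cnj
    by (rule coeff_action_lam_scalar)
  have "bdd_above ((\<lambda>\<psi>. ell2_norm (lam_scalar q \<psi>)) ` {\<psi> \<in> ell2. ell2_norm \<psi> \<le> 1})"
  proof (rule bdd_aboveI2)
    fix \<psi> :: "'g \<Rightarrow> complex" assume "\<psi> \<in> {\<psi> \<in> ell2. ell2_norm \<psi> \<le> 1}"
    then show "ell2_norm (lam_scalar q \<psi>) \<le> nm1 q * 1"
      using gact_norm[of \<psi> q] nm1_nonneg[of q] mult_left_mono[of "ell2_norm \<psi>" 1 "nm1 q"]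
      by (simp add: lam_scalar_eq_gact)
  qed
  then show ?thesis unfolding ell2_onorm_def using assms by (intro cSUP_upper) auto
qed

lemma ell2_onorm_nonneg: "0 \<le> ell2_onorm (lam_scalar q)"
  using ell2_onorm_upper[of "\<lambda>x. 0" q] ell2_zero ell2_norm_nonneg order_trans by (metis zero_le_one)

lemma lam_scalar_norm:
  fixes q :: "'g::group_add \<Rightarrow>\<^sub>0 complex"
  assumes "\<psi> \<in> ell2"
  shows "ell2_norm (lam_scalar q \<psi>) \<le> ell2_onorm (lam_scalar q) * ell2_norm \<psi>"
proof (cases "ell2_norm \<psi> = 0")
  case True
  then have "\<psi> = (\<lambda>x. 0)" using ell2_norm_eq_0[OF assms] by simp
  then have "lam_scalar q \<psi> = (\<lambda>x. 0)" by (simp add: lam_scalar_def left_regular_def)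
  then show ?thesis using True by (simp add: ell2_zero)
next
  case False
  then have p: "0 < ell2_norm \<psi>" using ell2_norm_nonneg[of \<psi>] by linarith
  let ?\<phi> = "\<lambda>x. (1 / ell2_norm \<psi>) *\<^sub>R \<psi> x"
  have "lam_scalar q ?\<phi> = (\<lambda>x. (1 / ell2_norm \<psi>) *\<^sub>R lam_scalar q \<psi> x)"
    by (simp add: lam_scalar_def left_regular_def fun_eq_iff scaleR_sum_right)
  then have "ell2_norm (lam_scalar q ?\<phi>) = (1 / ell2_norm \<psi>) * ell2_norm (lam_scalar q \<psi>)"
    using p by (simp only:) (simp add: ell2_scaleR(2))
  moreover have "ell2_norm (lam_scalar q ?\<phi>) \<le> ell2_onorm (lam_scalar q)"
    by (rule ell2_onorm_upper[OF ell2_scaleR(1)[OF assms]]) (use p in \<open>simp add: ell2_scaleR(2)\<close>)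
  ultimately have "(1 / ell2_norm \<psi>) * ell2_norm (lam_scalar q \<psi>) \<le> ell2_onorm (lam_scalar q)" by simp
  then show ?thesis using p by (simp add: pos_divide_le_eq)
qed

text \<open>The element of the group algebra with coefficients \<open>W\<close> on the finite set
  \<open>G\<close>. Keeping \<open>W\<close> total allows it to be cut to several sets.\<close>

definition pm :: "'g set \<Rightarrow> ('g \<Rightarrow> 'c) \<Rightarrow> 'g \<Rightarrow>\<^sub>0 'c::comm_monoid_add" where
  "pm G W = (\<Sum>g\<in>G. Poly_Mapping.single g (W g))"

lemma lookup_pm: "finite G \<Longrightarrow> Poly_Mapping.lookup (pm G W) g = (if g \<in> G then W g else 0)"
  by (simp add: pm_def lookup_sum lookup_single when_def)

lemma keys_pm: "finite G \<Longrightarrow> Poly_Mapping.keys (pm G W) \<subseteq> G"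
  by (auto simp: in_keys_iff lookup_pm split: if_splits)

lemma gact_pm:
  fixes W :: "'g::group_add \<Rightarrow> complex"
  assumes "finite G"
  shows "gact (*) \<sigma> (pm G W) f x = (\<Sum>g\<in>G. W g * f (\<sigma> (- g) x))"
  by (subst gact_superset[OF assms keys_pm[OF assms]]) (auto simp: lookup_pm assms)

lemma ell2_onorm_pm_sum:
  fixes W :: "'g::group_add \<Rightarrow> complex"
  assumes "finite I" "\<And>i. i \<in> I \<Longrightarrow> finite (G i)" "disjoint_family_on G I"
  shows "ell2_onorm (lam_scalar (pm (\<Union>i\<in>I. G i) W)) \<le> (\<Sum>i\<in>I. ell2_onorm (lam_scalar (pm (G i) W)))"
proof (rule ell2_onorm_least)
  fix \<psi> :: "'g \<Rightarrow> complex" assume \<psi>: "\<psi> \<in> ell2" "ell2_norm \<psi> \<le> 1"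
  have eq: "lam_scalar (pm (\<Union>i\<in>I. G i) W) \<psi> = (\<lambda>x. \<Sum>i\<in>I. lam_scalar (pm (G i) W) \<psi> x)"
    using assms by (intro ext) (simp add: lam_scalar_eq_gact gact_pm sum.UNION_disjoint_family)
  interpret coeff_action "(+) :: 'g \<Rightarrow> 'g \<Rightarrow> 'g" "(*) :: complex \<Rightarrow> complex \<Rightarrow> complex" cmod cnj
    by (rule coeff_action_lam_scalar)
  have "ell2_norm (\<lambda>x. \<Sum>i\<in>I. lam_scalar (pm (G i) W) \<psi> x) \<le> (\<Sum>i\<in>I. ell2_norm (lam_scalar (pm (G i) W) \<psi>))"
    using ell2_sum[OF assms(1), of "\<lambda>i. lam_scalar (pm (G i) W) \<psi>"] gact_ell2[OF \<psi>(1)] by (simp add: lam_scalar_eq_gact)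
  also have "\<dots> \<le> (\<Sum>i\<in>I. ell2_onorm (lam_scalar (pm (G i) W)))"
    by (intro sum_mono ell2_onorm_upper \<psi>)
  finally show "ell2_norm (lam_scalar (pm (\<Union>i\<in>I. G i) W) \<psi>) \<le> (\<Sum>i\<in>I. ell2_onorm (lam_scalar (pm (G i) W)))"
    unfolding eq .
qed

lemma diam_supp_le:
  assumes "\<And>g h. g \<in> Poly_Mapping.keys q \<Longrightarrow> h \<in> Poly_Mapping.keys q \<Longrightarrow> cayley_dist S g h \<le> n" "1 \<le> n"
  shows "diam_supp S q \<le> n"
  unfolding diam_supp_def using assms by (subst Max_le_iff) auto

text \<open>The element is cut into the spheres \<open>|g| = k\<close>, on which the diameter is \<open>O(k)\<close>; the resulting
  series \<open>\<Sum>\<^sub>k k\<^bsup>2 C1 - C1'\<^esup>\<close> converges as \<open>C1' > 2 C1 + 1\<close>.\<close>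

lemma RD_weighted:
  fixes S :: "'g::group_add set"
  assumes RD: "RD TYPE('g) C1" and S: "finite S" "generates S" and C1': "C1' > 2 * C1 + 1"
  obtains K where "0 < K" "\<And>G W. finite G \<Longrightarrow> ell2_onorm (lam_scalar (pm G (W :: 'g \<Rightarrow> complex)))
     \<le> K * (cmod (W 0) + sqrt (\<Sum>g\<in>G. real (word_length S g) powr C1' * (cmod (W g))\<^sup>2))"
proof -
  from RD obtain S' C where C1: "C1 > 0" and S': "finite S'" "generates S'" and C: "C > 0"
    and bound: "\<And>q :: 'g \<Rightarrow>\<^sub>0 complex. ell2_onorm (lam_scalar q)
       \<le> C * real (diam_supp S' q) powr C1 * sqrt (\<Sum>g\<in>Poly_Mapping.keys q. (cmod (Poly_Mapping.lookup q g))\<^sup>2)"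
    unfolding RD_def by blast
  obtain \<kappa> where \<kappa>: "\<And>g. word_length S' g \<le> \<kappa> * word_length S g"
    using word_length_comparison[OF S S'(2)] by blast
  define M where "M = (2 * real \<kappa> + 1) powr C1"
  define Z where "Z = suminf (\<lambda>k. real (Suc k) powr (2 * C1 - C1'))"
  have Z: "summable (\<lambda>k. real (Suc k) powr (2 * C1 - C1'))"
    using C1' by (subst summable_Suc_iff) (simp add: summable_real_powr_iff)
  have M: "M \<ge> 1" unfolding M_def using C1 by (intro ge_one_powr_ge_zero) auto
  have Z0: "0 \<le> Z" unfolding Z_def by (intro suminf_nonneg Z) auto
  have sphere: "ell2_onorm (lam_scalar (pm G W)) \<le> C * M * (real (max 1 k) powr C1 * sqrt (\<Sum>g\<in>G. (cmod (W g))\<^sup>2))"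
    if G: "finite G" "\<And>g. g \<in> G \<Longrightarrow> word_length S g = k" for G k and W :: "'g \<Rightarrow> complex"
  proof -
    \<comment> \<open>Two elements of the sphere differ by a word of length at most
      \<open>2 k\<close>. The \<open>+ 1\<close> and \<open>max 1 k\<close> cover the convention
      that the diameter is at least 1.\<close>
    have "diam_supp S' (pm G W) \<le> (2 * \<kappa> + 1) * max 1 k"
    proof (rule diam_supp_le)
      fix g h assume "g \<in> Poly_Mapping.keys (pm G W)" "h \<in> Poly_Mapping.keys (pm G W)"
      then have gh: "word_length S g = k" "word_length S h = k" using keys_pm[OF G(1)] G(2) by blast+
      have "cayley_dist S' g h \<le> word_length S' (h + - g)" using cayley_dist_le[OF S'(2), of g h] by simp
      also have "\<dots> \<le> \<kappa> * word_length S (h + - g)" by (rule \<kappa>)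
      also have "\<dots> \<le> \<kappa> * (k + k)"
        using word_length_add[OF S(2), of h "- g"] gh word_length_minus[OF S(2), of g] by (intro mult_left_mono) auto
      also have "\<dots> \<le> (2 * \<kappa> + 1) * max 1 k" by (cases k) (simp_all add: algebra_simps)
      finally show "cayley_dist S' g h \<le> (2 * \<kappa> + 1) * max 1 k" .
    qed simp
    then have "real (diam_supp S' (pm G W)) \<le> (2 * real \<kappa> + 1) * real (max 1 k)"
      by (metis (mono_tags, lifting) of_nat_1 of_nat_add of_nat_le_iff of_nat_mult of_nat_numeral)
    then have "real (diam_supp S' (pm G W)) powr C1 \<le> ((2 * real \<kappa> + 1) * real (max 1 k)) powr C1"
      using C1 by (intro powr_mono2) auto
    also have "\<dots> = M * real (max 1 k) powr C1" unfolding M_def by (rule powr_mult)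
    finally have d: "real (diam_supp S' (pm G W)) powr C1 \<le> M * real (max 1 k) powr C1" .
    have s: "(\<Sum>g\<in>Poly_Mapping.keys (pm G W). (cmod (Poly_Mapping.lookup (pm G W) g))\<^sup>2) \<le> (\<Sum>g\<in>G. (cmod (W g))\<^sup>2)"
    proof -
      have "(\<Sum>g\<in>Poly_Mapping.keys (pm G W). (cmod (Poly_Mapping.lookup (pm G W) g))\<^sup>2) = (\<Sum>g\<in>Poly_Mapping.keys (pm G W). (cmod (W g))\<^sup>2)"
        using keys_pm[OF G(1), of W] by (intro sum.cong) (auto simp: lookup_pm[OF G(1)])
      also have "\<dots> \<le> (\<Sum>g\<in>G. (cmod (W g))\<^sup>2)"
        by (rule sum_mono2[OF G(1) keys_pm[OF G(1)]]) simp
      finally show ?thesis .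
    qed
    have "ell2_onorm (lam_scalar (pm G W)) \<le> C * (M * real (max 1 k) powr C1) * sqrt (\<Sum>g\<in>G. (cmod (W g))\<^sup>2)"
    proof (rule order_trans[OF bound], rule mult_mono)
      show "C * real (diam_supp S' (pm G W)) powr C1 \<le> C * (M * real (max 1 k) powr C1)"
        by (rule mult_left_mono[OF d]) (use C in simp)
      show "0 \<le> C * (M * real (max 1 k) powr C1)" using C M by simp
    qed (auto intro: s sum_nonneg)
    then show ?thesis by (simp add: mult.assoc)
  qed
  show ?thesis
  \<comment> \<open>The summand 1 pays for the sphere \<open>k = 0\<close>, the root of
    \<open>Z\<close> for all the others.\<close>
  proof (rule that[of "C * M * (1 + sqrt Z)"])
    show "0 < C * M * (1 + sqrt Z)" using C M Z0 by (intro mult_pos_pos) (auto intro: add_pos_nonneg)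
    fix G :: "'g set" and W :: "'g \<Rightarrow> complex" assume G: "finite G"
    obtain n where n: "G \<subseteq> wball S n" using finite_set_in_wball[OF G] by blast
    define Gk where "Gk = (\<lambda>k. {g\<in>G. word_length S g = k})"
    define s where "s = (\<lambda>k. sqrt (\<Sum>g\<in>Gk k. (cmod (W g))\<^sup>2))"
    have s0: "0 \<le> s k" for k unfolding s_def by (simp add: sum_nonneg)
    have Un: "G = (\<Union>k\<in>{..n}. Gk k)" using n by (auto simp: Gk_def wball_def)
    have disj: "disjoint_family_on Gk {..n}" by (auto simp: disjoint_family_on_def Gk_def)
    have Gkf: "finite (Gk k)" for k using G by (simp add: Gk_def)
    have sph: "ell2_onorm (lam_scalar (pm (Gk k) W)) \<le> C * M * (real (max 1 k) powr C1 * s k)" for k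
      unfolding s_def by (rule sphere[OF Gkf]) (simp add: Gk_def)
    have 1: "ell2_onorm (lam_scalar (pm G W)) \<le> (\<Sum>k\<le>n. C * M * (real (max 1 k) powr C1 * s k))"
      by (rule order_trans[OF ell2_onorm_pm_sum[OF finite_atMost Gkf disj, of W, folded Un]]) (intro sum_mono sph)
    \<comment> \<open>The unit is singled out because its weight, a positive power of 0, vanishes:
      the weighted sum does not see \<open>W 0\<close>.\<close>
    have s_0: "s 0 \<le> cmod (W 0)"
    proof -
      have "(\<Sum>g\<in>Gk 0. (cmod (W g))\<^sup>2) \<le> (\<Sum>g\<in>{0}. (cmod (W g))\<^sup>2)"
        by (rule sum_mono2) (auto simp: Gk_def word_length_eq_0[OF S(2)])
      then show ?thesis unfolding s_def by (simp add: real_le_lsqrt)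
    qed
    have 2: "(\<Sum>k\<in>{1..n}. real k powr C1 * s k) \<le> sqrt Z * sqrt (\<Sum>g\<in>G. real (word_length S g) powr C1' * (cmod (W g))\<^sup>2)"
    proof -
      \<comment> \<open>Cauchy-Schwarz with half of the weight, \<open>k^(C1'/2)\<close>, moved to
        the coefficients; the other factor is square-summable as
        \<open>2 C1 - C1' < -1\<close>.\<close>
      have "(\<Sum>k\<in>{1..n}. real k powr C1 * s k)
          = (\<Sum>k\<in>{1..n}. \<bar>real k powr (C1 - C1' / 2)\<bar> * \<bar>real k powr (C1' / 2) * s k\<bar>)"
      proof (rule sum.cong[OF refl])
        fix k assume "k \<in> {1..n}"
        have "real k powr (C1 - C1' / 2) * real k powr (C1' / 2) = real k powr C1"
          by (simp add: powr_add[symmetric])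
        then show "real k powr C1 * s k = \<bar>real k powr (C1 - C1' / 2)\<bar> * \<bar>real k powr (C1' / 2) * s k\<bar>"
          using s0[of k] by (simp add: abs_mult)
      qed
      also have "\<dots> \<le> L2_set (\<lambda>k. real k powr (C1 - C1' / 2)) {1..n} * L2_set (\<lambda>k. real k powr (C1' / 2) * s k) {1..n}"
        by (rule L2_set_mult_ineq)
      also have "\<dots> \<le> sqrt Z * sqrt (\<Sum>g\<in>G. real (word_length S g) powr C1' * (cmod (W g))\<^sup>2)"
      proof (intro mult_mono)
        have "(\<Sum>k\<in>{1..n}. (real k powr (C1 - C1' / 2))\<^sup>2) = (\<Sum>k\<in>{1..n}. real k powr (2 * C1 - C1'))"
          by (intro sum.cong refl) (simp add: power2_eq_square powr_add[symmetric])
        also have "\<dots> = (\<Sum>k<n. real (Suc k) powr (2 * C1 - C1'))"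
          by (rule sum.reindex_bij_witness[of _ Suc "\<lambda>k. k - 1"]) auto
        also have "\<dots> \<le> Z" unfolding Z_def by (intro sum_le_suminf Z) auto
        finally show "L2_set (\<lambda>k. real k powr (C1 - C1' / 2)) {1..n} \<le> sqrt Z"
          unfolding L2_set_def by (rule real_sqrt_le_mono)
        have "(\<Sum>k\<in>{1..n}. (real k powr (C1' / 2) * s k)\<^sup>2) = (\<Sum>k\<in>{1..n}. \<Sum>g\<in>Gk k. real (word_length S g) powr C1' * (cmod (W g))\<^sup>2)"
        proof (rule sum.cong[OF refl])
          fix k
          have "(real k powr (C1' / 2) * s k)\<^sup>2 = real k powr C1' * (\<Sum>g\<in>Gk k. (cmod (W g))\<^sup>2)"
            unfolding power_mult_distrib s_def by (simp add: sum_nonneg power2_eq_square powr_add[symmetric])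
          also have "\<dots> = (\<Sum>g\<in>Gk k. real (word_length S g) powr C1' * (cmod (W g))\<^sup>2)"
            unfolding sum_distrib_left by (intro sum.cong refl) (simp add: Gk_def)
          finally show "(real k powr (C1' / 2) * s k)\<^sup>2 = (\<Sum>g\<in>Gk k. real (word_length S g) powr C1' * (cmod (W g))\<^sup>2)" .
        qed
        also have "\<dots> \<le> (\<Sum>k\<le>n. \<Sum>g\<in>Gk k. real (word_length S g) powr C1' * (cmod (W g))\<^sup>2)"
          by (rule sum_mono2) (auto intro!: sum_nonneg)
        also have "\<dots> = (\<Sum>g\<in>G. real (word_length S g) powr C1' * (cmod (W g))\<^sup>2)"
          by (subst Un, subst sum.UNION_disjoint_family[OF _ _ disj]) (auto simp: Gkf)
        finally show "L2_set (\<lambda>k. real k powr (C1' / 2) * s k) {1..n} \<le> sqrt (\<Sum>g\<in>G. real (word_length S g) powr C1' * (cmod (W g))\<^sup>2)"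
          unfolding L2_set_def by (rule real_sqrt_le_mono)
      qed (use Z0 in auto)
      finally show ?thesis .
    qed
    let ?R = "sqrt (\<Sum>g\<in>G. real (word_length S g) powr C1' * (cmod (W g))\<^sup>2)"
    have R0: "0 \<le> ?R" by (simp add: sum_nonneg)
    have "(\<Sum>k\<le>n. real (max 1 k) powr C1 * s k) = s 0 + (\<Sum>k\<in>{1..n}. real k powr C1 * s k)"
    proof -
      have "{..n} = insert 0 {1..n}" by auto
      moreover have "(\<Sum>k\<in>{1..n}. real (max 1 k) powr C1 * s k) = (\<Sum>k\<in>{1..n}. real k powr C1 * s k)"
        by (intro sum.cong refl) (simp add: max_def)
      ultimately show ?thesis by simp
    qed
    also have "\<dots> \<le> cmod (W 0) + sqrt Z * ?R" using s_0 2 by linarith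
    also have "\<dots> \<le> (1 + sqrt Z) * (cmod (W 0) + ?R)"
      using Z0 R0 by (simp add: algebra_simps)
    finally have "(C * M) * (\<Sum>k\<le>n. real (max 1 k) powr C1 * s k) \<le> (C * M) * ((1 + sqrt Z) * (cmod (W 0) + ?R))"
      using C M by (intro mult_left_mono) auto
    then show "ell2_onorm (lam_scalar (pm G W)) \<le> C * M * (1 + sqrt Z) * (cmod (W 0) + ?R)"
      using 1 by (simp add: sum_distrib_left[symmetric] mult.assoc)
  qed
qed

section \<open>Strong convergence off a small subspace\<close>

abbreviation sact :: "('g::group_add \<Rightarrow> 'x \<Rightarrow> 'x) \<Rightarrow> ('g \<Rightarrow>\<^sub>0 complex) \<Rightarrow> ('x \<Rightarrow> complex) \<Rightarrow> 'x \<Rightarrow> complex" where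
  "sact \<equiv> gact (*)"

lemma poly_mapping_as_sum: "p = (\<Sum>g\<in>Poly_Mapping.keys p. Poly_Mapping.single g (Poly_Mapping.lookup p g))"
  by (rule poly_mapping_eqI) (simp add: lookup_sum lookup_single when_def in_keys_iff)

lemma sact_add: "sact \<sigma> (p + q) f x = sact \<sigma> p f x + sact \<sigma> q f x"
proof -
  let ?G = "Poly_Mapping.keys p \<union> Poly_Mapping.keys q"
  have k: "Poly_Mapping.keys (p + q) \<subseteq> ?G" by (rule keys_add)
  show ?thesis
    by (subst (1 2 3) gact_superset[where G = ?G]) (use k in \<open>auto simp: lookup_add sum.distrib ring_distribs\<close>)
qed

lemma sact_zero: "sact \<sigma> 0 f x = 0" by (simp add: gact_def)

lemma sact_sum: "sact \<sigma> (\<Sum>i\<in>I. p i) f x = (\<Sum>i\<in>I. sact \<sigma> (p i) f x)"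
  by (induction I rule: infinite_finite_induct) (simp_all add: sact_zero sact_add)

lemma sact_single: "sact \<sigma> (Poly_Mapping.single g a) f x = a * f (\<sigma> (- g) x)"
  by (subst gact_superset[where G = "{g}"]) (auto simp: keys_single)

lemma sact_times:
  assumes "group_action \<sigma>"
  shows "sact \<sigma> (p * q) f = sact \<sigma> p (sact \<sigma> q f)"
proof
  fix x
  interpret group_action \<sigma> by fact
  have act: "\<sigma> (- b - a) x = \<sigma> (- b) (\<sigma> (- a) x)" for a b
    using act_add[of "- b" "- a" x] by simp
  have "p * q = (\<Sum>a\<in>Poly_Mapping.keys p. Poly_Mapping.single a (Poly_Mapping.lookup p a)) *
      (\<Sum>b\<in>Poly_Mapping.keys q. Poly_Mapping.single b (Poly_Mapping.lookup q b))"
    by (simp only: poly_mapping_as_sum[symmetric])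
  also have "\<dots> = (\<Sum>a\<in>Poly_Mapping.keys p. \<Sum>b\<in>Poly_Mapping.keys q.
      Poly_Mapping.single (a + b) (Poly_Mapping.lookup p a * Poly_Mapping.lookup q b))"
    by (simp only: sum_distrib_left sum_distrib_right mult_single) (rule sum.swap)
  finally show "sact \<sigma> (p * q) f x = sact \<sigma> p (sact \<sigma> q f) x"
    by (simp only: sact_sum sact_single minus_add act)
      (simp add: gact_def sum_distrib_left mult.assoc minus_add act)
qed

definition pstar :: "('g::group_add \<Rightarrow>\<^sub>0 complex) \<Rightarrow> 'g \<Rightarrow>\<^sub>0 complex" where
  "pstar q = (\<Sum>g\<in>Poly_Mapping.keys q. Poly_Mapping.single (- g) (cnj (Poly_Mapping.lookup q g)))"

lemma lookup_pstar: "Poly_Mapping.lookup (pstar q) (- g) = cnj (Poly_Mapping.lookup q g)"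
  by (simp add: pstar_def lookup_sum lookup_single when_def in_keys_iff)

text \<open>This is \<open>(w^* w)^(2^j)\<close>. Repeated squaring of a self-adjoint element suits
  the iterated Cauchy-Schwarz argument below.\<close>

fun spow :: "('g::group_add \<Rightarrow>\<^sub>0 complex) \<Rightarrow> nat \<Rightarrow> 'g \<Rightarrow>\<^sub>0 complex" where
  "spow w 0 = pstar w * w" |
  "spow w (Suc j) = spow w j * spow w j"

locale scalar_action = group_action \<sigma> for \<sigma> :: "'g::group_add \<Rightarrow> 'x \<Rightarrow> 'x"

sublocale scalar_action \<subseteq> coeff_action \<sigma> "(*) :: complex \<Rightarrow> complex \<Rightarrow> complex" cmod cnj
  by (rule coeff_action_scalar) (rule group_action_axioms)

context scalar_action
begin

lemma pstar_adjoint: "u \<in> ell2 \<Longrightarrow> v \<in> ell2 \<Longrightarrow> eip (sact \<sigma> w u) v = eip u (sact \<sigma> (pstar w) v)"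
  by (rule gact_adjoint) (rule lookup_pstar)

lemma spow_sym: "u \<in> ell2 \<Longrightarrow> v \<in> ell2 \<Longrightarrow> eip (sact \<sigma> (spow w j) u) v = eip u (sact \<sigma> (spow w j) v)"
proof (induction j arbitrary: u v)
  case 0
  have "eip (sact \<sigma> (pstar w) (sact \<sigma> w u)) v = eip v (sact \<sigma> (pstar w) (sact \<sigma> w u))" by (rule eip_commute)
  also have "\<dots> = eip (sact \<sigma> w v) (sact \<sigma> w u)" by (rule pstar_adjoint[symmetric]) (auto intro: 0 gact_ell2)
  also have "\<dots> = eip (sact \<sigma> w u) (sact \<sigma> w v)" by (rule eip_commute)
  also have "\<dots> = eip u (sact \<sigma> (pstar w) (sact \<sigma> w v))" by (rule pstar_adjoint) (auto intro: 0 gact_ell2)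
  finally show ?case by (simp add: sact_times[OF group_action_axioms])
next
  case (Suc j)
  then show ?case by (simp add: sact_times[OF group_action_axioms] gact_ell2)
qed

text \<open>Iterated Cauchy-Schwarz: the squared norm of \<open>s u\<close> equals
  \<open>eip u (s (s u))\<close>, hence is at most the norm of \<open>s (s u)\<close> for a unit
  vector \<open>u\<close>.\<close>

lemma spow_lower:
  assumes "u \<in> ell2" "ell2_norm u = 1"
  shows "ell2_norm (sact \<sigma> w u) ^ 2 ^ Suc j \<le> ell2_norm (sact \<sigma> (spow w j) u)"
proof (induction j)
  case 0
  have "(ell2_norm (sact \<sigma> w u))\<^sup>2 = eip u (sact \<sigma> (spow w 0) u)"
    using pstar_adjoint[OF assms(1) gact_ell2[OF assms(1)], of w w]
    by (simp add: eip_self sact_times[OF group_action_axioms])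
  also have "\<dots> \<le> ell2_norm u * ell2_norm (sact \<sigma> (spow w 0) u)"
    using eip_le[OF assms(1) gact_ell2[OF assms(1)]] abs_le_D1 by blast
  finally show ?case using assms(2) by simp
next
  case (Suc j)
  let ?s = "sact \<sigma> (spow w j)"
  have "ell2_norm (sact \<sigma> w u) ^ 2 ^ Suc (Suc j) = (ell2_norm (sact \<sigma> w u) ^ 2 ^ Suc j)\<^sup>2"
    by (simp add: power_mult[symmetric] mult.commute)
  also have "\<dots> \<le> (ell2_norm (?s u))\<^sup>2" by (intro power_mono Suc) auto
  also have "\<dots> = eip u (?s (?s u))"
    using spow_sym[OF assms(1) gact_ell2[OF assms(1)], of w j "spow w j"] by (simp add: eip_self)
  also have "\<dots> \<le> ell2_norm u * ell2_norm (?s (?s u))"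
    using eip_le[OF assms(1) gact_ell2[OF gact_ell2[OF assms(1)]]] abs_le_D1 by blast
  finally show ?case using assms(2) by (simp add: sact_times[OF group_action_axioms])
qed

text \<open>The adjoint satisfies the same bound: its squared norm at \<open>\<psi>\<close> is a
  product of \<open>w w^* \<psi>\<close> with \<open>\<psi>\<close>, and one factor cancels.\<close>

lemma pstar_bound:
  assumes B: "\<And>\<psi>. \<psi> \<in> ell2 \<Longrightarrow> ell2_norm (sact \<sigma> w \<psi>) \<le> B * ell2_norm \<psi>" and \<psi>: "\<psi> \<in> ell2"
  shows "ell2_norm (sact \<sigma> (pstar w) \<psi>) \<le> B * ell2_norm \<psi>"
proof -
  let ?v = "sact \<sigma> (pstar w) \<psi>"
  have v: "?v \<in> ell2" by (rule gact_ell2[OF \<psi>])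
  have "(ell2_norm ?v)\<^sup>2 = eip (sact \<sigma> w ?v) \<psi>" using pstar_adjoint[OF v \<psi>, of w] by (simp add: eip_self)
  also have "\<dots> \<le> ell2_norm (sact \<sigma> w ?v) * ell2_norm \<psi>"
    using eip_le[OF gact_ell2[OF v] \<psi>] abs_le_D1 by blast
  also have "\<dots> \<le> B * ell2_norm ?v * ell2_norm \<psi>" by (intro mult_right_mono B v) simp
  finally have *: "ell2_norm ?v * ell2_norm ?v \<le> ell2_norm ?v * (B * ell2_norm \<psi>)"
    by (simp add: power2_eq_square mult_ac)
  show ?thesis
  proof (cases "ell2_norm ?v = 0")
    case True
    have "0 \<le> B * ell2_norm \<psi>" using order_trans[OF ell2_norm_nonneg B[OF \<psi>]] .
    then show ?thesis using True by simp
  next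
    case False
    then have "0 < ell2_norm ?v" using ell2_norm_nonneg[of ?v] by linarith
    then show ?thesis using * mult_le_cancel_left_pos by blast
  qed
qed

lemma spow_upper:
  assumes B: "\<And>\<psi>. \<psi> \<in> ell2 \<Longrightarrow> ell2_norm (sact \<sigma> w \<psi>) \<le> B * ell2_norm \<psi>" "0 \<le> B" and \<psi>: "\<psi> \<in> ell2"
  shows "ell2_norm (sact \<sigma> (spow w j) \<psi>) \<le> B ^ 2 ^ Suc j * ell2_norm \<psi>"
  using \<psi>
proof (induction j arbitrary: \<psi>)
  case 0
  have "ell2_norm (sact \<sigma> (pstar w) (sact \<sigma> w \<psi>)) \<le> B * ell2_norm (sact \<sigma> w \<psi>)"
    using pstar_bound[OF B(1) gact_ell2[OF 0]] .
  also have "\<dots> \<le> B * (B * ell2_norm \<psi>)" by (intro mult_left_mono B 0)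
  finally show ?case by (simp add: sact_times[OF group_action_axioms] power2_eq_square mult.assoc)
next
  case (Suc j)
  let ?s = "sact \<sigma> (spow w j)"
  have "ell2_norm (?s (?s \<psi>)) \<le> B ^ 2 ^ Suc j * ell2_norm (?s \<psi>)" by (rule Suc.IH[OF gact_ell2[OF Suc.prems]])
  also have "\<dots> \<le> B ^ 2 ^ Suc j * (B ^ 2 ^ Suc j * ell2_norm \<psi>)"
    using B(2) by (intro mult_left_mono Suc) auto
  also have "\<dots> = B ^ 2 ^ Suc (Suc j) * ell2_norm \<psi>"
    by (simp add: power_add[symmetric] mult_2[symmetric] mult.assoc[symmetric])
  finally show ?case by (simp add: sact_times[OF group_action_axioms])
qed

end

text \<open>The coefficients are the image of the delta function at the unit, so their square norm
  is at most the operator norm.\<close>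

lemma lookup_spow_le:
  fixes w :: "'g::group_add \<Rightarrow>\<^sub>0 complex"
  shows "(\<Sum>g\<in>Poly_Mapping.keys (spow w j). (cmod (Poly_Mapping.lookup (spow w j) g))\<^sup>2)
    \<le> (ell2_onorm (lam_scalar w) ^ 2 ^ Suc j)\<^sup>2"
proof -
  interpret scalar_action "(+) :: 'g \<Rightarrow> 'g \<Rightarrow> 'g"
    by (simp add: scalar_action_def group_action_left)
  let ?v = "spow w j" and ?\<delta> = "delta_vec 0 1 :: 'g \<Rightarrow> complex"
  have \<delta>: "?\<delta> \<in> ell2" by (rule delta_vec_ell2)
  have eq: "sact (+) ?v ?\<delta> h = Poly_Mapping.lookup ?v h" for h
  proof -
    have "sact (+) ?v ?\<delta> h = (\<Sum>g\<in>Poly_Mapping.keys ?v. if g = h then Poly_Mapping.lookup ?v g else 0)"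
      unfolding gact_def delta_vec_def by (intro sum.cong refl) (auto simp: neg_equal_iff_equal add_eq_0_iff)
    then show ?thesis by (simp add: in_keys_iff)
  qed
  have "(\<Sum>g\<in>Poly_Mapping.keys ?v. (cmod (Poly_Mapping.lookup ?v g))\<^sup>2) \<le> (ell2_norm (sact (+) ?v ?\<delta>))\<^sup>2"
    unfolding eq[symmetric] by (intro ell2_sum_sq_le gact_ell2 \<delta>) simp
  also have "\<dots> \<le> (ell2_onorm (lam_scalar w) ^ 2 ^ Suc j * ell2_norm ?\<delta>)\<^sup>2"
    by (intro power_mono spow_upper \<delta> ell2_onorm_nonneg) (auto simp: lam_scalar_norm lam_scalar_eq_gact[symmetric])
  finally show ?thesis by (simp add: delta_vec_norm)
qed

lemma eventually_along: "eventually P (along NN) \<longleftrightarrow> (\<exists>N0. \<forall>N\<in>NN. N \<ge> N0 \<longrightarrow> P N)"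
  unfolding along_def by (auto simp: eventually_inf_principal eventually_sequentially)

text \<open>The normalised trace of a permutation matrix.\<close>

definition fixfrac :: "nat \<Rightarrow> ('g \<Rightarrow> nat \<Rightarrow> nat) \<Rightarrow> 'g \<Rightarrow> real" where
  "fixfrac N \<sigma> g = real (card {x\<in>{1..N}. \<sigma> g x = x}) / real N"

locale permutation_limit =
  fixes NN :: "nat set" and \<rho> :: "nat \<Rightarrow> 'g::group_add \<Rightarrow> nat \<Rightarrow> nat"
  assumes NN0: "0 \<notin> NN" and perm: "\<And>N. N \<in> NN \<Longrightarrow> perm_rep N (\<rho> N)" and cd: "conv_distr NN \<rho>"
begin

lemma action: assumes "N \<in> NN" shows "scalar_action (\<rho> N)"
proof -
  have add: "\<rho> N (g + h) x = \<rho> N g (\<rho> N h x)" for g h x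
    using perm[OF assms] by (simp add: perm_rep_def)
  \<comment> \<open>Multiplicativity makes the image of the unit idempotent, and an injective
    idempotent map is the identity.\<close>
  have "\<rho> N 0 x = x" for x
  proof -
    have "inj (\<rho> N 0)" using perm[OF assms] permutes_inj by (auto simp: perm_rep_def)
    moreover have "\<rho> N 0 (\<rho> N 0 x) = \<rho> N 0 x" using add[of 0 0 x] by simp
    ultimately show ?thesis by (simp add: inj_eq)
  qed
  then show ?thesis using add by unfold_locales auto
qed

lemma group_act: "N \<in> NN \<Longrightarrow> group_action (\<rho> N)"
  using action by (simp add: scalar_action_def)

lemma rho_in: "N \<in> NN \<Longrightarrow> \<rho> N g x \<in> {1..N} \<longleftrightarrow> x \<in> {1..N}"
  using perm[of N] permutes_in_image[of "\<rho> N g" "{1..N}" x] by (simp add: perm_rep_def)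

lemma rho_out: "N \<in> NN \<Longrightarrow> x \<notin> {1..N} \<Longrightarrow> \<rho> N g x = x"
  using perm[of N] permutes_not_in[of "\<rho> N g" "{1..N}" x] by (simp add: perm_rep_def)

lemma fixfrac_tendsto: assumes "g \<noteq> 0" shows "((\<lambda>N. fixfrac N (\<rho> N) g) \<longlongrightarrow> 0) (along NN)"
proof -
  have key: "1 / real N * (\<Sum>x\<in>{1..N}. perm_mat (\<rho> N g) x x) = fixfrac N (\<rho> N) g" for N
  proof -
    have "(\<Sum>x\<in>{1..N}. perm_mat (\<rho> N g) x x) = (\<Sum>x\<in>{1..N}. of_bool (\<rho> N g x = x))"
      by (intro sum.cong refl) (auto simp: perm_mat_def)
    also have "\<dots> = real (card {x\<in>{1..N}. \<rho> N g x = x})"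
      by (simp add: Int_def conj_commute)
    finally show ?thesis by (simp add: fixfrac_def)
  qed
  show ?thesis using cd[unfolded conv_distr_def, rule_format, OF assms] by (simp only: key)
qed

lemma fixfrac_sum_small:
  fixes B :: real
  assumes "finite F" "\<And>g. g \<in> F \<Longrightarrow> g \<noteq> 0" "0 < \<epsilon>"
  shows "\<forall>\<^sub>F N in along NN. B * (\<Sum>g\<in>F. fixfrac N (\<rho> N) g) < \<epsilon>"
proof -
  have "((\<lambda>N. B * (\<Sum>g\<in>F. fixfrac N (\<rho> N) g)) \<longlongrightarrow> B * (\<Sum>g\<in>F. 0)) (along NN)"
    using assms by (intro tendsto_intros fixfrac_tendsto) auto
  then show ?thesis using assms(3) by (auto dest!: order_tendstoD(2))
qed

text \<open>Vectors on \<open>{1..N}\<close> are functions on all naturals vanishing elsewhere. The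
  permutations fix the remaining points, so the theory of square-summable functions applies
  verbatim.\<close>

definition supp_on :: "nat \<Rightarrow> (nat \<Rightarrow> complex) \<Rightarrow> bool" where
  "supp_on N f \<longleftrightarrow> (\<forall>x. x \<notin> {1..N} \<longrightarrow> f x = 0)"

lemma supp_on_ell2:
  assumes "supp_on N f"
  shows "f \<in> ell2" and "(ell2_norm f)\<^sup>2 = (\<Sum>x\<in>{1..N}. (cmod (f x))\<^sup>2)"
proof -
  have *: "finite {1..N}" "\<And>x. x \<notin> {1..N} \<Longrightarrow> f x = 0" using assms unfolding supp_on_def by blast+
  show "f \<in> ell2" by (rule ell2_finite_support(1)[OF *])
  show "(ell2_norm f)\<^sup>2 = (\<Sum>x\<in>{1..N}. (cmod (f x))\<^sup>2)"
  proof -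
    have "ell2_norm f = L2_set (\<lambda>x. cmod (f x)) {1..N}"
      by (rule ell2_finite_support(2)) (use * in auto)
    then show ?thesis by (simp add: L2_set_def sum_nonneg)
  qed
qed

lemma supp_on_sact: "N \<in> NN \<Longrightarrow> supp_on N f \<Longrightarrow> supp_on N (sact (\<rho> N) v f)"
  by (auto simp: supp_on_def gact_def rho_out intro!: sum.neutral)

lemma fixfrac_nonneg: "0 \<le> fixfrac N \<sigma> g"
  by (simp add: fixfrac_def)

lemma coincidence_count:
  assumes "N \<in> NN"
  shows "(\<Sum>x\<in>{1..N}. of_bool (\<rho> N (- g) x = \<rho> N (- h) x)) = real N * fixfrac N (\<rho> N) (h - g)"
proof -
  interpret group_action "\<rho> N" by (rule group_act[OF assms])
  have "\<rho> N (- g) x = \<rho> N (- h) x \<longleftrightarrow> \<rho> N (h - g) x = x" for x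
  proof -
    have "\<rho> N (h - g) x = \<rho> N h (\<rho> N (- g) x)" using act_add[of h "- g" x] by simp
    then show ?thesis by (metis act_minus)
  qed
  then have "(\<Sum>x\<in>{1..N}. of_bool (\<rho> N (- g) x = \<rho> N (- h) x) :: real) = real (card {x\<in>{1..N}. \<rho> N (h - g) x = x})"
    by (simp add: Int_def conj_commute)
  then show ?thesis using NN0 assms by (auto simp: fixfrac_def)
qed

text \<open>Dominates the normalised squared Hilbert-Schmidt norm of the matrix of \<open>v\<close>.
  Absolute values cost nothing in the limit, since only the terms \<open>g = h\<close>
  survive.\<close>

definition hs_avg :: "nat \<Rightarrow> ('g \<Rightarrow>\<^sub>0 complex) \<Rightarrow> real" where
  "hs_avg N v = (\<Sum>g\<in>Poly_Mapping.keys v. \<Sum>h\<in>Poly_Mapping.keys v.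
     cmod (Poly_Mapping.lookup v g) * cmod (Poly_Mapping.lookup v h) * fixfrac N (\<rho> N) (h - g))"

lemma hs_avg_tendsto:
  assumes "infinite NN"
  shows "((\<lambda>N. hs_avg N v) \<longlongrightarrow> (\<Sum>g\<in>Poly_Mapping.keys v. (cmod (Poly_Mapping.lookup v g))\<^sup>2)) (along NN)"
proof -
  let ?K = "Poly_Mapping.keys v" and ?v = "\<lambda>g. cmod (Poly_Mapping.lookup v g)"
  have fixl: "((\<lambda>N. fixfrac N (\<rho> N) (h - g)) \<longlongrightarrow> of_bool (h = g)) (along NN)" for g h :: 'g
  proof (cases "h = g")
    case True
    have "\<forall>\<^sub>F N in along NN. fixfrac N (\<rho> N) (h - g) = 1"
      unfolding eventually_along
    proof (intro exI[of _ 0] ballI impI)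
      fix N assume N: "N \<in> NN"
      interpret group_action "\<rho> N" by (rule group_act[OF N])
      have "{x \<in> {1..N}. \<rho> N (h - g) x = x} = {1..N}" using True by auto
      moreover have "N \<noteq> 0" using N NN0 by metis
      ultimately show "fixfrac N (\<rho> N) (h - g) = 1" by (simp add: fixfrac_def)
    qed
    then show ?thesis using True by (simp add: tendsto_eventually)
  next
    case False
    then show ?thesis using fixfrac_tendsto[of "h - g"] by simp
  qed
  have "((\<lambda>N. hs_avg N v) \<longlongrightarrow> (\<Sum>g\<in>?K. \<Sum>h\<in>?K. ?v g * ?v h * of_bool (h = g))) (along NN)"
    unfolding hs_avg_def by (intro tendsto_intros fixl)
  moreover have "(\<Sum>g\<in>?K. \<Sum>h\<in>?K. ?v g * ?v h * of_bool (h = g)) = (\<Sum>g\<in>?K. (?v g)\<^sup>2)"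
    by (intro sum.cong refl) (subst sum_indicator_mult, auto simp: power2_eq_square)
  ultimately show ?thesis by simp
qed

text \<open>Bessel's inequality for each row of the matrix; summing over the rows leaves the
  Hilbert-Schmidt norm.\<close>

lemma hs_bound:
  assumes N: "N \<in> NN" and U: "finite U" "orthonormal_fam {1..N} U (\<lambda>u. u)" "\<And>u. u \<in> U \<Longrightarrow> supp_on N u"
  shows "(\<Sum>u\<in>U. (ell2_norm (sact (\<rho> N) v u))\<^sup>2) \<le> real N * hs_avg N v"
proof -
  let ?K = "Poly_Mapping.keys v" and ?v = "Poly_Mapping.lookup v"
  define M where "M = (\<lambda>x y. \<Sum>g\<in>?K. ?v g * of_bool (y = \<rho> N (- g) x))"
  have act: "sact (\<rho> N) v u x = (\<Sum>y\<in>{1..N}. M x y * u y)" if "x \<in> {1..N}" for u x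
  proof -
    have "(\<Sum>y\<in>{1..N}. M x y * u y) = (\<Sum>g\<in>?K. \<Sum>y\<in>{1..N}. ?v g * u y * of_bool (y = \<rho> N (- g) x))"
      unfolding M_def sum_distrib_right by (subst sum.swap) (simp add: mult_ac)
    also have "\<dots> = (\<Sum>g\<in>?K. ?v g * u (\<rho> N (- g) x))"
      using that rho_in[OF N] by (intro sum.cong refl sum_indicator_mult) blast+
    finally show ?thesis by (simp add: gact_def)
  qed
  have Mx: "(\<Sum>y\<in>{1..N}. (cmod (M x y))\<^sup>2) \<le> (\<Sum>g\<in>?K. \<Sum>h\<in>?K. cmod (?v g) * cmod (?v h) * of_bool (\<rho> N (- g) x = \<rho> N (- h) x))"
    if x: "x \<in> {1..N}" for x
  proof -
    have "complex_of_real (\<Sum>y\<in>{1..N}. (cmod (M x y))\<^sup>2) = (\<Sum>y\<in>{1..N}. M x y * cnj (M x y))"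
      by (simp only: of_real_sum complex_norm_square)
    also have "\<dots> = (\<Sum>y\<in>{1..N}. \<Sum>g\<in>?K. \<Sum>h\<in>?K. ?v g * cnj (?v h) * of_bool (y = \<rho> N (- h) x) * of_bool (y = \<rho> N (- g) x))"
    proof -
      have cM: "cnj (M x y) = (\<Sum>h\<in>?K. cnj (?v h) * of_bool (y = \<rho> N (- h) x))" for y
        unfolding M_def cnj_sum by (intro sum.cong refl) auto
      show ?thesis
        unfolding cM by (simp only: M_def sum_product) (intro sum.cong refl, simp only: mult_ac)
    qed
    also have "\<dots> = (\<Sum>g\<in>?K. \<Sum>h\<in>?K. \<Sum>y\<in>{1..N}. ?v g * cnj (?v h) * of_bool (y = \<rho> N (- h) x) * of_bool (y = \<rho> N (- g) x))"
      by (subst sum.swap, intro sum.cong refl, rule sum.swap)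
    also have "\<dots> = (\<Sum>g\<in>?K. \<Sum>h\<in>?K. ?v g * cnj (?v h) * of_bool (\<rho> N (- g) x = \<rho> N (- h) x))"
      using x rho_in[OF N] by (intro sum.cong refl sum_indicator_mult) blast+
    finally have eq: "complex_of_real (\<Sum>y\<in>{1..N}. (cmod (M x y))\<^sup>2)
        = (\<Sum>g\<in>?K. \<Sum>h\<in>?K. ?v g * cnj (?v h) * of_bool (\<rho> N (- g) x = \<rho> N (- h) x))" .
    have "(\<Sum>y\<in>{1..N}. (cmod (M x y))\<^sup>2) = cmod (complex_of_real (\<Sum>y\<in>{1..N}. (cmod (M x y))\<^sup>2))"
      unfolding norm_of_real by (rule abs_of_nonneg[symmetric]) (simp add: sum_nonneg)
    also have "\<dots> = cmod (\<Sum>g\<in>?K. \<Sum>h\<in>?K. ?v g * cnj (?v h) * of_bool (\<rho> N (- g) x = \<rho> N (- h) x))"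
      unfolding eq ..
    also have "\<dots> \<le> (\<Sum>g\<in>?K. \<Sum>h\<in>?K. cmod (?v g * cnj (?v h) * of_bool (\<rho> N (- g) x = \<rho> N (- h) x)))"
      by (intro order_trans[OF norm_sum] sum_mono norm_sum)
    finally show ?thesis
    proof -
      assume *: "(\<Sum>y\<in>{1..N}. (cmod (M x y))\<^sup>2) \<le> (\<Sum>g\<in>?K. \<Sum>h\<in>?K. cmod (?v g * cnj (?v h) * of_bool (\<rho> N (- g) x = \<rho> N (- h) x)))"
      have "cmod (of_bool b) = of_bool b" for b by (cases b) auto
      then show ?thesis using * by (simp only: norm_mult complex_mod_cnj)
    qed
  qed
  have "(\<Sum>u\<in>U. (ell2_norm (sact (\<rho> N) v u))\<^sup>2) = (\<Sum>u\<in>U. \<Sum>x\<in>{1..N}. (cmod (\<Sum>y\<in>{1..N}. cnj (u y) * cnj (M x y)))\<^sup>2)"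
  proof (rule sum.cong[OF refl])
    fix u assume u: "u \<in> U"
    have "cmod (sact (\<rho> N) v u x) = cmod (\<Sum>y\<in>{1..N}. cnj (u y) * cnj (M x y))" if "x \<in> {1..N}" for x
    proof -
      have "(\<Sum>y\<in>{1..N}. cnj (u y) * cnj (M x y)) = cnj (\<Sum>y\<in>{1..N}. M x y * u y)"
        by (simp add: mult.commute)
      then show ?thesis by (simp only: act[OF that] complex_mod_cnj)
    qed
    then show "(ell2_norm (sact (\<rho> N) v u))\<^sup>2 = (\<Sum>x\<in>{1..N}. (cmod (\<Sum>y\<in>{1..N}. cnj (u y) * cnj (M x y)))\<^sup>2)"
      by (simp add: supp_on_ell2(2)[OF supp_on_sact[OF N U(3)[OF u]]])
  qed
  also have "\<dots> = (\<Sum>x\<in>{1..N}. \<Sum>u\<in>U. (cmod (\<Sum>y\<in>{1..N}. cnj (u y) * cnj (M x y)))\<^sup>2)" by (rule sum.swap)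
  also have "\<dots> \<le> (\<Sum>x\<in>{1..N}. \<Sum>y\<in>{1..N}. (cmod (cnj (M x y)))\<^sup>2)"
    by (intro sum_mono bessel[OF _ U(1,2)]) simp
  also have "\<dots> \<le> (\<Sum>x\<in>{1..N}. \<Sum>g\<in>?K. \<Sum>h\<in>?K. cmod (?v g) * cmod (?v h) * of_bool (\<rho> N (- g) x = \<rho> N (- h) x))"
    by (intro sum_mono) (simp only: complex_mod_cnj Mx)
  also have "\<dots> = (\<Sum>g\<in>?K. \<Sum>h\<in>?K. \<Sum>x\<in>{1..N}. cmod (?v g) * cmod (?v h) * of_bool (\<rho> N (- g) x = \<rho> N (- h) x))"
    by (subst sum.swap, intro sum.cong refl, rule sum.swap)
  also have "\<dots> = real N * hs_avg N v"
    by (simp only: sum_distrib_left[symmetric] coincidence_count[OF N]) (simp add: hs_avg_def sum_distrib_left mult_ac)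
  finally show ?thesis .
qed

definition cand :: "nat \<Rightarrow> ('g \<Rightarrow>\<^sub>0 complex) \<Rightarrow> real \<Rightarrow> (nat \<Rightarrow> complex) set \<Rightarrow> bool" where
  "cand N w \<kappa> U \<longleftrightarrow> finite U \<and> (\<forall>u\<in>U. supp_on N u \<and> \<kappa> < ell2_norm (sact (\<rho> N) w u))
      \<and> orthonormal_fam {1..N} U (\<lambda>u. u)"

text \<open>A largest orthonormal family of vectors expanded beyond \<kappa> stands in for a
  spectral subspace of \<open>w^* w\<close>, so nothing has to be diagonalised. It exists because
  cardinalities are at most \<open>N\<close>.\<close>

definition maxfam :: "nat \<Rightarrow> ('g \<Rightarrow>\<^sub>0 complex) \<Rightarrow> real \<Rightarrow> (nat \<Rightarrow> complex) set" where
  "maxfam N w \<kappa> = (SOME U. cand N w \<kappa> U \<and> (\<forall>U'. cand N w \<kappa> U' \<longrightarrow> card U' \<le> card U))"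

lemma maxfam: "cand N w \<kappa> (maxfam N w \<kappa>) \<and> (\<forall>U'. cand N w \<kappa> U' \<longrightarrow> card U' \<le> card (maxfam N w \<kappa>))"
proof -
  have "\<exists>U. cand N w \<kappa> U \<and> (\<forall>U'. cand N w \<kappa> U' \<longrightarrow> card U' \<le> card U)"
  proof (rule ex_has_greatest_nat)
    show "cand N w \<kappa> {}" by (simp add: cand_def orthonormal_fam_def)
    show "\<forall>U. cand N w \<kappa> U \<longrightarrow> card U < Suc N"
    proof (intro allI impI)
      fix U assume "cand N w \<kappa> U"
      then show "card U < Suc N"
        using orthonormal_fam_card_le[of "{1..N}" U "\<lambda>u. u"] by (simp add: cand_def)
    qed
  qed
  from someI_ex[OF this] show ?thesis unfolding maxfam_def .
qed

lemmas maxfam_cand = conjunct1[OF maxfam]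
lemmas maxfam_max = conjunct2[OF maxfam, rule_format]

text \<open>Maximality: a vector orthogonal to the family and expanded beyond \<kappa> could be
  normalised and added to it.\<close>

lemma maxfam_perp:
  assumes N: "N \<in> NN" and f: "supp_on N f" and perp: "\<And>u. u \<in> maxfam N w \<kappa> \<Longrightarrow> (\<Sum>x\<in>{1..N}. cnj (u x) * f x) = 0"
  shows "ell2_norm (sact (\<rho> N) w f) \<le> \<kappa> * ell2_norm f"
proof (rule ccontr)
  assume big: "\<not> ell2_norm (sact (\<rho> N) w f) \<le> \<kappa> * ell2_norm f"
  interpret scalar_action "\<rho> N" by (rule action[OF N])
  let ?U = "maxfam N w \<kappa>" and ?n = "ell2_norm f"
  have "?n \<noteq> 0"
  proof
    assume "?n = 0"
    then have "f = (\<lambda>x. 0)" using ell2_norm_eq_0[OF supp_on_ell2(1)[OF f]] by simp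
    then have "sact (\<rho> N) w f = (\<lambda>x. 0)" by (simp add: gact_def)
    then show False using big \<open>?n = 0\<close> by (simp add: ell2_zero)
  qed
  then have n: "0 < ?n" using ell2_norm_nonneg[of f] by linarith
  define u where "u = (\<lambda>x. (1 / ?n) *\<^sub>R f x)"
  have us: "supp_on N u" using f by (simp add: supp_on_def u_def)
  have un: "ell2_norm u = 1" using n by (simp add: u_def ell2_scaleR(2))
  have "sact (\<rho> N) w u = (\<lambda>x. (1 / ?n) *\<^sub>R sact (\<rho> N) w f x)"
    unfolding u_def using linear_op.lin_scale[OF linear_gact] .
  then have "ell2_norm (sact (\<rho> N) w u) = ell2_norm (sact (\<rho> N) w f) / ?n" using n by (simp add: ell2_scaleR(2))
  then have ub: "\<kappa> < ell2_norm (sact (\<rho> N) w u)" using big n by (simp add: pos_less_divide_eq)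
  have uu: "(\<Sum>x\<in>{1..N}. cnj (u x) * u x) = 1"
  proof -
    have "(\<Sum>x\<in>{1..N}. cnj (u x) * u x) = complex_of_real (\<Sum>x\<in>{1..N}. (cmod (u x))\<^sup>2)"
      by (simp only: of_real_sum complex_norm_square mult.commute)
    then show ?thesis unfolding supp_on_ell2(2)[OF us, symmetric] un by simp
  qed
  have vu: "(\<Sum>x\<in>{1..N}. cnj (v x) * u x) = 0" if "v \<in> ?U" for v
  proof -
    have "(\<Sum>x\<in>{1..N}. cnj (v x) * u x) = (1 / ?n) *\<^sub>R (\<Sum>x\<in>{1..N}. cnj (v x) * f x)"
      by (simp add: u_def scaleR_sum_right)
    then show ?thesis using perp[OF that] by simp
  qed
  have uv: "(\<Sum>x\<in>{1..N}. cnj (u x) * v x) = 0" if "v \<in> ?U" for v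
  proof -
    have "(\<Sum>x\<in>{1..N}. cnj (u x) * v x) = cnj (\<Sum>x\<in>{1..N}. cnj (v x) * u x)" by (simp add: mult.commute)
    then show ?thesis unfolding vu[OF that] by simp
  qed
  have "u \<notin> ?U" using vu[of u] uu by auto
  have c: "cand N w \<kappa> ?U" by (rule maxfam_cand)
  have "cand N w \<kappa> (insert u ?U)"
    using c us ub uu vu uv \<open>u \<notin> ?U\<close> unfolding cand_def orthonormal_fam_def by auto
  from maxfam_max[OF this] show False using c \<open>u \<notin> ?U\<close> by (simp add: cand_def)
qed

text \<open>Each vector \<open>u\<close> of the family has \<open>\<parallel>\<rho>\<^sub>N((w\<^sup>*w)\<^bsup>2^j\<^esup>) u\<parallel> \<ge> \<kappa>\<^bsup>2^(j+1)\<^esup>\<close>, while the normalised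
  Hilbert-Schmidt norm of this power tends to a number at most \<open>\<parallel>\<lambda>(w)\<parallel>\<^bsup>2^(j+1)\<^esup>\<close>.\<close>

lemma maxfam_card:
  assumes "infinite NN" "ell2_onorm (lam_scalar w) < \<kappa>" "0 < \<epsilon>"
  shows "\<forall>\<^sub>F N in along NN. real (card (maxfam N w \<kappa>)) \<le> \<epsilon> * real N"
proof -
  define B where "B = ell2_onorm (lam_scalar w)"
  have B: "0 \<le> B" "B < \<kappa>" using assms(2) by (auto simp: B_def ell2_onorm_nonneg)
  then have \<kappa>: "0 < \<kappa>" by linarith
  have r: "0 \<le> B / \<kappa>" "B / \<kappa> < 1" using B \<kappa> by auto
  \<comment> \<open>The exponent that occurs, \<open>2^(j+1) * 2\<close>, exceeds \<open>j\<close>;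
    as the ratio is below 1, passing to it preserves the inequality.\<close>
  obtain j where j: "(B / \<kappa>) ^ j < \<epsilon>" using real_arch_pow_inv[OF assms(3) r(2)] by blast
  have "j \<le> 2 ^ j" by (rule less_imp_le[OF less_exp])
  also have "(2::nat) ^ j \<le> 2 ^ Suc j * 2" by simp
  finally have "j \<le> 2 ^ Suc j * 2" .
  then have "(B / \<kappa>) ^ (2 ^ Suc j * 2) < \<epsilon>" using power_decreasing[of j _ "B / \<kappa>"] r j by fastforce
  then have lt: "(B ^ 2 ^ Suc j)\<^sup>2 < \<epsilon> * (\<kappa> ^ 2 ^ Suc j)\<^sup>2"
    using \<kappa> by (simp add: power_divide pos_divide_less_eq power_mult del: power_Suc)
  let ?v = "spow w j"
  have "(\<Sum>g\<in>Poly_Mapping.keys ?v. (cmod (Poly_Mapping.lookup ?v g))\<^sup>2) < \<epsilon> * (\<kappa> ^ 2 ^ Suc j)\<^sup>2"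
    using lookup_spow_le[of w j] lt by (simp add: B_def)
  then have "\<forall>\<^sub>F N in along NN. hs_avg N ?v < \<epsilon> * (\<kappa> ^ 2 ^ Suc j)\<^sup>2"
    using hs_avg_tendsto[OF assms(1), of ?v] order_tendstoD(2) by blast
  moreover have "\<forall>\<^sub>F N in along NN. N \<in> NN" by (auto simp: eventually_along)
  ultimately show ?thesis
  proof eventually_elim
    case (elim N)
    interpret scalar_action "\<rho> N" by (rule action[OF elim(2)])
    let ?U = "maxfam N w \<kappa>"
    have c: "finite ?U" "orthonormal_fam {1..N} ?U (\<lambda>u. u)" "\<And>u. u \<in> ?U \<Longrightarrow> supp_on N u"
      "\<And>u. u \<in> ?U \<Longrightarrow> \<kappa> < ell2_norm (sact (\<rho> N) w u)"
      using maxfam_cand[of N w \<kappa>] by (auto simp: cand_def)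
    have "(\<kappa> ^ 2 ^ Suc j)\<^sup>2 \<le> (ell2_norm (sact (\<rho> N) ?v u))\<^sup>2" if u: "u \<in> ?U" for u
    proof -
      have "(ell2_norm u)\<^sup>2 = 1" using orthonormal_fam_norm[OF c(2) u] supp_on_ell2(2)[OF c(3)[OF u]] by simp
      then have "ell2_norm u = 1" using ell2_norm_nonneg[of u] by (simp add: power2_eq_1_iff)
      then have "ell2_norm (sact (\<rho> N) w u) ^ 2 ^ Suc j \<le> ell2_norm (sact (\<rho> N) ?v u)"
        by (rule spow_lower[OF supp_on_ell2(1)[OF c(3)[OF u]]])
      moreover have "\<kappa> ^ 2 ^ Suc j \<le> ell2_norm (sact (\<rho> N) w u) ^ 2 ^ Suc j"
        using c(4)[OF u] \<kappa> by (intro power_mono) auto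
      ultimately have "\<kappa> ^ 2 ^ Suc j \<le> ell2_norm (sact (\<rho> N) ?v u)" by (rule order_trans[rotated])
      then show ?thesis using \<kappa> by (intro power_mono) auto
    qed
    then have "(\<Sum>u\<in>?U. (\<kappa> ^ 2 ^ Suc j)\<^sup>2) \<le> (\<Sum>u\<in>?U. (ell2_norm (sact (\<rho> N) ?v u))\<^sup>2)" by (rule sum_mono)
    also have "\<dots> \<le> real N * hs_avg N ?v" by (rule hs_bound[OF elim(2) c(1-3)])
    also have "\<dots> \<le> real N * (\<epsilon> * (\<kappa> ^ 2 ^ Suc j)\<^sup>2)" using elim(1) by (intro mult_left_mono) auto
    finally have "real (card ?U) * (\<kappa> ^ 2 ^ Suc j)\<^sup>2 \<le> (\<epsilon> * real N) * (\<kappa> ^ 2 ^ Suc j)\<^sup>2" by (simp add: mult_ac)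
    then show ?case using \<kappa> by (simp del: power_Suc)
  qed
qed

end

section \<open>Finite nets in the group algebra and norm bounds uniform in the coefficients\<close>

definition grid :: "nat \<Rightarrow> complex set" where
  "grid k = (\<lambda>(a, b). Complex (real_of_int a / real (Suc k)) (real_of_int b / real (Suc k)))
     ` ({- int ((Suc k)\<^sup>2)..int ((Suc k)\<^sup>2)} \<times> {- int ((Suc k)\<^sup>2)..int ((Suc k)\<^sup>2)})"

lemma grid_real_approx:
  assumes "\<bar>x\<bar> \<le> real (Suc k)"
  shows "\<lfloor>real (Suc k) * x\<rfloor> \<in> {- int ((Suc k)\<^sup>2)..int ((Suc k)\<^sup>2)}"
    and "\<bar>x - real_of_int \<lfloor>real (Suc k) * x\<rfloor> / real (Suc k)\<bar> \<le> 1 / real (Suc k)"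
proof -
  let ?y = "real (Suc k) * x"
  have "\<bar>?y\<bar> \<le> real (Suc k) * real (Suc k)"
    unfolding abs_mult using assms by (intro mult_mono) auto
  then have y: "- real_of_int (int ((Suc k)\<^sup>2)) \<le> ?y" "?y \<le> real_of_int (int ((Suc k)\<^sup>2))"
  proof -
    have e: "real_of_int (int ((Suc k)\<^sup>2)) = real (Suc k) * real (Suc k)"
      by (simp only: of_int_of_nat_eq of_nat_power power2_eq_square of_nat_mult of_int_mult)
    show "- real_of_int (int ((Suc k)\<^sup>2)) \<le> ?y" "?y \<le> real_of_int (int ((Suc k)\<^sup>2))"
      using \<open>\<bar>?y\<bar> \<le> real (Suc k) * real (Suc k)\<close> unfolding e by linarith+
  qed
  show "\<lfloor>?y\<rfloor> \<in> {- int ((Suc k)\<^sup>2)..int ((Suc k)\<^sup>2)}"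
  proof -
    have "\<lfloor>?y\<rfloor> \<le> int ((Suc k)\<^sup>2)" using floor_mono[OF y(2)] unfolding floor_of_int .
    moreover have "- int ((Suc k)\<^sup>2) \<le> \<lfloor>?y\<rfloor>"
      unfolding le_floor_iff of_int_minus by (rule y(1))
    ultimately show ?thesis by simp
  qed
  have "\<bar>?y - real_of_int \<lfloor>?y\<rfloor>\<bar> \<le> 1" by linarith
  then have "\<bar>?y - real_of_int \<lfloor>?y\<rfloor>\<bar> / real (Suc k) \<le> 1 / real (Suc k)"
    by (intro divide_right_mono) auto
  moreover have "\<bar>?y - real_of_int \<lfloor>?y\<rfloor>\<bar> / real (Suc k) = \<bar>x - real_of_int \<lfloor>?y\<rfloor> / real (Suc k)\<bar>"
    by (subst abs_divide[symmetric, of _ "real (Suc k)", simplified abs_of_nat] | simp add: diff_divide_distrib abs_divide[symmetric] del: of_nat_Suc)+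
  ultimately show "\<bar>x - real_of_int \<lfloor>?y\<rfloor> / real (Suc k)\<bar> \<le> 1 / real (Suc k)" by simp
qed

lemma grid_approx:
  assumes "cmod z \<le> real (Suc k)"
  obtains z' where "z' \<in> grid k" "cmod (z - z') \<le> 2 / real (Suc k)"
proof -
  have r: "\<bar>Re z\<bar> \<le> real (Suc k)" "\<bar>Im z\<bar> \<le> real (Suc k)"
    using assms abs_Re_le_cmod[of z] abs_Im_le_cmod[of z] by linarith+
  let ?z = "Complex (real_of_int \<lfloor>real (Suc k) * Re z\<rfloor> / real (Suc k)) (real_of_int \<lfloor>real (Suc k) * Im z\<rfloor> / real (Suc k))"
  have "?z \<in> grid k"
    unfolding grid_def using grid_real_approx(1)[OF r(1)] grid_real_approx(1)[OF r(2)]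
    by (intro image_eqI[of _ _ "(\<lfloor>real (Suc k) * Re z\<rfloor>, \<lfloor>real (Suc k) * Im z\<rfloor>)"]) auto
  moreover have "cmod (z - ?z) \<le> 2 / real (Suc k)"
    using cmod_le[of "z - ?z"] grid_real_approx(2)[OF r(1)] grid_real_approx(2)[OF r(2)] by simp
  ultimately show ?thesis by (rule that)
qed

lemma finite_grid: "finite (grid k)"
  by (simp add: grid_def)

lemma zero_in_grid: "0 \<in> grid k"
proof -
  have "(0, 0) \<in> {- int ((Suc k)\<^sup>2)..int ((Suc k)\<^sup>2)} \<times> {- int ((Suc k)\<^sup>2)..int ((Suc k)\<^sup>2)}" by simp
  then show ?thesis unfolding grid_def by (rule rev_image_eqI) (simp add: complex_eq_iff)
qed

text \<open>Support radius \<open>k\<close>, mesh \<open>1 / (k + 1)\<close> and coefficient range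
  \<open>k + 1\<close> are tied to one parameter, so that the nets grow wider and finer together and
  remain finite.\<close>

definition nets :: "'g::group_add set \<Rightarrow> nat \<Rightarrow> ('g \<Rightarrow>\<^sub>0 complex) set" where
  "nets S k = pm (wball S k) ` (PiE (wball S k) (\<lambda>_. grid k))"

lemma finite_nets:
  assumes "finite S" "generates S" shows "finite (nets S k)"
  unfolding nets_def using finite_wball[OF assms] finite_grid by (intro finite_imageI finite_PiE) auto

text \<open>The threshold \<open>k0\<close> does not depend on \<open>W\<close>. The error keeps its
  support in \<open>G\<close>, so its operator norm in any action is at most its number of terms
  times \<delta>.\<close>

lemma net_approx:
  fixes S :: "'g::group_add set"
  assumes S: "finite S" "generates S" and G: "finite G" and "0 < \<delta>"
  obtains k0 where "\<And>k W. k0 \<le> k \<Longrightarrow> (\<And>g. g \<in> G \<Longrightarrow> cmod (W g) \<le> B) \<Longrightarrow>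
     \<exists>w\<in>nets S k. \<exists>e. pm G W = w + pm G e \<and> (\<forall>g\<in>G. cmod (e g) \<le> \<delta>)"
proof -
  obtain n where n: "G \<subseteq> wball S n" using finite_set_in_wball[OF G] by blast
  define k0 where "k0 = max n (max (nat \<lceil>B\<rceil>) (nat \<lceil>2 / \<delta>\<rceil>))"
  show ?thesis
  proof (rule that[of k0])
    fix k and W :: "'g \<Rightarrow> complex" assume k: "k0 \<le> k" and W: "\<And>g. g \<in> G \<Longrightarrow> cmod (W g) \<le> B"
    have kn: "n \<le> k" "B \<le> real (Suc k)" "2 / \<delta> \<le> real (Suc k)" using k unfolding k0_def by linarith+
    have Gk: "G \<subseteq> wball S k" using n kn(1) by (auto simp: wball_def)
    have d: "2 / real (Suc k) \<le> \<delta>" using kn(3) \<open>0 < \<delta>\<close> by (simp add: field_simps)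
    have "\<exists>z. z \<in> grid k \<and> cmod (W g - z) \<le> 2 / real (Suc k)" if "g \<in> G" for g
    proof -
      have "cmod (W g) \<le> real (Suc k)" using W[OF that] kn(2) by linarith
      then show ?thesis using grid_approx by blast
    qed
    then obtain W' where W': "\<And>g. g \<in> G \<Longrightarrow> W' g \<in> grid k \<and> cmod (W g - W' g) \<le> 2 / real (Suc k)"
      by metis
    define V where "V = restrict (\<lambda>g. if g \<in> G then W' g else 0) (wball S k)"
    have V: "V \<in> PiE (wball S k) (\<lambda>_. grid k)"
      unfolding V_def using W' zero_in_grid by (auto simp: restrict_PiE_iff)
    have "pm G W = pm (wball S k) V + pm G (\<lambda>g. W g - W' g)"
      using Gk by (intro poly_mapping_eqI) (auto simp: lookup_add lookup_pm G finite_wball[OF S] V_def)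
    moreover have "\<forall>g\<in>G. cmod (W g - W' g) \<le> \<delta>" using W' d by force
    ultimately show "\<exists>w\<in>nets S k. \<exists>e. pm G W = w + pm G e \<and> (\<forall>g\<in>G. cmod (e g) \<le> \<delta>)"
      using V by (auto simp: nets_def)
  qed
qed

lemma sact_pm_bound:
  assumes "group_action \<sigma>" "finite G" "\<And>g. g \<in> G \<Longrightarrow> cmod (e g) \<le> \<delta>" "f \<in> ell2"
  shows "sact \<sigma> (pm G e) f \<in> ell2" and "ell2_norm (sact \<sigma> (pm G e) f) \<le> real (card G) * \<delta> * ell2_norm f"
proof -
  interpret scalar_action \<sigma> by (simp add: scalar_action_def assms)
  show "sact \<sigma> (pm G e) f \<in> ell2" by (rule gact_ell2[OF assms(4)])
  have "nm1 (pm G e) \<le> (\<Sum>g\<in>G. cmod (Poly_Mapping.lookup (pm G e) g))"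
    unfolding nm1_def by (rule sum_mono2[OF assms(2) keys_pm[OF assms(2)]]) simp
  also have "\<dots> \<le> (\<Sum>g\<in>G. \<delta>)" using assms by (intro sum_mono) (simp add: lookup_pm)
  finally have "nm1 (pm G e) * ell2_norm f \<le> (real (card G) * \<delta>) * ell2_norm f"
    by (intro mult_right_mono) auto
  then show "ell2_norm (sact \<sigma> (pm G e) f) \<le> real (card G) * \<delta> * ell2_norm f"
    using gact_norm[OF assms(4), of "pm G e"] by linarith
qed

lemma ell2_onorm_add_pm:
  fixes w :: "'g::group_add \<Rightarrow>\<^sub>0 complex"
  assumes G: "finite G" and e: "\<And>g. g \<in> G \<Longrightarrow> cmod (e g) \<le> \<delta>"
  shows "ell2_onorm (lam_scalar w) \<le> ell2_onorm (lam_scalar (w + pm G e)) + real (card G) * \<delta>"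
proof (rule ell2_onorm_least)
  fix \<psi> :: "'g \<Rightarrow> complex" assume \<psi>: "\<psi> \<in> ell2" "ell2_norm \<psi> \<le> 1"
  interpret scalar_action "(+) :: 'g \<Rightarrow> 'g \<Rightarrow> 'g" by (simp add: scalar_action_def group_action_left)
  have eq: "lam_scalar w \<psi> = (\<lambda>x. lam_scalar (w + pm G e) \<psi> x - sact (+) (pm G e) \<psi> x)"
    by (simp add: lam_scalar_eq_gact sact_add fun_eq_iff)
  have "ell2_norm (lam_scalar w \<psi>) \<le> ell2_norm (lam_scalar (w + pm G e) \<psi>) + ell2_norm (sact (+) (pm G e) \<psi>)"
    unfolding eq by (rule ell2_diff(2)) (auto simp: lam_scalar_eq_gact intro: gact_ell2 \<psi>)
  also have "\<dots> \<le> ell2_onorm (lam_scalar (w + pm G e)) + real (card G) * \<delta> * ell2_norm \<psi>"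
    by (intro add_mono ell2_onorm_upper \<psi> sact_pm_bound(2)[OF group_action_left G e \<psi>(1)])
  also have "real (card G) * \<delta> * ell2_norm \<psi> \<le> real (card G) * \<delta> * 1"
  proof (cases "G = {}")
    case False
    then obtain g where "g \<in> G" by blast
    then have "0 \<le> \<delta>" using order_trans[OF norm_ge_zero e] by blast
    then show ?thesis using \<psi>(2) by (intro mult_left_mono) auto
  qed simp
  finally show "ell2_norm (lam_scalar w \<psi>) \<le> ell2_onorm (lam_scalar (w + pm G e)) + real (card G) * \<delta>" by simp
qed

context permutation_limit begin

text \<open>Families of vectors on which net elements asymptotically expand no more than in the
  regular representation. This is the common interface of the cases using rapid decay: each
  requirement concerns finitely many elements.\<close>

definition tempered :: "'g set \<Rightarrow> (nat \<Rightarrow> (nat \<Rightarrow> complex) set) \<Rightarrow> bool" where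
  "tempered S V \<longleftrightarrow> (\<forall>N\<in>NN. \<forall>f\<in>V N. supp_on N f) \<and>
     (\<forall>k. \<forall>\<^sub>F N in along NN. \<forall>w\<in>nets S k. \<forall>f\<in>V N.
        ell2_norm (sact (\<rho> N) w f) \<le> (ell2_onorm (lam_scalar w) + 1 / real (Suc k)) * ell2_norm f)"

lemma eventually_NN: "\<forall>\<^sub>F N in along NN. N \<in> NN"
  by (auto simp: eventually_along)

text \<open>The paired coefficients depend on two energies from a continuum, so the bound must hold
  for all bounded \<open>W\<close> at the same \<open>N\<close>; approximation by the finite nets
  provides this.\<close>

lemma tempered_uniform:
  assumes S: "finite S" "generates S" and V: "tempered S V" and G: "finite G" and "0 < \<delta>"
  shows "\<forall>\<^sub>F N in along NN. \<forall>W. (\<forall>g\<in>G. cmod (W g) \<le> B) \<longrightarrow> (\<forall>f\<in>V N.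
     ell2_norm (sact (\<rho> N) (pm G W) f) \<le> (ell2_onorm (lam_scalar (pm G W)) + \<delta>) * ell2_norm f)"
proof -
  \<comment> \<open>Three errors of at most \<open>\<delta> / 4\<close>: the tolerance on the net,
    the approximation error in the finite action, and the same error in the limit norm.\<close>
  define \<delta>' where "\<delta>' = \<delta> / (4 * (real (card G) + 1))"
  have \<delta>': "0 < \<delta>'" "real (card G) * \<delta>' \<le> \<delta> / 4"
    using \<open>0 < \<delta>\<close> by (auto simp: \<delta>'_def field_simps)
  obtain k0 where k0: "\<And>k W. k0 \<le> k \<Longrightarrow> (\<And>g. g \<in> G \<Longrightarrow> cmod (W g) \<le> B) \<Longrightarrow>
     \<exists>w\<in>nets S k. \<exists>e. pm G W = w + pm G e \<and> (\<forall>g\<in>G. cmod (e g) \<le> \<delta>')"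
    using net_approx[OF S G \<delta>'(1)] by blast
  obtain k1 where k1: "inverse (real (Suc k1)) < \<delta> / 4" using reals_Archimedean[of "\<delta> / 4"] \<open>0 < \<delta>\<close> by auto
  define k where "k = max k0 k1"
  have "1 / real (Suc k) \<le> inverse (real (Suc k1))" unfolding k_def inverse_eq_divide by (intro divide_left_mono) auto
  then have k: "k0 \<le> k" "1 / real (Suc k) \<le> \<delta> / 4" using k1 by (auto simp: k_def)
  have "\<forall>\<^sub>F N in along NN. \<forall>w\<in>nets S k. \<forall>f\<in>V N.
        ell2_norm (sact (\<rho> N) w f) \<le> (ell2_onorm (lam_scalar w) + 1 / real (Suc k)) * ell2_norm f"
    using V by (simp add: tempered_def)
  then show ?thesis
    using eventually_NN
  proof eventually_elim
    case (elim N)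
    show ?case
    proof (intro allI impI ballI)
      fix W f assume W: "\<forall>g\<in>G. cmod (W g) \<le> B" and f: "f \<in> V N"
      have fe: "f \<in> ell2" using V elim(2) f supp_on_ell2(1) by (auto simp: tempered_def)
      obtain w e where w: "w \<in> nets S k" and eq: "pm G W = w + pm G e" and e: "\<And>g. g \<in> G \<Longrightarrow> cmod (e g) \<le> \<delta>'"
        using k0[OF k(1), of W] W by blast
      interpret scalar_action "\<rho> N" by (rule action[OF elim(2)])
      have ee: "ell2_onorm (lam_scalar w) \<le> ell2_onorm (lam_scalar (w + pm G e)) + real (card G) * \<delta>'"
        by (rule ell2_onorm_add_pm[OF G]) (rule e)
      have "ell2_norm (sact (\<rho> N) (pm G W) f) \<le> ell2_norm (sact (\<rho> N) w f) + ell2_norm (sact (\<rho> N) (pm G e) f)"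
        unfolding eq sact_add by (intro ell2_add(2) gact_ell2 fe)
      also have "\<dots> \<le> (ell2_onorm (lam_scalar w) + 1 / real (Suc k)) * ell2_norm f + real (card G) * \<delta>' * ell2_norm f"
        using elim(1) w f by (intro add_mono sact_pm_bound(2)[OF group_act[OF elim(2)] G e fe]) auto
      also have "\<dots> = (ell2_onorm (lam_scalar w) + 1 / real (Suc k) + real (card G) * \<delta>') * ell2_norm f"
        by (simp add: algebra_simps)
      also have "\<dots> \<le> (ell2_onorm (lam_scalar (pm G W)) + \<delta>) * ell2_norm f"
        using ee \<delta>'(2) k(2) \<open>0 < \<delta>\<close> eq by (intro mult_right_mono) auto
      finally show "ell2_norm (sact (\<rho> N) (pm G W) f) \<le> (ell2_onorm (lam_scalar (pm G W)) + \<delta>) * ell2_norm f" .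
    qed
  qed
qed

lemma eventually_ge_along: "\<forall>\<^sub>F N in along NN. C \<le> real N"
  unfolding eventually_along by (rule exI[of _ "nat \<lceil>C\<rceil>"]) (auto intro: order_trans[OF real_nat_ceiling_ge])

text \<open>Every stage removes o(N) vectors, but the stages are infinitely many: \<open>N\<close>
  admits stage \<open>k\<close> only when the stages up to \<open>k\<close> together have at most
  \<open>N / (k + 1)\<close> vectors. The constant vector is added so that orthogonality also
  implies mean zero.\<close>

lemma exceptional_subspace:
  assumes "infinite NN" and S: "finite S" "generates S"
  obtains U where "\<And>N. finite (U N)" "\<And>N u. u \<in> U N \<Longrightarrow> supp_on N u" "\<And>N. (\<lambda>x. of_bool (x \<in> {1..N})) \<in> U N"
    "\<And>\<epsilon>. 0 < \<epsilon> \<Longrightarrow> \<forall>\<^sub>F N in along NN. real (card (U N)) \<le> \<epsilon> * real N"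
    "tempered S (\<lambda>N. {f. supp_on N f \<and> (\<forall>u\<in>U N. (\<Sum>x\<in>{1..N}. cnj (u x) * f x) = 0)})"
proof -
  define \<kappa> where "\<kappa> = (\<lambda>k (w :: 'g \<Rightarrow>\<^sub>0 complex). ell2_onorm (lam_scalar w) + 1 / real (Suc k))"
  define St where "St = (\<lambda>N k. \<Union>w\<in>nets S k. maxfam N w (\<kappa> k w))"
  define c where "c = (\<lambda>N k. \<Sum>i\<le>k. card (St N i))"
  \<comment> \<open>The bound \<open>k \<le> N\<close> keeps the set finite even if the stages
    contain no vectors.\<close>
  define K where "K = (\<lambda>N. {k. k \<le> N \<and> real (c N k) * real (Suc k) \<le> real N})"
  define U where "U = (\<lambda>N. insert (\<lambda>x. of_bool (x \<in> {1..N})) (\<Union>k\<in>K N. \<Union>i\<le>k. St N i))"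
  have mf: "finite (maxfam N w \<kappa>')" "u \<in> maxfam N w \<kappa>' \<Longrightarrow> supp_on N u" for N w \<kappa>' u
    using maxfam_cand[of N w \<kappa>'] by (auto simp: cand_def)
  have Stf: "finite (St N k)" for N k unfolding St_def using finite_nets[OF S] mf(1) by blast
  have Kf: "finite (K N)" for N by (rule finite_subset[of _ "{..N}"]) (auto simp: K_def)
  have fin: "finite (U N)" for N unfolding U_def using Kf Stf by auto
  have St_small: "\<forall>\<^sub>F N in along NN. real (card (St N k)) \<le> \<epsilon> * real N" if "0 < \<epsilon>" for \<epsilon> k
  proof -
    define \<epsilon>' where "\<epsilon>' = \<epsilon> / (real (card (nets S k)) + 1)"
    have "0 < \<epsilon>'" using that by (simp add: \<epsilon>'_def add_nonneg_pos)
    then have "\<forall>\<^sub>F N in along NN. \<forall>w\<in>nets S k. real (card (maxfam N w (\<kappa> k w))) \<le> \<epsilon>' * real N"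
      by (intro eventually_ball_finite finite_nets S ballI maxfam_card assms) (auto simp: \<kappa>_def)
    then show ?thesis
    proof eventually_elim
      case (elim N)
      have "real (card (St N k)) \<le> (\<Sum>w\<in>nets S k. real (card (maxfam N w (\<kappa> k w))))"
        unfolding St_def of_nat_sum[symmetric] of_nat_le_iff by (rule card_UN_le[OF finite_nets[OF S]])
      also have "\<dots> \<le> (\<Sum>w\<in>nets S k. \<epsilon>' * real N)" by (intro sum_mono) (use elim in auto)
      also have "\<dots> = (real (card (nets S k)) * \<epsilon>') * real N" by simp
      also have "\<dots> \<le> \<epsilon> * real N"
        using that by (intro mult_right_mono) (auto simp: \<epsilon>'_def field_simps)
      finally show ?case .
    qed
  qed
  have c_small: "\<forall>\<^sub>F N in along NN. k \<in> K N" for k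
  proof -
    \<comment> \<open>There are \<open>k + 1\<close> stages, so the total is at most
      \<open>N / (k + 1)\<close>.\<close>
    have "\<forall>\<^sub>F N in along NN. \<forall>i\<in>{..k}. real (card (St N i)) \<le> (1 / (real (Suc k))\<^sup>2) * real N"
      by (intro eventually_ball_finite ballI St_small) auto
    moreover have "\<forall>\<^sub>F N in along NN. real k \<le> real N" by (rule eventually_ge_along)
    ultimately show ?thesis
    proof eventually_elim
      case (elim N)
      have "real (c N k) = (\<Sum>i\<le>k. real (card (St N i)))" by (simp add: c_def)
      also have "\<dots> \<le> (\<Sum>i\<le>k. (1 / (real (Suc k))\<^sup>2) * real N)" by (intro sum_mono) (use elim in auto)
      also have "\<dots> = real N / real (Suc k)" by (simp add: power2_eq_square)
      finally have "real (c N k) * real (Suc k) \<le> real N" by (simp add: pos_le_divide_eq del: of_nat_Suc)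
      then show ?case using elim(2) by (simp add: K_def)
    qed
  qed
  have card: "\<forall>\<^sub>F N in along NN. real (card (U N)) \<le> \<epsilon> * real N" if \<epsilon>: "0 < \<epsilon>" for \<epsilon>
  proof -
    obtain k where k: "inverse (real (Suc k)) < \<epsilon> / 2" using reals_Archimedean[of "\<epsilon> / 2"] \<epsilon> by auto
    have "\<forall>\<^sub>F N in along NN. 2 / \<epsilon> \<le> real N" by (rule eventually_ge_along)
    with c_small[of k] show ?thesis
    proof eventually_elim
      case (elim N)
      define m where "m = Max (K N)"
      have m: "m \<in> K N" "k \<le> m" using Max_in[OF Kf] Max_ge[OF Kf] elim(1) by (auto simp: m_def)
      have "U N \<subseteq> insert (\<lambda>x. of_bool (x \<in> {1..N})) (\<Union>i\<le>m. St N i)"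
      proof -
        have "k \<le> m" if "k \<in> K N" for k using Max_ge[OF Kf that] by (simp add: m_def)
        then show ?thesis unfolding U_def by fastforce
      qed
      then have "card (U N) \<le> card (insert (\<lambda>x. of_bool (x \<in> {1..N})) (\<Union>i\<le>m. St N i))"
        using Stf by (intro card_mono) auto
      also have "\<dots> \<le> Suc (card (\<Union>i\<le>m. St N i))" by (rule card_insert_le_m1) auto
      also have "card (\<Union>i\<le>m. St N i) \<le> c N m" unfolding c_def by (rule card_UN_le) simp
      finally have "real (card (U N)) \<le> 1 + real (c N m)" by simp
      also have "real (c N m) \<le> real N * inverse (real (Suc m))"
        using m(1) by (simp add: K_def field_simps del: of_nat_Suc)
      also have "inverse (real (Suc m)) \<le> inverse (real (Suc k))" using m(2) by simp
      also have "1 + real N * inverse (real (Suc k)) \<le> \<epsilon> / 2 * real N + real N * (\<epsilon> / 2)"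
        using elim(2) k \<epsilon> by (intro add_mono mult_left_mono) (auto simp: field_simps)
      finally show ?case by (simp add: mult_left_mono)
    qed
  qed
  have temp: "tempered S (\<lambda>N. {f. supp_on N f \<and> (\<forall>u\<in>U N. (\<Sum>x\<in>{1..N}. cnj (u x) * f x) = 0)})"
    unfolding tempered_def
  proof (intro conjI ballI allI)
    fix k
    show "\<forall>\<^sub>F N in along NN. \<forall>w\<in>nets S k. \<forall>f\<in>{f. supp_on N f \<and> (\<forall>u\<in>U N. (\<Sum>x\<in>{1..N}. cnj (u x) * f x) = 0)}.
        ell2_norm (sact (\<rho> N) w f) \<le> (ell2_onorm (lam_scalar w) + 1 / real (Suc k)) * ell2_norm f"
      using c_small[of k] eventually_NN
    proof eventually_elim
      case (elim N)
      show ?case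
      proof (intro ballI)
        fix w f assume w: "w \<in> nets S k" and f: "f \<in> {f. supp_on N f \<and> (\<forall>u\<in>U N. (\<Sum>x\<in>{1..N}. cnj (u x) * f x) = 0)}"
        have "maxfam N w (\<kappa> k w) \<subseteq> U N" using elim(1) w by (fastforce simp: U_def St_def)
        then show "ell2_norm (sact (\<rho> N) w f) \<le> (ell2_onorm (lam_scalar w) + 1 / real (Suc k)) * ell2_norm f"
          using maxfam_perp[OF elim(2), of f w "\<kappa> k w"] f by (auto simp: \<kappa>_def)
      qed
    qed
  qed auto
  show ?thesis
  proof (rule that[OF fin _ _ card temp])
    show "supp_on N u" if "u \<in> U N" for N u
      using that mf(2) by (auto simp: U_def St_def supp_on_def)
  qed (auto simp: U_def)
qed

end

section \<open>Spectral counting for the finite matrices\<close>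

text \<open>Each factor \<open>D\<close> contains two applications of \<open>p\<close> and so
  enlarges the support radius by \<open>2 l\<close>.\<close>

lemma Dop_support:
  fixes p :: "'g::group_add \<Rightarrow>\<^sub>0 complex^'r^'r"
  assumes gen: "generates S" and l: "Poly_Mapping.keys p \<subseteq> wball S l"
  shows "{g. (Dop (gact (**) (+) p) c E \<eta> ^^ k) unit_coeff g \<noteq> 0} \<subseteq> wball S (2 * l * k)"
proof (induction k)
  case 0
  show ?case using word_length_eq_0[OF gen, of 0] by (auto simp: unit_coeff_def wball_def)
next
  case (Suc k)
  let ?P = "gact (**) (+) p :: ('g \<Rightarrow> complex^'r^'r) \<Rightarrow> _"
  have mono: "m \<le> n \<Longrightarrow> wball S m \<subseteq> wball S n" for m n by (auto simp: wball_def)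
  have X: "{g. shiftop ?P E m g \<noteq> 0} \<subseteq> wball S (n + l)" if m: "{g. m g \<noteq> 0} \<subseteq> wball S n" for m n
  proof -
    have "{g. ?P m g \<noteq> 0} \<subseteq> wball S (n + l)"
    proof (rule order_trans[OF finite_support_gact[OF m]], rule subsetI)
      fix h assume "h \<in> (\<lambda>(a, b). a + b) ` (Poly_Mapping.keys p \<times> wball S n)"
      then obtain x y where xy: "h = x + y" "x \<in> wball S l" "y \<in> wball S n" using l by auto
      show "h \<in> wball S (n + l)" using xy word_length_add[OF gen, of x y] by (simp add: wball_def)
    qed
    moreover have "{g. shiftop ?P E m g \<noteq> 0} \<subseteq> {g. ?P m g \<noteq> 0} \<union> {g. m g \<noteq> 0}"
      by (auto simp: shiftop_def)
    ultimately show ?thesis using m mono[of n "n + l"] by auto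
  qed
  define m where "m = (Dop ?P c E \<eta> ^^ k) unit_coeff"
  have m: "{g. m g \<noteq> 0} \<subseteq> wball S (2 * l * k)" using Suc.IH by (simp add: m_def)
  have "{g. Dop ?P c E \<eta> m g \<noteq> 0} \<subseteq> {g. m g \<noteq> 0} \<union> {g. shiftop ?P E (shiftop ?P E m) g \<noteq> 0}"
    by (auto simp: Dop_def)
  also have "\<dots> \<subseteq> wball S (2 * l * Suc k)"
    using m X[OF X[OF m]] mono[of "2 * l * k" "2 * l * Suc k"] by (auto simp: algebra_simps)
  finally show ?case by (simp add: m_def)
qed

lemma qcoef_support:
  fixes p :: "'g::group_add \<Rightarrow>\<^sub>0 complex^'r^'r"
  assumes "generates S" "Poly_Mapping.keys p \<subseteq> wball S l" "g \<notin> wball S (2 * l * n)"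
  shows "qcoef p c E \<eta> n g = 0"
proof -
  have "(Dop (gact (**) (+) p) c E \<eta> ^^ k) unit_coeff g = 0" if "k < n" for k
  proof (rule ccontr)
    assume "(Dop (gact (**) (+) p) c E \<eta> ^^ k) unit_coeff g \<noteq> 0"
    then have "g \<in> wball S (2 * l * k)" using Dop_support[OF assms(1,2)] by blast
    moreover have "2 * l * k \<le> 2 * l * n" using that by simp
    ultimately show False using assms(3) by (auto simp: wball_def intro: order_trans)
  qed
  then show ?thesis by (simp add: qcoef_def Qop_def)
qed

locale qm_setup = permutation_limit NN \<rho>
  for NN :: "nat set" and \<rho> :: "nat \<Rightarrow> 'g::group_add \<Rightarrow> nat \<Rightarrow> nat" +
  fixes S :: "'g set" and p :: "'g \<Rightarrow>\<^sub>0 complex^'r^'r" and lo hi C0 :: real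
  assumes inf: "infinite NN" and Sfin: "finite S" and Sgen: "generates S"
    and sa: "self_adjoint p" and lohi: "lo < hi" and C0: "1 \<le> C0"
    and AC: "\<And>E \<eta>. E \<in> {lo..hi} \<Longrightarrow> 0 < \<eta> \<Longrightarrow> \<eta> \<le> 1 \<Longrightarrow>
      inverse C0 \<le> Re (trace (op_block (im_resolvent (lam p) (Complex E \<eta>)) 0 0)) \<and>
      Re (trace (op_block (im_resolvent (lam p) (Complex E \<eta>)) 0 0)) \<le> C0"
begin

text \<open>Admissible as \<open>c\<close> for every energy in the interval and every \<eta> up to
  1: the maximum bounds the energy and the summand 1 bounds \<open>\<eta>^2\<close>. The decay rate
  thus does not depend on the energy.\<close>

definition shift_const :: real where "shift_const = (bound1 p + max \<bar>lo\<bar> \<bar>hi\<bar>)\<^sup>2 + 1"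

text \<open>The contraction factor \<open>b\<close> at \<open>c = shift_const\<close>;
  \<open>decay_base \<eta> ^ n / \<eta>\<close> is the truncation error throughout.\<close>

definition decay_base :: "real \<Rightarrow> real" where "decay_base \<eta> = 1 - \<eta>\<^sup>2 / shift_const"

text \<open>\<open>im_coeff\<close> are the coefficients of the convolution operator \<open>\<Im>R\<^sup>z\<close>; \<open>approx_coeff\<close> are those of
  the partial Neumann sum, an element of the group algebra supported in \<open>coeff_ball\<close>.\<close>

definition approx_coeff :: "real \<Rightarrow> real \<Rightarrow> nat \<Rightarrow> 'g \<Rightarrow> complex^'r^'r" where "approx_coeff E \<eta> n g = qcoef p shift_const E \<eta> n g"

definition im_coeff :: "real \<Rightarrow> real \<Rightarrow> 'g \<Rightarrow> complex^'r^'r" where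
  "im_coeff E \<eta> h = op_block (im_resolvent (lam p) (Complex E \<eta>)) 0 (- h)"

lemma bound1_nonneg: "0 \<le> bound1 p"
  unfolding bound1_def by (intro sum_nonneg onorm_pos_le matrix_vector_mul_bounded_linear)

lemma shift_const_ge: "1 \<le> shift_const" by (simp add: shift_const_def)

lemma rs: assumes "E \<in> {lo..hi}" "0 < \<eta>" "\<eta> \<le> 1" shows "resolvent_setup p shift_const E \<eta>"
proof
  have "(bound1 p + \<bar>E\<bar>)\<^sup>2 \<le> (bound1 p + max \<bar>lo\<bar> \<bar>hi\<bar>)\<^sup>2"
    using assms bound1_nonneg by (intro power_mono add_mono) auto
  moreover have "\<eta>\<^sup>2 \<le> 1" using assms by (simp add: power_le_one)
  ultimately show "(bound1 p + \<bar>E\<bar>)\<^sup>2 + \<eta>\<^sup>2 \<le> shift_const" by (simp add: shift_const_def)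
qed (use sa assms in auto)

lemma mlim_im_coeff: "E \<in> {lo..hi} \<Longrightarrow> 0 < \<eta> \<Longrightarrow> \<eta> \<le> 1 \<Longrightarrow> resolvent_setup.mlim p E \<eta> = im_coeff E \<eta>"
  using resolvent_setup.mlim_def[OF rs] by (auto simp: fun_eq_iff im_coeff_def)

lemma im_coeff_tail:
  assumes "E \<in> {lo..hi}" "0 < \<eta>" "\<eta> \<le> 1" "finite F"
  shows "(\<Sum>h\<in>F. (cmod (im_coeff E \<eta> h $ i $ j - approx_coeff E \<eta> n h $ i $ j))\<^sup>2) \<le> (decay_base \<eta> ^ n / \<eta>)\<^sup>2"
proof -
  interpret r: resolvent_setup p shift_const E \<eta> by (rule rs) (use assms in auto)
  show ?thesis using r.mlim_tail[OF assms(4), of i j n] by (simp add: mlim_im_coeff[OF assms(1-3)] approx_coeff_def r.b_def decay_base_def)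
qed

lemma im_coeff_trace:
  assumes "E \<in> {lo..hi}" "0 < \<eta>" "\<eta> \<le> 1"
  shows "inverse C0 \<le> Re (trace (im_coeff E \<eta> 0))" "Re (trace (im_coeff E \<eta> 0)) \<le> C0"
  using AC[OF assms] by (auto simp: im_coeff_def)

lemma im_coeff_le:
  assumes "E \<in> {lo..hi}" "0 < \<eta>" "\<eta> \<le> 1"
  shows "cmod (im_coeff E \<eta> h $ i $ j) \<le> 4 * C0"
  using resolvent_setup.mlim_le[OF rs[OF assms], of C0] im_coeff_trace(2)[OF assms] by (simp add: mlim_im_coeff[OF assms])

lemma im_coeff_sum_sq:
  assumes "E \<in> {lo..hi}" "0 < \<eta>" "\<eta> \<le> 1" "finite F"
  shows "(\<Sum>h\<in>F. (cmod (im_coeff E \<eta> h $ i $ j))\<^sup>2) \<le> C0 / \<eta>"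
  using resolvent_setup.mlim_sum_sq[OF rs[OF assms(1-3)], of C0 F] im_coeff_trace(2)[OF assms(1-3)] assms(4)
  by (simp add: mlim_im_coeff[OF assms(1-3)])

lemma decay_base_bounds: assumes "0 < \<eta>" "\<eta> \<le> 1" shows "0 \<le> decay_base \<eta>" "decay_base \<eta> < 1"
proof -
  have "\<eta>\<^sup>2 \<le> 1" using assms by (simp add: power_le_one)
  then show "0 \<le> decay_base \<eta>" "decay_base \<eta> < 1" using shift_const_ge assms by (auto simp: decay_base_def field_simps)
qed

lemma err_small:
  assumes "0 < \<eta>" "\<eta> \<le> 1" "0 < \<epsilon>"
  shows "\<exists>n0. \<forall>n\<ge>n0. decay_base \<eta> ^ n / \<eta> \<le> \<epsilon>"
proof -
  obtain n0 where n0: "decay_base \<eta> ^ n0 < \<epsilon> * \<eta>"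
    using real_arch_pow_inv[of "\<epsilon> * \<eta>" "decay_base \<eta>"] decay_base_bounds[OF assms(1,2)] assms by auto
  have "decay_base \<eta> ^ n / \<eta> \<le> \<epsilon>" if "n0 \<le> n" for n
  proof -
    have "decay_base \<eta> ^ n \<le> decay_base \<eta> ^ n0" using decay_base_bounds[OF assms(1,2)] that by (intro power_decreasing) auto
    then show ?thesis using n0 assms(1) by (simp add: pos_divide_le_eq)
  qed
  then show ?thesis by blast
qed

lemma approx_coeff_diff:
  assumes "E \<in> {lo..hi}" "0 < \<eta>" "\<eta> \<le> 1"
  shows "cmod (im_coeff E \<eta> h $ i $ j - approx_coeff E \<eta> n h $ i $ j) \<le> decay_base \<eta> ^ n / \<eta>"
proof -
  have "0 \<le> decay_base \<eta> ^ n / \<eta>" using decay_base_bounds[OF assms(2,3)] assms(2) by simp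
  moreover have "(cmod (im_coeff E \<eta> h $ i $ j - approx_coeff E \<eta> n h $ i $ j))\<^sup>2 \<le> (decay_base \<eta> ^ n / \<eta>)\<^sup>2"
    using im_coeff_tail[OF assms, of "{h}" i j n] by simp
  ultimately show ?thesis by (rule power2_le_imp_le[rotated])
qed

lemma approx_coeff_le:
  assumes "E \<in> {lo..hi}" "0 < \<eta>" "\<eta> \<le> 1" "decay_base \<eta> ^ n / \<eta> \<le> 1"
  shows "cmod (approx_coeff E \<eta> n h $ i $ j) \<le> 4 * C0 + 1"
  using approx_coeff_diff[OF assms(1-3), of h i j n] im_coeff_le[OF assms(1-3), of h i j] assms(4)
    norm_triangle_ineq2[of "approx_coeff E \<eta> n h $ i $ j" "im_coeff E \<eta> h $ i $ j"]
  by (simp add: norm_minus_commute)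

lemma approx_coeff_sum_sq:
  assumes "E \<in> {lo..hi}" "0 < \<eta>" "\<eta> \<le> 1" "decay_base \<eta> ^ n / \<eta> \<le> 1" "finite F"
  shows "(\<Sum>h\<in>F. (cmod (approx_coeff E \<eta> n h $ i $ j))\<^sup>2) \<le> 4 * C0 / \<eta>"
proof -
  have e0: "0 \<le> decay_base \<eta> ^ n / \<eta>" using decay_base_bounds[OF assms(2,3)] assms(2) by simp
  have "(\<Sum>h\<in>F. (cmod (approx_coeff E \<eta> n h $ i $ j))\<^sup>2)
     \<le> (\<Sum>h\<in>F. 2 * (cmod (im_coeff E \<eta> h $ i $ j))\<^sup>2 + 2 * (cmod (im_coeff E \<eta> h $ i $ j - approx_coeff E \<eta> n h $ i $ j))\<^sup>2)"
  proof (intro sum_mono)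
    fix h
    let ?m = "im_coeff E \<eta> h $ i $ j" and ?q = "approx_coeff E \<eta> n h $ i $ j"
    have "cmod ?q \<le> cmod ?m + cmod (?m - ?q)"
      using norm_triangle_ineq2[of ?q ?m] by (simp add: norm_minus_commute)
    then have "(cmod ?q)\<^sup>2 \<le> (cmod ?m + cmod (?m - ?q))\<^sup>2" by (intro power_mono) auto
    also have "\<dots> \<le> 2 * (cmod ?m)\<^sup>2 + 2 * (cmod (?m - ?q))\<^sup>2"
      using sum_squares_bound[of "cmod ?m" "cmod (?m - ?q)"] by (simp add: power2_sum)
    finally show "(cmod ?q)\<^sup>2 \<le> 2 * (cmod ?m)\<^sup>2 + 2 * (cmod (?m - ?q))\<^sup>2" .
  qed
  also have "\<dots> = 2 * (\<Sum>h\<in>F. (cmod (im_coeff E \<eta> h $ i $ j))\<^sup>2) + 2 * (\<Sum>h\<in>F. (cmod (im_coeff E \<eta> h $ i $ j - approx_coeff E \<eta> n h $ i $ j))\<^sup>2)"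
    by (simp add: sum.distrib sum_distrib_left)
  also have "\<dots> \<le> 2 * (C0 / \<eta>) + 2 * 1"
    using im_coeff_sum_sq[OF assms(1-3,5), of i j] im_coeff_tail[OF assms(1-3,5), of i j n] power_le_one[OF e0 assms(4), of 2]
    by (intro add_mono mult_left_mono) auto
  \<comment> \<open>The truncation part is at most 2, which is absorbed because
    \<open>C0 / \<eta>\<close> is at least 1.\<close>
  also have "\<dots> \<le> 4 * C0 / \<eta>"
  proof -
    have "1 \<le> C0 / \<eta>" using C0 assms(2,3) by (simp add: pos_le_divide_eq)
    then show ?thesis by simp
  qed
  finally show ?thesis .
qed

definition supp_len :: nat where "supp_len = (SOME l. Poly_Mapping.keys p \<subseteq> wball S l)"

definition coeff_ball :: "nat \<Rightarrow> 'g set" where "coeff_ball n = wball S (2 * supp_len * n)"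

lemma coeff_ball_finite: "finite (coeff_ball n)"
  unfolding coeff_ball_def by (rule finite_wball[OF Sfin Sgen])

lemma approx_coeff_support: "g \<notin> coeff_ball n \<Longrightarrow> approx_coeff E \<eta> n g = 0"
proof -
  have "\<exists>l. Poly_Mapping.keys p \<subseteq> wball S l" by (rule finite_set_in_wball) simp
  then have "Poly_Mapping.keys p \<subseteq> wball S supp_len" unfolding supp_len_def by (rule someI_ex)
  then show "g \<notin> coeff_ball n \<Longrightarrow> approx_coeff E \<eta> n g = 0"
    unfolding approx_coeff_def coeff_ball_def by (rule qcoef_support[OF Sgen])
qed

definition ebasis :: "nat \<Rightarrow> (nat \<Rightarrow> real) \<Rightarrow> (nat \<Rightarrow> nat \<Rightarrow> complex^'r) \<Rightarrow> bool" where
  "ebasis N ev \<phi> \<longleftrightarrow> eigenbasis N (rep_mat (\<rho> N) p) ev \<phi>"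

lemma rep_mat_action:
  assumes N: "N \<in> NN" and x: "x \<in> {1..N}"
  shows "mat_app N (rep_mat (\<rho> N) q) f x = gact (*v) (\<rho> N) q f x"
proof -
  interpret group_action "\<rho> N" by (rule group_act[OF N])
  have iff: "x = \<rho> N g y \<longleftrightarrow> y = \<rho> N (- g) x" for g y by (metis act_minus)
  have "mat_app N (rep_mat (\<rho> N) q) f x = (\<Sum>y\<in>{1..N}. \<Sum>g\<in>Poly_Mapping.keys q. perm_mat (\<rho> N g) x y *\<^sub>R (Poly_Mapping.lookup q g *v f y))"
    unfolding mat_app_def rep_mat_def sum_matrix_mult_vec scaleR_mult_vec ..
  also have "\<dots> = (\<Sum>g\<in>Poly_Mapping.keys q. \<Sum>y\<in>{1..N}. perm_mat (\<rho> N g) x y *\<^sub>R (Poly_Mapping.lookup q g *v f y))"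
    by (rule sum.swap)
  also have "\<dots> = (\<Sum>g\<in>Poly_Mapping.keys q. Poly_Mapping.lookup q g *v f (\<rho> N (- g) x))"
  proof (rule sum.cong[OF refl])
    fix g
    have "(\<Sum>y\<in>{1..N}. perm_mat (\<rho> N g) x y *\<^sub>R (Poly_Mapping.lookup q g *v f y))
        = (\<Sum>y\<in>{1..N}. if y = \<rho> N (- g) x then Poly_Mapping.lookup q g *v f y else 0)"
      by (intro sum.cong refl) (simp add: perm_mat_def iff)
    also have "\<dots> = Poly_Mapping.lookup q g *v f (\<rho> N (- g) x)"
    proof -
      have "\<rho> N (- g) x \<in> {1..N}" using rho_in[OF N] x by blast
      then show ?thesis by (simp only: sum.delta[OF finite_atLeastAtMost] if_True)
    qed
    finally show "(\<Sum>y\<in>{1..N}. perm_mat (\<rho> N g) x y *\<^sub>R (Poly_Mapping.lookup q g *v f y)) = Poly_Mapping.lookup q g *v f (\<rho> N (- g) x)" .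
  qed
  finally show ?thesis by (simp add: gact_def)
qed

text \<open>The permutations fix every point outside \<open>{1..N}\<close>, so extension by zero
  turns an eigenvector of the matrix into one of the action on all naturals.\<close>

definition ext :: "nat \<Rightarrow> (nat \<Rightarrow> complex^'r) \<Rightarrow> nat \<Rightarrow> complex^'r" where
  "ext N f x = (if x \<in> {1..N} then f x else 0)"

lemma ext_eigen:
  assumes N: "N \<in> NN" and e: "ebasis N ev \<phi>" and \<alpha>: "\<alpha> \<in> {1..CARD('r) * N}"
  shows "gact (*v) (\<rho> N) p (ext N (\<phi> \<alpha>)) = (\<lambda>x. ev \<alpha> *\<^sub>R ext N (\<phi> \<alpha>) x)"
proof
  fix x
  show "gact (*v) (\<rho> N) p (ext N (\<phi> \<alpha>)) x = ev \<alpha> *\<^sub>R ext N (\<phi> \<alpha>) x"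
  proof (cases "x \<in> {1..N}")
    case True
    have "gact (*v) (\<rho> N) p (ext N (\<phi> \<alpha>)) x = mat_app N (rep_mat (\<rho> N) p) (ext N (\<phi> \<alpha>)) x"
      by (rule rep_mat_action[OF N True, symmetric])
    also have "\<dots> = mat_app N (rep_mat (\<rho> N) p) (\<phi> \<alpha>) x"
      by (simp add: mat_app_def ext_def)
    also have "\<dots> = ev \<alpha> *\<^sub>R \<phi> \<alpha> x"
      using e \<alpha> True by (auto simp: ebasis_def eigenbasis_def vector_scalar_mult_scaleR)
    finally show ?thesis using True by (simp add: ext_def)
  next
    case False
    then have z: "ext N (\<phi> \<alpha>) x = 0" by (simp only: ext_def if_False)
    show ?thesis by (simp add: gact_def rho_out[OF N False] z)
  qed
qed

lemma basis_orthonormal: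
  assumes "ebasis N ev \<phi>"
  shows "orthonormal_fam ({1..N} \<times> (UNIV :: 'r set)) ({1..CARD('r) * N}) (\<lambda>\<alpha> (x, i). \<phi> \<alpha> x $ i)"
proof -
  have "(\<Sum>z\<in>{1..N} \<times> (UNIV :: 'r set). cnj ((\<lambda>(x, i). \<phi> \<alpha> x $ i) z) * (\<lambda>(x, i). \<phi> \<beta> x $ i) z) = vec_inner N (\<phi> \<alpha>) (\<phi> \<beta>)" for \<alpha> \<beta>
    unfolding vec_inner_def sum.cartesian_product by (intro sum.cong refl) auto
  then show ?thesis using assms by (simp add: orthonormal_fam_def ebasis_def eigenbasis_def)
qed

lemma basis_complete:
  assumes "ebasis N ev \<phi>" "x \<in> {1..N}" "y \<in> {1..N}"
  shows "(\<Sum>\<alpha>\<in>{1..CARD('r) * N}. \<phi> \<alpha> x $ i * cnj (\<phi> \<alpha> y $ j)) = of_bool (x = y \<and> i = j)"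
  using orthonormal_fam_complete[OF _ _ basis_orthonormal[OF assms(1)], of "(x, i)" "(y, j)"] assms
  by (simp add: card_cartesian_product mult.commute)

lemma basis_norm:
  assumes "ebasis N ev \<phi>" "\<alpha> \<in> {1..CARD('r) * N}"
  shows "(\<Sum>x\<in>{1..N}. \<Sum>i\<in>UNIV. \<phi> \<alpha> x $ i * cnj (\<phi> \<alpha> x $ i)) = 1"
  using assms by (auto simp: ebasis_def eigenbasis_def vec_inner_def mult.commute)

text \<open>Keeps eigenvalues in the range where the Neumann series converges at the rate
  \<open>decay_base\<close>.\<close>

lemma ev_bounded:
  assumes N: "N \<in> NN" and e: "ebasis N ev \<phi>" and \<alpha>: "\<alpha> \<in> {1..CARD('r) * N}"
  shows "\<bar>ev \<alpha>\<bar> \<le> bound1 p"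
proof -
  interpret coeff_action "\<rho> N" "(*v) :: complex^'r^'r \<Rightarrow> complex^'r \<Rightarrow> complex^'r" "\<lambda>A. onorm ((*v) A)" conj_transpose
    by (rule coeff_action_matrix[OF group_act[OF N]])
  let ?f = "ext N (\<phi> \<alpha>)"
  have f: "?f \<in> ell2" by (rule ell2_finite_support(1)[of "{1..N}"]) (auto simp: ext_def)
  have "?f \<noteq> (\<lambda>x. 0)"
  proof
    assume "?f = (\<lambda>x. 0)"
    then have "\<phi> \<alpha> x = 0" if "x \<in> {1..N}" for x using that by (metis ext_def)
    then show False using basis_norm[OF e \<alpha>] by simp
  qed
  then have pos: "0 < ell2_norm ?f" using ell2_norm_eq_0[OF f] ell2_norm_nonneg[of ?f] by (metis less_eq_real_def)
  have "\<bar>ev \<alpha>\<bar> * ell2_norm ?f = ell2_norm (gact (*v) (\<rho> N) p ?f)"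
    unfolding ext_eigen[OF N e \<alpha>] by (simp add: ell2_scaleR(2))
  also have "\<dots> \<le> bound1 p * ell2_norm ?f"
    using gact_norm[OF f, of p] by (simp add: nm1_def bound1_def)
  finally show ?thesis using pos by simp
qed

definition approx_kernel :: "real \<Rightarrow> real \<Rightarrow> nat \<Rightarrow> nat \<Rightarrow> nat \<Rightarrow> nat \<Rightarrow> 'r \<Rightarrow> 'r \<Rightarrow> complex" where
  "approx_kernel E \<eta> n N x y i j = (\<Sum>g\<in>coeff_ball n. approx_coeff E \<eta> n g $ i $ j * of_bool (\<rho> N (- g) x = y))"

text \<open>The eigenvector equation replaces the factor \<open>Qval\<close> by the group action,
  after which completeness of the basis collapses the sum over \<alpha>. It equates the spectral and
  the group-theoretic form of the same matrix.\<close>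

lemma kernel_spectral:
  assumes N: "N \<in> NN" and e: "ebasis N ev \<phi>" and x: "x \<in> {1..N}" and y: "y \<in> {1..N}"
  shows "(\<Sum>\<alpha>\<in>{1..CARD('r) * N}. Qval shift_const E \<eta> n (ev \<alpha>) * (\<phi> \<alpha> x $ i * cnj (\<phi> \<alpha> y $ j))) = approx_kernel E \<eta> n N x y i j"
proof -
  interpret coeff_action "\<rho> N" "(*v) :: complex^'r^'r \<Rightarrow> complex^'r \<Rightarrow> complex^'r" "\<lambda>A. onorm ((*v) A)" conj_transpose
    by (rule coeff_action_matrix[OF group_act[OF N]])
  have act: "Qval shift_const E \<eta> n (ev \<alpha>) * \<phi> \<alpha> x $ i = (\<Sum>g\<in>coeff_ball n. \<Sum>k\<in>UNIV. approx_coeff E \<eta> n g $ i $ k * \<phi> \<alpha> (\<rho> N (- g) x) $ k)"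
    if \<alpha>: "\<alpha> \<in> {1..CARD('r) * N}" for \<alpha>
  proof -
    let ?f = "ext N (\<phi> \<alpha>)"
    have in': "\<rho> N (- g) x \<in> {1..N}" for g using rho_in[OF N] x by blast
    have "Qval shift_const E \<eta> n (ev \<alpha>) *\<^sub>R ?f x = Qop (gact (*v) (\<rho> N) p) shift_const E \<eta> n ?f x"
      using Qop_eigenvector[OF linear_gact ext_eigen[OF N e \<alpha>], of shift_const E \<eta> n] by simp
    also have "\<dots> = (\<Sum>g | approx_coeff E \<eta> n g \<noteq> 0. approx_coeff E \<eta> n g *v ?f (\<rho> N (- g) x))"
      unfolding approx_coeff_def by (rule qcoef_action[OF group_act[OF N]])
    also have "\<dots> = (\<Sum>g\<in>coeff_ball n. approx_coeff E \<eta> n g *v ?f (\<rho> N (- g) x))"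
      using approx_coeff_support by (intro sum_support_superset coeff_ball_finite) blast
    also have "\<dots> = (\<Sum>g\<in>coeff_ball n. approx_coeff E \<eta> n g *v \<phi> \<alpha> (\<rho> N (- g) x))"
      by (simp only: ext_def in' if_True)
    finally have "(Qval shift_const E \<eta> n (ev \<alpha>) *\<^sub>R \<phi> \<alpha> x) $ i = (\<Sum>g\<in>coeff_ball n. approx_coeff E \<eta> n g *v \<phi> \<alpha> (\<rho> N (- g) x)) $ i"
      using x by (simp add: ext_def)
    then show ?thesis by (simp add: sum_component matrix_vector_mult_def scaleR_conv_of_real[where 'a = complex])
  qed
  have "(\<Sum>\<alpha>\<in>{1..CARD('r) * N}. Qval shift_const E \<eta> n (ev \<alpha>) * (\<phi> \<alpha> x $ i * cnj (\<phi> \<alpha> y $ j)))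
     = (\<Sum>\<alpha>\<in>{1..CARD('r) * N}. (\<Sum>g\<in>coeff_ball n. \<Sum>k\<in>UNIV. approx_coeff E \<eta> n g $ i $ k * \<phi> \<alpha> (\<rho> N (- g) x) $ k) * cnj (\<phi> \<alpha> y $ j))"
    by (intro sum.cong refl) (simp only: act mult.assoc[symmetric])
  also have "\<dots> = (\<Sum>\<alpha>\<in>{1..CARD('r) * N}. \<Sum>g\<in>coeff_ball n. \<Sum>k\<in>UNIV. approx_coeff E \<eta> n g $ i $ k * (\<phi> \<alpha> (\<rho> N (- g) x) $ k * cnj (\<phi> \<alpha> y $ j)))"
    by (simp only: sum_distrib_right mult.assoc)
  also have "\<dots> = (\<Sum>g\<in>coeff_ball n. \<Sum>k\<in>UNIV. \<Sum>\<alpha>\<in>{1..CARD('r) * N}. approx_coeff E \<eta> n g $ i $ k * (\<phi> \<alpha> (\<rho> N (- g) x) $ k * cnj (\<phi> \<alpha> y $ j)))"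
    by (subst sum.swap, intro sum.cong refl, rule sum.swap)
  also have "\<dots> = (\<Sum>g\<in>coeff_ball n. \<Sum>k\<in>UNIV. approx_coeff E \<eta> n g $ i $ k * of_bool (\<rho> N (- g) x = y \<and> k = j))"
  proof (intro sum.cong refl)
    fix g k
    have "\<rho> N (- g) x \<in> {1..N}" using rho_in[OF N] x by blast
    then show "(\<Sum>\<alpha>\<in>{1..CARD('r) * N}. approx_coeff E \<eta> n g $ i $ k * (\<phi> \<alpha> (\<rho> N (- g) x) $ k * cnj (\<phi> \<alpha> y $ j)))
        = approx_coeff E \<eta> n g $ i $ k * of_bool (\<rho> N (- g) x = y \<and> k = j)"
      by (simp only: sum_distrib_left[symmetric] basis_complete[OF e _ y])
  qed
  also have "\<dots> = approx_kernel E \<eta> n N x y i j"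
  proof -
    have "(\<Sum>k\<in>UNIV. approx_coeff E \<eta> n g $ i $ k * of_bool (\<rho> N (- g) x = y \<and> k = j)) = approx_coeff E \<eta> n g $ i $ j * of_bool (\<rho> N (- g) x = y)" for g
      using sum_indicator_mult[OF finite UNIV_I, of "\<lambda>k. approx_coeff E \<eta> n g $ i $ k * of_bool (\<rho> N (- g) x = y)" j]
      by (simp only: of_bool_conj mult.assoc)
    then show ?thesis by (simp only: approx_kernel_def)
  qed
  finally show ?thesis .
qed

abbreviation energies :: "real set" where "energies \<equiv> {lo..hi}"

definition C2 :: real where "C2 = 4 * C0 + 1"

lemma C2_pos: "0 < C2" using C0 by (simp add: C2_def)

lemma NN_pos: "N \<in> NN \<Longrightarrow> 0 < N" using NN0 by (cases N) auto

lemma fixfrac_zero: "N \<in> NN \<Longrightarrow> fixfrac N (\<rho> N) 0 = 1"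
proof -
  assume N: "N \<in> NN"
  interpret group_action "\<rho> N" by (rule group_act[OF N])
  have "{x \<in> {1..N}. \<rho> N 0 x = x} = {1..N}" by auto
  then show ?thesis using NN_pos[OF N] by (simp add: fixfrac_def)
qed

lemma fixed_count:
  assumes "N \<in> NN"
  shows "(\<Sum>x\<in>{1..N}. of_bool (\<rho> N g x = x)) = real N * fixfrac N (\<rho> N) g"
proof -
  have "(\<Sum>x\<in>{1..N}. of_bool (\<rho> N g x = x) :: real) = real (card {x \<in> {1..N}. \<rho> N g x = x})"
    by (simp add: Int_def conj_commute)
  then show ?thesis using NN_pos[OF assms] by (simp add: fixfrac_def)
qed

lemma trace_formula:
  assumes N: "N \<in> NN" and e: "ebasis N ev \<phi>"
  shows "complex_of_real (\<Sum>\<alpha>\<in>{1..CARD('r) * N}. Qval shift_const E \<eta> n (ev \<alpha>))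
     = (\<Sum>g\<in>coeff_ball n. trace (approx_coeff E \<eta> n g) * of_real (real N * fixfrac N (\<rho> N) (- g)))"
proof -
  let ?A = "{1..CARD('r) * N}"
  have "complex_of_real (\<Sum>\<alpha>\<in>?A. Qval shift_const E \<eta> n (ev \<alpha>))
     = (\<Sum>\<alpha>\<in>?A. Qval shift_const E \<eta> n (ev \<alpha>) * (\<Sum>x\<in>{1..N}. \<Sum>i\<in>UNIV. \<phi> \<alpha> x $ i * cnj (\<phi> \<alpha> x $ i)))"
    unfolding of_real_sum by (intro sum.cong refl) (simp only: basis_norm[OF e] mult_1_right)
  also have "\<dots> = (\<Sum>\<alpha>\<in>?A. \<Sum>x\<in>{1..N}. \<Sum>i\<in>UNIV. Qval shift_const E \<eta> n (ev \<alpha>) * (\<phi> \<alpha> x $ i * cnj (\<phi> \<alpha> x $ i)))"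
    by (simp only: sum_distrib_left)
  also have "\<dots> = (\<Sum>x\<in>{1..N}. \<Sum>i\<in>UNIV. \<Sum>\<alpha>\<in>?A. Qval shift_const E \<eta> n (ev \<alpha>) * (\<phi> \<alpha> x $ i * cnj (\<phi> \<alpha> x $ i)))"
    by (subst sum.swap, intro sum.cong refl, rule sum.swap)
  also have "\<dots> = (\<Sum>x\<in>{1..N}. \<Sum>i\<in>UNIV. \<Sum>g\<in>coeff_ball n. approx_coeff E \<eta> n g $ i $ i * of_bool (\<rho> N (- g) x = x))"
    by (intro sum.cong refl) (simp only: kernel_spectral[OF N e] approx_kernel_def)
  also have "\<dots> = (\<Sum>x\<in>{1..N}. \<Sum>g\<in>coeff_ball n. \<Sum>i\<in>UNIV. approx_coeff E \<eta> n g $ i $ i * of_bool (\<rho> N (- g) x = x))"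
    by (intro sum.cong refl) (rule sum.swap)
  also have "\<dots> = (\<Sum>g\<in>coeff_ball n. \<Sum>x\<in>{1..N}. \<Sum>i\<in>UNIV. approx_coeff E \<eta> n g $ i $ i * of_bool (\<rho> N (- g) x = x))"
    by (rule sum.swap)
  also have "\<dots> = (\<Sum>g\<in>coeff_ball n. trace (approx_coeff E \<eta> n g) * of_real (\<Sum>x\<in>{1..N}. of_bool (\<rho> N (- g) x = x)))"
  proof -
    have "complex_of_real (of_bool P) = of_bool P" for P by (cases P) auto
    then show ?thesis
      by (simp only: trace_def sum_distrib_right[symmetric] sum_distrib_left[symmetric] of_real_sum)
  qed
  finally show ?thesis by (simp only: fixed_count[OF N])
qed

lemma zero_in_GG: "0 \<in> coeff_ball n"
  using word_length_eq_0[OF Sgen, of 0] by (simp add: coeff_ball_def wball_def)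

lemma trace_cmod_le:
  assumes "\<And>i. cmod ((A::complex^'r^'r) $ i $ i) \<le> B" shows "cmod (trace A) \<le> real CARD('r) * B"
proof -
  have "cmod (trace A) \<le> (\<Sum>i\<in>(UNIV::'r set). B)"
    unfolding trace_def by (intro order_trans[OF norm_sum] sum_mono assms)
  then show ?thesis by simp
qed

text \<open>The unit contributes the trace of the resolvent coefficient, between
  \<open>1 / C0\<close> and \<open>C0\<close>. Truncation and the fixed points of the other elements
  cost \<open>1 / (4 C0)\<close> each, and neither error depends on the basis or the energy.\<close>

lemma smoothed_count:
  assumes \<eta>: "0 < \<eta>" "\<eta> \<le> 1" and n: "decay_base \<eta> ^ n / \<eta> \<le> 1 / (4 * C0 * real CARD('r))"
  shows "\<forall>\<^sub>F N in along NN. \<forall>ev \<phi>. ebasis N ev \<phi> \<longrightarrow> (\<forall>E\<in>energies.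
     real N / (2 * C0) \<le> (\<Sum>\<alpha>\<in>{1..CARD('r) * N}. Qval shift_const E \<eta> n (ev \<alpha>)) \<and>
     (\<Sum>\<alpha>\<in>{1..CARD('r) * N}. Qval shift_const E \<eta> n (ev \<alpha>)) \<le> 2 * C0 * real N)"
proof -
  let ?r = "real CARD('r)"
  have r: "1 \<le> ?r" by (simp add: Suc_le_eq)
  have n1: "decay_base \<eta> ^ n / \<eta> \<le> 1"
  proof -
    have "1 * 1 \<le> (4 * C0) * ?r" using C0 r by (intro mult_mono) auto
    then have "1 / (4 * C0 * ?r) \<le> 1" by simp
    then show ?thesis using n by linarith
  qed
  have "\<forall>\<^sub>F N in along NN. ?r * C2 * (\<Sum>g\<in>uminus ` (coeff_ball n - {0}). fixfrac N (\<rho> N) g) < 1 / (4 * C0)"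
    using C0 coeff_ball_finite by (intro fixfrac_sum_small) auto
  then show ?thesis using eventually_NN
  proof eventually_elim
    case (elim N)
    show ?case
    proof (intro allI impI ballI)
      fix ev \<phi> E assume e: "ebasis N ev \<phi>" and E: "E \<in> energies"
      let ?s = "\<Sum>\<alpha>\<in>{1..CARD('r) * N}. Qval shift_const E \<eta> n (ev \<alpha>)"
      have Npos: "0 < real N" using NN_pos[OF elim(2)] by simp
      have "complex_of_real (?s / real N) = complex_of_real ?s / complex_of_real (real N)"
        by (rule of_real_divide)
      also have "\<dots> = (\<Sum>g\<in>coeff_ball n. trace (approx_coeff E \<eta> n g) * of_real (fixfrac N (\<rho> N) (- g)))"
        unfolding trace_formula[OF elim(2) e] sum_divide_distrib
        using Npos by (intro sum.cong refl) simp
      also have "\<dots> = trace (approx_coeff E \<eta> n 0) + (\<Sum>g\<in>coeff_ball n - {0}. trace (approx_coeff E \<eta> n g) * of_real (fixfrac N (\<rho> N) (- g)))"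
        by (subst sum.remove[OF coeff_ball_finite zero_in_GG]) (simp add: fixfrac_zero[OF elim(2)])
      finally have eq: "complex_of_real (?s / real N) - trace (im_coeff E \<eta> 0)
          = (trace (approx_coeff E \<eta> n 0) - trace (im_coeff E \<eta> 0)) + (\<Sum>g\<in>coeff_ball n - {0}. trace (approx_coeff E \<eta> n g) * of_real (fixfrac N (\<rho> N) (- g)))"
        by simp
      have b1: "cmod (trace (approx_coeff E \<eta> n 0) - trace (im_coeff E \<eta> 0)) \<le> 1 / (4 * C0)"
      proof -
        have "cmod (trace (approx_coeff E \<eta> n 0 - im_coeff E \<eta> 0)) \<le> ?r * (1 / (4 * C0 * ?r))"
          using order_trans[OF approx_coeff_diff[OF E \<eta>] n] by (intro trace_cmod_le) (simp add: norm_minus_commute)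
        then show ?thesis using r by (simp add: trace_sub)
      qed
      have b2: "cmod (\<Sum>g\<in>coeff_ball n - {0}. trace (approx_coeff E \<eta> n g) * of_real (fixfrac N (\<rho> N) (- g))) \<le> 1 / (4 * C0)"
      proof -
        have "cmod (\<Sum>g\<in>coeff_ball n - {0}. trace (approx_coeff E \<eta> n g) * of_real (fixfrac N (\<rho> N) (- g)))
            \<le> (\<Sum>g\<in>coeff_ball n - {0}. (?r * C2) * fixfrac N (\<rho> N) (- g))"
        proof (intro order_trans[OF norm_sum] sum_mono)
          fix g
          have "cmod (trace (approx_coeff E \<eta> n g)) \<le> ?r * C2"
            unfolding C2_def by (intro trace_cmod_le approx_coeff_le E \<eta> n1)
          then show "cmod (trace (approx_coeff E \<eta> n g) * of_real (fixfrac N (\<rho> N) (- g))) \<le> (?r * C2) * fixfrac N (\<rho> N) (- g)"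
            using fixfrac_nonneg[of N "\<rho> N" "- g"] by (simp add: norm_mult mult_right_mono)
        qed
        also have "\<dots> = ?r * C2 * (\<Sum>g\<in>uminus ` (coeff_ball n - {0}). fixfrac N (\<rho> N) g)"
          by (subst sum.reindex) (auto simp: inj_on_def sum_distrib_left)
        finally show ?thesis using elim(1) by linarith
      qed
      have "\<bar>?s / real N - Re (trace (im_coeff E \<eta> 0))\<bar> \<le> cmod (complex_of_real (?s / real N) - trace (im_coeff E \<eta> 0))"
        using abs_Re_le_cmod[of "complex_of_real (?s / real N) - trace (im_coeff E \<eta> 0)"] by simp
      also have "\<dots> \<le> 1 / (4 * C0) + 1 / (4 * C0)"
        unfolding eq by (intro order_trans[OF norm_triangle_ineq] add_mono b1 b2)
      finally have d: "\<bar>?s / real N - Re (trace (im_coeff E \<eta> 0))\<bar> \<le> 1 / (2 * C0)" by simp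
      have t: "1 / C0 \<le> Re (trace (im_coeff E \<eta> 0))" "Re (trace (im_coeff E \<eta> 0)) \<le> C0"
        using im_coeff_trace[OF E \<eta>] by (auto simp: inverse_eq_divide)
      have "1 / (2 * C0) \<le> 1" using C0 by simp
      have i: "1 / C0 = 1 / (2 * C0) + 1 / (2 * C0)" by simp
      have "1 / (2 * C0) \<le> ?s / real N" "?s / real N \<le> 2 * C0"
        using d t C0 \<open>1 / (2 * C0) \<le> 1\<close> i unfolding abs_le_iff by linarith+
      then show "real N / (2 * C0) \<le> ?s \<and> ?s \<le> 2 * C0 * real N"
        using Npos C0 by (simp add: field_simps)
    qed
  qed
qed

text \<open>On the spectrum \<open>Dval\<close> lies between 0 and \<open>decay_base \<eta>\<close>,
  so the truncation factor \<open>1 - Dval ^ n\<close> lies between 1/2 and 1 and the polynomial is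
  comparable to the Poisson kernel.\<close>

lemma Qval_bounds:
  assumes E: "E \<in> energies" and \<eta>: "0 < \<eta>" "\<eta> \<le> 1" and x: "\<bar>x\<bar> \<le> bound1 p" and n: "decay_base \<eta> ^ n / \<eta> \<le> 1 / 2"
  shows "\<eta> / ((x - E)\<^sup>2 + \<eta>\<^sup>2) / 2 \<le> Qval shift_const E \<eta> n x" "Qval shift_const E \<eta> n x \<le> \<eta> / ((x - E)\<^sup>2 + \<eta>\<^sup>2)"
    "0 \<le> Qval shift_const E \<eta> n x"
proof -
  let ?w = "\<eta> / ((x - E)\<^sup>2 + \<eta>\<^sup>2)" and ?D = "Dval shift_const E \<eta> x"
  have w: "0 \<le> ?w" using \<eta> by simp
  have "\<bar>x - E\<bar> \<le> bound1 p + max \<bar>lo\<bar> \<bar>hi\<bar>" using x E by auto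
  then have "(x - E)\<^sup>2 \<le> (bound1 p + max \<bar>lo\<bar> \<bar>hi\<bar>)\<^sup>2" using power_mono[of "\<bar>x - E\<bar>" _ 2] by simp
  moreover have "\<eta>\<^sup>2 \<le> 1" using \<eta> by (simp add: power_le_one)
  ultimately have "(x - E)\<^sup>2 + \<eta>\<^sup>2 \<le> shift_const" by (simp add: shift_const_def)
  then have D: "0 \<le> ?D" "?D \<le> decay_base \<eta>" using shift_const_ge by (auto simp: Dval_def decay_base_def field_simps)
  have "?D ^ n \<le> decay_base \<eta> ^ n" using D by (intro power_mono) auto
  also have "\<dots> \<le> \<eta> / 2" using n \<eta> by (simp add: pos_divide_le_eq)
  finally have Dn: "?D ^ n \<le> 1 / 2" using \<eta> by simp
  have Q: "Qval shift_const E \<eta> n x = ?w * (1 - ?D ^ n)" using shift_const_ge \<eta> by (intro Qval_eq) auto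
  have "?w * (1 / 2) \<le> Qval shift_const E \<eta> n x" unfolding Q using Dn by (intro mult_left_mono w) auto
  then show "?w / 2 \<le> Qval shift_const E \<eta> n x" by simp
  then show "0 \<le> Qval shift_const E \<eta> n x" by (rule order_trans[rotated]) (rule divide_nonneg_pos[OF w], simp)
  have "?w * (1 - ?D ^ n) \<le> ?w * 1" using D by (intro mult_left_mono w) simp
  then show "Qval shift_const E \<eta> n x \<le> ?w" unfolding Q by simp
qed

text \<open>Equals \<open>1 / (4 C0)\<close> times the scale ratio \<open>1 / (32 C0^2)\<close>
  chosen in \<open>spec_count\<close>.\<close>

definition c1 :: real where "c1 = 1 / (128 * C0 ^ 3)"

lemma c1_pos: "0 < c1" using C0 by (simp add: c1_def)

text \<open>Two scales are compared. The smoothed count at \<open>\<delta> \<eta>\<close> is at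
  least \<open>N / (2 C0)\<close>. Outside the window its kernel is at most
  \<open>4 \<delta>\<close> times the kernel at \<eta>, whose total is at most
  \<open>2 C0 N\<close>; the choice of \<delta> makes this \<open>N / (4 C0)\<close>. The remaining
  \<open>N / (4 C0)\<close> comes from the window, where each eigenvalue counts at most
  \<open>1 / (\<delta> \<eta>)\<close>.\<close>

lemma spec_count:
  assumes \<eta>: "0 < \<eta>" "\<eta> \<le> 1"
  shows "\<forall>\<^sub>F N in along NN. \<forall>ev \<phi>. ebasis N ev \<phi> \<longrightarrow> (\<forall>E\<in>energies.
     c1 * \<eta> * real N \<le> real (card (spec_index (CARD('r) * N) ev {E - \<eta>..E + \<eta>})))"
proof -
  define \<delta> where "\<delta> = 1 / (32 * C0\<^sup>2)"
  define \<epsilon> where "\<epsilon> = 1 / (4 * C0 * real CARD('r))"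
  have \<delta>: "0 < \<delta>" "\<delta> \<le> 1" using C0 by (auto simp: \<delta>_def divide_le_eq one_le_power intro: order_trans[of 1 "C0\<^sup>2"])
  have \<eta>': "0 < \<delta> * \<eta>" "\<delta> * \<eta> \<le> 1" using \<delta> \<eta> by (auto intro: mult_le_one)
  have \<epsilon>: "0 < \<epsilon>" using C0 by (simp add: \<epsilon>_def)
  have \<epsilon>2: "\<epsilon> \<le> 1 / 2"
  proof -
    have "2 * 1 \<le> (4 * C0) * real CARD('r)" using C0 by (intro mult_mono) (auto simp: Suc_le_eq)
    then show ?thesis unfolding \<epsilon>_def by (simp add: divide_le_eq)
  qed
  obtain n1 where n1: "decay_base \<eta> ^ n1 / \<eta> \<le> \<epsilon>" using err_small[OF \<eta> \<epsilon>] by blast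
  obtain n2 where n2: "decay_base (\<delta> * \<eta>) ^ n2 / (\<delta> * \<eta>) \<le> \<epsilon>" using err_small[OF \<eta>' \<epsilon>] by blast
  from smoothed_count[OF \<eta> n1[unfolded \<epsilon>_def]] smoothed_count[OF \<eta>' n2[unfolded \<epsilon>_def]] eventually_NN
  show ?thesis
  proof eventually_elim
    case (elim N)
    show ?case
    proof (intro allI impI ballI)
      fix ev \<phi> E assume e: "ebasis N ev \<phi>" and E: "E \<in> energies"
      let ?A = "{1..CARD('r) * N}"
      let ?\<Lambda> = "spec_index (CARD('r) * N) ev {E - \<eta>..E + \<eta>}"
      let ?q1 = "\<lambda>\<alpha>. Qval shift_const E \<eta> n1 (ev \<alpha>)" and ?q2 = "\<lambda>\<alpha>. Qval shift_const E (\<delta> * \<eta>) n2 (ev \<alpha>)"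
      have evb: "\<bar>ev \<alpha>\<bar> \<le> bound1 p" if "\<alpha> \<in> ?A" for \<alpha> by (rule ev_bounded[OF elim(3) e that])
      have sub: "?\<Lambda> \<subseteq> ?A" by (auto simp: spec_index_def)
      have pt: "?q2 \<alpha> \<le> (if \<alpha> \<in> ?\<Lambda> then 1 / (\<delta> * \<eta>) else 0) + 4 * \<delta> * ?q1 \<alpha>" if \<alpha>: "\<alpha> \<in> ?A" for \<alpha>
      proof -
        let ?x = "(ev \<alpha> - E)\<^sup>2"
        note q1 = Qval_bounds[OF E \<eta> evb[OF \<alpha>] order_trans[OF n1 \<epsilon>2]]
        note q2 = Qval_bounds[OF E \<eta>' evb[OF \<alpha>] order_trans[OF n2 \<epsilon>2]]
        show ?thesis
        proof (cases "\<alpha> \<in> ?\<Lambda>")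
          case True
          have "?q2 \<alpha> \<le> (\<delta> * \<eta>) / (?x + (\<delta> * \<eta>)\<^sup>2)" by (rule q2(2))
          also have "\<dots> \<le> (\<delta> * \<eta>) / (\<delta> * \<eta>)\<^sup>2" using \<eta>' by (intro divide_left_mono mult_pos_pos add_nonneg_pos) auto
          also have "\<dots> = 1 / (\<delta> * \<eta>)" using \<eta>' by (simp add: power2_eq_square)
          finally have "?q2 \<alpha> \<le> 1 / (\<delta> * \<eta>)" .
          moreover have "0 \<le> 4 * \<delta> * ?q1 \<alpha>" using q1(3) \<delta> by simp
          ultimately show ?thesis using True by simp
        next
          case False
          then have "\<eta> < \<bar>ev \<alpha> - E\<bar>" using \<alpha> by (auto simp: spec_index_def)
          then have far: "\<eta>\<^sup>2 \<le> ?x" using \<eta> power_mono[of \<eta> "\<bar>ev \<alpha> - E\<bar>" 2] by simp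
          have xp: "0 < ?x" using far \<eta> by (smt (verit) zero_less_power)
          have "?q2 \<alpha> \<le> (\<delta> * \<eta>) / (?x + (\<delta> * \<eta>)\<^sup>2)" by (rule q2(2))
          \<comment> \<open>Off the window \<open>(ev \<alpha> - E)^2\<close> is at least
            \<open>\<eta>^2\<close>, so the denominators compare up to a factor 2; truncation gives
            the other factor 2 in \<open>4 \<delta>\<close>.\<close>
          also have "\<dots> \<le> (\<delta> * \<eta>) / ((?x + \<eta>\<^sup>2) / 2)"
          proof (rule divide_left_mono)
            have aux: "y \<le> x \<Longrightarrow> 0 \<le> z \<Longrightarrow> (x + y) / 2 \<le> x + z" for x y z :: real by simp
            show "(?x + \<eta>\<^sup>2) / 2 \<le> ?x + (\<delta> * \<eta>)\<^sup>2" using aux[OF far zero_le_power2] .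
          qed (use \<eta>' xp in \<open>auto intro!: mult_pos_pos add_pos_nonneg\<close>)
          also have "\<dots> = 4 * \<delta> * (\<eta> / (?x + \<eta>\<^sup>2) / 2)"
          proof -
            have "d * e / (s / 2) = 4 * d * (e / s / 2)" for d e s :: real by simp
            then show ?thesis .
          qed
          also have "\<dots> \<le> 4 * \<delta> * ?q1 \<alpha>" using \<delta> by (intro mult_left_mono q1(1)) auto
          finally show ?thesis using False by simp
        qed
      qed
      have "real N / (2 * C0) \<le> (\<Sum>\<alpha>\<in>?A. ?q2 \<alpha>)" using elim(2) e E by blast
      also have "\<dots> \<le> (\<Sum>\<alpha>\<in>?A. (if \<alpha> \<in> ?\<Lambda> then 1 / (\<delta> * \<eta>) else 0) + 4 * \<delta> * ?q1 \<alpha>)" by (intro sum_mono pt)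
      also have "\<dots> = real (card ?\<Lambda>) * (1 / (\<delta> * \<eta>)) + 4 * \<delta> * (\<Sum>\<alpha>\<in>?A. ?q1 \<alpha>)"
      proof -
        have "?A \<inter> ?\<Lambda> = ?\<Lambda>" using sub by blast
        then have "(\<Sum>\<alpha>\<in>?A. if \<alpha> \<in> ?\<Lambda> then 1 / (\<delta> * \<eta>) else 0) = real (card ?\<Lambda>) * (1 / (\<delta> * \<eta>))"
          by (subst sum.inter_restrict[symmetric]) simp_all
        then show ?thesis by (simp only: sum.distrib sum_distrib_left)
      qed
      also have "\<dots> \<le> real (card ?\<Lambda>) * (1 / (\<delta> * \<eta>)) + 4 * \<delta> * (2 * C0 * real N)"
        using elim(1) e E \<delta> by (intro add_left_mono mult_left_mono) auto
      also have "4 * \<delta> * (2 * C0 * real N) = real N / (4 * C0)" using C0 by (simp add: \<delta>_def power2_eq_square)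
      finally have "real N / (4 * C0) \<le> real (card ?\<Lambda>) * (1 / (\<delta> * \<eta>))" by simp
      then have "real N / (4 * C0) * (\<delta> * \<eta>) \<le> real (card ?\<Lambda>)" using \<eta>' by (simp add: pos_le_divide_eq)
      moreover have "real N / (4 * C0) * (\<delta> * \<eta>) = c1 * \<eta> * real N" using C0 by (simp add: \<delta>_def c1_def power2_eq_square power3_eq_cube mult_ac)
      ultimately show "c1 * \<eta> * real N \<le> real (card ?\<Lambda>)" by simp
    qed
  qed
qed

end

section \<open>Expansion of the windowed trace into autocorrelations\<close>

lemma sum_swap3: "(\<Sum>x\<in>A. \<Sum>y\<in>B. \<Sum>g\<in>C. F x y g) = (\<Sum>g\<in>C. \<Sum>x\<in>A. \<Sum>y\<in>B. F x y g)"
proof -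
  have "(\<Sum>x\<in>A. \<Sum>y\<in>B. \<Sum>g\<in>C. F x y g) = (\<Sum>x\<in>A. \<Sum>g\<in>C. \<Sum>y\<in>B. F x y g)"
    by (intro sum.cong refl sum.swap)
  also have "\<dots> = (\<Sum>g\<in>C. \<Sum>x\<in>A. \<Sum>y\<in>B. F x y g)" by (rule sum.swap)
  finally show ?thesis .
qed

lemma sum_swap4:
  "(\<Sum>x\<in>A. \<Sum>y\<in>B. \<Sum>g\<in>C. \<Sum>h\<in>D. F x y g h) = (\<Sum>g\<in>C. \<Sum>h\<in>D. \<Sum>x\<in>A. \<Sum>y\<in>B. F x y g h)"
  by (subst sum_swap3, intro sum.cong refl, rule sum_swap3)

lemma sum_quad_swap:
  fixes F :: "'z \<Rightarrow> 'z \<Rightarrow> complex"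
  shows "(\<Sum>\<alpha>\<in>A. \<Sum>\<beta>\<in>B. \<Sum>z\<in>Z. \<Sum>z'\<in>Z. F z z' * (X \<alpha> z z' * Y \<beta> z z'))
     = (\<Sum>z\<in>Z. \<Sum>z'\<in>Z. F z z' * ((\<Sum>\<alpha>\<in>A. X \<alpha> z z') * (\<Sum>\<beta>\<in>B. Y \<beta> z z')))"
proof -
  have "(\<Sum>\<alpha>\<in>A. \<Sum>\<beta>\<in>B. \<Sum>z\<in>Z. \<Sum>z'\<in>Z. F z z' * (X \<alpha> z z' * Y \<beta> z z'))
      = (\<Sum>z\<in>Z. \<Sum>z'\<in>Z. \<Sum>\<alpha>\<in>A. \<Sum>\<beta>\<in>B. F z z' * (X \<alpha> z z' * Y \<beta> z z'))"
    by (rule sum_swap4)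
  also have "\<dots> = (\<Sum>z\<in>Z. \<Sum>z'\<in>Z. F z z' * ((\<Sum>\<alpha>\<in>A. X \<alpha> z z') * (\<Sum>\<beta>\<in>B. Y \<beta> z z')))"
    by (intro sum.cong refl) (subst sum_product, simp only: sum_distrib_left)
  finally show ?thesis .
qed

lemma norm_sum_le_card: "(cmod (\<Sum>i\<in>I. f i))\<^sup>2 \<le> real (card I) * (\<Sum>i\<in>I. (cmod (f i))\<^sup>2)"
proof -
  have "(cmod (\<Sum>i\<in>I. f i))\<^sup>2 \<le> (\<Sum>i\<in>I. \<bar>1\<bar> * \<bar>cmod (f i)\<bar>)\<^sup>2"
    by (intro power_mono order_trans[OF norm_sum]) auto
  also have "\<dots> \<le> (L2_set (\<lambda>i. 1) I * L2_set (\<lambda>i. cmod (f i)) I)\<^sup>2"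
    by (intro power_mono L2_set_mult_ineq sum_nonneg) auto
  also have "\<dots> = real (card I) * (\<Sum>i\<in>I. (cmod (f i))\<^sup>2)"
    by (simp add: L2_set_def power_mult_distrib sum_nonneg)
  finally show ?thesis .
qed

context qm_setup begin

text \<open>The contribution of one group element and one matrix entry. Passing to entries makes all
  factors commuting scalars, so that the trace can be rearranged freely.\<close>

definition entry_form :: "nat \<Rightarrow> 'g \<Rightarrow> (nat \<Rightarrow> complex^'r^'r) \<Rightarrow> 'r \<Rightarrow> 'r \<Rightarrow> (nat \<Rightarrow> complex^'r) \<Rightarrow> (nat \<Rightarrow> complex^'r) \<Rightarrow> complex" where
  "entry_form N t a i j u v = (\<Sum>y\<in>{1..N}. a y $ i $ j * (cnj (u (\<rho> N t y) $ i) * v y $ j))"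

definition autocorr :: "nat \<Rightarrow> (nat \<Rightarrow> complex^'r^'r) \<Rightarrow> 'r \<Rightarrow> 'r \<Rightarrow> 'r \<Rightarrow> 'r \<Rightarrow> 'g \<Rightarrow> complex" where
  "autocorr N a i j l k g = (1 / of_nat N) * (\<Sum>y\<in>{1..N}. a (\<rho> N g y) $ i $ j * cnj (a y $ l $ k))"

text \<open>In the expansion of the trace, the coefficients at \<open>g\<close> and \<open>h\<close> contribute at full order \<open>N\<close> only if
  \<open>h = t g\<^sup>-\<^sup>1 t\<^sup>-\<^sup>1\<close>; \<open>defect\<close> is the density of the other coincidences, which vanishes in the limit.\<close>

definition defect :: "nat \<Rightarrow> nat \<Rightarrow> 'g \<Rightarrow> real" where
  "defect N n t = (\<Sum>g\<in>coeff_ball n. \<Sum>h\<in>coeff_ball n. of_bool (h \<noteq> t - g - t) * fixfrac N (\<rho> N) (- t + h + t + g))"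

text \<open>Writing the square with two points \<open>y\<close> and \<open>y'\<close> decouples the
  sums over \<alpha> and \<beta>; each then becomes a kernel by
  \<open>kernel_spectral\<close>.\<close>

lemma quad_entry:
  assumes N: "N \<in> NN" and e: "ebasis N ev \<phi>"
  shows "(\<Sum>\<alpha>\<in>{1..CARD('r) * N}. \<Sum>\<beta>\<in>{1..CARD('r) * N}.
       complex_of_real (Qval shift_const E1 \<eta> n (ev \<alpha>)) * complex_of_real (Qval shift_const E2 \<eta> n (ev \<beta>)) * (entry_form N t a i j (\<phi> \<beta>) (\<phi> \<alpha>) * cnj (entry_form N t a l k (\<phi> \<beta>) (\<phi> \<alpha>))))
    = (\<Sum>y\<in>{1..N}. \<Sum>y'\<in>{1..N}. (a y $ i $ j * cnj (a y' $ l $ k)) *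
         (approx_kernel E1 \<eta> n N y y' j k * approx_kernel E2 \<eta> n N (\<rho> N t y') (\<rho> N t y) l i))"
    (is "?L = ?R")
proof -
  let ?A = "{1..CARD('r) * N}"
  let ?X = "\<lambda>\<alpha> y y'. Qval shift_const E1 \<eta> n (ev \<alpha>) * (\<phi> \<alpha> y $ j * cnj (\<phi> \<alpha> y' $ k))"
  let ?Y = "\<lambda>\<beta> y y'. Qval shift_const E2 \<eta> n (ev \<beta>) * (\<phi> \<beta> (\<rho> N t y') $ l * cnj (\<phi> \<beta> (\<rho> N t y) $ i))"
  have "?L = (\<Sum>\<alpha>\<in>?A. \<Sum>\<beta>\<in>?A. \<Sum>y\<in>{1..N}. \<Sum>y'\<in>{1..N}. (a y $ i $ j * cnj (a y' $ l $ k)) * (?X \<alpha> y y' * ?Y \<beta> y y'))"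
  proof (intro sum.cong refl)
    fix \<alpha> \<beta>
    have "entry_form N t a i j (\<phi> \<beta>) (\<phi> \<alpha>) * cnj (entry_form N t a l k (\<phi> \<beta>) (\<phi> \<alpha>))
        = (\<Sum>y\<in>{1..N}. \<Sum>y'\<in>{1..N}. (a y $ i $ j * (cnj (\<phi> \<beta> (\<rho> N t y) $ i) * \<phi> \<alpha> y $ j)) * cnj (a y' $ l $ k * (cnj (\<phi> \<beta> (\<rho> N t y') $ l) * \<phi> \<alpha> y' $ k)))"
      by (simp only: entry_form_def cnj_sum sum_product)
    then show "complex_of_real (Qval shift_const E1 \<eta> n (ev \<alpha>)) * complex_of_real (Qval shift_const E2 \<eta> n (ev \<beta>)) * (entry_form N t a i j (\<phi> \<beta>) (\<phi> \<alpha>) * cnj (entry_form N t a l k (\<phi> \<beta>) (\<phi> \<alpha>)))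
        = (\<Sum>y\<in>{1..N}. \<Sum>y'\<in>{1..N}. (a y $ i $ j * cnj (a y' $ l $ k)) * (?X \<alpha> y y' * ?Y \<beta> y y'))"
      by (simp only: sum_distrib_left complex_cnj_mult complex_cnj_cnj) (simp only: mult_ac)
  qed
  also have "\<dots> = (\<Sum>y\<in>{1..N}. \<Sum>y'\<in>{1..N}. (a y $ i $ j * cnj (a y' $ l $ k)) * ((\<Sum>\<alpha>\<in>?A. ?X \<alpha> y y') * (\<Sum>\<beta>\<in>?A. ?Y \<beta> y y')))"
    by (rule sum_quad_swap)
  also have "\<dots> = ?R"
  proof (intro sum.cong refl)
    fix y y' assume y: "y \<in> {1..N}" "y' \<in> {1..N}"
    have "\<rho> N t y \<in> {1..N}" "\<rho> N t y' \<in> {1..N}" using rho_in[OF N] y by blast+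
    then show "(a y $ i $ j * cnj (a y' $ l $ k)) * ((\<Sum>\<alpha>\<in>?A. ?X \<alpha> y y') * (\<Sum>\<beta>\<in>?A. ?Y \<beta> y y'))
       = (a y $ i $ j * cnj (a y' $ l $ k)) * (approx_kernel E1 \<eta> n N y y' j k * approx_kernel E2 \<eta> n N (\<rho> N t y') (\<rho> N t y) l i)"
      by (simp only: kernel_spectral[OF N e] y)
  qed
  finally show ?thesis .
qed

text \<open>The first indicator forces \<open>y = g.y'\<close>; the second then says that
  \<open>y'\<close> is a fixed point of a single group element, whose density of fixed points is
  known in the limit.\<close>

lemma inner_pairs:
  assumes N: "N \<in> NN"
  shows "(\<Sum>y\<in>{1..N}. \<Sum>y'\<in>{1..N}. f y y' * (of_bool (\<rho> N (- g) y = y') * of_bool (\<rho> N (- h) (\<rho> N t y') = \<rho> N t y)))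
     = (\<Sum>y\<in>{1..N}. f (\<rho> N g y) y * of_bool (\<rho> N (- t + h + t + g) y = y) :: complex)"
proof -
  interpret group_action "\<rho> N" by (rule group_act[OF N])
  have iff1: "\<rho> N (- g) y = y' \<longleftrightarrow> y = \<rho> N g y'" for y y' by (metis act_minus)
  have iff2: "\<rho> N (- h) (\<rho> N t y') = \<rho> N t (\<rho> N g y') \<longleftrightarrow> \<rho> N (- t + h + t + g) y' = y'" for y'
  proof -
    have "\<rho> N (- t + h + t + g) y' = \<rho> N (- t) (\<rho> N h (\<rho> N t (\<rho> N g y')))" by (simp only: act_add)
    then show ?thesis by (metis act_minus)
  qed
  have "(\<Sum>y\<in>{1..N}. \<Sum>y'\<in>{1..N}. f y y' * (of_bool (\<rho> N (- g) y = y') * of_bool (\<rho> N (- h) (\<rho> N t y') = \<rho> N t y)))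
      = (\<Sum>y'\<in>{1..N}. \<Sum>y\<in>{1..N}. (f y y' * of_bool (\<rho> N (- h) (\<rho> N t y') = \<rho> N t y)) * of_bool (y = \<rho> N g y'))"
    by (subst sum.swap) (simp only: iff1 mult_ac)
  also have "\<dots> = (\<Sum>y'\<in>{1..N}. f (\<rho> N g y') y' * of_bool (\<rho> N (- h) (\<rho> N t y') = \<rho> N t (\<rho> N g y')))"
    using rho_in[OF N] by (intro sum.cong refl sum_indicator_mult) blast+
  finally show ?thesis by (simp only: iff2)
qed

text \<open>The pairs with trivial group element form the autocorrelation sum exactly. For the
  others the coefficients are at most \<open>C2\<close> and the centred values at most 2, hence the
  constant \<open>4 * C2^2\<close> before \<open>defect\<close>.\<close>

lemma entry_bound:
  assumes N: "N \<in> NN" and a: "\<And>y i j. y \<in> {1..N} \<Longrightarrow> cmod (a y $ i $ j) \<le> 2"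
    and E: "E1 \<in> energies" "E2 \<in> energies" and \<eta>: "0 < \<eta>" "\<eta> \<le> 1" "decay_base \<eta> ^ n / \<eta> \<le> 1"
  shows "cmod (\<Sum>y\<in>{1..N}. \<Sum>y'\<in>{1..N}. (a y $ i $ j * cnj (a y' $ l $ k)) *
         (approx_kernel E1 \<eta> n N y y' j k * approx_kernel E2 \<eta> n N (\<rho> N t y') (\<rho> N t y) l i))
    \<le> real N * (cmod (\<Sum>g\<in>coeff_ball n. autocorr N a i j l k g * (approx_coeff E1 \<eta> n g $ j $ k * approx_coeff E2 \<eta> n (t - g - t) $ l $ i))
        + 4 * C2\<^sup>2 * defect N n t)"
proof -
  interpret group_action "\<rho> N" by (rule group_act[OF N])
  let ?q1 = "\<lambda>g. approx_coeff E1 \<eta> n g $ j $ k" and ?q2 = "\<lambda>g. approx_coeff E2 \<eta> n g $ l $ i"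
  let ?f = "\<lambda>y y'. a y $ i $ j * cnj (a y' $ l $ k)"
  define W where "W = (\<lambda>g h. \<Sum>y\<in>{1..N}. ?f (\<rho> N g y) y * of_bool (\<rho> N (- t + h + t + g) y = y))"
  have Npos: "0 < real N" using NN_pos[OF N] by simp
  have "(\<Sum>y\<in>{1..N}. \<Sum>y'\<in>{1..N}. ?f y y' * (approx_kernel E1 \<eta> n N y y' j k * approx_kernel E2 \<eta> n N (\<rho> N t y') (\<rho> N t y) l i))
     = (\<Sum>y\<in>{1..N}. \<Sum>y'\<in>{1..N}. \<Sum>g\<in>coeff_ball n. \<Sum>h\<in>coeff_ball n. (?q1 g * ?q2 h) * (?f y y' * (of_bool (\<rho> N (- g) y = y') * of_bool (\<rho> N (- h) (\<rho> N t y') = \<rho> N t y))))"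
  proof -
    have "approx_kernel E1 \<eta> n N y y' j k * approx_kernel E2 \<eta> n N (\<rho> N t y') (\<rho> N t y) l i
        = (\<Sum>g\<in>coeff_ball n. \<Sum>h\<in>coeff_ball n. (?q1 g * of_bool (\<rho> N (- g) y = y')) * (?q2 h * of_bool (\<rho> N (- h) (\<rho> N t y') = \<rho> N t y)))" for y y'
      by (simp only: approx_kernel_def sum_product)
    then show ?thesis by (simp only: sum_distrib_left) (simp only: mult_ac)
  qed
  also have "\<dots> = (\<Sum>g\<in>coeff_ball n. \<Sum>h\<in>coeff_ball n. \<Sum>y\<in>{1..N}. \<Sum>y'\<in>{1..N}. (?q1 g * ?q2 h) * (?f y y' * (of_bool (\<rho> N (- g) y = y') * of_bool (\<rho> N (- h) (\<rho> N t y') = \<rho> N t y))))"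
    by (rule sum_swap4)
  also have "\<dots> = (\<Sum>g\<in>coeff_ball n. \<Sum>h\<in>coeff_ball n. (?q1 g * ?q2 h) * W g h)"
    by (simp only: sum_distrib_left[symmetric] inner_pairs[OF N] W_def)
  also have "\<dots> = (\<Sum>g\<in>coeff_ball n. \<Sum>h\<in>coeff_ball n. ((?q1 g * ?q2 h) * W g h) * of_bool (h = t - g - t)
        + of_bool (h \<noteq> t - g - t) * ((?q1 g * ?q2 h) * W g h))"
    by (intro sum.cong refl) auto
  also have "\<dots> = (\<Sum>g\<in>coeff_ball n. \<Sum>h\<in>coeff_ball n. ((?q1 g * ?q2 h) * W g h) * of_bool (h = t - g - t))
        + (\<Sum>g\<in>coeff_ball n. \<Sum>h\<in>coeff_ball n. of_bool (h \<noteq> t - g - t) * ((?q1 g * ?q2 h) * W g h))"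
    by (simp only: sum.distrib)
  also have "(\<Sum>g\<in>coeff_ball n. \<Sum>h\<in>coeff_ball n. ((?q1 g * ?q2 h) * W g h) * of_bool (h = t - g - t))
      = of_nat N * (\<Sum>g\<in>coeff_ball n. autocorr N a i j l k g * (?q1 g * ?q2 (t - g - t)))"
  proof -
    have "(\<Sum>h\<in>coeff_ball n. ((?q1 g * ?q2 h) * W g h) * of_bool (h = t - g - t)) = of_nat N * (autocorr N a i j l k g * (?q1 g * ?q2 (t - g - t)))" for g
    proof -
      have z: "- t + (t - g - t) + t + g = 0" by (simp add: diff_conv_add_uminus add.assoc del: add_uminus_conv_diff)
      have W0: "W g (t - g - t) = of_nat N * autocorr N a i j l k g"
        using Npos unfolding W_def z by (simp add: autocorr_def)
      show ?thesis
      proof (cases "t - g - t \<in> coeff_ball n")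
        case True
        show ?thesis by (subst sum_indicator_mult[OF coeff_ball_finite True]) (simp add: W0)
      next
        \<comment> \<open>If the partner of \<open>g\<close> leaves the ball, its coefficient is 0,
          so nothing is lost on either side.\<close>
        case False
        have "(\<Sum>h\<in>coeff_ball n. ((?q1 g * ?q2 h) * W g h) * of_bool (h = t - g - t)) = 0"
          using False by (intro sum.neutral) auto
        then show ?thesis using approx_coeff_support[OF False] by simp
      qed
    qed
    then show ?thesis by (simp only: sum_distrib_left)
  qed
  finally have eq: "(\<Sum>y\<in>{1..N}. \<Sum>y'\<in>{1..N}. ?f y y' * (approx_kernel E1 \<eta> n N y y' j k * approx_kernel E2 \<eta> n N (\<rho> N t y') (\<rho> N t y) l i))
      = of_nat N * (\<Sum>g\<in>coeff_ball n. autocorr N a i j l k g * (?q1 g * ?q2 (t - g - t)))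
        + (\<Sum>g\<in>coeff_ball n. \<Sum>h\<in>coeff_ball n. of_bool (h \<noteq> t - g - t) * ((?q1 g * ?q2 h) * W g h))" .
  have rest: "cmod (\<Sum>g\<in>coeff_ball n. \<Sum>h\<in>coeff_ball n. of_bool (h \<noteq> t - g - t) * ((?q1 g * ?q2 h) * W g h)) \<le> real N * (4 * C2\<^sup>2 * defect N n t)"
  proof -
    have tm: "cmod (of_bool (h \<noteq> t - g - t) * ((?q1 g * ?q2 h) * W g h))
        \<le> (real N * (4 * C2\<^sup>2)) * (of_bool (h \<noteq> t - g - t) * fixfrac N (\<rho> N) (- t + h + t + g))" for g h
    proof -
      have f4: "cmod (?f (\<rho> N g y) y) \<le> 2 * 2" if "y \<in> {1..N}" for y
      proof -
        have "\<rho> N g y \<in> {1..N}" using rho_in[OF N] that by blast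
        then show ?thesis unfolding norm_mult complex_mod_cnj using that by (intro mult_mono a) auto
      qed
      have "cmod (W g h) \<le> (\<Sum>y\<in>{1..N}. 4 * of_bool (\<rho> N (- t + h + t + g) y = y))"
        unfolding W_def
      proof (intro order_trans[OF norm_sum] sum_mono)
        fix y assume "y \<in> {1..N}"
        then show "cmod (?f (\<rho> N g y) y * of_bool (\<rho> N (- t + h + t + g) y = y)) \<le> 4 * of_bool (\<rho> N (- t + h + t + g) y = y)"
          using f4[of y] by (cases "\<rho> N (- t + h + t + g) y = y") auto
      qed
      also have "\<dots> = 4 * (real N * fixfrac N (\<rho> N) (- t + h + t + g))"
        by (simp only: sum_distrib_left[symmetric] fixed_count[OF N])
      finally have W: "cmod (W g h) \<le> 4 * (real N * fixfrac N (\<rho> N) (- t + h + t + g))" .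
      have "cmod (?q1 g * ?q2 h * W g h) \<le> (C2 * C2) * (4 * (real N * fixfrac N (\<rho> N) (- t + h + t + g)))"
        unfolding norm_mult using C2_pos approx_coeff_le[OF E(1) \<eta>] approx_coeff_le[OF E(2) \<eta>]
        by (intro mult_mono W) (auto simp: C2_def)
      then show ?thesis by (cases "h = t - g - t") (auto simp: power2_eq_square mult_ac)
    qed
    have "cmod (\<Sum>g\<in>coeff_ball n. \<Sum>h\<in>coeff_ball n. of_bool (h \<noteq> t - g - t) * ((?q1 g * ?q2 h) * W g h))
        \<le> (\<Sum>g\<in>coeff_ball n. \<Sum>h\<in>coeff_ball n. (real N * (4 * C2\<^sup>2)) * (of_bool (h \<noteq> t - g - t) * fixfrac N (\<rho> N) (- t + h + t + g)))"
      by (intro order_trans[OF norm_sum] sum_mono order_trans[OF norm_sum] tm)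
    also have "\<dots> = real N * (4 * C2\<^sup>2 * defect N n t)"
      by (simp only: sum_distrib_left[symmetric] defect_def mult.assoc)
    finally show ?thesis .
  qed
  show ?thesis
    unfolding eq using rest
    by (intro order_trans[OF norm_triangle_ineq]) (simp add: norm_mult ring_distribs)
qed

lemma defect_small:
  assumes "0 < \<epsilon>" shows "\<forall>\<^sub>F N in along NN. B * defect N n t < \<epsilon>"
proof -
  have "((\<lambda>N. B * defect N n t) \<longlongrightarrow> B * (\<Sum>g\<in>coeff_ball n. \<Sum>h\<in>coeff_ball n. 0)) (along NN)"
    unfolding defect_def
  proof (intro tendsto_intros)
    fix g h
    show "((\<lambda>N. of_bool (h \<noteq> t - g - t) * fixfrac N (\<rho> N) (- t + h + t + g)) \<longlongrightarrow> 0) (along NN)"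
    proof (cases "h = t - g - t")
      case False
      have "- t + h + t + g \<noteq> 0"
      proof
        assume "- t + h + t + g = 0"
        then have "- t + h + t = - g" by (simp add: eq_neg_iff_add_eq_0)
        then have "h = t + - g + - t" by (metis add.assoc add.right_neutral add_minus_cancel right_minus)
        then show False using False by simp
      qed
      then show ?thesis using tendsto_mult_right_zero[OF fixfrac_tendsto] by blast
    qed simp
  qed
  then show ?thesis using assms by (auto dest!: order_tendstoD(2))
qed

lemma quad_bound:
  assumes N: "N \<in> NN" and e: "ebasis N ev \<phi>" and a: "\<And>y i j. y \<in> {1..N} \<Longrightarrow> cmod (a y $ i $ j) \<le> 2"
    and E: "E1 \<in> energies" "E2 \<in> energies" and \<eta>: "0 < \<eta>" "\<eta> \<le> 1" "decay_base \<eta> ^ n / \<eta> \<le> 1 / 2"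
  shows "(\<Sum>\<alpha>\<in>{1..CARD('r) * N}. \<Sum>\<beta>\<in>{1..CARD('r) * N}. Qval shift_const E1 \<eta> n (ev \<alpha>) * Qval shift_const E2 \<eta> n (ev \<beta>) *
       (cmod (\<Sum>i\<in>UNIV. \<Sum>j\<in>UNIV. entry_form N t a i j (\<phi> \<beta>) (\<phi> \<alpha>)))\<^sup>2)
    \<le> real N * (\<Sum>i\<in>UNIV. \<Sum>j\<in>UNIV. \<Sum>l\<in>UNIV. \<Sum>k\<in>UNIV.
        cmod (\<Sum>g\<in>coeff_ball n. autocorr N a i j l k g * (approx_coeff E1 \<eta> n g $ j $ k * approx_coeff E2 \<eta> n (t - g - t) $ l $ i)) + 4 * C2\<^sup>2 * defect N n t)"
proof -
  let ?A = "{1..CARD('r) * N}"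
  let ?w = "\<lambda>\<alpha> \<beta>. complex_of_real (Qval shift_const E1 \<eta> n (ev \<alpha>)) * complex_of_real (Qval shift_const E2 \<eta> n (ev \<beta>))"
  let ?S = "\<lambda>i j \<alpha> \<beta>. entry_form N t a i j (\<phi> \<beta>) (\<phi> \<alpha>)"
  let ?Z = "(UNIV :: 'r set) \<times> (UNIV :: 'r set)"
  let ?L = "\<Sum>\<alpha>\<in>?A. \<Sum>\<beta>\<in>?A. Qval shift_const E1 \<eta> n (ev \<alpha>) * Qval shift_const E2 \<eta> n (ev \<beta>) * (cmod (\<Sum>i\<in>UNIV. \<Sum>j\<in>UNIV. ?S i j \<alpha> \<beta>))\<^sup>2"
  let ?T = "\<lambda>i j l k. \<Sum>\<alpha>\<in>?A. \<Sum>\<beta>\<in>?A. ?w \<alpha> \<beta> * (?S i j \<alpha> \<beta> * cnj (?S l k \<alpha> \<beta>))"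
  have "complex_of_real ?L = (\<Sum>\<alpha>\<in>?A. \<Sum>\<beta>\<in>?A. ?w \<alpha> \<beta> * ((\<Sum>z\<in>?Z. ?S (fst z) (snd z) \<alpha> \<beta>) * cnj (\<Sum>z\<in>?Z. ?S (fst z) (snd z) \<alpha> \<beta>)))"
    by (simp only: of_real_sum of_real_mult complex_norm_square sum.cartesian_product case_prod_unfold)
  also have "\<dots> = (\<Sum>\<alpha>\<in>?A. \<Sum>\<beta>\<in>?A. \<Sum>z\<in>?Z. \<Sum>z'\<in>?Z. ?w \<alpha> \<beta> * (?S (fst z) (snd z) \<alpha> \<beta> * cnj (?S (fst z') (snd z') \<alpha> \<beta>)))"
    by (simp only: cnj_sum sum_product) (simp only: sum_distrib_left)
  also have "\<dots> = (\<Sum>z\<in>?Z. \<Sum>z'\<in>?Z. ?T (fst z) (snd z) (fst z') (snd z'))"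
    by (rule sum_swap4)
  finally have eq: "complex_of_real ?L = (\<Sum>z\<in>?Z. \<Sum>z'\<in>?Z. ?T (fst z) (snd z) (fst z') (snd z'))" .
  have "?L \<le> cmod (complex_of_real ?L)" unfolding norm_of_real by (rule abs_ge_self)
  also have "\<dots> \<le> (\<Sum>z\<in>?Z. \<Sum>z'\<in>?Z. cmod (?T (fst z) (snd z) (fst z') (snd z')))"
    unfolding eq by (rule order_trans[OF norm_sum], rule sum_mono, rule norm_sum)
  also have "\<dots> \<le> (\<Sum>z\<in>?Z. \<Sum>z'\<in>?Z. real N * (cmod (\<Sum>g\<in>coeff_ball n. autocorr N a (fst z) (snd z) (fst z') (snd z') g *
      (approx_coeff E1 \<eta> n g $ snd z $ snd z' * approx_coeff E2 \<eta> n (t - g - t) $ fst z' $ fst z)) + 4 * C2\<^sup>2 * defect N n t))"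
  proof (rule sum_mono, rule sum_mono)
    fix z z' :: "'r \<times> 'r"
    have n1: "decay_base \<eta> ^ n / \<eta> \<le> 1" using \<eta>(3) by linarith
    show "cmod (?T (fst z) (snd z) (fst z') (snd z')) \<le> real N * (cmod (\<Sum>g\<in>coeff_ball n. autocorr N a (fst z) (snd z) (fst z') (snd z') g *
      (approx_coeff E1 \<eta> n g $ snd z $ snd z' * approx_coeff E2 \<eta> n (t - g - t) $ fst z' $ fst z)) + 4 * C2\<^sup>2 * defect N n t)"
      unfolding quad_entry[OF N e] by (rule entry_bound[OF N a E \<eta>(1,2) n1])
  qed
  also have "\<dots> = real N * (\<Sum>i\<in>UNIV. \<Sum>j\<in>UNIV. \<Sum>l\<in>UNIV. \<Sum>k\<in>UNIV.
        cmod (\<Sum>g\<in>coeff_ball n. autocorr N a i j l k g * (approx_coeff E1 \<eta> n g $ j $ k * approx_coeff E2 \<eta> n (t - g - t) $ l $ i)) + 4 * C2\<^sup>2 * defect N n t)"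
    by (simp only: sum_distrib_left sum.cartesian_product' fst_conv snd_conv)
  finally show ?thesis .
qed

end

section \<open>Decomposition of an observable along \<open>T\<close> and the resulting window
  estimate\<close>

lemma bessel_hilbert_schmidt:
  assumes I: "finite I" and A: "finite A" and f: "orthonormal_fam I A f"
  shows "(\<Sum>\<alpha>\<in>A. \<Sum>\<beta>\<in>A. (cmod (\<Sum>z\<in>I. cnj (f \<beta> z) * (\<Sum>w\<in>I. R z w * f \<alpha> w)))\<^sup>2) \<le> (\<Sum>z\<in>I. \<Sum>w\<in>I. (cmod (R z w))\<^sup>2)"
proof -
  have "(\<Sum>\<alpha>\<in>A. \<Sum>\<beta>\<in>A. (cmod (\<Sum>z\<in>I. cnj (f \<beta> z) * (\<Sum>w\<in>I. R z w * f \<alpha> w)))\<^sup>2)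
      \<le> (\<Sum>\<alpha>\<in>A. \<Sum>z\<in>I. (cmod (\<Sum>w\<in>I. R z w * f \<alpha> w))\<^sup>2)"
    by (intro sum_mono bessel[OF I A f])
  also have "\<dots> = (\<Sum>z\<in>I. \<Sum>\<alpha>\<in>A. (cmod (\<Sum>w\<in>I. R z w * f \<alpha> w))\<^sup>2)" by (rule sum.swap)
  also have "\<dots> \<le> (\<Sum>z\<in>I. \<Sum>w\<in>I. (cmod (R z w))\<^sup>2)"
  proof (rule sum_mono)
    fix z
    have "cmod (\<Sum>w\<in>I. R z w * f \<alpha> w) = cmod (\<Sum>w\<in>I. cnj (f \<alpha> w) * cnj (R z w))" for \<alpha>
    proof -
      have "(\<Sum>w\<in>I. cnj (f \<alpha> w) * cnj (R z w)) = cnj (\<Sum>w\<in>I. R z w * f \<alpha> w)" by (simp add: mult.commute)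
      then show ?thesis by (simp only: complex_mod_cnj)
    qed
    then have "(\<Sum>\<alpha>\<in>A. (cmod (\<Sum>w\<in>I. R z w * f \<alpha> w))\<^sup>2) \<le> (\<Sum>w\<in>I. (cmod (cnj (R z w)))\<^sup>2)"
      using bessel[OF I A f, of "\<lambda>w. cnj (R z w)"] by simp
    then show "(\<Sum>\<alpha>\<in>A. (cmod (\<Sum>w\<in>I. R z w * f \<alpha> w))\<^sup>2) \<le> (\<Sum>w\<in>I. (cmod (R z w))\<^sup>2)" by simp
  qed
  finally show ?thesis .
qed

lemma entry_le_hs_norm: "cmod ((A::complex^'r^'r) $ i $ j) \<le> hs_norm A"
proof -
  have "Re (trace (A ** conj_transpose A)) = (\<Sum>i\<in>UNIV. \<Sum>j\<in>UNIV. (cmod (A $ i $ j))\<^sup>2)"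
    by (simp add: trace_def matrix_matrix_mult_def conj_transpose_nth complex_norm_square[symmetric] del: of_real_power)
  moreover have "(cmod (A $ i $ j))\<^sup>2 \<le> (\<Sum>i\<in>UNIV. \<Sum>j\<in>UNIV. (cmod (A $ i $ j))\<^sup>2)"
    by (rule order_trans[OF member_le_sum[of j UNIV "\<lambda>j. (cmod (A $ i $ j))\<^sup>2"] member_le_sum[of i UNIV "\<lambda>i. \<Sum>j\<in>UNIV. (cmod (A $ i $ j))\<^sup>2"]])
      (auto intro: sum_nonneg)
  ultimately show ?thesis unfolding hs_norm_def by (simp add: real_le_rsqrt)
qed

lemma norm_1_inf_entry:
  assumes "norm_1_inf N K \<le> 1" "x \<in> {1..N}" "y \<in> {1..N}"
  shows "cmod (K x y $ i $ j) \<le> 1"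
proof -
  have "hs_norm (K x y) \<le> norm_1_inf N K"
    unfolding norm_1_inf_def using assms(2,3) by (intro Max_ge) (auto intro!: image_eqI[of _ _ "(x, y)"])
  then show ?thesis using entry_le_hs_norm[of "K x y" i j] assms(1) by linarith
qed

context qm_setup begin

definition centred :: "nat \<Rightarrow> (nat \<Rightarrow> nat \<Rightarrow> complex^'r^'r) \<Rightarrow> 'g \<Rightarrow> nat \<Rightarrow> complex^'r^'r" where
  "centred N K t y = K (\<rho> N t y) y - avg N (\<lambda>x. K (\<rho> N t x) x)"

lemma avg_entry_le:
  assumes "\<And>x. x \<in> {1..N} \<Longrightarrow> cmod ((a x :: complex^'r^'r) $ i $ j) \<le> B" "0 \<le> B"
  shows "cmod (avg N a $ i $ j) \<le> B"
proof -
  have "cmod (avg N a $ i $ j) = 1 / real N * cmod (\<Sum>x\<in>{1..N}. a x $ i $ j)"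
    by (simp add: avg_def sum_component norm_divide)
  also have "\<dots> \<le> 1 / real N * (\<Sum>x\<in>{1..N}. B)"
    by (intro mult_left_mono order_trans[OF norm_sum] sum_mono assms) auto
  also have "\<dots> \<le> B" using assms(2) by (cases "N = 0") auto
  finally show ?thesis .
qed

lemma centred_le:
  assumes N: "N \<in> NN" and K: "norm_1_inf N K \<le> 1" and y: "y \<in> {1..N}"
  shows "cmod (centred N K t y $ i $ j) \<le> 2"
proof -
  have k: "cmod (K (\<rho> N t x) x $ i $ j) \<le> 1" if "x \<in> {1..N}" for x
    using rho_in[OF N] that by (intro norm_1_inf_entry[OF K]) blast+
  have "cmod (avg N (\<lambda>x. K (\<rho> N t x) x) $ i $ j) \<le> 1" using k by (intro avg_entry_le) auto
  then show ?thesis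
    using k[OF y] norm_triangle_ineq4[of "K (\<rho> N t y) y $ i $ j" "avg N (\<lambda>x. K (\<rho> N t x) x) $ i $ j"]
    by (simp add: centred_def)
qed

definition form :: "nat \<Rightarrow> (nat \<Rightarrow> nat \<Rightarrow> complex^'r^'r) \<Rightarrow> (nat \<Rightarrow> complex^'r) \<Rightarrow> (nat \<Rightarrow> complex^'r) \<Rightarrow> complex" where
  "form N M u v = (\<Sum>x\<in>{1..N}. \<Sum>y\<in>{1..N}. \<Sum>i\<in>UNIV. \<Sum>j\<in>UNIV. cnj (u x $ i) * (M x y $ i $ j * v y $ j))"

lemma vec_inner_form: "vec_inner N u (mat_app N M v) = form N M u v"
proof -
  have "vec_inner N u (mat_app N M v) = (\<Sum>x\<in>{1..N}. \<Sum>i\<in>UNIV. \<Sum>y\<in>{1..N}. \<Sum>j\<in>UNIV. cnj (u x $ i) * (M x y $ i $ j * v y $ j))"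
    by (simp add: vec_inner_def mat_app_def sum_component matrix_vector_mult_def sum_distrib_left)
  also have "\<dots> = form N M u v" unfolding form_def by (intro sum.cong refl sum.swap)
  finally show ?thesis .
qed

lemma form_add: "form N (\<lambda>x y. M x y + M' x y) u v = form N M u v + form N M' u v"
  by (simp add: form_def sum.distrib ring_distribs)

lemma form_diff: "form N (\<lambda>x y. M x y - M' x y) u v = form N M u v - form N M' u v"
  by (simp add: form_def sum_subtractf ring_distribs)

lemma form_sum: "finite T \<Longrightarrow> form N (\<lambda>x y. \<Sum>t\<in>T. M t x y) u v = (\<Sum>t\<in>T. form N (M t) u v)"
  by (induction T rule: finite_induct) (simp_all add: form_add, simp add: form_def)

lemma form_cong: "(\<And>x y. x \<in> {1..N} \<Longrightarrow> y \<in> {1..N} \<Longrightarrow> M x y = M' x y) \<Longrightarrow> form N M u v = form N M' u v"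
  unfolding form_def by (intro sum.cong refl) simp

lemma form_Sij:
  assumes N: "N \<in> NN"
  shows "form N (\<lambda>x y. of_bool (x = \<rho> N t y) *\<^sub>R a y) u v = (\<Sum>i\<in>UNIV. \<Sum>j\<in>UNIV. entry_form N t a i j u v)"
proof -
  have "form N (\<lambda>x y. of_bool (x = \<rho> N t y) *\<^sub>R a y) u v
     = (\<Sum>y\<in>{1..N}. \<Sum>x\<in>{1..N}. (\<Sum>i\<in>UNIV. \<Sum>j\<in>UNIV. a y $ i $ j * (cnj (u x $ i) * v y $ j)) * of_bool (x = \<rho> N t y))"
    unfolding form_def by (subst sum.swap) (intro sum.cong refl, simp add: sum_distrib_right mult_ac of_bool_def)
  also have "\<dots> = (\<Sum>y\<in>{1..N}. \<Sum>i\<in>UNIV. \<Sum>j\<in>UNIV. a y $ i $ j * (cnj (u (\<rho> N t y) $ i) * v y $ j))"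
    using rho_in[OF N] by (intro sum.cong refl sum_indicator_mult) blast+
  also have "\<dots> = (\<Sum>i\<in>UNIV. \<Sum>j\<in>UNIV. \<Sum>y\<in>{1..N}. a y $ i $ j * (cnj (u (\<rho> N t y) $ i) * v y $ j))"
    by (subst sum.swap, intro sum.cong refl, rule sum.swap)
  finally show ?thesis by (simp only: entry_form_def)
qed

text \<open>The decomposition of \<open>K\<close> according to the elements of \<open>T\<close> counts an entry several times when
  distinct elements of \<open>T\<close> act identically at a point.\<close>

definition overlap_rem :: "nat \<Rightarrow> 'g set \<Rightarrow> (nat \<Rightarrow> nat \<Rightarrow> complex^'r^'r) \<Rightarrow> nat \<Rightarrow> nat \<Rightarrow> complex^'r^'r" where
  "overlap_rem N T K x y = K x y - (\<Sum>t\<in>T. of_bool (x = \<rho> N t y) *\<^sub>R K x y)"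

lemma avg_obs_eq:
  assumes "finite T"
  shows "avg_obs N (\<rho> N) T K x y = (\<Sum>t\<in>T. of_bool (x = \<rho> N t y) *\<^sub>R avg N (\<lambda>x. K (\<rho> N t x) x))"
proof -
  let ?k = "\<lambda>t. avg N (\<lambda>x. K (\<rho> N t x) x)"
  have "avg_obs N (\<rho> N) T K x y = (\<Sum>t\<in>Poly_Mapping.keys (pm T ?k). perm_mat (\<rho> N t) x y *\<^sub>R Poly_Mapping.lookup (pm T ?k) t)"
    by (simp add: avg_obs_def rep_mat_def pm_def)
  also have "\<dots> = (\<Sum>t\<in>T. perm_mat (\<rho> N t) x y *\<^sub>R Poly_Mapping.lookup (pm T ?k) t)"
    using keys_pm[OF assms] by (intro sum.mono_neutral_left assms) (auto simp: in_keys_iff)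
  also have "\<dots> = (\<Sum>t\<in>T. of_bool (x = \<rho> N t y) *\<^sub>R ?k t)"
    by (intro sum.cong refl) (simp add: lookup_pm[OF assms] perm_mat_def)
  finally show ?thesis .
qed

text \<open>Subtracting the averaged observable subtracts the mean separately for each
  \<open>t\<close>, which centres every component; what multiple representations spoil is collected
  in \<open>overlap_rem\<close>.\<close>

lemma form_decomp:
  assumes N: "N \<in> NN" and T: "finite T"
  shows "form N K u v - form N (avg_obs N (\<rho> N) T K) u v
     = (\<Sum>t\<in>T. \<Sum>i\<in>UNIV. \<Sum>j\<in>UNIV. entry_form N t (centred N K t) i j u v) + form N (overlap_rem N T K) u v"
proof -
  have "form N (\<lambda>x y. K x y - avg_obs N (\<rho> N) T K x y) u v
      = form N (\<lambda>x y. (\<Sum>t\<in>T. of_bool (x = \<rho> N t y) *\<^sub>R centred N K t y) + overlap_rem N T K x y) u v"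
  proof (rule form_cong)
    fix x y
    have "(\<Sum>t\<in>T. of_bool (x = \<rho> N t y) *\<^sub>R centred N K t y)
        = (\<Sum>t\<in>T. of_bool (x = \<rho> N t y) *\<^sub>R K x y - of_bool (x = \<rho> N t y) *\<^sub>R avg N (\<lambda>x. K (\<rho> N t x) x))"
      by (intro sum.cong refl) (simp add: centred_def)
    then show "K x y - avg_obs N (\<rho> N) T K x y = (\<Sum>t\<in>T. of_bool (x = \<rho> N t y) *\<^sub>R centred N K t y) + overlap_rem N T K x y"
      by (simp add: overlap_rem_def avg_obs_eq[OF T] sum_subtractf)
  qed
  then show ?thesis by (simp only: form_diff form_add form_sum[OF T] form_Sij[OF N])
qed

text \<open>Where exactly one element of \<open>T\<close> carries \<open>y\<close> to
  \<open>x\<close>, the remainder vanishes. Elsewhere two distinct elements agree at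
  \<open>y\<close>, a fixed point of a nontrivial element, and an entry is at most
  \<open>card T + 1\<close>.\<close>

lemma overlap_rem_hs:
  assumes N: "N \<in> NN" and T: "finite T" and loc: "T_local N (\<rho> N) T K" and K: "norm_1_inf N K \<le> 1"
  shows "(\<Sum>x\<in>{1..N}. \<Sum>y\<in>{1..N}. \<Sum>i\<in>UNIV. \<Sum>j\<in>UNIV. (cmod (overlap_rem N T K x y $ i $ j))\<^sup>2)
    \<le> real N * ((real CARD('r))\<^sup>2 * (real (card T) + 1)\<^sup>2 * (\<Sum>(s, t)\<in>{(s, t)\<in>T \<times> T. s \<noteq> t}. fixfrac N (\<rho> N) (- t + s)))"
proof -
  let ?D = "{(s, t)\<in>T \<times> T. s \<noteq> t}"
  let ?c = "(real (card T) + 1)\<^sup>2"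
  have D: "finite ?D" using T by (auto intro: finite_subset[of _ "T \<times> T"])
  have pt: "(cmod (overlap_rem N T K x y $ i $ j))\<^sup>2 \<le> ?c * (\<Sum>(s, t)\<in>?D. of_bool (\<rho> N s y = \<rho> N t y) * of_bool (x = \<rho> N s y))"
    if x: "x \<in> {1..N}" and y: "y \<in> {1..N}" for x y i j
  proof (cases "\<exists>s t. (s, t) \<in> ?D \<and> x = \<rho> N s y \<and> x = \<rho> N t y")
    case True
    then obtain s t where st: "(s, t) \<in> ?D" "x = \<rho> N s y" "x = \<rho> N t y" by blast
    have "cmod (overlap_rem N T K x y $ i $ j) \<le> cmod (K x y $ i $ j) + cmod (\<Sum>t\<in>T. of_bool (x = \<rho> N t y) *\<^sub>R K x y $ i $ j)"
      unfolding overlap_rem_def by (simp add: sum_component norm_triangle_ineq4)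
    also have "\<dots> \<le> 1 + (\<Sum>t\<in>T. 1)"
    proof (intro add_mono norm_1_inf_entry[OF K x y] order_trans[OF norm_sum] sum_mono)
      fix t show "cmod (of_bool (x = \<rho> N t y) *\<^sub>R K x y $ i $ j) \<le> 1"
        using norm_1_inf_entry[OF K x y, of i j] by (cases "x = \<rho> N t y") auto
    qed
    finally have "(cmod (overlap_rem N T K x y $ i $ j))\<^sup>2 \<le> ?c" by (intro power_mono) auto
    also have "?c * 1 \<le> ?c * (\<Sum>(s, t)\<in>?D. of_bool (\<rho> N s y = \<rho> N t y) * of_bool (x = \<rho> N s y))"
    proof (rule mult_left_mono)
      have "(1::real) = (case (s, t) of (s, t) \<Rightarrow> of_bool (\<rho> N s y = \<rho> N t y) * of_bool (x = \<rho> N s y))"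
        using st by simp
      also have "\<dots> \<le> (\<Sum>(s, t)\<in>?D. of_bool (\<rho> N s y = \<rho> N t y) * of_bool (x = \<rho> N s y))"
        by (rule member_le_sum[OF st(1) _ D]) auto
      finally show "1 \<le> (\<Sum>(s, t)\<in>?D. of_bool (\<rho> N s y = \<rho> N t y) * of_bool (x = \<rho> N s y) :: real)" .
    qed simp
    finally show ?thesis by simp
  next
    case False
    have "overlap_rem N T K x y = 0"
    proof (cases "\<exists>t\<in>T. x = \<rho> N t y")
      case True
      then obtain t where t: "t \<in> T" "x = \<rho> N t y" by blast
      have "s = t" if "s \<in> T" "x = \<rho> N s y" for s using False that t by blast
      then have "(\<Sum>s\<in>T. of_bool (x = \<rho> N s y) *\<^sub>R K x y) = (\<Sum>s\<in>T. if s = t then K x y else 0)"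
        using t by (intro sum.cong refl) auto
      then show ?thesis using t T by (simp add: overlap_rem_def)
    next
      case False
      then have "K x y = 0" using loc x y unfolding T_local_def by blast
      then show ?thesis by (simp add: overlap_rem_def)
    qed
    moreover have "0 \<le> (\<Sum>(s, t)\<in>?D. of_bool (\<rho> N s y = \<rho> N t y) * of_bool (x = \<rho> N s y) :: real)"
      by (intro sum_nonneg) auto
    ultimately show ?thesis by simp
  qed
  have "(\<Sum>x\<in>{1..N}. \<Sum>y\<in>{1..N}. \<Sum>i\<in>(UNIV::'r set). \<Sum>j\<in>(UNIV::'r set). (cmod (overlap_rem N T K x y $ i $ j))\<^sup>2)
     \<le> (\<Sum>x\<in>{1..N}. \<Sum>y\<in>{1..N}. \<Sum>i\<in>(UNIV::'r set). \<Sum>j\<in>(UNIV::'r set). ?c * (\<Sum>(s, t)\<in>?D. of_bool (\<rho> N s y = \<rho> N t y) * of_bool (x = \<rho> N s y)))"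
    by (intro sum_mono pt)
  also have "\<dots> = (real CARD('r))\<^sup>2 * ?c * (\<Sum>x\<in>{1..N}. \<Sum>y\<in>{1..N}. \<Sum>(s, t)\<in>?D. of_bool (\<rho> N s y = \<rho> N t y) * of_bool (x = \<rho> N s y))"
    by (simp add: sum_distrib_left power2_eq_square mult_ac)
  also have "(\<Sum>x\<in>{1..N}. \<Sum>y\<in>{1..N}. \<Sum>(s, t)\<in>?D. of_bool (\<rho> N s y = \<rho> N t y) * of_bool (x = \<rho> N s y) :: real)
      = (\<Sum>z\<in>?D. \<Sum>y\<in>{1..N}. \<Sum>x\<in>{1..N}. of_bool (\<rho> N (fst z) y = \<rho> N (snd z) y) * of_bool (x = \<rho> N (fst z) y))"
    unfolding case_prod_unfold by (subst sum_swap3, intro sum.cong refl, rule sum.swap)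
  also have "\<dots> = (\<Sum>z\<in>?D. \<Sum>y\<in>{1..N}. of_bool (\<rho> N (fst z) y = \<rho> N (snd z) y))"
    using rho_in[OF N] by (intro sum.cong refl sum_indicator_mult) blast+
  also have "\<dots> = (\<Sum>z\<in>?D. real N * fixfrac N (\<rho> N) (- snd z + fst z))"
  proof (intro sum.cong refl)
    fix z
    show "(\<Sum>y\<in>{1..N}. of_bool (\<rho> N (fst z) y = \<rho> N (snd z) y)) = real N * fixfrac N (\<rho> N) (- snd z + fst z)"
      using coincidence_count[OF N, of "- fst z" "- snd z"] by simp
  qed
  also have "(real CARD('r))\<^sup>2 * ?c * (\<Sum>z\<in>?D. real N * fixfrac N (\<rho> N) (- snd z + fst z))
     = real N * ((real CARD('r))\<^sup>2 * ?c * (\<Sum>(s, t)\<in>?D. fixfrac N (\<rho> N) (- t + s)))"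
    by (simp add: sum_distrib_left case_prod_unfold mult_ac)
  finally show ?thesis .
qed

text \<open>Bessel's inequality in both arguments bounds all matrix coefficients in the eigenbasis
  by the Hilbert-Schmidt norm.\<close>

lemma overlap_rem_form:
  assumes N: "N \<in> NN" and e: "ebasis N ev \<phi>"
  shows "(\<Sum>\<alpha>\<in>{1..CARD('r) * N}. \<Sum>\<beta>\<in>{1..CARD('r) * N}. (cmod (form N R (\<phi> \<beta>) (\<phi> \<alpha>)))\<^sup>2)
     \<le> (\<Sum>x\<in>{1..N}. \<Sum>y\<in>{1..N}. \<Sum>i\<in>UNIV. \<Sum>j\<in>UNIV. (cmod (R x y $ i $ j))\<^sup>2)"
proof -
  let ?I = "{1..N} \<times> (UNIV :: 'r set)"
  let ?f = "\<lambda>\<alpha> (x, i). \<phi> \<alpha> x $ i"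
  let ?R = "\<lambda>z w. R (fst z) (fst w) $ (snd z) $ (snd w)"
  have form: "form N R (\<phi> \<beta>) (\<phi> \<alpha>) = (\<Sum>z\<in>?I. cnj (?f \<beta> z) * (\<Sum>w\<in>?I. ?R z w * ?f \<alpha> w))" for \<alpha> \<beta>
  proof -
    have "form N R (\<phi> \<beta>) (\<phi> \<alpha>) = (\<Sum>x\<in>{1..N}. \<Sum>i\<in>UNIV. \<Sum>y\<in>{1..N}. \<Sum>j\<in>UNIV. cnj (\<phi> \<beta> x $ i) * (R x y $ i $ j * \<phi> \<alpha> y $ j))"
      unfolding form_def by (intro sum.cong refl sum.swap)
    then show ?thesis by (simp only: sum.cartesian_product' fst_conv snd_conv prod.case sum_distrib_left)
  qed
  have hs: "(\<Sum>x\<in>{1..N}. \<Sum>y\<in>{1..N}. \<Sum>i\<in>UNIV. \<Sum>j\<in>UNIV. (cmod (R x y $ i $ j))\<^sup>2) = (\<Sum>z\<in>?I. \<Sum>w\<in>?I. (cmod (?R z w))\<^sup>2)"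
  proof -
    have "(\<Sum>x\<in>{1..N}. \<Sum>y\<in>{1..N}. \<Sum>i\<in>UNIV. \<Sum>j\<in>UNIV. (cmod (R x y $ i $ j))\<^sup>2) = (\<Sum>x\<in>{1..N}. \<Sum>i\<in>UNIV. \<Sum>y\<in>{1..N}. \<Sum>j\<in>UNIV. (cmod (R x y $ i $ j))\<^sup>2)"
      by (intro sum.cong refl sum.swap)
    then show ?thesis by (simp only: sum.cartesian_product' fst_conv snd_conv)
  qed
  show ?thesis
    unfolding form hs by (rule bessel_hilbert_schmidt[OF _ _ basis_orthonormal[OF e]]) auto
qed

text \<open>In a window the Poisson kernel is at least \<open>1 / (2 \<eta>)\<close> and truncation
  costs a factor 2, so the indicator is at most \<open>4 \<eta>\<close> times \<open>Qval\<close>.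
  Two windows give \<open>16 \<eta>^2\<close>, and there are \<open>CARD('r)^4\<close> pairs of
  matrix entries, each bounded by \<open>2 \<epsilon> / \<eta>\<close>.\<close>

lemma windowed_sum:
  assumes N: "N \<in> NN" and e: "ebasis N ev \<phi>" and E1: "E1 \<in> energies" and E2: "E2 \<in> energies"
    and \<eta>: "0 < \<eta>" "\<eta> \<le> 1" and n: "decay_base \<eta> ^ n / \<eta> \<le> 1 / 2"
    and a: "\<And>y i j. y \<in> {1..N} \<Longrightarrow> cmod (a y $ i $ j) \<le> 2"
    and bound: "\<And>i j l k. cmod (\<Sum>g\<in>coeff_ball n. autocorr N a i j l k g * (approx_coeff E1 \<eta> n g $ j $ k * approx_coeff E2 \<eta> n (t - g - t) $ l $ i))
       + 4 * C2\<^sup>2 * defect N n t \<le> 2 * (\<epsilon> / \<eta>)"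
  shows "(\<Sum>\<alpha>\<in>spec_index (CARD('r) * N) ev {E1 - \<eta>..E1 + \<eta>}. \<Sum>\<beta>\<in>spec_index (CARD('r) * N) ev {E2 - \<eta>..E2 + \<eta>}.
      (cmod (\<Sum>i\<in>UNIV. \<Sum>j\<in>UNIV. entry_form N t a i j (\<phi> \<beta>) (\<phi> \<alpha>)))\<^sup>2) \<le> 32 * real CARD('r) ^ 4 * \<epsilon> * \<eta> * real N"
proof -
  let ?A = "{1..CARD('r) * N}"
  let ?\<Lambda>1 = "spec_index (CARD('r) * N) ev {E1 - \<eta>..E1 + \<eta>}" and ?\<Lambda>2 = "spec_index (CARD('r) * N) ev {E2 - \<eta>..E2 + \<eta>}"
  let ?S = "\<lambda>\<alpha> \<beta>. \<Sum>i\<in>UNIV. \<Sum>j\<in>UNIV. entry_form N t a i j (\<phi> \<beta>) (\<phi> \<alpha>)"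
  have sub: "?\<Lambda>1 \<subseteq> ?A" "?\<Lambda>2 \<subseteq> ?A" by (auto simp: spec_index_def)
  let ?q1 = "\<lambda>\<alpha>. Qval shift_const E1 \<eta> n (ev \<alpha>)" and ?q2 = "\<lambda>\<beta>. Qval shift_const E2 \<eta> n (ev \<beta>)"
  have q0: "0 \<le> Qval shift_const E \<eta> n (ev \<alpha>)" if "E \<in> energies" "\<alpha> \<in> ?A" for E \<alpha>
    using Qval_bounds(3)[OF that(1) \<eta> ev_bounded[OF N e that(2)] n] .
  have ql: "1 \<le> 4 * \<eta> * Qval shift_const E \<eta> n (ev \<alpha>)" if E: "E \<in> energies" and \<alpha>: "\<alpha> \<in> spec_index (CARD('r) * N) ev {E - \<eta>..E + \<eta>}" for E \<alpha>
  proof -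
    have \<alpha>A: "\<alpha> \<in> ?A" and d: "\<bar>ev \<alpha> - E\<bar> \<le> \<eta>" using \<alpha> by (auto simp: spec_index_def)
    have "(ev \<alpha> - E)\<^sup>2 \<le> \<eta>\<^sup>2" using power_mono[OF d, of 2] by simp
    then have "\<eta> / (\<eta>\<^sup>2 + \<eta>\<^sup>2) \<le> \<eta> / ((ev \<alpha> - E)\<^sup>2 + \<eta>\<^sup>2)"
      using \<eta> by (intro divide_left_mono mult_pos_pos add_nonneg_pos) auto
    also have "\<eta> / (\<eta>\<^sup>2 + \<eta>\<^sup>2) = 1 / (2 * \<eta>)" using \<eta> by (simp add: power2_eq_square)
    finally have "1 / (2 * \<eta>) / 2 \<le> \<eta> / ((ev \<alpha> - E)\<^sup>2 + \<eta>\<^sup>2) / 2" by (rule divide_right_mono) simp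
    also have "\<dots> \<le> Qval shift_const E \<eta> n (ev \<alpha>)"
      by (rule Qval_bounds(1)[OF E \<eta> ev_bounded[OF N e \<alpha>A] n])
    finally show ?thesis using \<eta> by (simp add: field_simps)
  qed
  have "(\<Sum>\<alpha>\<in>?\<Lambda>1. \<Sum>\<beta>\<in>?\<Lambda>2. (cmod (?S \<alpha> \<beta>))\<^sup>2)
     \<le> (\<Sum>\<alpha>\<in>?\<Lambda>1. \<Sum>\<beta>\<in>?\<Lambda>2. (16 * \<eta>\<^sup>2) * (?q1 \<alpha> * ?q2 \<beta> * (cmod (?S \<alpha> \<beta>))\<^sup>2))"
  proof (intro sum_mono)
    fix \<alpha> \<beta> assume "\<alpha> \<in> ?\<Lambda>1" "\<beta> \<in> ?\<Lambda>2"
    then have "1 * 1 \<le> (4 * \<eta> * ?q1 \<alpha>) * (4 * \<eta> * ?q2 \<beta>)" by (intro mult_mono' ql E1 E2) auto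
    then have "1 * (cmod (?S \<alpha> \<beta>))\<^sup>2 \<le> (4 * \<eta> * ?q1 \<alpha>) * (4 * \<eta> * ?q2 \<beta>) * (cmod (?S \<alpha> \<beta>))\<^sup>2"
      by (intro mult_right_mono) auto
    then show "(cmod (?S \<alpha> \<beta>))\<^sup>2 \<le> (16 * \<eta>\<^sup>2) * (?q1 \<alpha> * ?q2 \<beta> * (cmod (?S \<alpha> \<beta>))\<^sup>2)"
      by (simp add: power2_eq_square mult_ac)
  qed
  also have "\<dots> \<le> (\<Sum>\<alpha>\<in>?A. \<Sum>\<beta>\<in>?A. (16 * \<eta>\<^sup>2) * (?q1 \<alpha> * ?q2 \<beta> * (cmod (?S \<alpha> \<beta>))\<^sup>2))"
  proof -
    have nn: "0 \<le> (16 * \<eta>\<^sup>2) * (?q1 \<alpha> * ?q2 \<beta> * (cmod (?S \<alpha> \<beta>))\<^sup>2)" if "\<alpha> \<in> ?A" "\<beta> \<in> ?A" for \<alpha> \<beta>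
      using q0[OF E1 that(1)] q0[OF E2 that(2)] by (intro mult_nonneg_nonneg) auto
    have "(\<Sum>\<alpha>\<in>?\<Lambda>1. \<Sum>\<beta>\<in>?\<Lambda>2. (16 * \<eta>\<^sup>2) * (?q1 \<alpha> * ?q2 \<beta> * (cmod (?S \<alpha> \<beta>))\<^sup>2))
      \<le> (\<Sum>\<alpha>\<in>?\<Lambda>1. \<Sum>\<beta>\<in>?A. (16 * \<eta>\<^sup>2) * (?q1 \<alpha> * ?q2 \<beta> * (cmod (?S \<alpha> \<beta>))\<^sup>2))"
      using sub nn by (intro sum_mono sum_mono2) auto
    also have "\<dots> \<le> (\<Sum>\<alpha>\<in>?A. \<Sum>\<beta>\<in>?A. (16 * \<eta>\<^sup>2) * (?q1 \<alpha> * ?q2 \<beta> * (cmod (?S \<alpha> \<beta>))\<^sup>2))"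
      using sub nn by (intro sum_mono2 sum_nonneg) auto
    finally show ?thesis .
  qed
  also have "\<dots> = (16 * \<eta>\<^sup>2) * (\<Sum>\<alpha>\<in>?A. \<Sum>\<beta>\<in>?A. ?q1 \<alpha> * ?q2 \<beta> * (cmod (?S \<alpha> \<beta>))\<^sup>2)"
    by (simp only: sum_distrib_left)
  also have "\<dots> \<le> (16 * \<eta>\<^sup>2) * (real N * (\<Sum>i\<in>(UNIV::'r set). \<Sum>j\<in>(UNIV::'r set). \<Sum>l\<in>(UNIV::'r set). \<Sum>k\<in>(UNIV::'r set). 2 * (\<epsilon> / \<eta>)))"
    by (rule mult_left_mono, rule order_trans[OF quad_bound[OF N e a E1 E2 \<eta> n]], assumption)
      (rule mult_left_mono[OF sum_mono[OF sum_mono[OF sum_mono[OF sum_mono[OF bound]]]]], simp_all)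
  also have "\<dots> = 32 * real CARD('r) ^ 4 * \<epsilon> * \<eta> * real N"
    using \<eta> by (simp add: power2_eq_square power4_eq_xxxx)
  finally show ?thesis .
qed

lemma obs_diff_split:
  assumes N: "N \<in> NN" and T: "finite T"
  shows "obs_diff N (\<rho> N) T K u v \<le> (real (card T) + 1) *
     ((\<Sum>t\<in>T. (cmod (\<Sum>i\<in>UNIV. \<Sum>j\<in>UNIV. entry_form N t (centred N K t) i j u v))\<^sup>2) + (cmod (form N (overlap_rem N T K) u v))\<^sup>2)"
proof -
  \<comment> \<open>The option type lists the components for \<open>T\<close> together with the
    remainder, so that one Cauchy-Schwarz estimate covers all \<open>card T + 1\<close>
    terms.\<close>
  define h where "h = (\<lambda>z. case z of None \<Rightarrow> form N (overlap_rem N T K) u v | Some t \<Rightarrow> (\<Sum>i\<in>UNIV. \<Sum>j\<in>UNIV. entry_form N t (centred N K t) i j u v))"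
  have fin: "finite (Some ` T)" "None \<notin> Some ` T" using T by auto
  have "obs_diff N (\<rho> N) T K u v = (cmod (\<Sum>z\<in>insert None (Some ` T). h z))\<^sup>2"
    unfolding obs_diff_def vec_inner_form form_decomp[OF N T] sum.insert[OF fin]
    by (simp add: h_def sum.reindex add.commute)
  also have "\<dots> \<le> real (card (insert None (Some ` T))) * (\<Sum>z\<in>insert None (Some ` T). (cmod (h z))\<^sup>2)"
    by (rule norm_sum_le_card)
  also have "\<dots> = (real (card T) + 1) * ((cmod (h None))\<^sup>2 + (\<Sum>t\<in>T. (cmod (h (Some t)))\<^sup>2))"
    unfolding sum.insert[OF fin] card_insert_disjoint[OF fin] by (simp add: sum.reindex card_image)
  finally show ?thesis by (simp add: h_def add.commute)
qed

text \<open>All errors are scaled to \<open>\<epsilon> \<eta> N\<close>, the order of the eigenvalue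
  count in a window by \<open>spec_count\<close>, so that division by that count leaves a multiple
  of \<epsilon>.\<close>

lemma window_bound:
  assumes N: "N \<in> NN" and T: "finite T" and K: "T_local N (\<rho> N) T K" "norm_1_inf N K \<le> 1"
    and e: "ebasis N ev \<phi>" and E1: "E1 \<in> energies" and E2: "E2 \<in> energies"
    and \<eta>: "0 < \<eta>" "\<eta> \<le> 1" and n: "decay_base \<eta> ^ n / \<eta> \<le> 1 / 2"
    and D: "((real CARD('r))\<^sup>2 * (real (card T) + 1)\<^sup>2) * (\<Sum>(s, t)\<in>{(s, t)\<in>T \<times> T. s \<noteq> t}. fixfrac N (\<rho> N) (- t + s)) < \<epsilon> * \<eta>"
    and df: "\<And>t. t \<in> T \<Longrightarrow> (4 * C2\<^sup>2 * \<eta>) * defect N n t < \<epsilon>"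
    and cr: "\<And>t i j l k. t \<in> T \<Longrightarrow> cmod (\<Sum>g\<in>coeff_ball n. autocorr N (centred N K t) i j l k g *
        (approx_coeff E1 \<eta> n g $ j $ k * approx_coeff E2 \<eta> n (t - g - t) $ l $ i)) * \<eta> \<le> \<epsilon>"
  shows "(\<Sum>\<alpha>\<in>spec_index (CARD('r) * N) ev {E1 - \<eta>..E1 + \<eta>}. \<Sum>\<beta>\<in>spec_index (CARD('r) * N) ev {E2 - \<eta>..E2 + \<eta>}.
      obs_diff N (\<rho> N) T K (\<phi> \<beta>) (\<phi> \<alpha>))
    \<le> ((real (card T) + 1) * (1 + 32 * real CARD('r) ^ 4 * real (card T)) * \<epsilon>) * (\<eta> * real N)"
proof -
  let ?A = "{1..CARD('r) * N}"
  define \<Lambda>1 where "\<Lambda>1 = spec_index (CARD('r) * N) ev {E1 - \<eta>..E1 + \<eta>}"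
  define \<Lambda>2 where "\<Lambda>2 = spec_index (CARD('r) * N) ev {E2 - \<eta>..E2 + \<eta>}"
  define SS where "SS = (\<lambda>t \<alpha> \<beta>. (cmod (\<Sum>i\<in>UNIV. \<Sum>j\<in>UNIV. entry_form N t (centred N K t) i j (\<phi> \<beta>) (\<phi> \<alpha>)))\<^sup>2)"
  define RR where "RR = (\<lambda>\<alpha> \<beta>. (cmod (form N (overlap_rem N T K) (\<phi> \<beta>) (\<phi> \<alpha>)))\<^sup>2)"
  let ?m = "real (card T)" and ?r = "real CARD('r)"
  have sub: "\<Lambda>1 \<subseteq> ?A" "\<Lambda>2 \<subseteq> ?A" by (auto simp: spec_index_def \<Lambda>1_def \<Lambda>2_def)
  have S: "(\<Sum>\<alpha>\<in>\<Lambda>1. \<Sum>\<beta>\<in>\<Lambda>2. SS t \<alpha> \<beta>) \<le> 32 * ?r ^ 4 * \<epsilon> * \<eta> * real N" if t: "t \<in> T" for t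
    unfolding SS_def \<Lambda>1_def \<Lambda>2_def
  proof (rule windowed_sum[OF N e E1 E2 \<eta> n])
    show "cmod (centred N K t y $ i $ j) \<le> 2" if "y \<in> {1..N}" for y i j by (rule centred_le[OF N K(2) that])
    fix i j l k
    have "cmod (\<Sum>g\<in>coeff_ball n. autocorr N (centred N K t) i j l k g * (approx_coeff E1 \<eta> n g $ j $ k * approx_coeff E2 \<eta> n (t - g - t) $ l $ i)) \<le> \<epsilon> / \<eta>"
      using cr[OF t] \<eta> by (simp add: pos_le_divide_eq)
    moreover have "4 * C2\<^sup>2 * defect N n t \<le> \<epsilon> / \<eta>"
      using df[OF t] \<eta> by (simp add: pos_le_divide_eq mult_ac)
    ultimately show "cmod (\<Sum>g\<in>coeff_ball n. autocorr N (centred N K t) i j l k g * (approx_coeff E1 \<eta> n g $ j $ k * approx_coeff E2 \<eta> n (t - g - t) $ l $ i)) + 4 * C2\<^sup>2 * defect N n t \<le> 2 * (\<epsilon> / \<eta>)"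
      by linarith
  qed
  have R: "(\<Sum>\<alpha>\<in>\<Lambda>1. \<Sum>\<beta>\<in>\<Lambda>2. RR \<alpha> \<beta>) \<le> \<epsilon> * \<eta> * real N"
  proof -
    have nn: "0 \<le> RR \<alpha> \<beta>" for \<alpha> \<beta> by (simp add: RR_def)
    have "(\<Sum>\<alpha>\<in>\<Lambda>1. \<Sum>\<beta>\<in>\<Lambda>2. RR \<alpha> \<beta>) \<le> (\<Sum>\<alpha>\<in>\<Lambda>1. \<Sum>\<beta>\<in>?A. RR \<alpha> \<beta>)"
      by (intro sum_mono sum_mono2 sub nn) auto
    also have "\<dots> \<le> (\<Sum>\<alpha>\<in>?A. \<Sum>\<beta>\<in>?A. RR \<alpha> \<beta>)"
      by (intro sum_mono2 sub sum_nonneg nn) auto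
    also have "\<dots> \<le> real N * (?r\<^sup>2 * (?m + 1)\<^sup>2 * (\<Sum>(s, t)\<in>{(s, t)\<in>T \<times> T. s \<noteq> t}. fixfrac N (\<rho> N) (- t + s)))"
      unfolding RR_def by (rule order_trans[OF overlap_rem_form[OF N e] overlap_rem_hs[OF N T K]])
    also have "\<dots> \<le> real N * (\<epsilon> * \<eta>)" by (rule mult_left_mono[OF less_imp_le[OF D]]) simp
    finally show ?thesis by (simp only: mult_ac)
  qed
  have "(\<Sum>\<alpha>\<in>\<Lambda>1. \<Sum>\<beta>\<in>\<Lambda>2. obs_diff N (\<rho> N) T K (\<phi> \<beta>) (\<phi> \<alpha>))
      \<le> (\<Sum>\<alpha>\<in>\<Lambda>1. \<Sum>\<beta>\<in>\<Lambda>2. (?m + 1) * ((\<Sum>t\<in>T. SS t \<alpha> \<beta>) + RR \<alpha> \<beta>))"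
    unfolding SS_def RR_def by (intro sum_mono obs_diff_split[OF N T])
  also have "\<dots> = (?m + 1) * ((\<Sum>\<alpha>\<in>\<Lambda>1. \<Sum>\<beta>\<in>\<Lambda>2. \<Sum>t\<in>T. SS t \<alpha> \<beta>) + (\<Sum>\<alpha>\<in>\<Lambda>1. \<Sum>\<beta>\<in>\<Lambda>2. RR \<alpha> \<beta>))"
    by (simp only: sum_distrib_left[symmetric] sum.distrib)
  also have "(\<Sum>\<alpha>\<in>\<Lambda>1. \<Sum>\<beta>\<in>\<Lambda>2. \<Sum>t\<in>T. SS t \<alpha> \<beta>) = (\<Sum>t\<in>T. \<Sum>\<alpha>\<in>\<Lambda>1. \<Sum>\<beta>\<in>\<Lambda>2. SS t \<alpha> \<beta>)"
    by (rule sum_swap3)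
  also have "(?m + 1) * ((\<Sum>t\<in>T. \<Sum>\<alpha>\<in>\<Lambda>1. \<Sum>\<beta>\<in>\<Lambda>2. SS t \<alpha> \<beta>) + (\<Sum>\<alpha>\<in>\<Lambda>1. \<Sum>\<beta>\<in>\<Lambda>2. RR \<alpha> \<beta>))
      \<le> (?m + 1) * ((\<Sum>t\<in>T. 32 * ?r ^ 4 * \<epsilon> * \<eta> * real N) + \<epsilon> * \<eta> * real N)"
    by (rule mult_left_mono[OF add_mono[OF sum_mono[OF S] R]]) simp_all
  also have "\<dots> = ((?m + 1) * (1 + 32 * ?r ^ 4 * ?m) * \<epsilon>) * (\<eta> * real N)"
    by (simp add: algebra_simps)
  finally show ?thesis unfolding \<Lambda>1_def \<Lambda>2_def .
qed

text \<open>The smallness of the paired autocorrelations is the only input that differs between the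
  cases of the theorem.\<close>

definition crit_at :: "(nat \<Rightarrow> complex^'r^'r) \<Rightarrow> 'g \<Rightarrow> real \<Rightarrow> real \<Rightarrow> nat \<Rightarrow> nat \<Rightarrow> bool" where
  "crit_at a t \<epsilon> \<eta> n N \<longleftrightarrow> (\<forall>E1\<in>energies. \<forall>E2\<in>energies. \<forall>i j l k.
     cmod (\<Sum>g\<in>coeff_ball n. autocorr N a i j l k g * (approx_coeff E1 \<eta> n g $ j $ k * approx_coeff E2 \<eta> n (t - g - t) $ l $ i)) * \<eta> \<le> \<epsilon>)"

text \<open>The order of the quantifiers reflects the dependence: the truncation order is large
  depending on \<eta>, and the size \<open>N\<close> depending on both.\<close>

definition crit :: "'g \<Rightarrow> (nat \<Rightarrow> nat \<Rightarrow> complex^'r^'r) \<Rightarrow> bool" where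
  "crit t A \<longleftrightarrow> (\<forall>\<epsilon>>0. \<forall>\<^sub>F \<eta> in at_right 0. \<forall>\<^sub>F n in sequentially. \<forall>\<^sub>F N in along NN. crit_at (A N) t \<epsilon> \<eta> n N)"

definition mixing_at :: "'g set \<Rightarrow> (nat \<Rightarrow> nat \<Rightarrow> complex^'r^'r) \<Rightarrow> real \<Rightarrow> real \<Rightarrow> nat \<Rightarrow> bool" where
  "mixing_at T K \<epsilon> \<eta> N \<longleftrightarrow> (\<forall>ev \<phi>. ebasis N ev \<phi> \<longrightarrow> (\<forall>E1\<in>energies. \<forall>E2\<in>energies.
     (\<Sum>\<alpha>\<in>spec_index (CARD('r) * N) ev {E1 - \<eta>..E1 + \<eta>}. \<Sum>\<beta>\<in>spec_index (CARD('r) * N) ev {E2 - \<eta>..E2 + \<eta>}.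
        obs_diff N (\<rho> N) T K (\<phi> \<beta>) (\<phi> \<alpha>))
     \<le> \<epsilon> * real (card (spec_index (CARD('r) * N) ev {E1 - \<eta>..E1 + \<eta>}))))"

lemma mixing_eventually:
  assumes T: "finite T" and K: "\<And>N. N \<in> NN \<Longrightarrow> T_local N (\<rho> N) T (K N) \<and> norm_1_inf N (K N) \<le> 1"
    and crit: "\<And>t. t \<in> T \<Longrightarrow> crit t (\<lambda>N. centred N (K N) t)" and \<epsilon>: "0 < \<epsilon>"
  shows "\<forall>\<^sub>F \<eta> in at_right 0. \<forall>\<^sub>F N in along NN. mixing_at T (K N) \<epsilon> \<eta> N"
proof -
  let ?r = "real CARD('r)" and ?m = "real (card T)"
  define w where "w = (?m + 1) * (1 + 32 * ?r ^ 4 * ?m)"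
  \<comment> \<open>Compensates the constant \<open>w\<close> of \<open>window_bound\<close> and the
    constant \<open>c1\<close> of the eigenvalue count.\<close>
  define \<epsilon>1 where "\<epsilon>1 = \<epsilon> * c1 / w"
  have w: "0 < w" unfolding w_def
  proof (rule mult_pos_pos)
    show "0 < 1 + 32 * ?r ^ 4 * ?m" by (intro add_pos_nonneg) auto
  qed simp
  have \<epsilon>1: "0 < \<epsilon>1" unfolding \<epsilon>1_def using \<epsilon> c1_pos w by simp
  have \<epsilon>1eq: "w * \<epsilon>1 = \<epsilon> * c1" unfolding \<epsilon>1_def using w by simp
  have "\<forall>\<^sub>F \<eta> in at_right 0. \<forall>t\<in>T. \<forall>\<^sub>F n in sequentially. \<forall>\<^sub>F N in along NN. crit_at (centred N (K N) t) t \<epsilon>1 \<eta> n N"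
  proof (rule eventually_ball_finite[OF T], rule ballI)
    fix t assume "t \<in> T"
    from crit[OF this] \<epsilon>1 show "\<forall>\<^sub>F \<eta> in at_right 0. \<forall>\<^sub>F n in sequentially. \<forall>\<^sub>F N in along NN. crit_at (centred N (K N) t) t \<epsilon>1 \<eta> n N"
      unfolding crit_def by simp
  qed
  moreover have "\<forall>\<^sub>F \<eta>::real in at_right 0. 0 < \<eta>" by (rule eventually_at_right_less)
  moreover have "\<forall>\<^sub>F \<eta>::real in at_right 0. \<eta> < 1" by (rule eventually_at_rightI[of 0 1]) auto
  ultimately show ?thesis
  proof eventually_elim
    case (elim \<eta>)
    have \<eta>: "0 < \<eta>" "\<eta> \<le> 1" using elim(2,3) by auto
    have A: "\<forall>\<^sub>F n in sequentially. \<forall>t\<in>T. \<forall>\<^sub>F N in along NN. crit_at (centred N (K N) t) t \<epsilon>1 \<eta> n N"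
      by (rule eventually_ball_finite[OF T elim(1)])
    have B: "\<forall>\<^sub>F n in sequentially. decay_base \<eta> ^ n / \<eta> \<le> 1 / 2"
      unfolding eventually_sequentially by (rule err_small[OF \<eta>]) simp
    \<comment> \<open>For given \<eta> a single truncation order suffices; it stays fixed while
      \<open>N\<close> tends to infinity.\<close>
    obtain n where cr: "\<forall>t\<in>T. \<forall>\<^sub>F N in along NN. crit_at (centred N (K N) t) t \<epsilon>1 \<eta> n N" and n: "decay_base \<eta> ^ n / \<eta> \<le> 1 / 2"
      using eventually_happens'[OF sequentially_bot eventually_conj[OF A B]] by blast
    let ?D = "{(s, t)\<in>T \<times> T. s \<noteq> t}"
    have ev1: "\<forall>\<^sub>F N in along NN. \<forall>t\<in>T. crit_at (centred N (K N) t) t \<epsilon>1 \<eta> n N"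
      by (rule eventually_ball_finite[OF T cr])
    have ev2: "\<forall>\<^sub>F N in along NN. \<forall>t\<in>T. (4 * C2\<^sup>2 * \<eta>) * defect N n t < \<epsilon>1"
      by (intro eventually_ball_finite[OF T] ballI defect_small \<epsilon>1)
    have ev3: "\<forall>\<^sub>F N in along NN. (?r\<^sup>2 * (?m + 1)\<^sup>2) * (\<Sum>(s, t)\<in>?D. fixfrac N (\<rho> N) (- t + s)) < \<epsilon>1 * \<eta>"
    proof -
      have "((\<lambda>N. (?r\<^sup>2 * (?m + 1)\<^sup>2) * (\<Sum>z\<in>?D. fixfrac N (\<rho> N) (- snd z + fst z))) \<longlongrightarrow> (?r\<^sup>2 * (?m + 1)\<^sup>2) * (\<Sum>z\<in>?D. 0)) (along NN)"
      proof (intro tendsto_mult tendsto_const tendsto_sum fixfrac_tendsto)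
        fix z assume "z \<in> ?D"
        then have "fst z \<noteq> snd z" by auto
        then show "- snd z + fst z \<noteq> 0" by (metis add_minus_cancel add.right_neutral)
      qed
      then have "((\<lambda>N. (?r\<^sup>2 * (?m + 1)\<^sup>2) * (\<Sum>z\<in>?D. fixfrac N (\<rho> N) (- snd z + fst z))) \<longlongrightarrow> 0) (along NN)" by simp
      from order_tendstoD(2)[OF this, of "\<epsilon>1 * \<eta>"] \<epsilon>1 \<eta>(1) show ?thesis by (simp add: case_prod_unfold)
    qed
    from ev1 ev2 ev3 spec_count[OF \<eta>] eventually_NN show ?case
    proof eventually_elim
      case (elim N)
      have KN: "T_local N (\<rho> N) T (K N)" "norm_1_inf N (K N) \<le> 1" using K[OF elim(5)] by auto
      show ?case
        unfolding mixing_at_def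
      proof (intro allI impI ballI)
        fix ev \<phi> E1 E2 assume e: "ebasis N ev \<phi>" and E1: "E1 \<in> energies" and E2: "E2 \<in> energies"
        let ?\<Lambda>1 = "spec_index (CARD('r) * N) ev {E1 - \<eta>..E1 + \<eta>}" and ?\<Lambda>2 = "spec_index (CARD('r) * N) ev {E2 - \<eta>..E2 + \<eta>}"
        have cnt: "c1 * \<eta> * real N \<le> real (card ?\<Lambda>1)" using elim(4) e E1 by blast
        have "(\<Sum>\<alpha>\<in>?\<Lambda>1. \<Sum>\<beta>\<in>?\<Lambda>2. obs_diff N (\<rho> N) T (K N) (\<phi> \<beta>) (\<phi> \<alpha>)) \<le> (w * \<epsilon>1) * (\<eta> * real N)"
          unfolding w_def
        proof (rule window_bound[OF elim(5) T KN e E1 E2 \<eta> n elim(3)])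
          fix t assume t: "t \<in> T"
          show "(4 * C2\<^sup>2 * \<eta>) * defect N n t < \<epsilon>1" by (rule bspec[OF elim(2) t])
          fix i j l k
          show "cmod (\<Sum>g\<in>coeff_ball n. autocorr N (centred N (K N) t) i j l k g * (approx_coeff E1 \<eta> n g $ j $ k * approx_coeff E2 \<eta> n (t - g - t) $ l $ i)) * \<eta> \<le> \<epsilon>1"
            using bspec[OF elim(1) t] E1 E2 unfolding crit_at_def by blast
        qed
        also have "\<dots> = \<epsilon> * (c1 * \<eta> * real N)" unfolding \<epsilon>1eq by (simp only: mult_ac)
        also have "\<dots> \<le> \<epsilon> * real (card ?\<Lambda>1)" by (rule mult_left_mono[OF cnt]) (use \<epsilon> in simp)
        finally show "(\<Sum>\<alpha>\<in>?\<Lambda>1. \<Sum>\<beta>\<in>?\<Lambda>2. obs_diff N (\<rho> N) T (K N) (\<phi> \<beta>) (\<phi> \<alpha>)) \<le> \<epsilon> * real (card ?\<Lambda>1)" .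
      qed
    qed
  qed
qed

end

section \<open>Smallness of the paired autocorrelations in the separate cases\<close>

lemma entry_le_onorm: "cmod ((A::complex^'n^'m) $ i $ j) \<le> onorm ((*v) A)"
proof -
  have "(A *v axis j 1) $ i = A $ i $ j"
    by (simp add: matrix_vector_mult_def axis_def if_distrib sum.delta cong: if_cong)
  moreover have "cmod ((A *v axis j 1) $ i) \<le> norm (A *v axis j 1)" by (rule Finite_Cartesian_Product.norm_nth_le)
  moreover have "norm (A *v axis j 1) \<le> onorm ((*v) A) * norm (axis j (1::complex) :: complex^'n)"
    by (rule onorm[OF matrix_vector_mul_bounded_linear])
  ultimately show ?thesis by simp
qed

text \<open>With \<open>x = y^m\<close> for an integer \<open>m\<close> above the exponent, the
  sequence is dominated by a constant times the m-th power of \<open>n y^n\<close>.\<close>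

lemma power_powr_tendsto_0:
  assumes "0 \<le> x" "x < (1::real)"
  shows "(\<lambda>n. real (c * n) powr a * x ^ n) \<longlonglongrightarrow> 0"
proof -
  define m where "m = Suc (nat \<lceil>a\<rceil>)"
  have m: "a \<le> real m" "0 < m" unfolding m_def by linarith+
  define y where "y = root m x"
  have y: "0 \<le> y" "y < 1" "y ^ m = x" using assms m(2) by (auto simp: y_def)
  have "(\<lambda>n. real n * y ^ n) \<longlonglongrightarrow> 0" using powser_times_n_limit_0[of y] y by simp
  then have "(\<lambda>n. real c ^ m * (real n * y ^ n) ^ m) \<longlonglongrightarrow> real c ^ m * 0 ^ m" by (intro tendsto_intros)
  moreover have z: "real c ^ m * 0 ^ m = 0" using m(2) by simp
  ultimately have lim: "(\<lambda>n. real c ^ m * (real n * y ^ n) ^ m) \<longlonglongrightarrow> 0" by (simp only: z)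
  show ?thesis
  proof (rule tendsto_0_le[OF lim, of _ 1], rule always_eventually, rule allI)
    fix n
    have "real (c * n) powr a \<le> real (c * n) ^ m"
    proof (cases "c * n = 0")
      case False
      then have "1 \<le> real (c * n)" by (metis One_nat_def Suc_leI of_nat_1 of_nat_mono neq0_conv)
      then have "real (c * n) powr a \<le> real (c * n) powr real m" by (intro powr_mono m(1))
      also have "\<dots> = real (c * n) ^ m" using False by (intro powr_realpow) (simp del: of_nat_mult)
      finally show ?thesis .
    next
      case True
      show ?thesis unfolding True by simp
    qed
    then have "real (c * n) powr a * x ^ n \<le> real (c * n) ^ m * x ^ n" using assms by (intro mult_right_mono) auto
    also have "\<dots> = real c ^ m * (real n * y ^ n) ^ m"
      unfolding y(3)[symmetric] by (simp add: power_mult_distrib power_mult[symmetric] mult_ac)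
    finally show "norm (real (c * n) powr a * x ^ n) \<le> norm (real c ^ m * (real n * y ^ n) ^ m) * 1"
      using assms y by simp
  qed
qed

lemma inj_conj: "inj (\<lambda>g::'a::group_add. t - g - t)"
proof (rule injI)
  fix x y assume "t - x - t = t - y - t"
  then have "t - x - t + t = t - y - t + t" by simp
  then have "t - x = t - y" by simp
  then have "- t + (t - x) = - t + (t - y)" by simp
  then show "x = y" by (simp only: diff_conv_add_uminus minus_add_cancel neg_equal_iff_equal)
qed

context qm_setup begin

lemma autocorr_le:
  assumes N: "N \<in> NN" and K: "norm_1_inf N K \<le> 1"
  shows "cmod (autocorr N (centred N K t) i j l k g) \<le> 4"
proof -
  have "cmod (autocorr N (centred N K t) i j l k g) = 1 / real N * cmod (\<Sum>y\<in>{1..N}. centred N K t (\<rho> N g y) $ i $ j * cnj (centred N K t y $ l $ k))"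
    by (simp add: autocorr_def norm_mult norm_divide)
  also have "\<dots> \<le> 1 / real N * (\<Sum>y\<in>{1..N}. 2 * 2)"
  proof (intro mult_left_mono order_trans[OF norm_sum] sum_mono)
    fix y assume y: "y \<in> {1..N}"
    then have "\<rho> N g y \<in> {1..N}" using rho_in[OF N] by blast
    then show "cmod (centred N K t (\<rho> N g y) $ i $ j * cnj (centred N K t y $ l $ k)) \<le> 2 * 2"
      unfolding norm_mult complex_mod_cnj using y by (intro mult_mono centred_le[OF N K]) auto
  qed auto
  also have "\<dots> = 4" using NN_pos[OF N] by simp
  finally show ?thesis .
qed

text \<open>An autocorrelation is an entry of the averaged Kronecker product, and entries are
  bounded by the operator norm. The conjugated factor comes first there, whence the index pairs
  \<open>(l, i)\<close> and \<open>(k, j)\<close>.\<close>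

lemma autocorr_le_correlation:
  assumes N: "N \<in> NN"
  shows "cmod (autocorr N (centred N K t) i j l k g) \<le> correlation N (\<rho> N) (\<lambda>x. K (\<rho> N t x) x) g"
proof -
  let ?M = "avg N (\<lambda>x. kron (map_matrix cnj (centred N K t x)) (centred N K t (\<rho> N g x)))"
  have "?M $ (l, i) $ (k, j) = (1 / real N) *\<^sub>R (\<Sum>x\<in>{1..N}. cnj (centred N K t x $ l $ k) * centred N K t (\<rho> N g x) $ i $ j)"
    by (simp add: avg_def sum_component kron_def)
  also have "\<dots> = autocorr N (centred N K t) i j l k g"
    by (simp add: autocorr_def scaleR_conv_of_real mult.commute)
  finally have "autocorr N (centred N K t) i j l k g = ?M $ (l, i) $ (k, j)" ..
  then have "cmod (autocorr N (centred N K t) i j l k g) \<le> onorm ((*v) ?M)" by (simp only: entry_le_onorm)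
  then show ?thesis by (simp add: correlation_def centred_def)
qed

lemma approx_coeff_conj_sum_sq:
  assumes "E \<in> energies" "0 < \<eta>" "\<eta> \<le> 1" "decay_base \<eta> ^ n / \<eta> \<le> 1" "finite F"
  shows "(\<Sum>g\<in>F. (cmod (approx_coeff E \<eta> n (t - g - t) $ i $ j))\<^sup>2) \<le> 4 * C0 / \<eta>"
proof -
  have inj: "inj_on (\<lambda>g. t - g - t) F" by (rule inj_on_subset[OF inj_conj]) simp
  show ?thesis
    using approx_coeff_sum_sq[OF assms(1-4) finite_imageI[OF assms(5), of "\<lambda>g. t - g - t"], of i j] by (simp add: sum.reindex[OF inj])
qed

lemma crit_uncorrelated:
  assumes K: "\<And>N. N \<in> NN \<Longrightarrow> norm_1_inf N (K N) \<le> 1" and t: "t \<in> T" and unc: "asymp_uncorrelated S NN \<rho> T K"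
  shows "crit t (\<lambda>N. centred N (K N) t)"
  unfolding crit_def
proof (intro allI impI)
  fix \<epsilon> :: real assume \<epsilon>: "0 < \<epsilon>"
  \<comment> \<open>The products of coefficients sum to at most \<open>4 C0 / \<eta>\<close>; after
    multiplication by \<eta> the far elements contribute \<open>\<epsilon> / 2\<close>.\<close>
  define \<epsilon>' where "\<epsilon>' = \<epsilon> / (8 * C0)"
  have \<epsilon>': "0 < \<epsilon>'" using \<epsilon> C0 by (simp add: \<epsilon>'_def)
  let ?\<sigma> = "\<lambda>N g. correlation N (\<rho> N) (\<lambda>x. K N (\<rho> N t x) x) g"
  have "((\<lambda>g. Limsup (along NN) (\<lambda>N. ereal (?\<sigma> N g))) \<longlongrightarrow> 0) (filtercomap (word_length S) at_top)"
    using unc t by (simp add: asymp_uncorrelated_def)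
  then have "\<forall>\<^sub>F g in filtercomap (word_length S) at_top. Limsup (along NN) (\<lambda>N. ereal (?\<sigma> N g)) < ereal \<epsilon>'"
    using \<epsilon>' by (intro order_tendstoD(2)) auto
  then obtain m where m: "\<And>g. m \<le> word_length S g \<Longrightarrow> Limsup (along NN) (\<lambda>N. ereal (?\<sigma> N g)) < ereal \<epsilon>'"
    unfolding eventually_filtercomap_at_top_linorder by blast
  \<comment> \<open>Bounds the near elements: autocorrelations are at most 4 and products of
    coefficients at most \<open>C2^2\<close>. It does not depend on \<open>n\<close>, so the factor
    \<eta> makes it small.\<close>
  define D where "D = real (card (wball S m)) * (4 * C2\<^sup>2)"
  have D0: "0 \<le> D" by (simp add: D_def)
  have "\<forall>\<^sub>F \<eta> in at_right 0. \<eta> * D < \<epsilon> / 2"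
  proof -
    have "((\<lambda>\<eta>. \<eta> * D) \<longlongrightarrow> 0 * D) (at_right 0)" by (intro tendsto_intros)
    then show ?thesis using \<epsilon> by (intro order_tendstoD(2)) auto
  qed
  moreover have "\<forall>\<^sub>F \<eta>::real in at_right 0. 0 < \<eta>" by (rule eventually_at_right_less)
  moreover have "\<forall>\<^sub>F \<eta>::real in at_right 0. \<eta> < 1" by (rule eventually_at_rightI[of 0 1]) auto
  ultimately show "\<forall>\<^sub>F \<eta> in at_right 0. \<forall>\<^sub>F n in sequentially. \<forall>\<^sub>F N in along NN. crit_at (centred N (K N) t) t \<epsilon> \<eta> n N"
  proof eventually_elim
    case (elim \<eta>)
    have \<eta>: "0 < \<eta>" "\<eta> \<le> 1" using elim(2,3) by auto
    have "\<forall>\<^sub>F n in sequentially. decay_base \<eta> ^ n / \<eta> \<le> 1"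
      unfolding eventually_sequentially by (rule err_small[OF \<eta>]) simp
    then show ?case
    proof eventually_elim
      case (elim n)
      note n = elim
      \<comment> \<open>The limes superior is controlled for each \<open>g\<close> separately;
        finiteness of the ball makes the bounds simultaneous.\<close>
      have "\<forall>\<^sub>F N in along NN. \<forall>g\<in>coeff_ball n - wball S m. ereal (?\<sigma> N g) < ereal \<epsilon>'"
      proof (rule eventually_ball_finite, simp add: coeff_ball_finite, rule ballI)
        fix g assume "g \<in> coeff_ball n - wball S m"
        then have "m \<le> word_length S g" by (simp add: wball_def)
        then show "\<forall>\<^sub>F N in along NN. ereal (?\<sigma> N g) < ereal \<epsilon>'" by (intro Limsup_lessD m)
      qed
      then show ?case using eventually_NN
      proof eventually_elim
        case (elim N)
        show ?case
          unfolding crit_at_def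
        proof (intro ballI allI)
          fix E1 E2 i j l k assume E: "E1 \<in> energies" "E2 \<in> energies"
          let ?W = "\<lambda>g. cmod (approx_coeff E1 \<eta> n g $ j $ k) * cmod (approx_coeff E2 \<eta> n (t - g - t) $ l $ i)"
          let ?c = "\<lambda>g. cmod (autocorr N (centred N (K N) t) i j l k g)"
          have W0: "0 \<le> ?W g" for g by simp
          have Wle: "?W g \<le> C2\<^sup>2" for g
            unfolding power2_eq_square C2_def using C0 by (intro mult_mono approx_coeff_le E \<eta> n) auto
          have Wsum: "(\<Sum>g\<in>coeff_ball n. ?W g) \<le> 4 * C0 / \<eta>"
          proof -
            have "?W g \<le> ((cmod (approx_coeff E1 \<eta> n g $ j $ k))\<^sup>2 + (cmod (approx_coeff E2 \<eta> n (t - g - t) $ l $ i))\<^sup>2) / 2" for g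
              using sum_squares_bound[of "cmod (approx_coeff E1 \<eta> n g $ j $ k)" "cmod (approx_coeff E2 \<eta> n (t - g - t) $ l $ i)"] by simp
            then have "(\<Sum>g\<in>coeff_ball n. ?W g) \<le> (\<Sum>g\<in>coeff_ball n. ((cmod (approx_coeff E1 \<eta> n g $ j $ k))\<^sup>2 + (cmod (approx_coeff E2 \<eta> n (t - g - t) $ l $ i))\<^sup>2) / 2)"
              by (intro sum_mono)
            also have "\<dots> = ((\<Sum>g\<in>coeff_ball n. (cmod (approx_coeff E1 \<eta> n g $ j $ k))\<^sup>2) + (\<Sum>g\<in>coeff_ball n. (cmod (approx_coeff E2 \<eta> n (t - g - t) $ l $ i))\<^sup>2)) / 2"
              by (simp only: sum_divide_distrib[symmetric] sum.distrib)
            also have "\<dots> \<le> (4 * C0 / \<eta> + 4 * C0 / \<eta>) / 2"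
              by (intro divide_right_mono add_mono approx_coeff_sum_sq approx_coeff_conj_sum_sq E \<eta> n coeff_ball_finite) simp
            finally show ?thesis by simp
          qed
          have pt: "?c g * ?W g \<le> of_bool (g \<in> wball S m) * (4 * C2\<^sup>2) + \<epsilon>' * ?W g" if g: "g \<in> coeff_ball n" for g
          proof (cases "g \<in> wball S m")
            case True
            have "?c g * ?W g \<le> 4 * C2\<^sup>2" by (intro mult_mono autocorr_le[OF elim(2) K[OF elim(2)]] Wle W0) auto
            moreover have "0 \<le> \<epsilon>' * ?W g" using \<epsilon>' by (intro mult_nonneg_nonneg) auto
            ultimately show ?thesis using True by simp
          next
            case False
            have "ereal (?\<sigma> N g) < ereal \<epsilon>'" using elim(1) g False by blast
            then have "?c g \<le> \<epsilon>'" by (intro order_trans[OF autocorr_le_correlation[OF elim(2)]]) simp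
            then have "?c g * ?W g \<le> \<epsilon>' * ?W g" by (rule mult_right_mono[OF _ W0])
            then show ?thesis using False by simp
          qed
          have "cmod (\<Sum>g\<in>coeff_ball n. autocorr N (centred N (K N) t) i j l k g * (approx_coeff E1 \<eta> n g $ j $ k * approx_coeff E2 \<eta> n (t - g - t) $ l $ i))
             \<le> (\<Sum>g\<in>coeff_ball n. ?c g * ?W g)"
            by (rule order_trans[OF norm_sum]) (simp add: norm_mult)
          also have "\<dots> \<le> (\<Sum>g\<in>coeff_ball n. of_bool (g \<in> wball S m) * (4 * C2\<^sup>2) + \<epsilon>' * ?W g)" by (intro sum_mono pt)
          also have "\<dots> = (\<Sum>g\<in>coeff_ball n. of_bool (g \<in> wball S m)) * (4 * C2\<^sup>2) + \<epsilon>' * (\<Sum>g\<in>coeff_ball n. ?W g)"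
            by (simp only: sum.distrib sum_distrib_left sum_distrib_right)
          also have "\<dots> \<le> D + \<epsilon>' * (4 * C0 / \<eta>)"
          proof (rule add_mono)
            have "(\<Sum>g\<in>coeff_ball n. of_bool (g \<in> wball S m)) = real (card (coeff_ball n \<inter> wball S m))"
              using coeff_ball_finite by (simp add: Int_def)
            also have "\<dots> \<le> real (card (wball S m))" using finite_wball[OF Sfin Sgen] by (simp add: card_mono)
            finally show "(\<Sum>g\<in>coeff_ball n. of_bool (g \<in> wball S m)) * (4 * C2\<^sup>2) \<le> D"
              unfolding D_def by (intro mult_right_mono) auto
            show "\<epsilon>' * (\<Sum>g\<in>coeff_ball n. ?W g) \<le> \<epsilon>' * (4 * C0 / \<eta>)" using \<epsilon>' by (intro mult_left_mono Wsum) auto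
          qed
          finally have "cmod (\<Sum>g\<in>coeff_ball n. autocorr N (centred N (K N) t) i j l k g * (approx_coeff E1 \<eta> n g $ j $ k * approx_coeff E2 \<eta> n (t - g - t) $ l $ i)) * \<eta>
              \<le> (D + \<epsilon>' * (4 * C0 / \<eta>)) * \<eta>" using \<eta> by (intro mult_right_mono) auto
          also have "\<dots> = \<eta> * D + \<epsilon> / 2" using \<eta> C0 by (simp add: \<epsilon>'_def field_simps)
          also have "\<dots> \<le> \<epsilon>" using \<open>\<eta> * D < \<epsilon> / 2\<close> by simp
          finally show "cmod (\<Sum>g\<in>coeff_ball n. autocorr N (centred N (K N) t) i j l k g * (approx_coeff E1 \<eta> n g $ j $ k * approx_coeff E2 \<eta> n (t - g - t) $ l $ i)) * \<eta> \<le> \<epsilon>" .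
        qed
      qed
    qed
  qed
qed

text \<open>Brings the condition into the form used here: finite partial sums in place of an
  extended infinite sum, entries in place of norms, and coefficients at inverses, which have the
  same length.\<close>

lemma R4_entries:
  assumes "R4mat S p energies a" "0 < \<delta>"
  shows "\<forall>\<^sub>F \<eta> in at_right 0. \<forall>E\<in>energies. \<forall>F i j. finite F \<longrightarrow>
     (\<Sum>h\<in>F. \<eta>\<^sup>2 * cmod (im_coeff E \<eta> h $ i $ j) ^ 4 * real (word_length S h) powr a) \<le> \<delta>"
proof -
  let ?f = "\<lambda>\<eta> E g. \<eta>\<^sup>2 * hs_norm (op_block (im_resolvent (lam p) (Complex E \<eta>)) 0 g) ^ 4 * real (word_length S g) powr a"
  have "\<forall>\<^sub>F \<eta> in at_right 0. (SUP E\<in>energies. \<Sum>\<^sub>\<infinity>g. ennreal (?f \<eta> E g)) < ennreal \<delta>"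
    using assms unfolding R4mat_def by (intro order_tendstoD(2)) auto
  then show ?thesis
  proof eventually_elim
    case (elim \<eta>)
    show ?case
    proof (intro ballI allI impI)
      fix E and F :: "'g set" and i j assume E: "E \<in> energies" and F: "finite F"
      have f0: "0 \<le> ?f \<eta> E g" for g by simp
      have "ennreal (\<Sum>g\<in>uminus ` F. ?f \<eta> E g) = (\<Sum>g\<in>uminus ` F. ennreal (?f \<eta> E g))"
        using f0 by (intro sum_ennreal[symmetric]) blast
      also have "\<dots> \<le> (\<Sum>\<^sub>\<infinity>g. ennreal (?f \<eta> E g))"
      proof -
        have "(\<Sum>\<^sub>\<infinity>g\<in>uminus ` F. ennreal (?f \<eta> E g)) \<le> (\<Sum>\<^sub>\<infinity>g. ennreal (?f \<eta> E g))"
          by (intro infsum_mono_neutral nonneg_summable_on_complete) auto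
        then show ?thesis using infsum_finite[OF finite_imageI[OF F], of "\<lambda>g. ennreal (?f \<eta> E g)" uminus] by (simp only:)
      qed
      also have "\<dots> \<le> (SUP E\<in>energies. \<Sum>\<^sub>\<infinity>g. ennreal (?f \<eta> E g))" by (rule SUP_upper[OF E])
      finally have "ennreal (\<Sum>g\<in>uminus ` F. ?f \<eta> E g) \<le> ennreal \<delta>" using elim by simp
      then have le: "(\<Sum>g\<in>uminus ` F. ?f \<eta> E g) \<le> \<delta>" using assms(2) by (subst (asm) ennreal_le_iff) auto
      have "(\<Sum>h\<in>F. \<eta>\<^sup>2 * cmod (im_coeff E \<eta> h $ i $ j) ^ 4 * real (word_length S h) powr a) \<le> (\<Sum>h\<in>F. ?f \<eta> E (- h))"
        unfolding im_coeff_def word_length_minus[OF Sgen]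
        by (intro sum_mono mult_right_mono mult_left_mono power_mono entry_le_hs_norm) auto
      also have "\<dots> = (\<Sum>g\<in>uminus ` F. ?f \<eta> E g)" by (subst sum.reindex) (auto simp: inj_on_def)
      finally show "(\<Sum>h\<in>F. \<eta>\<^sup>2 * cmod (im_coeff E \<eta> h $ i $ j) ^ 4 * real (word_length S h) powr a) \<le> \<delta>" using le by linarith
    qed
  qed
qed

end

section \<open>Weighted sums of coefficient products and the bound from rapid decay\<close>

lemma sum_three_sq: "((x::real) + y + z)\<^sup>2 \<le> 3 * (x\<^sup>2 + y\<^sup>2 + z\<^sup>2)"
proof -
  have "0 \<le> (x - y)\<^sup>2 + (y - z)\<^sup>2 + (x - z)\<^sup>2" by simp
  then show ?thesis by (simp add: power2_eq_square algebra_simps)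
qed

context qm_setup begin

text \<open>The additive bound \<open>2 * word_length S t\<close> becomes a factor because the
  conjugate has length at least 1; a factor passes through powers of the length.\<close>

lemma word_length_conj_le:
  assumes "h \<noteq> 0"
  shows "word_length S h \<le> (1 + 2 * word_length S t) * word_length S (t - h - t)"
proof -
  let ?u = "t - h - t"
  have "- t + (t + - h) = - h" by (rule minus_add_cancel)
  then have h: "h = - (- t + (?u + t))" by simp
  have "?u \<noteq> 0"
  proof
    assume "?u = 0"
    then have "t - h = t" by simp
    then have "t + - h = t + 0" by simp
    then have "- h = 0" by (rule add_left_imp_eq)
    then show False using assms by simp
  qed
  then have u: "1 \<le> word_length S ?u" using word_length_eq_0[OF Sgen, of ?u] by linarith
  have "word_length S h = word_length S (- t + (?u + t))" by (subst h) (rule word_length_minus[OF Sgen])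
  also have "\<dots> \<le> word_length S (- t) + (word_length S ?u + word_length S t)"
    by (rule order_trans[OF word_length_add[OF Sgen] add_left_mono[OF word_length_add[OF Sgen]]])
  also have "\<dots> = word_length S ?u + 2 * word_length S t * 1" by (simp only: word_length_minus[OF Sgen])
  also have "\<dots> \<le> word_length S ?u + 2 * word_length S t * word_length S ?u" using u by (intro add_left_mono mult_left_mono) simp_all
  finally show ?thesis by (simp add: algebra_simps)
qed

text \<open>The inequality \<open>(x y)^2 \<le> (x^4 + y^4) / 2\<close> leads from products to the
  fourth powers in (R4mat). The second factor is evaluated at a conjugate, which costs a constant in
  the weight. In the truncation terms the weight is replaced by its maximum on the ball.\<close>

lemma approx_coeff_product_weighted:
  assumes E: "E1 \<in> energies" "E2 \<in> energies" and \<eta>: "0 < \<eta>" "\<eta> \<le> 1" and n: "decay_base \<eta> ^ n / \<eta> \<le> 1" and a: "0 \<le> a"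
    and R4: "\<And>E F i j. E \<in> energies \<Longrightarrow> finite F \<Longrightarrow>
      (\<Sum>h\<in>F. \<eta>\<^sup>2 * cmod (im_coeff E \<eta> h $ i $ j) ^ 4 * real (word_length S h) powr a) \<le> \<delta>"
  shows "(\<Sum>h\<in>coeff_ball n. real (word_length S h) powr a * (\<eta> * (cmod (approx_coeff E1 \<eta> n h $ j $ k) * cmod (approx_coeff E2 \<eta> n (t - h - t) $ l $ i)))\<^sup>2)
    \<le> 3 * ((1 + real (1 + 2 * word_length S t) powr a) * \<delta> / 2 + 2 * C2\<^sup>2 * (real (2 * supp_len * n) powr a * (decay_base \<eta> ^ n)\<^sup>2))"
proof -
  define w where "w = (\<lambda>h. real (word_length S h) powr a)"
  define \<kappa> where "\<kappa> = real (1 + 2 * word_length S t) powr a"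
  define L where "L = real (2 * supp_len * n) powr a"
  define e where "e = decay_base \<eta> ^ n / \<eta>"
  let ?u = "\<lambda>h. t - h - t"
  let ?q1 = "\<lambda>h. cmod (approx_coeff E1 \<eta> n h $ j $ k)" and ?q2 = "\<lambda>h. cmod (approx_coeff E2 \<eta> n h $ l $ i)"
  let ?m1 = "\<lambda>h. cmod (im_coeff E1 \<eta> h $ j $ k)" and ?m2 = "\<lambda>h. cmod (im_coeff E2 \<eta> h $ l $ i)"
  let ?d1 = "\<lambda>h. cmod (im_coeff E1 \<eta> h $ j $ k - approx_coeff E1 \<eta> n h $ j $ k)"
  let ?d2 = "\<lambda>h. cmod (im_coeff E2 \<eta> h $ l $ i - approx_coeff E2 \<eta> n h $ l $ i)"
  have w0: "0 \<le> w h" for h by (simp add: w_def)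
  have wu: "w h \<le> \<kappa> * w (?u h)" for h
  proof (cases "h = 0")
    case True
    then show ?thesis using word_length_eq_0[OF Sgen, of 0] by (simp add: w_def \<kappa>_def)
  next
    case False
    have "w h \<le> real ((1 + 2 * word_length S t) * word_length S (?u h)) powr a"
      unfolding w_def by (intro powr_mono2 a of_nat_mono word_length_conj_le False) simp
    also have "\<dots> = \<kappa> * w (?u h)" unfolding w_def \<kappa>_def of_nat_mult by (rule powr_mult)
    finally show ?thesis .
  qed
  have wL: "w h \<le> L" if "h \<in> coeff_ball n" for h
    unfolding w_def L_def using that by (intro powr_mono2 a of_nat_mono) (auto simp: coeff_ball_def wball_def)
  \<comment> \<open>Exact coefficients are substituted one factor at a time; the factor left beside
    an error is bounded by \<open>C2\<close>.\<close>
  have prod: "?q1 h * ?q2 v \<le> ?m1 h * ?m2 v + C2 * ?d1 h + C2 * ?d2 v" for h v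
  proof -
    have t1: "?q1 h \<le> ?m1 h + ?d1 h" using norm_triangle_ineq4[of "im_coeff E1 \<eta> h $ j $ k" "im_coeff E1 \<eta> h $ j $ k - approx_coeff E1 \<eta> n h $ j $ k"] by simp
    have t2: "?q2 v \<le> ?m2 v + ?d2 v" using norm_triangle_ineq4[of "im_coeff E2 \<eta> v $ l $ i" "im_coeff E2 \<eta> v $ l $ i - approx_coeff E2 \<eta> n v $ l $ i"] by simp
    have b1: "?m1 h \<le> C2" using im_coeff_le[OF E(1) \<eta>, of h j k] by (simp add: C2_def)
    have b2: "?q2 v \<le> C2" unfolding C2_def by (intro approx_coeff_le E \<eta> n)
    have "?q1 h * ?q2 v \<le> (?m1 h + ?d1 h) * ?q2 v" by (intro mult_right_mono t1) simp
    also have "\<dots> = ?m1 h * ?q2 v + ?q2 v * ?d1 h" by (simp add: algebra_simps)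
    also have "\<dots> \<le> ?m1 h * (?m2 v + ?d2 v) + C2 * ?d1 h" by (intro add_mono mult_left_mono mult_right_mono t2 b2) simp_all
    also have "\<dots> = ?m1 h * ?m2 v + ?m1 h * ?d2 v + C2 * ?d1 h" by (simp only: distrib_left)
    also have "\<dots> \<le> ?m1 h * ?m2 v + C2 * ?d2 v + C2 * ?d1 h" by (intro add_mono mult_right_mono b1) simp_all
    finally show ?thesis by simp
  qed
  have am: "(x * y)\<^sup>2 \<le> (x ^ 4 + y ^ 4) / 2" for x y :: real
    using sum_squares_bound[of "x\<^sup>2" "y\<^sup>2"] by (simp add: power_mult_distrib power_mult[symmetric])
  have sq: "(?q1 h * ?q2 v)\<^sup>2 \<le> 3 * ((?m1 h ^ 4 + ?m2 v ^ 4) / 2 + C2\<^sup>2 * (?d1 h)\<^sup>2 + C2\<^sup>2 * (?d2 v)\<^sup>2)" for h v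
  proof -
    have "(?q1 h * ?q2 v)\<^sup>2 \<le> (?m1 h * ?m2 v + C2 * ?d1 h + C2 * ?d2 v)\<^sup>2" by (intro power_mono prod) simp
    also have "\<dots> \<le> 3 * ((?m1 h * ?m2 v)\<^sup>2 + (C2 * ?d1 h)\<^sup>2 + (C2 * ?d2 v)\<^sup>2)" by (rule sum_three_sq)
    also have "\<dots> \<le> 3 * ((?m1 h ^ 4 + ?m2 v ^ 4) / 2 + C2\<^sup>2 * (?d1 h)\<^sup>2 + C2\<^sup>2 * (?d2 v)\<^sup>2)"
      using am[of "?m1 h" "?m2 v"] by (simp add: power_mult_distrib)
    finally show ?thesis .
  qed
  have alg1: "(w * e) * (3 * ((x + y) / 2 + c * u + c * v)) = 3 / 2 * (e * x * w) + w * (3 / 2 * e * y) + w * (3 * c * e * u) + w * (3 * c * e * v)"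
    for w e x y c u v :: real by (simp add: algebra_simps)
  have alg2: "z + k * w * (3 / 2 * e * y) + L * (3 * c * e * u) + L * (3 * c * e * v) = z + 3 * k / 2 * (e * y * w) + 3 * c * e * L * u + 3 * c * e * L * v"
    for z k w e y L c u v :: real by (simp add: algebra_simps)
  have alg3: "3 / 2 * d + 3 * k / 2 * d + 3 * c * e * L * u + 3 * c * e * L * u = 3 * ((1 + k) * d / 2 + 2 * c * (L * (e * u)))"
    for d k c e L u :: real by (simp add: algebra_simps)
  have pt: "w h * (\<eta> * (?q1 h * ?q2 (?u h)))\<^sup>2 \<le> 3 / 2 * (\<eta>\<^sup>2 * ?m1 h ^ 4 * w h) + 3 * \<kappa> / 2 * (\<eta>\<^sup>2 * ?m2 (?u h) ^ 4 * w (?u h))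
      + 3 * C2\<^sup>2 * \<eta>\<^sup>2 * L * (?d1 h)\<^sup>2 + 3 * C2\<^sup>2 * \<eta>\<^sup>2 * L * (?d2 (?u h))\<^sup>2" if h: "h \<in> coeff_ball n" for h
  proof -
    have "w h * (\<eta> * (?q1 h * ?q2 (?u h)))\<^sup>2 = (w h * \<eta>\<^sup>2) * (?q1 h * ?q2 (?u h))\<^sup>2" by (simp add: power_mult_distrib)
    also have "\<dots> \<le> (w h * \<eta>\<^sup>2) * (3 * ((?m1 h ^ 4 + ?m2 (?u h) ^ 4) / 2 + C2\<^sup>2 * (?d1 h)\<^sup>2 + C2\<^sup>2 * (?d2 (?u h))\<^sup>2))"
      by (intro mult_left_mono sq) (simp add: w0)
    also have "\<dots> = 3 / 2 * (\<eta>\<^sup>2 * ?m1 h ^ 4 * w h) + w h * (3 / 2 * \<eta>\<^sup>2 * ?m2 (?u h) ^ 4)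
       + w h * (3 * C2\<^sup>2 * \<eta>\<^sup>2 * (?d1 h)\<^sup>2) + w h * (3 * C2\<^sup>2 * \<eta>\<^sup>2 * (?d2 (?u h))\<^sup>2)"
      by (rule alg1)
    also have "\<dots> \<le> 3 / 2 * (\<eta>\<^sup>2 * ?m1 h ^ 4 * w h) + (\<kappa> * w (?u h)) * (3 / 2 * \<eta>\<^sup>2 * ?m2 (?u h) ^ 4)
       + L * (3 * C2\<^sup>2 * \<eta>\<^sup>2 * (?d1 h)\<^sup>2) + L * (3 * C2\<^sup>2 * \<eta>\<^sup>2 * (?d2 (?u h))\<^sup>2)"
      by (intro add_mono mult_right_mono wu wL h) (simp_all add: w0)
    also have "\<dots> = 3 / 2 * (\<eta>\<^sup>2 * ?m1 h ^ 4 * w h) + 3 * \<kappa> / 2 * (\<eta>\<^sup>2 * ?m2 (?u h) ^ 4 * w (?u h))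
      + 3 * C2\<^sup>2 * \<eta>\<^sup>2 * L * (?d1 h)\<^sup>2 + 3 * C2\<^sup>2 * \<eta>\<^sup>2 * L * (?d2 (?u h))\<^sup>2" by (rule alg2)
    finally show ?thesis .
  qed
  have inj: "inj_on ?u (coeff_ball n)" by (rule inj_on_subset[OF inj_conj]) simp
  have re: "(\<Sum>h\<in>coeff_ball n. f (?u h)) = (\<Sum>v\<in>?u ` coeff_ball n. f v)" for f :: "'g \<Rightarrow> real" by (simp add: sum.reindex[OF inj])
  have s1: "(\<Sum>h\<in>coeff_ball n. \<eta>\<^sup>2 * ?m1 h ^ 4 * w h) \<le> \<delta>" unfolding w_def by (intro R4 E coeff_ball_finite)
  have s2: "(\<Sum>h\<in>coeff_ball n. \<eta>\<^sup>2 * ?m2 (?u h) ^ 4 * w (?u h)) \<le> \<delta>"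
    unfolding re[of "\<lambda>v. \<eta>\<^sup>2 * ?m2 v ^ 4 * w v"] unfolding w_def by (intro R4 E coeff_ball_finite finite_imageI)
  have s3: "(\<Sum>h\<in>coeff_ball n. (?d1 h)\<^sup>2) \<le> e\<^sup>2" unfolding e_def by (intro im_coeff_tail E \<eta> coeff_ball_finite)
  have s4: "(\<Sum>h\<in>coeff_ball n. (?d2 (?u h))\<^sup>2) \<le> e\<^sup>2" unfolding e_def re[of "\<lambda>v. (?d2 v)\<^sup>2"] by (intro im_coeff_tail E \<eta> coeff_ball_finite finite_imageI)
  have "(\<Sum>h\<in>coeff_ball n. w h * (\<eta> * (?q1 h * ?q2 (?u h)))\<^sup>2)
     \<le> (\<Sum>h\<in>coeff_ball n. 3 / 2 * (\<eta>\<^sup>2 * ?m1 h ^ 4 * w h) + 3 * \<kappa> / 2 * (\<eta>\<^sup>2 * ?m2 (?u h) ^ 4 * w (?u h))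
      + 3 * C2\<^sup>2 * \<eta>\<^sup>2 * L * (?d1 h)\<^sup>2 + 3 * C2\<^sup>2 * \<eta>\<^sup>2 * L * (?d2 (?u h))\<^sup>2)" by (intro sum_mono pt)
  also have "\<dots> = 3 / 2 * (\<Sum>h\<in>coeff_ball n. \<eta>\<^sup>2 * ?m1 h ^ 4 * w h) + 3 * \<kappa> / 2 * (\<Sum>h\<in>coeff_ball n. \<eta>\<^sup>2 * ?m2 (?u h) ^ 4 * w (?u h))
      + 3 * C2\<^sup>2 * \<eta>\<^sup>2 * L * (\<Sum>h\<in>coeff_ball n. (?d1 h)\<^sup>2) + 3 * C2\<^sup>2 * \<eta>\<^sup>2 * L * (\<Sum>h\<in>coeff_ball n. (?d2 (?u h))\<^sup>2)"
    by (simp only: sum.distrib sum_distrib_left[symmetric])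
  also have "\<dots> \<le> 3 / 2 * \<delta> + 3 * \<kappa> / 2 * \<delta> + 3 * C2\<^sup>2 * \<eta>\<^sup>2 * L * e\<^sup>2 + 3 * C2\<^sup>2 * \<eta>\<^sup>2 * L * e\<^sup>2"
    by (intro add_mono mult_left_mono s1 s2 s3 s4) (simp_all add: \<kappa>_def L_def)
  also have "\<dots> = 3 * ((1 + \<kappa>) * \<delta> / 2 + 2 * C2\<^sup>2 * (L * (\<eta> * e)\<^sup>2))" unfolding power_mult_distrib by (rule alg3)
  also have "\<eta> * e = decay_base \<eta> ^ n" using \<eta> by (simp add: e_def)
  finally show ?thesis unfolding w_def \<kappa>_def L_def .
qed

lemma uminus_GG: "uminus ` coeff_ball n = coeff_ball n"
proof -
  have "uminus ` coeff_ball n \<subseteq> coeff_ball n" by (auto simp: coeff_ball_def wball_def word_length_minus[OF Sgen])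
  moreover from this have "uminus ` uminus ` coeff_ball n \<subseteq> uminus ` coeff_ball n" by (rule image_mono)
  ultimately show ?thesis by (simp add: image_image)
qed

text \<open>The inverse argument appears because a group algebra element acts through
  \<open>\<rho> N (- g)\<close>, while the autocorrelation translates by \<open>g\<close>. The
  factor \<eta> is included so that the operator norm becomes small.\<close>

definition pair_weight :: "real \<Rightarrow> real \<Rightarrow> real \<Rightarrow> nat \<Rightarrow> 'g \<Rightarrow> 'r \<Rightarrow> 'r \<Rightarrow> 'r \<Rightarrow> 'r \<Rightarrow> 'g \<Rightarrow> complex" where
  "pair_weight E1 E2 \<eta> n t i j l k g = of_real \<eta> * (approx_coeff E1 \<eta> n (- g) $ j $ k * approx_coeff E2 \<eta> n (t - (- g) - t) $ l $ i)"

lemma pair_weight_le: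
  assumes "E1 \<in> energies" "E2 \<in> energies" and \<eta>: "0 < \<eta>" "\<eta> \<le> 1" and n: "decay_base \<eta> ^ n / \<eta> \<le> 1"
  shows "cmod (pair_weight E1 E2 \<eta> n t i j l k g) \<le> \<eta> * C2\<^sup>2"
  unfolding pair_weight_def norm_mult power2_eq_square using \<eta> C2_pos unfolding C2_def
  by (simp only: norm_of_real abs_of_pos) (intro mult_left_mono mult_mono approx_coeff_le assms; simp)

lemma pair_weight_small:
  assumes RD: "RD TYPE('g) C1" and a: "a > 2 * C1 + 1" and R4: "R4mat S p energies a" and \<epsilon>: "0 < \<epsilon>"
  shows "\<forall>\<^sub>F \<eta> in at_right 0. \<forall>\<^sub>F n in sequentially. \<forall>E1\<in>energies. \<forall>E2\<in>energies. \<forall>i j l k.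
     ell2_onorm (lam_scalar (pm (coeff_ball n) (pair_weight E1 E2 \<eta> n t i j l k))) \<le> \<epsilon>"
proof -
  obtain K where K: "0 < K" and RDK: "\<And>G W. finite G \<Longrightarrow> ell2_onorm (lam_scalar (pm G (W :: 'g \<Rightarrow> complex)))
     \<le> K * (cmod (W 0) + sqrt (\<Sum>g\<in>G. real (word_length S g) powr a * (cmod (W g))\<^sup>2))"
    using RD_weighted[OF RD Sfin Sgen a] by metis
  have a0: "0 \<le> a" using RD a by (simp add: RD_def)
  \<comment> \<open>Half of the allowance goes to the unit coefficient, half to the weighted
    sum.\<close>
  define \<epsilon>0 where "\<epsilon>0 = \<epsilon> / (2 * K)"
  have \<epsilon>0: "0 < \<epsilon>0" using \<epsilon> K by (simp add: \<epsilon>0_def)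
  define \<kappa> where "\<kappa> = real (1 + 2 * word_length S t) powr a"
  have \<kappa>: "0 \<le> \<kappa>" by (simp add: \<kappa>_def)
  \<comment> \<open>Chosen so that the exact part of the weighted sum is
    \<open>\<epsilon>0^2 / 2\<close>, leaving an equal share to truncation.\<close>
  define \<delta> where "\<delta> = \<epsilon>0\<^sup>2 / (3 * (1 + \<kappa>))"
  have \<delta>: "0 < \<delta>" unfolding \<delta>_def using \<epsilon>0 \<kappa> by (intro divide_pos_pos) auto
  have \<delta>eq: "3 * ((1 + \<kappa>) * \<delta> / 2) = \<epsilon>0\<^sup>2 / 2" unfolding \<delta>_def using \<kappa> by (simp add: field_simps)
  have ev1: "\<forall>\<^sub>F \<eta> in at_right 0. \<eta> * C2\<^sup>2 < \<epsilon>0"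
  proof -
    have "((\<lambda>\<eta>. \<eta> * C2\<^sup>2) \<longlongrightarrow> 0 * C2\<^sup>2) (at_right 0)" by (intro tendsto_intros)
    then show ?thesis using \<epsilon>0 by (intro order_tendstoD(2)) auto
  qed
  have ev2: "\<forall>\<^sub>F \<eta>::real in at_right 0. 0 < \<eta>" by (rule eventually_at_right_less)
  have ev3: "\<forall>\<^sub>F \<eta>::real in at_right 0. \<eta> < 1" by (rule eventually_at_rightI[of 0 1]) auto
  from R4_entries[OF R4 \<delta>] ev1 ev2 ev3 show ?thesis
  proof eventually_elim
    case (elim \<eta>)
    have \<eta>: "0 < \<eta>" "\<eta> \<le> 1" using elim(3,4) by auto
    note small = elim(2)
    have R4': "(\<Sum>h\<in>F. \<eta>\<^sup>2 * cmod (im_coeff E \<eta> h $ i $ j) ^ 4 * real (word_length S h) powr a) \<le> \<delta>"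
      if "E \<in> energies" "finite F" for E F i j using elim(1) that by blast
    have n1: "\<forall>\<^sub>F n in sequentially. decay_base \<eta> ^ n / \<eta> \<le> 1"
      unfolding eventually_sequentially by (rule err_small[OF \<eta>]) simp
    \<comment> \<open>For fixed \<eta> the weight grows polynomially in \<open>n\<close> while the
      squared error decays geometrically.\<close>
    have "decay_base \<eta> ^ 2 < 1" using decay_base_bounds[OF \<eta>] by (simp add: power_less_one_iff)
    then have "(\<lambda>n. (6 * C2\<^sup>2) * (real ((2 * supp_len) * n) powr a * (decay_base \<eta> ^ 2) ^ n)) \<longlonglongrightarrow> (6 * C2\<^sup>2) * 0"
      by (intro tendsto_mult tendsto_const power_powr_tendsto_0) simp_all
    then have n2: "\<forall>\<^sub>F n in sequentially. (6 * C2\<^sup>2) * (real ((2 * supp_len) * n) powr a * (decay_base \<eta> ^ 2) ^ n) < \<epsilon>0\<^sup>2 / 2"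
      using \<epsilon>0 by (intro order_tendstoD(2)) auto
    from n1 n2 show ?case
    proof eventually_elim
      case (elim n)
      show ?case
      proof (intro ballI allI)
        fix E1 E2 i j l k assume E: "E1 \<in> energies" "E2 \<in> energies"
        let ?W = "pair_weight E1 E2 \<eta> n t i j l k"
        have "(\<Sum>g\<in>coeff_ball n. real (word_length S g) powr a * (cmod (?W g))\<^sup>2)
          = (\<Sum>g\<in>uminus ` coeff_ball n. real (word_length S g) powr a * (cmod (?W g))\<^sup>2)" by (simp only: uminus_GG)
        also have "\<dots> = (\<Sum>h\<in>coeff_ball n. real (word_length S h) powr a * (\<eta> * (cmod (approx_coeff E1 \<eta> n h $ j $ k) * cmod (approx_coeff E2 \<eta> n (t - h - t) $ l $ i)))\<^sup>2)"
          using \<eta> by (subst sum.reindex) (auto simp: pair_weight_def norm_mult word_length_minus[OF Sgen] inj_on_def)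
        also have "\<dots> \<le> 3 * ((1 + \<kappa>) * \<delta> / 2 + 2 * C2\<^sup>2 * (real (2 * supp_len * n) powr a * (decay_base \<eta> ^ n)\<^sup>2))"
          unfolding \<kappa>_def by (rule approx_coeff_product_weighted[OF E \<eta> elim(1) a0 R4'])
        also have "\<dots> = \<epsilon>0\<^sup>2 / 2 + (6 * C2\<^sup>2) * (real ((2 * supp_len) * n) powr a * (decay_base \<eta> ^ 2) ^ n)"
          unfolding distrib_left[of 3] \<delta>eq by (simp add: power_mult[symmetric] mult.commute)
        also have "\<dots> \<le> \<epsilon>0\<^sup>2" using elim(2) by simp
        finally have "sqrt (\<Sum>g\<in>coeff_ball n. real (word_length S g) powr a * (cmod (?W g))\<^sup>2) \<le> \<epsilon>0"
          using \<epsilon>0 by (intro real_le_lsqrt) (simp_all add: sum_nonneg)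
        moreover have "cmod (?W 0) \<le> \<epsilon>0" using order_trans[OF pair_weight_le[OF E \<eta> elim(1)]] small by simp
        ultimately have "K * (cmod (?W 0) + sqrt (\<Sum>g\<in>coeff_ball n. real (word_length S g) powr a * (cmod (?W g))\<^sup>2)) \<le> K * (\<epsilon>0 + \<epsilon>0)"
          using K by (intro mult_left_mono add_mono) auto
        also have "\<dots> = \<epsilon>" using K by (simp add: \<epsilon>0_def)
        finally show "ell2_onorm (lam_scalar (pm (coeff_ball n) ?W)) \<le> \<epsilon>" by (rule order_trans[OF RDK[OF coeff_ball_finite]])
      qed
    qed
  qed
qed

lemma autocorr_sum_eq:
  assumes N: "N \<in> NN"
  shows "(\<Sum>g\<in>coeff_ball n. autocorr N A i j l k g * (approx_coeff E1 \<eta> n g $ j $ k * approx_coeff E2 \<eta> n (t - g - t) $ l $ i)) * of_real \<eta>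
    = (1 / of_nat N) * (\<Sum>y\<in>{1..N}. cnj (A y $ l $ k) * sact (\<rho> N) (pm (coeff_ball n) (pair_weight E1 E2 \<eta> n t i j l k)) (\<lambda>x. if x \<in> {1..N} then A x $ i $ j else 0) y)"
proof -
  let ?f = "\<lambda>x. if x \<in> {1..N} then A x $ i $ j else 0"
  let ?W = "pair_weight E1 E2 \<eta> n t i j l k"
  have inj: "inj_on uminus (coeff_ball n)" by (simp add: inj_on_def)
  have "(\<Sum>y\<in>{1..N}. cnj (A y $ l $ k) * sact (\<rho> N) (pm (coeff_ball n) ?W) ?f y)
      = (\<Sum>y\<in>{1..N}. \<Sum>g\<in>uminus ` coeff_ball n. ?W g * (?f (\<rho> N (- g) y) * cnj (A y $ l $ k)))"
    by (simp only: gact_pm[OF coeff_ball_finite] sum_distrib_left uminus_GG mult_ac)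
  also have "\<dots> = (\<Sum>y\<in>{1..N}. \<Sum>g\<in>coeff_ball n. ?W (- g) * (?f (\<rho> N g y) * cnj (A y $ l $ k)))"
    unfolding sum.reindex[OF inj] o_def minus_minus by (rule refl)
  also have "\<dots> = (\<Sum>g\<in>coeff_ball n. \<Sum>y\<in>{1..N}. ?W (- g) * (?f (\<rho> N g y) * cnj (A y $ l $ k)))" by (rule sum.swap)
  also have "\<dots> = (\<Sum>g\<in>coeff_ball n. ?W (- g) * (\<Sum>y\<in>{1..N}. A (\<rho> N g y) $ i $ j * cnj (A y $ l $ k)))"
    unfolding sum_distrib_left by (intro sum.cong refl) (use rho_in[OF N] in auto)
  finally have "(1 / of_nat N) * (\<Sum>y\<in>{1..N}. cnj (A y $ l $ k) * sact (\<rho> N) (pm (coeff_ball n) ?W) ?f y)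
     = (\<Sum>g\<in>coeff_ball n. ?W (- g) * autocorr N A i j l k g)" by (simp only: autocorr_def sum_distrib_left mult_ac)
  also have "\<dots> = (\<Sum>g\<in>coeff_ball n. autocorr N A i j l k g * (approx_coeff E1 \<eta> n g $ j $ k * approx_coeff E2 \<eta> n (t - g - t) $ l $ i) * of_real \<eta>)"
    by (simp add: pair_weight_def mult_ac)
  finally show ?thesis by (simp only: sum_distrib_right)
qed

lemma crit_tempered:
  assumes RD: "RD TYPE('g) C1" and a: "a > 2 * C1 + 1" and R4: "R4mat S p energies a" and V: "tempered S V"
    and K: "\<And>N. N \<in> NN \<Longrightarrow> norm_1_inf N (K N) \<le> 1"
    and KV: "\<And>N i j. N \<in> NN \<Longrightarrow> (\<lambda>x. if x \<in> {1..N} then centred N (K N) t x $ i $ j else 0) \<in> V N"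
  shows "crit t (\<lambda>N. centred N (K N) t)"
  unfolding crit_def
proof (intro allI impI)
  fix \<epsilon> :: real assume \<epsilon>: "0 < \<epsilon>"
  \<comment> \<open>Both vectors have norm at most twice the root of \<open>N\<close>, and two
    errors of \<open>\<epsilon> / 8\<close> add up, so the normalised coefficient is at most
    \<epsilon>.\<close>
  then have \<epsilon>8: "0 < \<epsilon> / 8" by simp
  have ev2: "\<forall>\<^sub>F \<eta>::real in at_right 0. 0 < \<eta>" by (rule eventually_at_right_less)
  have ev3: "\<forall>\<^sub>F \<eta>::real in at_right 0. \<eta> < 1" by (rule eventually_at_rightI[of 0 1]) auto
  from pair_weight_small[OF RD a R4 \<epsilon>8, of t] ev2 ev3
  show "\<forall>\<^sub>F \<eta> in at_right 0. \<forall>\<^sub>F n in sequentially. \<forall>\<^sub>F N in along NN. crit_at (centred N (K N) t) t \<epsilon> \<eta> n N"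
  proof eventually_elim
    case (elim \<eta>)
    have \<eta>: "0 < \<eta>" "\<eta> \<le> 1" using elim(2,3) by auto
    have n1: "\<forall>\<^sub>F n in sequentially. decay_base \<eta> ^ n / \<eta> \<le> 1"
      unfolding eventually_sequentially by (rule err_small[OF \<eta>]) simp
    from elim(1) n1 show ?case
    proof eventually_elim
      case (elim n)
      note sm = elim(1) and n = elim(2)
      \<comment> \<open>The bound holds for all coefficients up to \<open>C2^2\<close> at once,
        hence for all pairs of energies with the same threshold on \<open>N\<close>.\<close>
      from tempered_uniform[OF Sfin Sgen V coeff_ball_finite \<epsilon>8, of n "C2\<^sup>2"] eventually_NN show ?case
      proof eventually_elim
        case (elim N)
        note N = elim(2)
        show ?case
          unfolding crit_at_def
        proof (intro ballI allI)
          fix E1 E2 i j l k assume E: "E1 \<in> energies" "E2 \<in> energies"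
          let ?A = "centred N (K N) t"
          let ?f = "\<lambda>x. if x \<in> {1..N} then ?A x $ i $ j else 0"
          let ?W = "pair_weight E1 E2 \<eta> n t i j l k"
          let ?g = "sact (\<rho> N) (pm (coeff_ball n) ?W) ?f"
          have W: "\<forall>g\<in>coeff_ball n. cmod (?W g) \<le> C2\<^sup>2"
          proof
            fix g
            have "\<eta> * C2\<^sup>2 \<le> 1 * C2\<^sup>2" using \<eta> by (intro mult_right_mono) auto
            then show "cmod (?W g) \<le> C2\<^sup>2" using pair_weight_le[OF E \<eta> n, of t i j l k g] by linarith
          qed
          have f: "supp_on N ?f" by (simp add: supp_on_def)
          have A2: "cmod (?A y $ i' $ j') \<le> 2" if "y \<in> {1..N}" for y i' j' by (rule centred_le[OF N K[OF N] that])
          have nA: "sqrt (\<Sum>y\<in>{1..N}. (cmod (?A y $ i' $ j'))\<^sup>2) \<le> 2 * sqrt (real N)" for i' j'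
          proof -
            have "(\<Sum>y\<in>{1..N}. (cmod (?A y $ i' $ j'))\<^sup>2) \<le> (\<Sum>y\<in>{1..N}. 2\<^sup>2)" by (intro sum_mono power_mono A2) auto
            also have "\<dots> = (2 * sqrt (real N))\<^sup>2" by (simp add: power_mult_distrib)
            finally show ?thesis by (intro real_le_lsqrt sum_nonneg) simp_all
          qed
          have nf: "ell2_norm ?f \<le> 2 * sqrt (real N)"
          proof -
            have "(ell2_norm ?f)\<^sup>2 = (\<Sum>y\<in>{1..N}. (cmod (?A y $ i $ j))\<^sup>2)" unfolding supp_on_ell2(2)[OF f] by (intro sum.cong) auto
            then have "sqrt ((ell2_norm ?f)\<^sup>2) \<le> 2 * sqrt (real N)" using nA[of i j] by simp
            then show ?thesis by simp
          qed
          have "ell2_norm ?g \<le> (ell2_onorm (lam_scalar (pm (coeff_ball n) ?W)) + \<epsilon> / 8) * ell2_norm ?f"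
            using elim(1) W KV[OF N] by blast
          also have "\<dots> \<le> (\<epsilon> / 8 + \<epsilon> / 8) * (2 * sqrt (real N))"
          proof (rule mult_mono)
            have "ell2_onorm (lam_scalar (pm (coeff_ball n) ?W)) \<le> \<epsilon> / 8" using sm E by blast
            then show "ell2_onorm (lam_scalar (pm (coeff_ball n) ?W)) + \<epsilon> / 8 \<le> \<epsilon> / 8 + \<epsilon> / 8" by simp
            show "ell2_norm ?f \<le> 2 * sqrt (real N)" by (rule nf)
          qed (use \<epsilon> in \<open>auto simp: ell2_norm_def infsum_nonneg\<close>)
          finally have ng: "ell2_norm ?g \<le> \<epsilon> / 2 * sqrt (real N)" by simp
          have ngs: "sqrt (\<Sum>y\<in>{1..N}. (cmod (?g y))\<^sup>2) = ell2_norm ?g"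
            unfolding supp_on_ell2(2)[OF supp_on_sact[OF N f], symmetric] by (simp add: ell2_norm_def infsum_nonneg)
          have "cmod (\<Sum>y\<in>{1..N}. cnj (?A y $ l $ k) * ?g y) \<le> (\<Sum>y\<in>{1..N}. \<bar>cmod (?A y $ l $ k)\<bar> * \<bar>cmod (?g y)\<bar>)"
            by (rule order_trans[OF norm_sum]) (simp add: norm_mult)
          also have "\<dots> \<le> L2_set (\<lambda>y. cmod (?A y $ l $ k)) {1..N} * L2_set (\<lambda>y. cmod (?g y)) {1..N}"
            by (rule L2_set_mult_ineq)
          also have "\<dots> \<le> (2 * sqrt (real N)) * (\<epsilon> / 2 * sqrt (real N))"
            unfolding L2_set_def ngs by (intro mult_mono nA ng) (auto simp: ell2_norm_def infsum_nonneg)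
          also have "\<dots> = \<epsilon> * real N" by (simp add: field_simps)
          finally have fin: "cmod (\<Sum>y\<in>{1..N}. cnj (?A y $ l $ k) * ?g y) \<le> \<epsilon> * real N" .
          have "cmod (\<Sum>g\<in>coeff_ball n. autocorr N ?A i j l k g * (approx_coeff E1 \<eta> n g $ j $ k * approx_coeff E2 \<eta> n (t - g - t) $ l $ i)) * \<eta>
            = cmod ((\<Sum>g\<in>coeff_ball n. autocorr N ?A i j l k g * (approx_coeff E1 \<eta> n g $ j $ k * approx_coeff E2 \<eta> n (t - g - t) $ l $ i)) * of_real \<eta>)"
            using \<eta> by (simp add: norm_mult)
          also have "\<dots> = 1 / real N * cmod (\<Sum>y\<in>{1..N}. cnj (?A y $ l $ k) * ?g y)"
            unfolding autocorr_sum_eq[OF N] by (simp add: norm_mult norm_divide)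
          also have "\<dots> \<le> 1 / real N * (\<epsilon> * real N)" by (intro mult_left_mono fin) simp
          also have "\<dots> = \<epsilon>" using NN_pos[OF N] by simp
          finally show "cmod (\<Sum>g\<in>coeff_ball n. autocorr N ?A i j l k g * (approx_coeff E1 \<eta> n g $ j $ k * approx_coeff E2 \<eta> n (t - g - t) $ l $ i)) * \<eta> \<le> \<epsilon>" .
        qed
      qed
    qed
  qed
qed

end

section \<open>Quantum mixing and quantum ergodicity from window estimates\<close>

text \<open>Adjacent closed windows share an endpoint, hence multiplicity 2 rather than 1.\<close>

lemma window_multiplicity:
  fixes lo \<eta> x :: real
  assumes \<eta>: "0 < \<eta>" and m: "0 < m"
  shows "of_bool (x \<in> {lo..lo + 2 * real m * \<eta>}) \<le> (\<Sum>j<m. of_bool (x \<in> {lo + 2 * real j * \<eta>..lo + 2 * real (Suc j) * \<eta>}) :: real)"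
    and "(\<Sum>j<m. of_bool (x \<in> {lo + 2 * real j * \<eta>..lo + 2 * real (Suc j) * \<eta>}) :: real) \<le> 2 * of_bool (x \<in> {lo..lo + 2 * real m * \<eta>})"
proof -
  let ?W = "\<lambda>j. {lo + 2 * real j * \<eta>..lo + 2 * real (Suc j) * \<eta>}"
  have cover: "\<exists>j<k. x \<in> ?W j" if "lo \<le> x" "x \<le> lo + 2 * real k * \<eta>" "0 < k" for k
    using that
  proof (induction k)
    case (Suc k)
    show ?case
    proof (cases "0 < k \<and> x \<le> lo + 2 * real k * \<eta>")
      case True
      then show ?thesis using Suc less_SucI by blast
    next
      case False
      then have "lo + 2 * real k * \<eta> \<le> x" using Suc.prems by (cases k) auto
      then show ?thesis using Suc.prems by (intro exI[of _ k]) simp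
    qed
  qed simp
  define A where "A = {j. j < m \<and> x \<in> ?W j}"
  have finA: "finite A" by (simp add: A_def)
  have sum: "(\<Sum>j<m. of_bool (x \<in> ?W j) :: real) = real (card A)" by (simp add: A_def Int_def)
  show "of_bool (x \<in> {lo..lo + 2 * real m * \<eta>}) \<le> (\<Sum>j<m. of_bool (x \<in> ?W j) :: real)"
  proof (cases "x \<in> {lo..lo + 2 * real m * \<eta>}")
    case True
    then have "A \<noteq> {}" using cover[of m] m by (auto simp: A_def)
    then have "1 \<le> card A" using finA by (simp add: Suc_le_eq card_gt_0_iff)
    then show ?thesis unfolding sum using True by simp
  next
    case False
    then show ?thesis unfolding sum by (simp only: of_bool_def if_False of_nat_0_le_iff)
  qed
  show "(\<Sum>j<m. of_bool (x \<in> ?W j) :: real) \<le> 2 * of_bool (x \<in> {lo..lo + 2 * real m * \<eta>})"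
  proof (cases "A = {}")
    case True
    then show ?thesis unfolding sum by simp
  next
    case False
    \<comment> \<open>From the first window that contains \<open>x\<close> on, only the next one can
      contain it as well.\<close>
    define j0 where "j0 = Min A"
    have j0: "j0 \<in> A" unfolding j0_def using finA False by simp
    have "A \<subseteq> {j0, Suc j0}"
    proof
      fix j assume j: "j \<in> A"
      then have "j0 \<le> j" unfolding j0_def using finA by simp
      moreover have "2 * real j * \<eta> \<le> 2 * real (Suc j0) * \<eta>" using j j0 by (auto simp: A_def)
      then have "j \<le> Suc j0" using \<eta> by simp
      ultimately show "j \<in> {j0, Suc j0}" by auto
    qed
    then have c: "card A \<le> 2" using card_mono[of "{j0, Suc j0}" A] by simp
    have "0 \<le> 2 * real j0 * \<eta>" using \<eta> by simp
    moreover have "2 * real (Suc j0) * \<eta> \<le> 2 * real m * \<eta>"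
      using j0 \<eta> by (intro mult_right_mono mult_left_mono of_nat_mono) (auto simp: A_def)
    moreover have "lo + 2 * real j0 * \<eta> \<le> x" "x \<le> lo + 2 * real (Suc j0) * \<eta>" using j0 by (auto simp: A_def)
    ultimately have "x \<in> {lo..lo + 2 * real m * \<eta>}" unfolding atLeastAtMost_iff by linarith
    then show ?thesis unfolding sum using c by simp
  qed
qed

lemma sum_spec_index: "(\<Sum>\<alpha>\<in>spec_index n ev J. f \<alpha>) = (\<Sum>\<alpha>\<in>{1..n}. of_bool (ev \<alpha> \<in> J) * (f \<alpha> :: real))"
proof -
  have "(\<Sum>\<alpha>\<in>{1..n}. of_bool (ev \<alpha> \<in> J) * f \<alpha>) = (\<Sum>\<alpha>\<in>{1..n}. if ev \<alpha> \<in> J then f \<alpha> else 0)"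
    by (intro sum.cong refl) simp
  then show ?thesis unfolding spec_index_def by (simp only: sum.inter_filter[OF finite_atLeastAtMost])
qed

lemma finite_spec_index: "finite (spec_index n ev J)"
  by (simp add: spec_index_def)

lemma obs_diff_nonneg: "0 \<le> obs_diff N \<rho> T K u v"
  by (simp add: obs_diff_def)

context qm_setup begin

lemma along_neq_bot: "along NN \<noteq> bot"
proof
  assume "along NN = bot"
  then have "eventually (\<lambda>_. False) (along NN)" by simp
  then obtain N0 where "\<forall>N\<in>NN. \<not> N0 \<le> N" unfolding eventually_along by blast
  then show False using inf unfolding infinite_nat_iff_unbounded_le by blast
qed

lemma QM_from_mixing:
  assumes mix: "\<And>\<epsilon>. 0 < \<epsilon> \<Longrightarrow> \<forall>\<^sub>F \<eta> in at_right 0. \<forall>\<^sub>F N in along NN. mixing_at T (K N) \<epsilon> \<eta> N"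
    and e: "\<And>N. N \<in> NN \<Longrightarrow> ebasis N (ev N) (\<phi> N)"
  shows "QM NN \<rho> {lo..hi} ev \<phi> T K"
proof -
  define X where "X = (\<lambda>\<eta> N E1 E2. (1 / real (card (spec_index (CARD('r) * N) (ev N) {E1 - \<eta>..E1 + \<eta>}))) *
     (\<Sum>\<alpha>\<in>spec_index (CARD('r) * N) (ev N) {E1 - \<eta>..E1 + \<eta>}. \<Sum>\<beta>\<in>spec_index (CARD('r) * N) (ev N) {E2 - \<eta>..E2 + \<eta>}.
        obs_diff N (\<rho> N) T (K N) (\<phi> N \<beta>) (\<phi> N \<alpha>)))"
  let ?Y = "\<lambda>\<eta> N. SUP (E1, E2)\<in>interior {lo..hi} \<times> interior {lo..hi}. ereal (X \<eta> N E1 E2)"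
  have X0: "0 \<le> X \<eta> N E1 E2" for \<eta> N E1 E2
    unfolding X_def by (intro mult_nonneg_nonneg sum_nonneg obs_diff_nonneg) simp
  have "((\<lambda>\<eta>. Limsup (along NN) (?Y \<eta>)) \<longlongrightarrow> 0) (at_right 0)"
  proof (rule order_tendstoI)
    fix a :: ereal assume a: "a < 0"
    \<comment> \<open>The lower half of the limit: the filter is proper and the interior contains
      the midpoint, so no supremum runs over the empty set, where it would be minus
      infinity.\<close>
    have "0 \<le> Limsup (along NN) (?Y \<eta>)" for \<eta>
    proof (rule le_Limsup[OF along_neq_bot], rule always_eventually, rule allI)
      fix N
      have "((lo + hi) / 2, (lo + hi) / 2) \<in> interior {lo..hi} \<times> interior {lo..hi}"
        using lohi by (simp add: interior_atLeastAtMost_real)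
      then show "0 \<le> ?Y \<eta> N" by (rule SUP_upper2) (simp add: X0)
    qed
    then show "\<forall>\<^sub>F \<eta> in at_right 0. a < Limsup (along NN) (?Y \<eta>)"
      using a by (intro always_eventually allI) (rule less_le_trans)
  next
    fix a :: ereal assume "0 < a"
    then obtain \<epsilon> where \<epsilon>: "0 < ereal \<epsilon>" "ereal \<epsilon> < a" using ereal_dense2 by blast
    have \<epsilon>0: "0 < \<epsilon>" using \<epsilon>(1) by simp
    from mix[OF \<epsilon>0] show "\<forall>\<^sub>F \<eta> in at_right 0. Limsup (along NN) (?Y \<eta>) < a"
    proof eventually_elim
      case (elim \<eta>)
      from elim eventually_NN have "\<forall>\<^sub>F N in along NN. ?Y \<eta> N \<le> ereal \<epsilon>"
      proof eventually_elim
        case (elim N)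
        have "X \<eta> N E1 E2 \<le> \<epsilon>" if E: "E1 \<in> interior {lo..hi}" "E2 \<in> interior {lo..hi}" for E1 E2
        proof -
          let ?c = "real (card (spec_index (CARD('r) * N) (ev N) {E1 - \<eta>..E1 + \<eta>}))"
          have E': "E1 \<in> {lo..hi}" "E2 \<in> {lo..hi}" using E interior_subset by blast+
          have "X \<eta> N E1 E2 \<le> 1 / ?c * (\<epsilon> * ?c)"
            unfolding X_def by (rule mult_left_mono) (use elim(1) e[OF elim(2)] E' in \<open>auto simp: mixing_at_def\<close>)
          \<comment> \<open>For an empty window the convention \<open>1 / 0 = 0\<close> makes the
            average 0.\<close>
          also have "\<dots> \<le> \<epsilon>" using \<epsilon>0 by (cases "?c = 0") simp_all
          finally show ?thesis .
        qed
        then show ?case by (intro SUP_least) auto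
      qed
      then have "Limsup (along NN) (?Y \<eta>) \<le> ereal \<epsilon>" by (rule Limsup_bounded)
      then show ?case using \<epsilon>(2) by (rule le_less_trans)
    qed
  qed
  then show ?thesis unfolding QM_def X_def Let_def .
qed

text \<open>The windows of half-width \<open>\<eta>\<close> cover the interval with multiplicity at most \<open>2\<close>, and the diagonal
  terms are bounded by the double sum over a window.\<close>

lemma QE_bound:
  assumes mx: "mixing_at T K \<epsilon> \<eta> N" and e: "ebasis N ev \<phi>" and \<epsilon>: "0 < \<epsilon>"
    and \<eta>: "0 < \<eta>" and m: "0 < m" "hi = lo + 2 * real m * \<eta>"
  shows "(\<Sum>\<alpha>\<in>spec_index (CARD('r) * N) ev {lo..hi}. obs_diff N (\<rho> N) T K (\<phi> \<alpha>) (\<phi> \<alpha>))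
     \<le> 2 * \<epsilon> * real (card (spec_index (CARD('r) * N) ev {lo..hi}))"
proof -
  let ?n = "CARD('r) * N"
  let ?W = "\<lambda>j. {lo + 2 * real j * \<eta>..lo + 2 * real (Suc j) * \<eta>}"
  let ?f = "\<lambda>\<alpha>. obs_diff N (\<rho> N) T K (\<phi> \<alpha>) (\<phi> \<alpha>)"
  have win: "(\<Sum>\<alpha>\<in>spec_index ?n ev (?W j). ?f \<alpha>) \<le> \<epsilon> * real (card (spec_index ?n ev (?W j)))" if j: "j < m" for j
  proof -
    define E where "E = lo + (2 * real j + 1) * \<eta>"
    have W: "?W j = {E - \<eta>..E + \<eta>}" by (simp add: E_def algebra_simps)
    have "(2 * real j + 1) * \<eta> \<le> (2 * real m) * \<eta>" using j \<eta> by (intro mult_right_mono) auto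
    moreover have "0 \<le> (2 * real j + 1) * \<eta>" using \<eta> by simp
    ultimately have E: "E \<in> {lo..hi}" unfolding E_def m(2) by simp
    have "(\<Sum>\<alpha>\<in>spec_index ?n ev (?W j). ?f \<alpha>) \<le> (\<Sum>\<alpha>\<in>spec_index ?n ev (?W j). \<Sum>\<beta>\<in>spec_index ?n ev (?W j). obs_diff N (\<rho> N) T K (\<phi> \<beta>) (\<phi> \<alpha>))"
    proof (rule sum_mono)
      fix \<alpha> assume "\<alpha> \<in> spec_index ?n ev (?W j)"
      then show "?f \<alpha> \<le> (\<Sum>\<beta>\<in>spec_index ?n ev (?W j). obs_diff N (\<rho> N) T K (\<phi> \<beta>) (\<phi> \<alpha>))"
        by (rule member_le_sum[of \<alpha> _ "\<lambda>\<beta>. obs_diff N (\<rho> N) T K (\<phi> \<beta>) (\<phi> \<alpha>)", OF _ obs_diff_nonneg finite_spec_index])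
    qed
    also have "\<dots> \<le> \<epsilon> * real (card (spec_index ?n ev (?W j)))"
      unfolding W using mx e E unfolding mixing_at_def by blast
    finally show ?thesis .
  qed
  have cd: "real (card (spec_index ?n ev J)) = (\<Sum>\<alpha>\<in>{1..?n}. of_bool (ev \<alpha> \<in> J))" for J
    using sum_spec_index[of "\<lambda>_. 1" ?n ev J] by simp
  have "(\<Sum>\<alpha>\<in>spec_index ?n ev {lo..hi}. ?f \<alpha>) = (\<Sum>\<alpha>\<in>{1..?n}. of_bool (ev \<alpha> \<in> {lo..hi}) * ?f \<alpha>)" by (rule sum_spec_index)
  also have "\<dots> \<le> (\<Sum>\<alpha>\<in>{1..?n}. (\<Sum>j<m. of_bool (ev \<alpha> \<in> ?W j)) * ?f \<alpha>)"
    unfolding m(2) by (intro sum_mono mult_right_mono window_multiplicity(1) \<eta> m(1) obs_diff_nonneg)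
  also have "\<dots> = (\<Sum>j<m. \<Sum>\<alpha>\<in>{1..?n}. of_bool (ev \<alpha> \<in> ?W j) * ?f \<alpha>)"
    unfolding sum_distrib_right by (rule sum.swap)
  also have "\<dots> = (\<Sum>j<m. \<Sum>\<alpha>\<in>spec_index ?n ev (?W j). ?f \<alpha>)" by (simp only: sum_spec_index)
  also have "\<dots> \<le> (\<Sum>j<m. \<epsilon> * real (card (spec_index ?n ev (?W j))))" by (intro sum_mono win) simp
  also have "\<dots> = \<epsilon> * (\<Sum>j<m. \<Sum>\<alpha>\<in>{1..?n}. of_bool (ev \<alpha> \<in> ?W j))" unfolding cd by (simp only: sum_distrib_left)
  also have "(\<Sum>j<m. \<Sum>\<alpha>\<in>{1..?n}. of_bool (ev \<alpha> \<in> ?W j)) = (\<Sum>\<alpha>\<in>{1..?n}. \<Sum>j<m. of_bool (ev \<alpha> \<in> ?W j) :: real)"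
    by (rule sum.swap)
  also have "\<epsilon> * \<dots> \<le> \<epsilon> * (\<Sum>\<alpha>\<in>{1..?n}. 2 * of_bool (ev \<alpha> \<in> {lo..hi}))"
    unfolding m(2) using \<epsilon> by (intro mult_left_mono sum_mono window_multiplicity(2) \<eta> m(1)) auto
  also have "\<dots> = 2 * \<epsilon> * real (card (spec_index ?n ev {lo..hi}))" unfolding cd by (simp only: sum_distrib_left mult_ac)
  finally show ?thesis .
qed

lemma QE_from_mixing:
  assumes mix: "\<And>\<epsilon>. 0 < \<epsilon> \<Longrightarrow> \<forall>\<^sub>F \<eta> in at_right 0. \<forall>\<^sub>F N in along NN. mixing_at T (K N) \<epsilon> \<eta> N"
    and e: "\<And>N. N \<in> NN \<Longrightarrow> ebasis N (ev N) (\<phi> N)"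
  shows "QE NN \<rho> {lo..hi} ev \<phi> T K"
proof -
  define X where "X = (\<lambda>N. (1 / real (card (spec_index (CARD('r) * N) (ev N) {lo..hi}))) *
     (\<Sum>\<alpha>\<in>spec_index (CARD('r) * N) (ev N) {lo..hi}. obs_diff N (\<rho> N) T (K N) (\<phi> N \<alpha>) (\<phi> N \<alpha>)))"
  have X0: "0 \<le> X N" for N
    unfolding X_def by (intro mult_nonneg_nonneg sum_nonneg obs_diff_nonneg) simp
  have "(X \<longlongrightarrow> 0) (along NN)"
  proof (rule tendstoI)
    fix \<epsilon> :: real assume "0 < \<epsilon>"
    then have \<epsilon>4: "0 < \<epsilon> / 4" by simp
    obtain b where b: "0 < b" "\<And>\<eta>. 0 < \<eta> \<Longrightarrow> \<eta> < b \<Longrightarrow> \<forall>\<^sub>F N in along NN. mixing_at T (K N) (\<epsilon> / 4) \<eta> N"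
      using mix[OF \<epsilon>4] unfolding eventually_at_right_field by blast
    \<comment> \<open>Ergodicity does not involve \<eta>, so one small value is enough; it is taken
      of the form \<open>(hi - lo) / (2 m)\<close> so that the windows tile the interval
      exactly.\<close>
    obtain k where k: "inverse (real (Suc k)) < b / (hi - lo)"
      using reals_Archimedean[of "b / (hi - lo)"] b(1) lohi by auto
    define m where "m = Suc k"
    define \<eta> where "\<eta> = (hi - lo) / (2 * real m)"
    have m: "0 < m" by (simp add: m_def)
    have \<eta>: "0 < \<eta>" using lohi m by (simp add: \<eta>_def)
    have hi: "hi = lo + 2 * real m * \<eta>" using m by (simp add: \<eta>_def)
    have "(hi - lo) * inverse (real m) < b"
      using k lohi unfolding m_def[symmetric] by (simp add: pos_less_divide_eq mult.commute)
    moreover have "\<eta> \<le> (hi - lo) * inverse (real m)" using lohi m by (simp add: \<eta>_def field_simps)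
    ultimately have "\<eta> < b" by linarith
    from b(2)[OF \<eta> this] eventually_NN show "\<forall>\<^sub>F N in along NN. dist (X N) 0 < \<epsilon>"
    proof eventually_elim
      case (elim N)
      let ?c = "real (card (spec_index (CARD('r) * N) (ev N) {lo..hi}))"
      have "X N \<le> 1 / ?c * (2 * (\<epsilon> / 4) * ?c)"
        unfolding X_def by (intro mult_left_mono QE_bound[OF elim(1) e[OF elim(2)] \<epsilon>4 \<eta> m hi]) simp
      also have "\<dots> \<le> \<epsilon> / 2" using \<open>0 < \<epsilon>\<close> by (cases "?c = 0") simp_all
      finally show ?case using X0[of N] \<open>0 < \<epsilon>\<close> by (simp add: dist_real_def)
    qed
  qed
  then show ?thesis unfolding QE_def X_def Let_def .
qed

lemma QE_QM_crit:
  assumes adm: "admissible NN \<rho> p ev \<phi> T K" and crit: "\<And>t. t \<in> T \<Longrightarrow> crit t (\<lambda>N. centred N (K N) t)"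
  shows "QE NN \<rho> {lo..hi} ev \<phi> T K \<and> QM NN \<rho> {lo..hi} ev \<phi> T K"
proof -
  have T: "finite T" and K: "\<And>N. N \<in> NN \<Longrightarrow> T_local N (\<rho> N) T (K N) \<and> norm_1_inf N (K N) \<le> 1"
    and e: "\<And>N. N \<in> NN \<Longrightarrow> ebasis N (ev N) (\<phi> N)"
    using adm unfolding admissible_def ebasis_def by blast+
  have mix: "\<forall>\<^sub>F \<eta> in at_right 0. \<forall>\<^sub>F N in along NN. mixing_at T (K N) \<epsilon> \<eta> N" if "0 < \<epsilon>" for \<epsilon>
    by (rule mixing_eventually[OF T K crit that])
  show ?thesis by (intro conjI QE_from_mixing QM_from_mixing mix e)
qed

end

section \<open>Observables orthogonal to the exceptional subspace\<close>

text \<open>A real supremum bounds its members only once the set is bounded above; the sum of all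
  entries gives such a bound. Vectors of other norms follow by scaling.\<close>

lemma onorm_perp_one_bound:
  assumes f: "(\<Sum>x\<in>{1..N}. f x) = 0"
  shows "L2_set (\<lambda>x. cmod (\<Sum>y\<in>{1..N}. M x y * f y)) {1..N} \<le> onorm_perp_one N M * L2_set (\<lambda>x. cmod (f x)) {1..N}"
proof -
  let ?A = "\<lambda>f. L2_set (\<lambda>x. cmod (\<Sum>y\<in>{1..N}. M x y * f y)) {1..N}"
  let ?n = "L2_set (\<lambda>x. cmod (f x)) {1..N}"
  let ?S = "{f. (\<Sum>x\<in>{1..N}. f x) = 0 \<and> L2_set (\<lambda>x. cmod (f x)) {1..N} \<le> 1}"
  have bdd: "bdd_above (?A ` ?S)"
  proof (rule bdd_aboveI2)
    fix g assume "g \<in> ?S"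
    then have g: "L2_set (\<lambda>x. cmod (g x)) {1..N} \<le> 1" by blast
    have g1: "cmod (g y) \<le> 1" if y: "y \<in> {1..N}" for y
      using order_trans[OF member_le_L2_set[OF finite_atLeastAtMost y, of "\<lambda>x. cmod (g x)"] g] .
    have "?A g \<le> (\<Sum>x\<in>{1..N}. cmod (\<Sum>y\<in>{1..N}. M x y * g y))" by (rule L2_set_le_sum) simp
    also have "\<dots> \<le> (\<Sum>x\<in>{1..N}. \<Sum>y\<in>{1..N}. cmod (M x y) * 1)"
      by (intro sum_mono order_trans[OF norm_sum]) (simp only: norm_mult, intro mult_left_mono g1, simp_all)
    finally show "?A g \<le> (\<Sum>x\<in>{1..N}. \<Sum>y\<in>{1..N}. cmod (M x y) * 1)" .
  qed
  show ?thesis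
  proof (cases "?n = 0")
    case True
    then have "f y = 0" if "y \<in> {1..N}" for y
      using that by (simp add: L2_set_eq_0_iff)
    then have "(\<Sum>y\<in>{1..N}. M x y * f y) = 0" for x by (intro sum.neutral) simp
    then show ?thesis unfolding True by (simp add: L2_set_def)
  next
    case False
    then have n: "0 < ?n" using L2_set_nonneg[of "\<lambda>x. cmod (f x)" "{1..N}"] by linarith
    define g where "g = (\<lambda>x. of_real (1 / ?n) * f x)"
    have s: "(\<Sum>y\<in>{1..N}. M x y * g y) = of_real (1 / ?n) * (\<Sum>y\<in>{1..N}. M x y * f y)" for x
      unfolding g_def sum_distrib_left by (intro sum.cong refl) (rule mult.left_commute)
    have gn: "L2_set (\<lambda>x. cmod (g x)) {1..N} = 1 / ?n * ?n"
      unfolding g_def norm_mult norm_of_real using n by (subst L2_set_right_distrib) simp_all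
    have Ag: "?A g = 1 / ?n * ?A f"
      unfolding s norm_mult norm_of_real using n by (subst L2_set_right_distrib) simp_all
    have "(\<Sum>x\<in>{1..N}. g x) = 0" unfolding g_def sum_distrib_left[symmetric] f by simp
    then have "g \<in> ?S" using n gn by simp
    then have "?A g \<le> onorm_perp_one N M" unfolding onorm_perp_one_def by (rule cSUP_upper[OF _ bdd])
    then show ?thesis unfolding Ag using n by (simp add: field_simps)
  qed
qed

text \<open>The vector \<open>u\<close> tensored with a matrix unit. Orthogonality to all of these
  means that every matrix entry of the family is orthogonal to \<open>u\<close>.\<close>

definition elem_fam :: "(nat \<Rightarrow> complex) \<Rightarrow> 'r \<Rightarrow> 'r \<Rightarrow> nat \<Rightarrow> complex^'r^'r" where
  "elem_fam u k l = (\<lambda>x. \<chi> i j. if i = k \<and> j = l then u x else 0)"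

lemma elem_fam_inner:
  "(\<Sum>x\<in>{1..N}. \<Sum>i\<in>UNIV. \<Sum>j\<in>UNIV. cnj (elem_fam u k l x $ i $ j) * M x $ i $ j)
     = (\<Sum>x\<in>{1..N}. cnj (u x) * M x $ k $ (l::'r::finite))"
proof (rule sum.cong[OF refl])
  fix x
  have "(\<Sum>i\<in>UNIV. \<Sum>j\<in>UNIV. cnj (elem_fam u k l x $ i $ j) * M x $ i $ j)
     = (\<Sum>i\<in>UNIV. \<Sum>j\<in>UNIV. if i = k then (if j = l then cnj (u x) * M x $ i $ j else 0) else 0)"
    by (intro sum.cong refl) (simp add: elem_fam_def)
  also have "\<dots> = (\<Sum>i\<in>UNIV. if i = k then (\<Sum>j\<in>UNIV. if j = l then cnj (u x) * M x $ i $ j else 0) else 0)"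
    by (intro sum.cong refl) simp
  finally show "(\<Sum>i\<in>UNIV. \<Sum>j\<in>UNIV. cnj (elem_fam u k l x $ i $ j) * M x $ i $ j) = cnj (u x) * M x $ k $ l"
    by (simp only: sum.delta[OF finite] UNIV_I if_True)
qed

context permutation_limit begin

lemma rep_mat_sact:
  assumes N: "N \<in> NN" and x: "x \<in> {1..N}"
  shows "(\<Sum>y\<in>{1..N}. rep_mat (\<rho> N) q x y * f y) = sact (\<rho> N) q f x"
proof -
  interpret group_action "\<rho> N" by (rule group_act[OF N])
  have iff: "x = \<rho> N g y \<longleftrightarrow> y = \<rho> N (- g) x" for g y by (metis act_minus)
  let ?q = "Poly_Mapping.lookup q"
  have "(\<Sum>y\<in>{1..N}. rep_mat (\<rho> N) q x y * f y) = (\<Sum>y\<in>{1..N}. \<Sum>g\<in>Poly_Mapping.keys q. (perm_mat (\<rho> N g) x y *\<^sub>R ?q g) * f y)"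
    unfolding rep_mat_def sum_distrib_right ..
  also have "\<dots> = (\<Sum>g\<in>Poly_Mapping.keys q. \<Sum>y\<in>{1..N}. (perm_mat (\<rho> N g) x y *\<^sub>R ?q g) * f y)"
    by (rule sum.swap)
  also have "\<dots> = (\<Sum>g\<in>Poly_Mapping.keys q. ?q g * f (\<rho> N (- g) x))"
  proof (rule sum.cong[OF refl])
    fix g
    have "(\<Sum>y\<in>{1..N}. (perm_mat (\<rho> N g) x y *\<^sub>R ?q g) * f y) = (\<Sum>y\<in>{1..N}. if y = \<rho> N (- g) x then ?q g * f y else 0)"
      by (intro sum.cong refl) (simp add: perm_mat_def iff)
    also have "\<dots> = ?q g * f (\<rho> N (- g) x)"
    proof -
      have "\<rho> N (- g) x \<in> {1..N}" using rho_in[OF N] x by blast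
      then show ?thesis by (simp only: sum.delta[OF finite_atLeastAtMost] if_True)
    qed
    finally show "(\<Sum>y\<in>{1..N}. (perm_mat (\<rho> N g) x y *\<^sub>R ?q g) * f y) = ?q g * f (\<rho> N (- g) x)" .
  qed
  finally show ?thesis by (simp only: gact_def)
qed

lemma supp_on_ell2_norm: "supp_on N f \<Longrightarrow> ell2_norm f = L2_set (\<lambda>x. cmod (f x)) {1..N}"
  using supp_on_ell2(2)[of N f] by (simp add: L2_set_def real_sqrt_unique ell2_norm_def infsum_nonneg)

text \<open>Strong convergence treats one element at a time; the nets are finite, so it applies to
  all their elements simultaneously.\<close>

lemma tempered_strong:
  assumes S: "finite S" "generates S" and strong: "strong_conv_distr NN \<rho>"
  shows "tempered S (\<lambda>N. {f. supp_on N f \<and> (\<Sum>x\<in>{1..N}. f x) = 0})"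
  unfolding tempered_def
proof (intro conjI allI)
  fix k
  have "\<forall>\<^sub>F N in along NN. \<forall>w\<in>nets S k. onorm_perp_one N (rep_mat (\<rho> N) w) < ell2_onorm (lam_scalar w) + 1 / real (Suc k)"
  proof (rule eventually_ball_finite[OF finite_nets[OF S]], rule ballI)
    fix w :: "'g \<Rightarrow>\<^sub>0 complex"
    have "((\<lambda>N. onorm_perp_one N (rep_mat (\<rho> N) w)) \<longlongrightarrow> ell2_onorm (lam_scalar w)) (along NN)"
      using strong unfolding strong_conv_distr_def by blast
    then show "\<forall>\<^sub>F N in along NN. onorm_perp_one N (rep_mat (\<rho> N) w) < ell2_onorm (lam_scalar w) + 1 / real (Suc k)"
      by (rule order_tendstoD(2)) simp
  qed
  then show "\<forall>\<^sub>F N in along NN. \<forall>w\<in>nets S k. \<forall>f\<in>{f. supp_on N f \<and> (\<Sum>x\<in>{1..N}. f x) = 0}.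
      ell2_norm (sact (\<rho> N) w f) \<le> (ell2_onorm (lam_scalar w) + 1 / real (Suc k)) * ell2_norm f"
    using eventually_NN
  proof eventually_elim
    case (elim N)
    show ?case
    proof (intro ballI)
      fix w f assume w: "w \<in> nets S k" and "f \<in> {f. supp_on N f \<and> (\<Sum>x\<in>{1..N}. f x) = 0}"
      then have f: "supp_on N f" "(\<Sum>x\<in>{1..N}. f x) = 0" by blast+
      have "ell2_norm (sact (\<rho> N) w f) = L2_set (\<lambda>x. cmod (\<Sum>y\<in>{1..N}. rep_mat (\<rho> N) w x y * f y)) {1..N}"
        unfolding supp_on_ell2_norm[OF supp_on_sact[OF elim(2) f(1)]]
        by (rule L2_set_cong[OF refl]) (simp only: rep_mat_sact[OF elim(2)])
      also have "\<dots> \<le> onorm_perp_one N (rep_mat (\<rho> N) w) * ell2_norm f"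
        unfolding supp_on_ell2_norm[OF f(1)] by (rule onorm_perp_one_bound[OF f(2)])
      also have "\<dots> \<le> (ell2_onorm (lam_scalar w) + 1 / real (Suc k)) * ell2_norm f"
        using elim(1) w by (intro mult_right_mono) (auto simp: ell2_norm_def infsum_nonneg intro: less_imp_le)
      finally show "ell2_norm (sact (\<rho> N) w f) \<le> (ell2_onorm (lam_scalar w) + 1 / real (Suc k)) * ell2_norm f" .
    qed
  qed
qed blast

end

context qm_setup begin

lemma QE_QM_tempered:
  assumes RD: "RD TYPE('g) C1" and a: "a > 2 * C1 + 1" and R4: "R4mat S p energies a" and V: "tempered S V"
    and adm: "admissible NN \<rho> p ev \<phi> T K"
    and K0: "\<And>N t. N \<in> NN \<Longrightarrow> t \<in> T \<Longrightarrow> (\<Sum>x\<in>{1..N}. K N (\<rho> N t x) x) = 0"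
    and KV: "\<And>N t i j. N \<in> NN \<Longrightarrow> t \<in> T \<Longrightarrow> (\<lambda>x. if x \<in> {1..N} then K N (\<rho> N t x) x $ i $ j else 0) \<in> V N"
  shows "QE NN \<rho> {lo..hi} ev \<phi> T K \<and> QM NN \<rho> {lo..hi} ev \<phi> T K"
proof (rule QE_QM_crit[OF adm], rule crit_tempered[OF RD a R4 V])
  show "norm_1_inf N (K N) \<le> 1" if "N \<in> NN" for N using adm that unfolding admissible_def by blast
  show "(\<lambda>x. if x \<in> {1..N} then centred N (K N) t x $ i $ j else 0) \<in> V N" if "t \<in> T" "N \<in> NN" for t N i j
  proof -
    have eq: "centred N (K N) t = (\<lambda>x. K N (\<rho> N t x) x)"
      by (rule ext) (simp only: centred_def avg_def K0[OF that(2,1)] scaleR_zero_right diff_zero)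
    show ?thesis unfolding eq by (rule KV[OF that(2,1)])
  qed
qed

lemma QE_QM_uncorrelated:
  assumes adm: "admissible NN \<rho> p ev \<phi> T K" and unc: "asymp_uncorrelated S NN \<rho> T K"
  shows "QE NN \<rho> {lo..hi} ev \<phi> T K \<and> QM NN \<rho> {lo..hi} ev \<phi> T K"
proof (rule QE_QM_crit[OF adm], rule crit_uncorrelated[OF _ _ unc])
  show "norm_1_inf N (K N) \<le> 1" if "N \<in> NN" for N using adm that unfolding admissible_def by blast
qed

lemma QE_QM_strong:
  assumes RD: "RD TYPE('g) C1" and a: "a > 2 * C1 + 1" and R4: "R4mat S p energies a" and strong: "strong_conv_distr NN \<rho>"
    and adm: "admissible NN \<rho> p ev \<phi> T K"
    and K0: "\<And>N t. N \<in> NN \<Longrightarrow> t \<in> T \<Longrightarrow> (\<Sum>x\<in>{1..N}. K N (\<rho> N t x) x) = 0"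
  shows "QE NN \<rho> {lo..hi} ev \<phi> T K \<and> QM NN \<rho> {lo..hi} ev \<phi> T K"
proof (rule QE_QM_tempered[OF RD a R4 tempered_strong[OF Sfin Sgen strong] adm K0])
  fix N t i j assume Nt: "N \<in> NN" "t \<in> T"
  let ?f = "\<lambda>x. if x \<in> {1..N} then K N (\<rho> N t x) x $ i $ j else 0"
  have "(\<Sum>x\<in>{1..N}. ?f x) = (\<Sum>x\<in>{1..N}. K N (\<rho> N t x) x $ i $ j)" by (intro sum.cong) simp_all
  also have "\<dots> = (\<Sum>x\<in>{1..N}. K N (\<rho> N t x) x) $ i $ j" by (simp only: sum_component)
  also have "\<dots> = 0" unfolding K0[OF Nt] by simp
  finally show "?f \<in> {f. supp_on N f \<and> (\<Sum>x\<in>{1..N}. f x) = 0}" by (simp add: supp_on_def)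
qed

text \<open>Tensoring the exceptional scalar vectors with all matrix units multiplies their number
  by at most the square of \<open>CARD('r)\<close>, which leaves the dimension of the span
  o(N).\<close>

lemma QE_QM_exceptional:
  assumes RD: "RD TYPE('g) C1" and a: "a > 2 * C1 + 1" and R4: "R4mat S p energies a"
  obtains H :: "nat \<Rightarrow> (nat \<Rightarrow> complex^'r^'r) set" where "\<And>N. fam_subspace N (H N)"
    "(\<lambda>N. real (fam.dim (H N))) \<in> o[along NN](\<lambda>N. real N)"
    "\<And>ev \<phi> T K. admissible NN \<rho> p ev \<phi> T K \<Longrightarrow>
       (\<And>N t. N \<in> NN \<Longrightarrow> t \<in> T \<Longrightarrow> (\<lambda>x. K N (\<rho> N t x) x) \<in> fam_perp N (H N)) \<Longrightarrow>
       QE NN \<rho> {lo..hi} ev \<phi> T K \<and> QM NN \<rho> {lo..hi} ev \<phi> T K"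
proof (rule exceptional_subspace[OF inf Sfin Sgen])
  fix U
  assume Uf: "\<And>N. finite (U N)" and Us: "\<And>N u. u \<in> U N \<Longrightarrow> supp_on N u"
    and Uc: "\<And>N. (\<lambda>x. of_bool (x \<in> {1..N})) \<in> U N"
    and Ud: "\<And>\<epsilon>. 0 < \<epsilon> \<Longrightarrow> \<forall>\<^sub>F N in along NN. real (card (U N)) \<le> \<epsilon> * real N"
    and Ut: "tempered S (\<lambda>N. {f. supp_on N f \<and> (\<forall>u\<in>U N. (\<Sum>x\<in>{1..N}. cnj (u x) * f x) = 0)})"
  define B :: "nat \<Rightarrow> (nat \<Rightarrow> complex^'r^'r) set" where "B = (\<lambda>N. (\<lambda>(u, k, l). elem_fam u k l) ` (U N \<times> UNIV))"
  have Bf: "finite (B N)" for N unfolding B_def using Uf by (intro finite_imageI finite_cartesian_product) auto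
  define H where "H = (\<lambda>N. fam.span (B N))"
  define R where "R = real (card (UNIV :: ('r \<times> 'r) set))"
  have R: "0 < R" by (simp add: R_def card_gt_0_iff)
  have sub: "fam_subspace N (H N)" for N
  proof -
    let ?Z = "{M :: nat \<Rightarrow> complex^'r^'r. \<forall>x. x \<notin> {1..N} \<longrightarrow> M x = 0}"
    have "fam.subspace ?Z" unfolding fam.subspace_def by (auto simp: fam_scale_def vec_eq_iff)
    moreover have "B N \<subseteq> ?Z"
      unfolding B_def using Us by (auto simp: elem_fam_def supp_on_def vec_eq_iff)
    ultimately have "H N \<subseteq> ?Z" unfolding H_def by (intro fam.span_minimal)
    then show ?thesis unfolding fam_subspace_def H_def using fam.subspace_span by blast
  qed
  have dim: "real (fam.dim (H N)) \<le> R * real (card (U N))" for N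
  proof -
    have "fam.dim (H N) \<le> card (B N)" unfolding H_def by (rule fam.dim_le_card[OF order_refl Bf])
    also have "\<dots> \<le> card (U N \<times> (UNIV :: ('r \<times> 'r) set))" unfolding B_def using Uf by (intro card_image_le) simp
    finally have "real (fam.dim (H N)) \<le> real (card (U N \<times> (UNIV :: ('r \<times> 'r) set)))" by (rule of_nat_mono)
    then show ?thesis by (simp only: R_def card_cartesian_product of_nat_mult mult.commute)
  qed
  have small: "(\<lambda>N. real (fam.dim (H N))) \<in> o[along NN](\<lambda>N. real N)"
  proof (rule landau_o.smallI)
    fix c :: real assume "0 < c"
    then have "0 < c / R" using R by simp
    from Ud[OF this] show "\<forall>\<^sub>F N in along NN. norm (real (fam.dim (H N))) \<le> c * norm (real N)"
    proof eventually_elim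
      case (elim N)
      have "R * real (card (U N)) \<le> R * (c / R * real N)" using elim R by (intro mult_left_mono) auto
      also have "\<dots> = c * real N" using R by simp
      finally show ?case using dim[of N] by simp
    qed
  qed
  show thesis
  proof (rule that[OF sub small])
    fix ev \<phi> T and K :: "nat \<Rightarrow> nat \<Rightarrow> nat \<Rightarrow> complex^'r^'r"
    assume adm: "admissible NN \<rho> p ev \<phi> T K"
      and perp: "\<And>N t. N \<in> NN \<Longrightarrow> t \<in> T \<Longrightarrow> (\<lambda>x. K N (\<rho> N t x) x) \<in> fam_perp N (H N)"
    have ort: "(\<Sum>x\<in>{1..N}. cnj (u x) * K N (\<rho> N t x) x $ k $ l) = 0" if "N \<in> NN" "t \<in> T" "u \<in> U N" for N t u k l
    proof -
      have "(\<lambda>(u, k, l). elem_fam u k l) (u, k, l) \<in> B N" unfolding B_def by (rule imageI) (simp add: that(3))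
      then have "elem_fam u k l \<in> H N" unfolding H_def by (simp add: fam.span_base)
      then show ?thesis using perp[OF that(1,2)] unfolding fam_perp_def elem_fam_inner[symmetric] by blast
    qed
    show "QE NN \<rho> {lo..hi} ev \<phi> T K \<and> QM NN \<rho> {lo..hi} ev \<phi> T K"
    proof (rule QE_QM_tempered[OF RD a R4 Ut adm])
      fix N t assume Nt: "N \<in> NN" "t \<in> T"
      \<comment> \<open>The constant vector is among the exceptional ones, so these observables are
        already centred.\<close>
      have "(\<Sum>x\<in>{1..N}. K N (\<rho> N t x) x $ k $ l) = 0" for k l
      proof -
        have "(\<Sum>x\<in>{1..N}. K N (\<rho> N t x) x $ k $ l) = (\<Sum>x\<in>{1..N}. cnj (of_bool (x \<in> {1..N})) * K N (\<rho> N t x) x $ k $ l)"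
          by (intro sum.cong refl) simp
        also have "\<dots> = 0" by (rule ort[OF Nt Uc])
        finally show ?thesis .
      qed
      then show "(\<Sum>x\<in>{1..N}. K N (\<rho> N t x) x) = 0" by (simp add: vec_eq_iff sum_component)
      fix i j
      let ?f = "\<lambda>x. if x \<in> {1..N} then K N (\<rho> N t x) x $ i $ j else 0"
      have "(\<Sum>x\<in>{1..N}. cnj (u x) * ?f x) = 0" if "u \<in> U N" for u
      proof -
        have "(\<Sum>x\<in>{1..N}. cnj (u x) * ?f x) = (\<Sum>x\<in>{1..N}. cnj (u x) * K N (\<rho> N t x) x $ i $ j)"
          by (intro sum.cong refl) simp
        then show ?thesis using ort[OF Nt that] by simp
      qed
      then show "?f \<in> {f. supp_on N f \<and> (\<forall>u\<in>U N. (\<Sum>x\<in>{1..N}. cnj (u x) * f x) = 0)}"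
        unfolding supp_on_def by (intro CollectI conjI ballI) auto
    qed
  qed
qed

end

section \<open>Quantum ergodicity and mixing under the three sets of conditions\<close>

theorem theorem5p3:
  fixes S :: "'g::group_add set"
    and NN :: "nat set"
    and \<rho> :: "nat \<Rightarrow> 'g \<Rightarrow> nat \<Rightarrow> nat"
    and p :: "'g \<Rightarrow>\<^sub>0 complex^'r^'r"
    and a0 b0 a b :: real
  assumes "finite S" and "generates S"
    and "infinite NN" and "0 \<notin> NN"
    and "\<forall>N\<in>NN. perm_rep N (\<rho> N)"
    and "conv_distr NN \<rho>"
    and "self_adjoint p"
    and "ACmat p {a0..b0}"
    and "a < b" and "{a..b} \<subseteq> interior {a0..b0}"
  shows
    "(\<forall>ev \<phi> T K. admissible NN \<rho> p ev \<phi> T K \<and> asymp_uncorrelated S NN \<rho> T K \<longrightarrow>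
        QE NN \<rho> {a..b} ev \<phi> T K \<and> QM NN \<rho> {a..b} ev \<phi> T K)
     \<and>
     (\<forall>C1 C1'. RD TYPE('g) C1 \<and> C1' > 2 * C1 + 1 \<and> R4mat S p {a..b} C1' \<longrightarrow>
        (\<exists>H :: nat \<Rightarrow> (nat \<Rightarrow> complex^'r^'r) set.
           (\<forall>N\<in>NN. fam_subspace N (H N)) \<and>
           (\<lambda>N. real (fam.dim (H N))) \<in> o[along NN](\<lambda>N. real N) \<and>
           (\<forall>ev \<phi> T K. admissible NN \<rho> p ev \<phi> T K \<and>
              (\<forall>N\<in>NN. \<forall>t\<in>T. (\<lambda>x. K N (\<rho> N t x) x) \<in> fam_perp N (H N)) \<longrightarrow>
              QE NN \<rho> {a..b} ev \<phi> T K \<and> QM NN \<rho> {a..b} ev \<phi> T K)))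
     \<and>
     (\<forall>C1 C1'. RD TYPE('g) C1 \<and> C1' > 2 * C1 + 1 \<and> R4mat S p {a..b} C1' \<and>
        strong_conv_distr NN \<rho> \<longrightarrow>
        (\<forall>ev \<phi> T K. admissible NN \<rho> p ev \<phi> T K \<and>
           (\<forall>N\<in>NN. \<forall>t\<in>T. (\<Sum>x\<in>{1..N}. K N (\<rho> N t x) x) = 0) \<longrightarrow>
           QE NN \<rho> {a..b} ev \<phi> T K \<and> QM NN \<rho> {a..b} ev \<phi> T K))"
proof -
  obtain C0 where C0: "1 \<le> C0" and AC: "\<And>E \<eta>. E \<in> {a0..b0} \<Longrightarrow> 0 < \<eta> \<Longrightarrow> \<eta> \<le> 1 \<Longrightarrow>
      inverse C0 \<le> Re (trace (op_block (im_resolvent (lam p) (Complex E \<eta>)) 0 0)) \<and>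
      Re (trace (op_block (im_resolvent (lam p) (Complex E \<eta>)) 0 0)) \<le> C0"
    using assms(8) unfolding ACmat_def Let_def by blast
  have sub: "{a..b} \<subseteq> {a0..b0}" using assms(10) interior_subset by blast
  \<comment> \<open>The energies range over \<open>{a..b}\<close>, where (R4mat) is assumed; the
    bounds of (ACmat) restrict to it.\<close>
  interpret qm_setup NN \<rho> S p a b C0
  proof unfold_locales
    fix E \<eta> :: real assume "E \<in> {a..b}" "0 < \<eta>" "\<eta> \<le> 1"
    then show "inverse C0 \<le> Re (trace (op_block (im_resolvent (lam p) (Complex E \<eta>)) 0 0)) \<and>
      Re (trace (op_block (im_resolvent (lam p) (Complex E \<eta>)) 0 0)) \<le> C0" using AC sub by blast
  qed (use assms C0 in blast)+
  show ?thesis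
  proof (intro conjI; intro allI impI)
    fix ev \<phi> T K assume "admissible NN \<rho> p ev \<phi> T K \<and> asymp_uncorrelated S NN \<rho> T K"
    then show "QE NN \<rho> {a..b} ev \<phi> T K \<and> QM NN \<rho> {a..b} ev \<phi> T K" using QE_QM_uncorrelated by blast
  next
    fix C1 C1' assume *: "RD TYPE('g) C1 \<and> C1' > 2 * C1 + 1 \<and> R4mat S p {a..b} C1'"
    obtain H :: "nat \<Rightarrow> (nat \<Rightarrow> complex^'r^'r) set" where H: "\<And>N. fam_subspace N (H N)"
      "(\<lambda>N. real (fam.dim (H N))) \<in> o[along NN](\<lambda>N. real N)"
      "\<And>ev \<phi> T K. admissible NN \<rho> p ev \<phi> T K \<Longrightarrow>
         (\<And>N t. N \<in> NN \<Longrightarrow> t \<in> T \<Longrightarrow> (\<lambda>x. K N (\<rho> N t x) x) \<in> fam_perp N (H N)) \<Longrightarrow>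
         QE NN \<rho> {a..b} ev \<phi> T K \<and> QM NN \<rho> {a..b} ev \<phi> T K"
      by (rule QE_QM_exceptional[of C1 C1']) (use * in blast)+
    show "\<exists>H :: nat \<Rightarrow> (nat \<Rightarrow> complex^'r^'r) set.
           (\<forall>N\<in>NN. fam_subspace N (H N)) \<and>
           (\<lambda>N. real (fam.dim (H N))) \<in> o[along NN](\<lambda>N. real N) \<and>
           (\<forall>ev \<phi> T K. admissible NN \<rho> p ev \<phi> T K \<and>
              (\<forall>N\<in>NN. \<forall>t\<in>T. (\<lambda>x. K N (\<rho> N t x) x) \<in> fam_perp N (H N)) \<longrightarrow>
              QE NN \<rho> {a..b} ev \<phi> T K \<and> QM NN \<rho> {a..b} ev \<phi> T K)"
      using H by (intro exI[of _ H]) blast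
  next
    fix C1 C1' ev \<phi> T K
    assume "RD TYPE('g) C1 \<and> C1' > 2 * C1 + 1 \<and> R4mat S p {a..b} C1' \<and> strong_conv_distr NN \<rho>"
      and "admissible NN \<rho> p ev \<phi> T K \<and> (\<forall>N\<in>NN. \<forall>t\<in>T. (\<Sum>x\<in>{1..N}. K N (\<rho> N t x) x) = 0)"
    then show "QE NN \<rho> {a..b} ev \<phi> T K \<and> QM NN \<rho> {a..b} ev \<phi> T K"
      using QE_QM_strong[of C1 C1' ev \<phi> T K] by blast
  qed
qed

end
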